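(* Let $k$ be a fixed positive integer. Consider the problem: given a temporal digraph $\mathcal{G}=(G,\gamma,\lambda)$ and subsets $R_1,\dots,R_k\subseteq V_T$ of temporal vertices, find (equivalently, decide the existence of) $k$ branchings of $\mathcal{G}$ rooted at $R_1,\dots,R_k$ respectively, satisfying the disjointness and spanning requirement indicated below. Then: 1. For t-edge-disjoint temporal-spanning branchings, the problem is solvable in polynomial time. 2. For edge-disjoint temporal-spanning branchings, the problem is $\mathsf{NP}$-complete, even if the underlying undirected graph of $G$ is a star and each snapshot of $\mathcal{G}$ has constant size; it is also $\mathsf{NP}$-complete even if $\mathcal{G}$ has lifetime $3$. If all vertices are eternal, or if $\mathcal{G}$ has lifetime $2$, then the edge-disjoint temporal-spanning problem is solvable in polynomial time. 3. For edge-disjoint vertex-spanning branchings, the problem is $\mathsf{NP}$-complete even if $G$ is a DAG, $\mathcal{G}$ has lifetime $2$, and all vertices are eternal. 4. For t-edge-disjoint vertex-spanning branchings, the problem is $\mathsf{NP}$-complete even if $G$ is a DAG, $\mathcal{G}$ has lifetime $2$, and all vertices are eternal.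
   Context: A temporal digraph is a triple $\mathcal{G}=(G,\gamma,\lambda)$ where $G$ is a finite digraph (loops and multiple edges allowed), $\gamma(v)\subseteq\mathbb{N}$ for each $v\in V(G)$, and $\lambda(e)\subseteq\mathbb{N}\times\mathbb{N}$ for each $e\in E(G)$, such that if $(t,t')\in\lambda(uv)$ then $t\le t'$, $t\in\gamma(u)$ and $t'\in\gamma(v)$. $G$ is the base digraph. The lifetime is $\mathsf{T}=\max\bigcup_{v}\gamma(v)$. Vertex $v$ is active at time $t$ if $t\in\gamma(v)$; $v$ is eternal if it is active at every timestamp of the lifetime. Temporal vertices: $V_T=\{(v,t): t\in\gamma(v)\}$; temporal edges: $E_T=\{(u,t)(v,t'): uv\in E(G),(t,t')\in\lambda(uv)\}$. The snapshot at time $t$ is the digraph formed by the vertices active at $t$ and the edges $uv$ with $(t,t)\in\lambda(uv)$. A temporal walk from $s_1$ to $s_k$ is a sequence $(s_1,\dots,s_k)$ of temporal vertices and temporal edges in which each temporal edge $s_i$ goes from $s_{i-1}$ to $s_{i+1}$ (both temporal vertices), and any two consecutive temporal vertices are of the form $(v,t),(v,t+1)$. A temporal subdigraph of $\mathcal{G}$ is $(G',\gamma',\lambda')$ with $G'\subseteq G$, $\gamma'\subseteq\gamma$, $\lambda'\subseteq\lambda$ (functions viewed as sets of pairs). For $R\subseteq V_T$, a temporal subdigraph $\mathcal{B}$ is a temporal-spanning branching with root $R$ if for every $(u,i)\in V_T$ there is exactly one temporal walk in $\mathcal{B}$ starting at some $r\in R$ and arriving at $(u,i)$; it is a vertex-spanning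 branching with root $R$ if for every $u\in V(G)$ there is exactly one temporal walk in $\mathcal{B}$ from $R$ to some temporal vertex of the form $(u,i)\in V_T$. Two branchings $\mathcal{B}_1=(G_1,\gamma_1,\lambda_1)$, $\mathcal{B}_2=(G_2,\gamma_2,\lambda_2)$ are t-edge-disjoint if $\lambda_1(e)\cap\lambda_2(e)=\emptyset$ for all $e\in E(G)$, and edge-disjoint if $E(G_1)\cap E(G_2)=\emptyset$. $k$ branchings are (t-)edge-disjoint if pairwise so.
   Formalization: The NP-completeness claims of item 2 are stated for k ≥ 2 only: for k = 1 edge-disjointness is vacuous, so the problem coincides with item 1 and is solvable in polynomial time, and NP-completeness would mean P = NP. *)

theory Defs
  imports "Graph_Theory.Arc_Walk"
begin

section \<open>Temporal digraphs\<close>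

text \<open>Arcs have an identity of their own, so loops and parallel arcs are allowed.\<close>

record ('v, 'e) tdigraph =
  base :: "('v, 'e) pre_digraph"
  active :: "'v \<Rightarrow> nat set"
  avail :: "'e \<Rightarrow> (nat \<times> nat) set"

text \<open>Timestamps are positive, so that a temporal digraph of lifetime \<open>T\<close> has the \<open>T\<close>
  timestamps \<open>1, \<dots>, T\<close>.\<close>

definition temporal_digraph :: "('v, 'e) tdigraph \<Rightarrow> bool" where
  "temporal_digraph \<G> \<longleftrightarrow>
     fin_digraph (base \<G>) \<and>
     (\<forall>v \<in> verts (base \<G>). finite (active \<G> v) \<and> 0 \<notin> active \<G> v) \<and>
     (\<forall>e \<in> arcs (base \<G>). \<forall>(t, t') \<in> avail \<G> e.
        t \<le> t' \<and> t \<in> active \<G> (tail (base \<G>) e) \<and> t' \<in> active \<G> (head (base \<G>) e))"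

text \<open>The inserted \<open>0\<close> only matters if no vertex is ever active.\<close>

definition lifetime :: "('v, 'e) tdigraph \<Rightarrow> nat" where
  "lifetime \<G> = Max (insert 0 (\<Union>v \<in> verts (base \<G>). active \<G> v))"

definition eternal :: "('v, 'e) tdigraph \<Rightarrow> 'v \<Rightarrow> bool" where
  "eternal \<G> v \<longleftrightarrow> (\<forall>t \<in> {1..lifetime \<G>}. t \<in> active \<G> v)"

definition all_eternal :: "('v, 'e) tdigraph \<Rightarrow> bool" where
  "all_eternal \<G> \<longleftrightarrow> (\<forall>v \<in> verts (base \<G>). eternal \<G> v)"

definition tverts :: "('v, 'e) tdigraph \<Rightarrow> ('v \<times> nat) set" where
  "tverts \<G> = {(v, t). v \<in> verts (base \<G>) \<and> t \<in> active \<G> v}"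

text \<open>The temporal edge \<open>(e, t, t')\<close> goes from \<open>(tail e, t)\<close> to \<open>(head e, t')\<close>.\<close>

definition tedges :: "('v, 'e) tdigraph \<Rightarrow> ('e \<times> nat \<times> nat) set" where
  "tedges \<G> = {(e, t, t'). e \<in> arcs (base \<G>) \<and> (t, t') \<in> avail \<G> e}"

definition snapshot :: "('v, 'e) tdigraph \<Rightarrow> nat \<Rightarrow> ('v, 'e) pre_digraph" where
  "snapshot \<G> t = (base \<G>)\<lparr>
     verts := {v \<in> verts (base \<G>). t \<in> active \<G> v},
     arcs := {e \<in> arcs (base \<G>). (t, t) \<in> avail \<G> e}\<rparr>"

definition snapshots_bounded :: "nat \<Rightarrow> ('v, 'e) tdigraph \<Rightarrow> bool" where
  "snapshots_bounded c \<G> \<longleftrightarrow>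
     (\<forall>t. card (verts (snapshot \<G> t)) + card (arcs (snapshot \<G> t)) \<le> c)"

text \<open>Forgetting the orientation of the arcs yields a star, with neither loops nor parallel
  (in particular no antiparallel) arcs.\<close>

definition underlying_star :: "('v, 'e) pre_digraph \<Rightarrow> bool" where
  "underlying_star G \<longleftrightarrow> (\<exists>c \<in> verts G.
     (\<forall>e \<in> arcs G. \<exists>v \<in> verts G - {c}. {tail G e, head G e} = {c, v}) \<and>
     (\<forall>v \<in> verts G - {c}. \<exists>!e. e \<in> arcs G \<and> {tail G e, head G e} = {c, v}))"

definition dag :: "('v, 'e) pre_digraph \<Rightarrow> bool" where
  "dag G \<longleftrightarrow> (\<nexists>p. pre_digraph.cycle G p)"


section \<open>Temporal walks and branchings\<close>

datatype ('v, 'e) titem = TV "'v \<times> nat" | TE "'e \<times> nat \<times> nat"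

definition temporal_walk :: "('v, 'e) tdigraph \<Rightarrow> ('v, 'e) titem list \<Rightarrow> bool" where
  "temporal_walk \<G> s \<longleftrightarrow>
     s \<noteq> [] \<and> set s \<subseteq> TV ` tverts \<G> \<union> TE ` tedges \<G> \<and>
     (\<forall>i < length s. \<forall>e t t'. s ! i = TE (e, t, t') \<longrightarrow>
        0 < i \<and> i + 1 < length s \<and>
        s ! (i - 1) = TV (tail (base \<G>) e, t) \<and> s ! (i + 1) = TV (head (base \<G>) e, t')) \<and>
     (\<forall>i. i + 1 < length s \<longrightarrow> (\<forall>v t w u. s ! i = TV (v, t) \<and> s ! (i + 1) = TV (w, u) \<longrightarrow>
        w = v \<and> u = t + 1))"

text \<open>Tails and heads are only compared on the arcs of the subdigraph; the library's
  \<open>subgraph\<close> compares them as total functions.\<close>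

definition tsubdigraph :: "('v, 'e) tdigraph \<Rightarrow> ('v, 'e) tdigraph \<Rightarrow> bool" where
  "tsubdigraph \<B> \<G> \<longleftrightarrow>
     temporal_digraph \<B> \<and>
     verts (base \<B>) \<subseteq> verts (base \<G>) \<and> arcs (base \<B>) \<subseteq> arcs (base \<G>) \<and>
     (\<forall>e \<in> arcs (base \<B>).
        tail (base \<B>) e = tail (base \<G>) e \<and> head (base \<B>) e = head (base \<G>) e) \<and>
     (\<forall>v \<in> verts (base \<B>). active \<B> v \<subseteq> active \<G> v) \<and>
     (\<forall>e \<in> arcs (base \<B>). avail \<B> e \<subseteq> avail \<G> e)"

definition temporal_spanning ::
    "('v, 'e) tdigraph \<Rightarrow> ('v \<times> nat) set \<Rightarrow> ('v, 'e) tdigraph \<Rightarrow> bool" where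
  "temporal_spanning \<G> R \<B> \<longleftrightarrow> (\<forall>(u, i) \<in> tverts \<G>.
     \<exists>!s. temporal_walk \<B> s \<and> (\<exists>r \<in> R. hd s = TV r) \<and> last s = TV (u, i))"

definition vertex_spanning ::
    "('v, 'e) tdigraph \<Rightarrow> ('v \<times> nat) set \<Rightarrow> ('v, 'e) tdigraph \<Rightarrow> bool" where
  "vertex_spanning \<G> R \<B> \<longleftrightarrow> (\<forall>u \<in> verts (base \<G>).
     \<exists>!s. temporal_walk \<B> s \<and> (\<exists>r \<in> R. hd s = TV r) \<and>
          (\<exists>i. (u, i) \<in> tverts \<G> \<and> last s = TV (u, i)))"

definition t_edge_disjoint :: "('v, 'e) tdigraph \<Rightarrow> ('v, 'e) tdigraph \<Rightarrow> bool" where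
  "t_edge_disjoint \<B>\<^sub>1 \<B>\<^sub>2 \<longleftrightarrow>
     (\<forall>e \<in> arcs (base \<B>\<^sub>1) \<inter> arcs (base \<B>\<^sub>2). avail \<B>\<^sub>1 e \<inter> avail \<B>\<^sub>2 e = {})"

definition edge_disjoint :: "('v, 'e) tdigraph \<Rightarrow> ('v, 'e) tdigraph \<Rightarrow> bool" where
  "edge_disjoint \<B>\<^sub>1 \<B>\<^sub>2 \<longleftrightarrow> arcs (base \<B>\<^sub>1) \<inter> arcs (base \<B>\<^sub>2) = {}"

type_synonym ('v, 'e) spanning_req =
  "('v, 'e) tdigraph \<Rightarrow> ('v \<times> nat) set \<Rightarrow> ('v, 'e) tdigraph \<Rightarrow> bool"

type_synonym ('v, 'e) disjointness_req = "('v, 'e) tdigraph \<Rightarrow> ('v, 'e) tdigraph \<Rightarrow> bool"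

definition disjoint_branchings ::
    "('v, 'e) disjointness_req \<Rightarrow> ('v, 'e) spanning_req \<Rightarrow>
     ('v, 'e) tdigraph \<Rightarrow> ('v \<times> nat) set list \<Rightarrow> ('v, 'e) tdigraph list \<Rightarrow> bool" where
  "disjoint_branchings dis spn \<G> Rs Bs \<longleftrightarrow>
     length Bs = length Rs \<and>
     (\<forall>i < length Rs. tsubdigraph (Bs ! i) \<G> \<and> spn \<G> (Rs ! i) (Bs ! i)) \<and>
     (\<forall>i < length Rs. \<forall>j < length Rs. i \<noteq> j \<longrightarrow> dis (Bs ! i) (Bs ! j))"


section \<open>Turing machines and complexity classes\<close>

text \<open>Deterministic machines with finitely many two-way infinite tapes. The states are
  \<open>0, \<dots>, num_states - 1\<close>, with initial state \<open>0\<close> and halting state \<open>1\<close>; the symbols are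
  \<open>0, \<dots>, num_syms - 1\<close>, with blank \<open>0\<close> and the two bits coded by \<open>1\<close> and \<open>2\<close>. Tape \<open>0\<close>
  carries the input and the output.\<close>

datatype move = Go_Left | Go_Stay | Go_Right

record tm =
  num_tapes :: nat
  num_syms :: nat
  num_states :: nat
  delta :: "nat \<Rightarrow> nat list \<Rightarrow> nat \<times> (nat \<times> move) list"

definition turing_machine :: "tm \<Rightarrow> bool" where
  "turing_machine M \<longleftrightarrow>
     1 \<le> num_tapes M \<and> 3 \<le> num_syms M \<and> 2 \<le> num_states M \<and>
     (\<forall>q < num_states M. \<forall>as. length as = num_tapes M \<and> (\<forall>a \<in> set as. a < num_syms M) \<longrightarrow>
        (case delta M q as of (q', bs) \<Rightarrow>
           q' < num_states M \<and> length bs = num_tapes M \<and> (\<forall>(b, m) \<in> set bs. b < num_syms M)))"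

type_synonym tape = "(int \<Rightarrow> nat) \<times> int"

type_synonym config = "nat \<times> tape list"

fun offset :: "move \<Rightarrow> int" where
  "offset Go_Left = -1"
| "offset Go_Stay = 0"
| "offset Go_Right = 1"

fun act :: "nat \<times> move \<Rightarrow> tape \<Rightarrow> tape" where
  "act (b, m) (f, p) = (f(p := b), p + offset m)"

fun step :: "tm \<Rightarrow> config \<Rightarrow> config" where
  "step M (q, ts) =
     (if q = 1 then (q, ts)
      else case delta M q (map (\<lambda>(f, p). f p) ts) of (q', bs) \<Rightarrow> (q', map2 act bs ts))"

definition word_tape :: "bool list \<Rightarrow> int \<Rightarrow> nat" where
  "word_tape x p =
     (if 0 \<le> p \<and> p < int (length x) then (if x ! nat p then 2 else 1) else 0)"

definition init :: "tm \<Rightarrow> bool list \<Rightarrow> config" where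
  "init M x = (0, (word_tape x, 0) # replicate (num_tapes M - 1) (\<lambda>_. 0, 0))"

text \<open>\<open>step\<close> fixes halted configurations, so this says that \<open>M\<close> halts on \<open>x\<close> with output \<open>y\<close>
  after at most \<open>n\<close> steps.\<close>

definition outputs_within :: "tm \<Rightarrow> bool list \<Rightarrow> nat \<Rightarrow> bool list \<Rightarrow> bool" where
  "outputs_within M x n y \<longleftrightarrow>
     (case (step M ^^ n) (init M x) of (q, ts) \<Rightarrow> q = 1 \<and> fst (hd ts) = word_tape y)"

definition poly_time :: "(bool list \<Rightarrow> bool list) \<Rightarrow> bool" where
  "poly_time f \<longleftrightarrow>
     (\<exists>M c d. turing_machine M \<and> (\<forall>x. outputs_within M x (c * length x ^ d + c) (f x)))"

type_synonym language = "bool list set"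

definition class_P :: "language set" where
  "class_P = {L. poly_time (\<lambda>x. [x \<in> L])}"


subsection \<open>Encodings\<close>

definition enc_list :: "('a \<Rightarrow> bool list) \<Rightarrow> 'a list \<Rightarrow> bool list" where
  "enc_list f xs = concat (map (\<lambda>x. True # f x) xs) @ [False]"

definition enc_pair :: "('a \<Rightarrow> bool list) \<Rightarrow> ('b \<Rightarrow> bool list) \<Rightarrow> 'a \<times> 'b \<Rightarrow> bool list" where
  "enc_pair f g p = f (fst p) @ g (snd p)"

definition enc_word :: "bool list \<Rightarrow> bool list" where
  "enc_word = enc_list (\<lambda>b. [b])"

fun nat_bits :: "nat \<Rightarrow> bool list" where
  "nat_bits n = (if n = 0 then [] else odd n # nat_bits (n div 2))"

declare nat_bits.simps [simp del]

definition enc_nat :: "nat \<Rightarrow> bool list" where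
  "enc_nat n = enc_word (nat_bits n)"

text \<open>All encodings are prefix-free, hence injective.\<close>

definition prefix_free :: "('a \<Rightarrow> bool list) \<Rightarrow> bool" where
  "prefix_free f \<longleftrightarrow> (\<forall>x y u v. f x @ u = f y @ v \<longrightarrow> x = y \<and> u = v)"

lemma prefix_free_imp_inj: "prefix_free f \<Longrightarrow> inj f"
  unfolding prefix_free_def inj_def by (metis append_Nil2)

lemma prefix_free_enc_list:
  assumes "prefix_free f"
  shows "prefix_free (enc_list f)"
proof -
  have "xs = ys \<and> u = v" if "enc_list f xs @ u = enc_list f ys @ v" for xs ys u v
    using that
  proof (induction xs arbitrary: ys)
    case Nil
    then show ?case by (cases ys) (auto simp: enc_list_def)
  next
    case (Cons x xs)
    from Cons.prems obtain y ys' where ys: "ys = y # ys'"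
      by (cases ys) (auto simp: enc_list_def)
    with Cons.prems have "f x @ (enc_list f xs @ u) = f y @ (enc_list f ys' @ v)"
      by (simp add: enc_list_def)
    with assms have "x = y" "enc_list f xs @ u = enc_list f ys' @ v"
      unfolding prefix_free_def by blast+
    with Cons.IH ys show ?case by blast
  qed
  then show ?thesis unfolding prefix_free_def by blast
qed

lemma prefix_free_enc_pair:
  "prefix_free f \<Longrightarrow> prefix_free g \<Longrightarrow> prefix_free (enc_pair f g)"
  unfolding prefix_free_def enc_pair_def by (metis append_assoc prod.collapse)

lemma prefix_free_enc_word: "prefix_free enc_word"
  unfolding enc_word_def by (rule prefix_free_enc_list) (simp add: prefix_free_def)

lemma nat_bits_inject: "nat_bits m = nat_bits n \<Longrightarrow> m = n"
proof (induction m arbitrary: n rule: less_induct)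
  case (less m)
  show ?case
  proof (cases "m = 0 \<or> n = 0")
    case True
    with less.prems show ?thesis
      by (metis list.distinct(1) nat_bits.simps)
  next
    case False
    with less.prems have *: "odd m = odd n" "nat_bits (m div 2) = nat_bits (n div 2)"
      by (metis list.inject nat_bits.simps)+
    have "m div 2 = n div 2"
      using False by (intro less.IH) (auto simp: *)
    with *(1) show ?thesis
      by (metis even_two_times_div_two odd_two_times_div_two_succ)
  qed
qed

lemma prefix_free_enc_nat: "prefix_free enc_nat"
  using prefix_free_enc_word nat_bits_inject unfolding prefix_free_def enc_nat_def by blast


subsection \<open>NP\<close>

definition class_NP :: "language set" where
  "class_NP = {L. \<exists>V \<in> class_P. \<exists>c d. \<forall>x.
     x \<in> L \<longleftrightarrow> (\<exists>y. length y \<le> c * length x ^ d + c \<and> enc_word x @ y \<in> V)}"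

definition poly_reducible :: "language \<Rightarrow> language \<Rightarrow> bool" where
  "poly_reducible L L' \<longleftrightarrow> (\<exists>f. poly_time f \<and> (\<forall>x. x \<in> L \<longleftrightarrow> f x \<in> L'))"

definition NP_complete :: "language \<Rightarrow> bool" where
  "NP_complete L \<longleftrightarrow> L \<in> class_NP \<and> (\<forall>L' \<in> class_NP. poly_reducible L' L)"


section \<open>The branching problems\<close>

text \<open>A finite temporal digraph is presented by the lists of its vertices, of its arcs
  \<open>(e, tail, head)\<close>, of its temporal vertices \<open>(v, t)\<close> and of its temporal edges \<open>(e, t, t')\<close>,
  all numbers being written in binary.\<close>

type_synonym presentation =
  "nat list \<times> (nat \<times> nat \<times> nat) list \<times> (nat \<times> nat) list \<times> (nat \<times> nat \<times> nat) list"

fun present :: "presentation \<Rightarrow> (nat, nat) tdigraph" where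
  "present (vs, as, gs, ls) =
     \<lparr>base = \<lparr>verts = set vs, arcs = fst ` set as,
              tail = (\<lambda>e. fst (the (map_of as e))), head = (\<lambda>e. snd (the (map_of as e)))\<rparr>,
      active = (\<lambda>v. {t. (v, t) \<in> set gs}),
      avail = (\<lambda>e. {(t, t'). (e, t, t') \<in> set ls})\<rparr>"

fun valid_presentation :: "presentation \<Rightarrow> bool" where
  "valid_presentation (vs, as, gs, ls) \<longleftrightarrow>
     distinct (map fst as) \<and> fst ` set gs \<subseteq> set vs \<and> fst ` set ls \<subseteq> fst ` set as \<and>
     temporal_digraph (present (vs, as, gs, ls))"

abbreviation enc_nat2 :: "nat \<times> nat \<Rightarrow> bool list" where
  "enc_nat2 \<equiv> enc_pair enc_nat enc_nat"

abbreviation enc_nat3 :: "nat \<times> nat \<times> nat \<Rightarrow> bool list" where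
  "enc_nat3 \<equiv> enc_pair enc_nat enc_nat2"

definition enc_presentation :: "presentation \<Rightarrow> bool list" where
  "enc_presentation =
     enc_pair (enc_list enc_nat) (enc_pair (enc_list enc_nat3)
       (enc_pair (enc_list enc_nat2) (enc_list enc_nat3)))"

type_synonym problem_instance = "presentation \<times> (nat \<times> nat) list list"

definition enc_instance :: "problem_instance \<Rightarrow> bool list" where
  "enc_instance = enc_pair enc_presentation (enc_list (enc_list enc_nat2))"

lemma prefix_free_enc_presentation: "prefix_free enc_presentation"
  unfolding enc_presentation_def
  by (intro prefix_free_enc_pair prefix_free_enc_list prefix_free_enc_nat)

lemma inj_enc_instance: "inj enc_instance"
  unfolding enc_instance_def
  by (intro prefix_free_imp_inj prefix_free_enc_pair prefix_free_enc_list prefix_free_enc_nat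
      prefix_free_enc_presentation)

type_synonym tdigraph_class = "(nat, nat) tdigraph \<Rightarrow> bool"

definition instances :: "nat \<Rightarrow> tdigraph_class \<Rightarrow> problem_instance set" where
  "instances k C = {(p, Rs). valid_presentation p \<and> C (present p) \<and>
     length Rs = k \<and> (\<forall>R \<in> set Rs. set R \<subseteq> tverts (present p))}"

definition branching_problem ::
    "(nat, nat) disjointness_req \<Rightarrow> (nat, nat) spanning_req \<Rightarrow>
     nat \<Rightarrow> tdigraph_class \<Rightarrow> language" where
  "branching_problem dis spn k C = {enc_instance (p, Rs) | p Rs.
     (p, Rs) \<in> instances k C \<and>
     (\<exists>Bs. disjoint_branchings dis spn (present p) (map set Rs) Bs)}"

text \<open>The search problem: on an instance of the class, the output is \<open>[False]\<close> if there are no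
  such branchings, and otherwise \<open>True\<close> followed by presentations of \<open>k\<close> such branchings.\<close>

definition find_branchings_poly_time ::
    "(nat, nat) disjointness_req \<Rightarrow> (nat, nat) spanning_req \<Rightarrow>
     nat \<Rightarrow> tdigraph_class \<Rightarrow> bool" where
  "find_branchings_poly_time dis spn k C \<longleftrightarrow> (\<exists>f. poly_time f \<and>
     (\<forall>(p, Rs) \<in> instances k C.
        if \<exists>Bs. disjoint_branchings dis spn (present p) (map set Rs) Bs
        then \<exists>bs. (\<forall>b \<in> set bs. valid_presentation b) \<and>
               disjoint_branchings dis spn (present p) (map set Rs) (map present bs) \<and>
               f (enc_instance (p, Rs)) = True # enc_list enc_presentation bs
        else f (enc_instance (p, Rs)) = [False]))"

definition solvable_poly_time ::
    "(nat, nat) disjointness_req \<Rightarrow> (nat, nat) spanning_req \<Rightarrow>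
     nat \<Rightarrow> tdigraph_class \<Rightarrow> bool" where
  "solvable_poly_time dis spn k C \<longleftrightarrow>
     branching_problem dis spn k C \<in> class_P \<and> find_branchings_poly_time dis spn k C"

abbreviation any_tdigraph :: tdigraph_class where
  "any_tdigraph \<equiv> \<lambda>_. True"

end

theory Submission
  imports Defs
begin

text \<open>Call an active time of a vertex a start if the vertex is inactive just before. Walks are unique exactly if every
  start that is not a root is entered by one temporal edge and nothing else is entered by an edge. So temporal-spanning
  branchings are arc-disjoint arborescences of the static digraph of temporal vertices, in which the waiting
  steps are free. They are found by Lovasz' greedy proof of Edmonds' theorem: an arc may be added to a partial
  arborescence as long as every set of vertices closed under waiting backwards keeps enough entering arcs,
  which for fixed \<open>k\<close> is tested by deleting fewer than \<open>k\<close> arcs and root sets in all possible ways. If every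
  vertex has a single start, then all temporal edges of an arc into that start are interchangeable, so edge-disjointness
  reduces to the same problem. The hardness results are reductions from satisfiability of clauses, which is
  NP-hard by Cook's tableau. Polynomial time bounds come from a class of functions on typed data that is closed
  under the usual list operations and bounded iteration and is compiled to multi-tape machines with a stack.\<close>

text \<open>Waiting is where the static picture departs from Edmonds' theorem: a waiting step may
  belong to all branchings at once and is no capacity. Hence only sets that no waiting step enters
  impose a demand; they are closed under union and intersection, so the uncrossing argument
  survives. For edge-disjointness the obstacle is that one arc can feed several starts of its head
  at different times, and the branching that owns the arc owns it at all these times. Choices made
  at different times are thereby coupled, and both temporal-spanning reductions exploit such heads:
  a center with one start for each variable and clause, and path vertices that vanish at time 2 and
  start again at time 3. Each reduction has one or two genuine branchings; the remaining ones get
  root sets from which waiting alone reaches all they have to span. On the side of machines, only a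
  few stack primitives are programmed directly. The price is that every iteration has to come with a
  bound on its intermediate values.\<close>

abbreviation (input) iff_ascii :: "bool => bool => bool" (infixr "<->" 25) where
  "A <-> B == A = B"

section \<open>Structured programs for Turing machines\<close>

datatype prog =
  Act "nat list => (nat \<times> move) list"
 | Seq prog prog
 | Cond "nat list => bool" prog prog
 | While "nat list => bool" prog

definition stay :: "nat list => (nat \<times> move) list" where
 "stay as = map (%a. (a, Go_Stay)) as"

definition reads :: "tape list => nat list" where
 "reads ts = map (%(f, p). f p) ts"

text \<open>The control state is the list of programs that remain to be executed. Only finitely many
 such lists are reachable, so that they can serve as the states of a Turing machine.\<close>

fun ctl :: "prog list => nat list => prog list \<times> (nat \<times> move) list" where
 "ctl [] as = ([], stay as)"
| "ctl (Act f # k) as = (k, f as)"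
| "ctl (Seq a b # k) as = (a # b # k, stay as)"
| "ctl (Cond P a b # k) as = ((if P as then a else b) # k, stay as)"
| "ctl (While P a # k) as = (if P as then a # While P a # k else k, stay as)"

fun pstep :: "prog list \<times> tape list => prog list \<times> tape list" where
 "pstep (k, ts) = (fst (ctl k (reads ts)), map2 act (snd (ctl k (reads ts))) ts)"

text \<open>The control lists met while \<open>c\<close> runs in front of \<open>k\<close>, before
  \<open>k\<close> itself is exposed. A loop is the continuation of its own body, which keeps the
  set finite however long the loop runs.\<close>

fun conts :: "prog => prog list => prog list set" where
 "conts (Act f) k = {Act f # k}"
| "conts (Seq a b) k = insert (Seq a b # k) (conts a (b # k) Un conts b k)"
| "conts (Cond P a b) k = insert (Cond P a b # k) (conts a k Un conts b k)"
| "conts (While P a) k = insert (While P a # k) (conts a (While P a # k))"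

fun wf_prog :: "nat => prog => bool" where
 "wf_prog N (Act f) <-> (ALL as. length as = N & (ALL a : set as. a < 3) -->
   length (f as) = N & (ALL (b, m) : set (f as). b < 3))"
| "wf_prog N (Seq a b) <-> wf_prog N a & wf_prog N b"
| "wf_prog N (Cond P a b) <-> wf_prog N a & wf_prog N b"
| "wf_prog N (While P a) <-> wf_prog N a"

lemma finite_conts: "finite (conts c k)"
 by (induction c arbitrary: k) auto

lemma conts_self: "c # k : conts c k"
 by (cases c) auto

lemma conts_closed: "l : conts c k ==> fst (ctl l as) : insert k (conts c k)"
proof (induction c arbitrary: k)
 case (Act f)
 then show ?case by simp
next
 case (Seq a b)
 from Seq.prems consider "l = Seq a b # k" | "l : conts a (b # k)" | "l : conts b k" by auto
 then show ?case
  by cases (use conts_self[of a "b # k"] conts_self[of b k] Seq.IH(1)[of "b # k"] Seq.IH(2)[of k]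
   in auto)
next
 case (Cond P a b)
 from Cond.prems consider "l = Cond P a b # k" | "l : conts a k" | "l : conts b k" by auto
 then show ?case
  by cases (use conts_self[of a k] conts_self[of b k] Cond.IH(1)[of k] Cond.IH(2)[of k] in auto)
next
 case (While P a)
 from While.prems consider "l = While P a # k" | "l : conts a (While P a # k)" by auto
 then show ?case
  by cases (use conts_self[of a "While P a # k"] While.IH[of "While P a # k"] in auto)
qed

lemma conts_wf:
 "l : conts c k ==> wf_prog N c ==> ALL a : set k. wf_prog N a ==> ALL a : set l. wf_prog N a"
proof (induction c arbitrary: k)
 case (Act f)
 then show ?case by simp
next
 case (Seq a b)
 from Seq.prems(1) consider "l = Seq a b # k" | "l : conts a (b # k)" | "l : conts b k" by auto
 then show ?case
 proof cases
  case 1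
  then show ?thesis using Seq.prems by simp
 next
  case 2
  show ?thesis by (rule Seq.IH(1)[OF 2]) (use Seq.prems in simp_all)
 next
  case 3
  show ?thesis by (rule Seq.IH(2)[OF 3]) (use Seq.prems in simp_all)
 qed
next
 case (Cond P a b)
 from Cond.prems(1) consider "l = Cond P a b # k" | "l : conts a k" | "l : conts b k" by auto
 then show ?case
 proof cases
  case 1
  then show ?thesis using Cond.prems by simp
 next
  case 2
  show ?thesis by (rule Cond.IH(1)[OF 2]) (use Cond.prems in simp_all)
 next
  case 3
  show ?thesis by (rule Cond.IH(2)[OF 3]) (use Cond.prems in simp_all)
 qed
next
 case (While P a)
 from While.prems(1) consider "l = While P a # k" | "l : conts a (While P a # k)" by auto
 then show ?case
 proof cases
  case 1
  then show ?thesis using While.prems by simp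
 next
  case 2
  show ?thesis by (rule While.IH[OF 2]) (use While.prems in simp_all)
 qed
qed

lemma ctl_wf:
 assumes "ALL a : set l. wf_prog N a" "length as = N" "ALL a : set as. a < 3"
 shows "length (snd (ctl l as)) = N & (ALL (b, m) : set (snd (ctl l as)). b < 3)"
proof (cases l)
 case Nil
 then show ?thesis using assms(2,3) by (auto simp: stay_def)
next
 case (Cons c k)
 then have wf: "wf_prog N c" using assms(1) by simp
 have "snd (ctl l as) = stay as | (EX f. c = Act f & snd (ctl l as) = f as)"
  using Cons by (cases c) auto
 then show ?thesis
 proof (elim disjE exE conjE)
  assume "snd (ctl l as) = stay as"
  then show ?thesis using assms(2,3) by (auto simp: stay_def)
 next
  fix f assume f: "c = Act f" and "snd (ctl l as) = f as"
  then show ?thesis using wf assms(2,3) unfolding f wf_prog.simps by simp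
 qed
qed

lemma length_reads [simp]: "length (reads ts) = length ts"
 by (simp add: reads_def)

lemma act_stay: "map2 act (stay (reads ts)) ts = ts"
 by (rule nth_equalityI) (auto simp: stay_def reads_def split: prod.splits)

lemma compile:
 assumes wf: "wf_prog N c" and N: "1 <= N"
 obtains M where "turing_machine M" "num_tapes M = N"
  "!!ts n ts'. (pstep ^^ n) ([c], ts) = ([], ts') ==> (step M ^^ n) (0, ts) = (1, ts')"
proof -
 define S where "S = insert [] (conts c [])"
 have fin: "finite S" by (simp add: S_def finite_conts)
 obtain g :: "prog list => nat" and n where g: "g ` S = {i. i < n}" "inj_on g S"
  using finite_imp_inj_to_nat_seg[OF fin] by (elim exE conjE)
 \<comment> \<open>State 0 must be the initial list \<open>[c]\<close> and state 1 the empty list,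
   where the machine halts; all other numbers are shifted by two.\<close>
 define e where "e k = (if k = [c] then 0 else if k = [] then 1 else g k + 2)" for k
 have e_inj: "inj_on e S"
 proof (rule inj_onI)
  fix x y assume "x : S" "y : S" "e x = e y"
  then show "x = y" using inj_onD[OF g(2), of x y] unfolding e_def by (simp split: if_splits)
 qed
 define d where "d = inv_into S e"
 have de: "d (e k) = k" if "k : S" for k
  using that e_inj by (simp add: d_def)
 have eS: "e k < n + 2" if "k : S" for k
  using g(1) that by (auto simp: e_def)
 \<comment> \<open>Numbers that code no list in \<open>S\<close> lead to the halting state, which
   makes the transition function total on all \<open>n + 2\<close> states.\<close>
 define M where "M = \<lparr>num_tapes = N, num_syms = 3, num_states = n + 2,
  delta = (%q as. if q : e ` S then (e (fst (ctl (d q) as)), snd (ctl (d q) as))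
       else (1, stay as))\<rparr>"
 have cS: "[c] : S" by (simp add: S_def conts_self)
 have cl: "fst (ctl k as) : S" if "k : S" for k as
  using that conts_closed[of k c "[]" as] by (auto simp: S_def)
 have wfS: "ALL a : set k. wf_prog N a" if "k : S" for k
  using that conts_wf[of k c "[]" N] wf by (auto simp: S_def)
 have tm: "turing_machine M"
  unfolding turing_machine_def
 proof (intro conjI allI impI)
  fix q as assume q: "q < num_states M"
   and as: "length as = num_tapes M & (ALL a:set as. a < num_syms M)"
  show "case delta M q as of (q', bs) => q' < num_states M & length bs = num_tapes M &
    (ALL (b, m):set bs. b < num_syms M)"
  proof (cases "q : e ` S")
   case True
   then obtain k where k: "k : S" "q = e k" by blast
   then have "delta M q as = (e (fst (ctl k as)), snd (ctl k as))"
    by (simp add: M_def de)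
   moreover have "length (snd (ctl k as)) = N & (ALL (b, m) : set (snd (ctl k as)). b < 3)"
    using ctl_wf[OF wfS[OF k(1)], of as] as by (simp add: M_def)
   ultimately show ?thesis
    using eS[OF cl[OF k(1), of as]] by (simp add: M_def)
  next
   case False
   then have "delta M q as = (1, stay as)" by (simp add: M_def)
   then show ?thesis using as by (auto simp: M_def stay_def)
  qed
 qed (use N in \<open>simp_all add: M_def\<close>)
 have one: "step M (e k, ts) = (e (fst (pstep (k, ts))), snd (pstep (k, ts)))
   & fst (pstep (k, ts)) : S" if k: "k : S" for k ts
 proof (cases "k = []")
  case True
  then show ?thesis by (auto simp: e_def act_stay S_def)
 next
  case False
  then have "e k ~= 1" by (auto simp: e_def)
  then show ?thesis
   using k cl[OF k] by (auto simp: M_def de[OF k] reads_def)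
 qed
 have many: "(step M ^^ n) (e k, ts) = (e (fst ((pstep ^^ n) (k, ts))), snd ((pstep ^^ n) (k, ts)))
   & fst ((pstep ^^ n) (k, ts)) : S" if k: "k : S" for k ts n
 proof (induction n)
  case 0
  then show ?case using k by simp
 next
  case (Suc n)
  then show ?case using one[of "fst ((pstep ^^ n) (k, ts))" "snd ((pstep ^^ n) (k, ts))"]
   by (simp del: step.simps pstep.simps)
 qed
 show thesis
 proof (rule that[OF tm])
  show "num_tapes M = N" by (simp add: M_def)
  fix ts n ts' assume "(pstep ^^ n) ([c], ts) = ([], ts')"
  then show "(step M ^^ n) (0, ts) = (1, ts')"
   using many[OF cS, of n ts] by (simp add: e_def del: step.simps pstep.simps)
 qed
qed

text \<open>The continuation is universally quantified so that runs can be chained. The number of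
  steps is exact here; upper bounds appear only in \<open>run\<close>.\<close>

definition exec :: "prog => tape list => nat => tape list => bool" where
 "exec c ts n ts' <-> (ALL k. (pstep ^^ n) (c # k, ts) = (k, ts'))"

text \<open>The summands follow the order of application from right to left: one step that unfolds
  the construct, \<open>m\<close> steps of its first part, \<open>n\<close> steps of the
  rest.\<close>

lemma funpow_add_one: "(f ^^ (n + m + 1)) x = (f ^^ n) ((f ^^ m) (f x))"
 by (simp only: funpow_add o_apply One_nat_def funpow.simps id_apply)

lemma exec_Act: "exec (Act f) ts 1 (map2 act (f (reads ts)) ts)"
 by (simp add: exec_def)

lemma exec_Seq:
 assumes "exec a ts m ts'" "exec b ts' n ts''"
 shows "exec (Seq a b) ts (n + m + 1) ts''"
 using assms unfolding exec_def funpow_add_one by (simp add: act_stay)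

lemma exec_Cond:
 assumes "exec (if P (reads ts) then a else b) ts m ts'"
 shows "exec (Cond P a b) ts (m + 1) ts'"
proof -
 have "exec (Cond P a b) ts (0 + m + 1) ts'"
  using assms unfolding exec_def funpow_add_one by (simp add: act_stay)
 then show ?thesis by simp
qed

lemma exec_While_False:
 assumes "~ P (reads ts)"
 shows "exec (While P a) ts 1 ts"
 using assms by (auto simp: exec_def act_stay)

lemma exec_While_True:
 assumes "P (reads ts)" "exec a ts m ts'" "exec (While P a) ts' n ts''"
 shows "exec (While P a) ts (n + m + 1) ts''"
 using assms unfolding exec_def funpow_add_one by (simp add: act_stay)


section \<open>Stack programs\<close>

definition bsym :: "bool => nat" where "bsym b = (if b then 2 else 1)"

text \<open>The top of the stack lies under the head and the rest to its right, with blanks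
  everywhere else. Popping thus erases and moves right, and a blank under the head means that the
  stack is empty.\<close>

definition stk :: "bool list => tape => bool" where
 "stk s t <-> fst t = (%q. if snd t <= q & q < snd t + int (length s)
   then bsym (s ! nat (q - snd t)) else 0)"

lemma stk_Pair: "stk s (f, p) <->
  f = (%q. if p <= q & q < p + int (length s) then bsym (s ! nat (q - p)) else 0)"
 unfolding stk_def fst_conv snd_conv ..

text \<open>Tape \<open>0\<close> is reserved for input and output and is described explicitly; the tapes
 \<open>1, ..., 4\<close> are stacks.\<close>

definition rep :: "tape => (nat => bool list) => tape list => bool" where
 "rep T S ts <-> length ts = 5 & ts ! 0 = T & (ALL i : {1..4}. stk (S i) (ts ! i))"

text \<open>The tapes are known only up to \<open>rep\<close>, which forgets the absolute positions
  of the stacks, and the time only up to a bound.\<close>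

definition run :: "prog => tape => (nat => bool list) => nat => tape => (nat => bool list) => bool"
 where "run c T S t T' S' <->
  (ALL ts. rep T S ts --> (EX n <= t. EX ts'. exec c ts n ts' & rep T' S' ts'))"

abbreviation one_tape :: "nat => (nat => nat \<times> move) => prog" where
 "one_tape i g == Act (%as. (stay as)[i := g (as ! i)])"

definition Pop :: "nat => prog" where "Pop i = one_tape i (%a. (0, Go_Right))"

text \<open>A machine step writes before it moves. The head therefore goes left while rewriting the
  old symbol, and the new bit is written in a separate step.\<close>

definition Push :: "nat => bool => prog" where
 "Push i b = Seq (one_tape i (%a. (a, Go_Left))) (one_tape i (%a. (bsym b, Go_Stay)))"

abbreviation While_nonempty :: "nat => prog => prog" where
 "While_nonempty i == While (%as. as ! i ~= 0)"

abbreviation If_top :: "nat => prog => prog => prog" where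
 "If_top i == Cond (%as. as ! i = 2)"

definition Nop :: prog where "Nop = Act stay"

lemma wf_one_tape:
 assumes "!!a. a < 3 ==> fst (g a) < 3" "i < 5"
 shows "wf_prog 5 (one_tape i g)"
proof -
 have "b < 3" if "(b, m) : set ((stay as)[i := g (as ! i)])" "length as = 5" "ALL a:set as. a < 3"
  for as b m
 proof -
  have "(b, m) : insert (g (as ! i)) (set (stay as))"
   using that(1) set_update_subset_insert by fast
  then show ?thesis
   using assms that(2,3) by (auto simp: stay_def) (metis fst_conv nth_mem)
 qed
 then show ?thesis by (auto simp: stay_def)
qed

lemma wf_Pop [simp]: "i < 5 ==> wf_prog 5 (Pop i)"
 unfolding Pop_def by (rule wf_one_tape) auto

lemma wf_Push [simp]: "i < 5 ==> wf_prog 5 (Push i b)"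
 unfolding Push_def wf_prog.simps(2) by (intro conjI wf_one_tape) (auto simp: bsym_def)

lemma wf_Nop [simp]: "wf_prog 5 Nop"
 by (auto simp: Nop_def stay_def)

lemma exec_one_tape:
 assumes "i < length ts"
 shows "exec (one_tape i g) ts 1 (ts[i := act (g (fst (ts ! i) (snd (ts ! i)))) (ts ! i)])"
proof -
 have "map2 act ((stay (reads ts))[i := g (reads ts ! i)]) ts
   = (map2 act (stay (reads ts)) ts)[i := act (g (reads ts ! i)) (ts ! i)]"
  using assms by (intro nth_equalityI) (auto simp: nth_list_update stay_def)
 moreover have "reads ts ! i = fst (ts ! i) (snd (ts ! i))"
  using assms by (simp add: reads_def split_beta)
 ultimately show ?thesis
  using exec_Act[of "%as. (stay as)[i := g (as ! i)]" ts] by (simp only: act_stay)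
qed

lemma rep_update:
 assumes "rep T S ts" "i : {1..4}" "stk s t"
 shows "rep T (S(i := s)) (ts[i := t])"
 using assms by (auto simp: rep_def nth_list_update)

lemma rep_update0: "rep T S ts ==> rep T' S (ts[0 := T'])"
 by (auto simp: rep_def nth_list_update)

lemma rep_read:
 assumes "rep T S ts" "i : {1..4}"
 shows "reads ts ! i = (case S i of [] => 0 | b # _ => bsym b)"
proof -
 have "stk (S i) (ts ! i)" "i < length ts" using assms by (auto simp: rep_def)
 then show ?thesis
  by (cases "ts ! i") (auto simp: reads_def stk_Pair split: list.split)
qed

lemma run_Pop [intro]:
 assumes i: "i : {1..4}" and S: "S i = b # s"
 shows "run (Pop i) T S 1 T (S(i := s))"
 unfolding run_def
proof (intro allI impI)
 fix ts assume r: "rep T S ts"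
 obtain f p where fp: "ts ! i = (f, p)" by fastforce
 have "stk (b # s) (f, p)" using r i S fp unfolding rep_def by force
 then have "stk s (f(p := 0), p + 1)"
  by (auto simp: stk_Pair fun_eq_iff nth_Cons' intro!: arg_cong[where f = "%i. bsym (s ! i)"])
 then have "rep T (S(i := s)) (ts[i := (f(p := 0), p + 1)])"
  by (rule rep_update[OF r i])
 moreover have "exec (Pop i) ts 1 (ts[i := (f(p := 0), p + 1)])"
  using exec_one_tape[of i ts "%a. (0, Go_Right)"] r i by (simp add: Pop_def fp rep_def)
 ultimately show "EX n<=1. EX ts'. exec (Pop i) ts n ts' & rep T (S(i := s)) ts'"
  by blast
qed

lemma run_Push [intro]:
 assumes i: "i : {1..4}"
 shows "run (Push i b) T S 3 T (S(i := b # S i))"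
 unfolding run_def
proof (intro allI impI)
 fix ts assume r: "rep T S ts"
 obtain f p where fp: "ts ! i = (f, p)" by fastforce
 have len: "i < length ts" using r i by (auto simp: rep_def)
 have "stk (S i) (f, p)" using r i fp unfolding rep_def by force
 then have s: "stk (b # S i) (f(p - 1 := bsym b), p - 1)"
  by (auto simp: stk_Pair fun_eq_iff nth_Cons' intro!: arg_cong[where f = "%j. bsym (S i ! j)"])
 have e1: "exec (one_tape i (%a. (a, Go_Left))) ts 1 (ts[i := (f, p - 1)])"
  using exec_one_tape[OF len, of "%a. (a, Go_Left)"] by (simp add: fp)
 have e2: "exec (one_tape i (%a. (bsym b, Go_Stay))) (ts[i := (f, p - 1)]) 1
   (ts[i := (f(p - 1 := bsym b), p - 1)])"
  using exec_one_tape[of i "ts[i := (f, p - 1)]" "%a. (bsym b, Go_Stay)"] len by simp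
 show "EX n<=3. EX ts'. exec (Push i b) ts n ts' & rep T (S(i := b # S i)) ts'"
  using exec_Seq[OF e1 e2] rep_update[OF r i s] unfolding Push_def
  by (intro exI[of _ "1 + 1 + 1"]) auto
qed

lemma run_Nop [intro]: "run Nop T S 1 T S"
 unfolding run_def Nop_def using exec_Act[of stay] by (auto simp: act_stay)

lemma run_mono: "run c T S t T' S' ==> t <= t' ==> run c T S t' T' S'"
 unfolding run_def by (meson le_trans)

lemma run_Seq:
 assumes "run a T S t T' S'" "run b T' S' t' T'' S''"
 shows "run (Seq a b) T S (t' + t + 1) T'' S''"
 unfolding run_def
proof (intro allI impI)
 fix ts assume "rep T S ts"
 with assms(1) obtain n ts' where 1: "n <= t" "exec a ts n ts'" "rep T' S' ts'"
  unfolding run_def by blast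
 with assms(2) obtain n' ts'' where 2: "n' <= t'" "exec b ts' n' ts''" "rep T'' S'' ts''"
  unfolding run_def by blast
 show "EX n<=t' + t + 1. EX ts'. exec (Seq a b) ts n ts' & rep T'' S'' ts'"
  using exec_Seq[OF 1(2) 2(2)] 1 2 by (intro exI[of _ "n' + n + 1"]) auto
qed

lemma run_If_True:
 assumes "S i = True # s" "i : {1..4}" "run a T S t T' S'"
 shows "run (If_top i a b) T S (t + 1) T' S'"
 unfolding run_def
proof (intro allI impI)
 fix ts assume r: "rep T S ts"
 with assms(3) obtain n ts' where 1: "n <= t" "exec a ts n ts'" "rep T' S' ts'"
  unfolding run_def by blast
 have "reads ts ! i = 2" using rep_read[OF r assms(2)] assms(1) by (simp add: bsym_def)
 then show "EX n<=t + 1. EX ts'. exec (If_top i a b) ts n ts' & rep T' S' ts'"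
  using exec_Cond[of "%as. as ! i = 2" ts a b n ts'] 1 by (intro exI[of _ "n + 1"]) auto
qed

lemma run_If_False:
 assumes "\<nexists>s. S i = True # s" "i : {1..4}" "run b T S t T' S'"
 shows "run (If_top i a b) T S (t + 1) T' S'"
 unfolding run_def
proof (intro allI impI)
 fix ts assume r: "rep T S ts"
 with assms(3) obtain n ts' where 1: "n <= t" "exec b ts n ts'" "rep T' S' ts'"
  unfolding run_def by blast
 have "reads ts ! i ~= 2" using rep_read[OF r assms(2)] assms(1)
  by (auto simp: bsym_def split: list.splits)
 then show "EX n<=t + 1. EX ts'. exec (If_top i a b) ts n ts' & rep T' S' ts'"
  using exec_Cond[of "%as. as ! i = 2" ts a b n ts'] 1 by (intro exI[of _ "n + 1"]) auto
qed

text \<open>The condition of a loop may inspect the tops of the stacks and the symbol on tape \<open>0\<close>.\<close>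

definition tops :: "tape => (nat => bool list) => nat list" where
 "tops T S = fst T (snd T) # map (%i. case S i of [] => 0 | b # _ => bsym b) [1, 2, 3, 4]"

lemma rep_tops:
 assumes "rep T S ts"
 shows "reads ts = tops T S"
proof (rule nth_equalityI)
 show l: "length (reads ts) = length (tops T S)"
  using assms by (simp add: rep_def tops_def)
 fix i assume "i < length (reads ts)"
 then have "i < 5" using l by (simp add: tops_def)
 then consider "i = 0" | "i = 1" | "i = 2" | "i = 3" | "i = 4" by linarith
 then show "reads ts ! i = tops T S ! i"
 proof cases
  case 1
  then show ?thesis using assms by (auto simp: reads_def tops_def rep_def split_beta)
 qed (use rep_read[OF assms, of i] in \<open>simp_all add: tops_def numeral_eq_Suc\<close>)
qed

lemma run_While_False:
 assumes "~ P (tops T S)"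
 shows "run (While P a) T S 1 T S"
 unfolding run_def
proof (intro allI impI)
 fix ts assume r: "rep T S ts"
 show "EX n<=1. EX ts'. exec (While P a) ts n ts' & rep T S ts'"
  using exec_While_False[of P ts a] assms rep_tops[OF r] r by (intro exI[of _ 1]) auto
qed

lemma run_While_True:
 assumes "P (tops T S)" "run a T S t T' S'" "run (While P a) T' S' t' T'' S''"
 shows "run (While P a) T S (t' + t + 1) T'' S''"
 unfolding run_def
proof (intro allI impI)
 fix ts assume r: "rep T S ts"
 with assms(2) obtain n ts' where 1: "n <= t" "exec a ts n ts'" "rep T' S' ts'"
  unfolding run_def by blast
 with assms(3) obtain n' ts'' where 2: "n' <= t'" "exec (While P a) ts' n' ts''" "rep T'' S'' ts''"
  unfolding run_def by blast
 show "EX n<=t' + t + 1. EX ts'. exec (While P a) ts n ts' & rep T'' S'' ts'"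
  using exec_While_True[of P, OF _ 1(2) 2(2)] assms(1) rep_tops[OF r] 1 2
  by (intro exI[of _ "n' + n + 1"]) auto
qed

lemma tops_nth:
 assumes "i : {1..4}"
 shows "tops T S ! i = (case S i of [] => 0 | b # _ => bsym b)"
proof -
 consider "i = 1" | "i = 2" | "i = 3" | "i = 4" using assms by force
 then show ?thesis by cases (simp_all add: tops_def numeral_eq_Suc)
qed

lemma tops_nonempty: "i : {1..4} ==> tops T S ! i ~= 0 <-> S i ~= []"
 by (simp add: tops_nth bsym_def split: list.split)

section \<open>Polynomially bounded functions\<close>

text \<open>Monotonicity is part of the notion because in a composition the bound on an intermediate
  value is substituted into the bound of the outer function.\<close>

definition polyb :: "(nat => nat) => bool" where
 "polyb p <-> mono p & (EX c d. ALL n. p n <= c * n ^ d + c)"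

lemma polyb_mono: "polyb p ==> m <= n ==> p m <= p n"
 by (auto simp: polyb_def mono_def)

text \<open>The summand \<open>1\<close> covers \<open>n = 0\<close>, where \<open>0 ^ 0 = 1\<close>
  may exceed the higher power.\<close>

lemma power_le_power_Suc0: "(n::nat) ^ a <= n ^ (a + b) + 1"
proof (cases n)
 case (Suc m)
 then have "n ^ a <= n ^ (a + b)" by (intro power_increasing) auto
 then show ?thesis by simp
qed (cases a; simp)

lemma polyb_const: "polyb (%_. c)"
 by (auto simp: polyb_def mono_def intro!: exI[of _ c])

lemma polyb_id: "polyb (%n. n)"
 by (auto simp: polyb_def mono_def intro!: exI[of _ 1])

lemma polyb_add:
 assumes "polyb p" "polyb q"
 shows "polyb (%n. p n + q n)"
proof -
 from assms obtain c d c' d' where pq: "!!n. p n <= c * n ^ d + c" "!!n. q n <= c' * n ^ d' + c'"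
  unfolding polyb_def by blast
 have "p n + q n <= (2 * (c + c')) * n ^ (d + d') + 2 * (c + c')" for n
 proof -
  have "p n <= c * (n ^ (d + d') + 1) + c"
   using pq(1)[of n] mult_le_mono2[OF power_le_power_Suc0[of n d d'], of c] by linarith
  moreover have "q n <= c' * (n ^ (d + d') + 1) + c'"
   using pq(2)[of n] mult_le_mono2[OF power_le_power_Suc0[of n d' d], of c']
   by (simp add: add.commute)
  ultimately show ?thesis by (simp add: algebra_simps)
 qed
 moreover have "mono (%n. p n + q n)"
  using assms by (auto simp: polyb_def mono_def intro: add_mono)
 ultimately show ?thesis unfolding polyb_def by blast
qed

lemma polyb_mult:
 assumes "polyb p" "polyb q"
 shows "polyb (%n. p n * q n)"
proof -
 from assms obtain c d c' d' where pq: "!!n. p n <= c * n ^ d + c" "!!n. q n <= c' * n ^ d' + c'"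
  unfolding polyb_def by blast
 have "p n * q n <= (4 * (c * c')) * n ^ (d + d') + 4 * (c * c')" for n
 proof -
  have "p n * q n <= (c * n ^ d + c) * (c' * n ^ d' + c')"
   using pq by (intro mult_le_mono) auto
  also have "... = (c * c') * (n ^ (d + d') + n ^ d + n ^ d' + 1)"
   by (simp add: algebra_simps power_add)
  also have "... <= (c * c') * (n ^ (d + d') + (n ^ (d + d') + 1) + (n ^ (d + d') + 1) + 1)"
   using power_le_power_Suc0[of n d d'] power_le_power_Suc0[of n d' d]
   by (intro mult_le_mono2 add_mono) (auto simp: add.commute)
  also have "... <= (4 * (c * c')) * n ^ (d + d') + 4 * (c * c')"
   by (simp add: algebra_simps)
  finally show ?thesis .
 qed
 moreover have "mono (%n. p n * q n)"
  using assms by (auto simp: polyb_def mono_def intro: mult_le_mono)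
 ultimately show ?thesis unfolding polyb_def by blast
qed

lemma polyb_power: "polyb p ==> polyb (%n. p n ^ k)"
 by (induction k) (auto intro: polyb_const polyb_mult)

lemmas polyb_intros = polyb_const polyb_id polyb_add polyb_mult polyb_power

lemma polyb_comp:
 assumes "polyb p" "polyb q"
 shows "polyb (%n. p (q n))"
proof -
 from assms(1) obtain c d where p: "!!n. p n <= c * n ^ d + c"
  unfolding polyb_def by blast
 have "polyb (%n. c * q n ^ d + c)"
  by (intro polyb_add polyb_mult polyb_power polyb_const assms)
 then obtain c' d' where "!!n. c * q n ^ d + c <= c' * n ^ d' + c'"
  unfolding polyb_def by blast
 then have "p (q n) <= c' * n ^ d' + c'" for n
  using p[of "q n"] le_trans by blast
 moreover have "mono (%n. p (q n))"
  using assms by (auto simp: polyb_def mono_def)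
 ultimately show ?thesis unfolding polyb_def by blast
qed


section \<open>Binary trees on a stack\<close>

datatype tree = Leaf | Node tree tree

text \<open>The code is prefix-free, so that a stack can hold a sequence of trees without separators.\<close>

fun enc :: "tree => bool list" where
 "enc Leaf = [False]"
| "enc (Node a b) = True # enc a @ enc b"

definition tsz :: "tree => nat" where "tsz x = length (enc x)"

lemma tsz_simps [simp]: "tsz Leaf = 1" "tsz (Node a b) = Suc (tsz a + tsz b)"
 by (simp_all add: tsz_def)

lemma tsz_pos [simp]: "0 < tsz x" "Suc 0 <= tsz x" by (cases x; simp)+

definition move_bit :: "nat => nat => prog" where
 "move_bit i j = If_top i (Seq (Pop i) (Push j True)) (Seq (Pop i) (Push j False))"

definition move_all :: "nat => nat => prog" where
 "move_all i j = While_nonempty i (move_bit i j)"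

text \<open>Stack 4 counts in unary the subtrees still to be read: \<open>True\<close> replaces one
  tree by its two children and adds one, \<open>False\<close> is a leaf and removes one. The end of
  the topmost code is found when the counter is empty.\<close>

definition scan_loop :: "nat => prog" where
 "scan_loop j = While_nonempty 4 (If_top 1 (Seq (move_bit 1 j) (Push 4 True))
   (Seq (move_bit 1 j) (Pop 4)))"

definition scan :: "nat => prog" where
 "scan j = Seq (Push 4 True) (scan_loop j)"

definition drop_top :: prog where
 "drop_top = Seq (scan 2) (While_nonempty 2 (Pop 2))"

text \<open>\<open>scan\<close> reverses a code and moving it back restores it. The order in which
  the two auxiliary stacks are emptied decides which code ends on top.\<close>

definition swap_top :: prog where
 "swap_top = Seq (scan 2) (Seq (scan 3) (Seq (move_all 2 1) (move_all 3 1)))"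

definition copy_loop :: prog where
 "copy_loop = While_nonempty 2 (If_top 2 (Seq (Pop 2) (Seq (Push 1 True) (Push 3 True)))
   (Seq (Pop 2) (Seq (Push 1 False) (Push 3 False))))"

definition dup_top :: prog where
 "dup_top = Seq (scan 2) (Seq copy_loop (Seq (move_all 3 2) (move_all 2 1)))"

lemma wf_stack_progs [simp]:
 "i < 5 ==> j < 5 ==> wf_prog 5 (move_bit i j)"
 "i < 5 ==> j < 5 ==> wf_prog 5 (move_all i j)"
 "j < 5 ==> wf_prog 5 (scan j)"
 "wf_prog 5 drop_top" "wf_prog 5 swap_top" "wf_prog 5 dup_top"
 by (simp_all add: move_bit_def move_all_def scan_def scan_loop_def drop_top_def swap_top_def
   copy_loop_def dup_top_def del: wf_prog.simps(1))

declare One_nat_def [simp del]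

lemma run_Pop': "i : {1..4} ==> S i = b # s ==> S' = S(i := s) ==> run (Pop i) T S 1 T S'"
 by (simp only:) (rule run_Pop)

lemma run_Push': "i : {1..4} ==> S' = S(i := b # S i) ==> run (Push i b) T S 3 T S'"
 by (simp only:) (rule run_Push)

lemma run_move_bit:
 assumes i: "i : {1..4}" "j : {1..4}" "i ~= j"
  and S: "S i = b # s" and S': "S' = S(i := s, j := b # S j)"
 shows "run (move_bit i j) T S 6 T S'"
proof -
 have 1: "run (Pop i) T S 1 T (S(i := s))" by (rule run_Pop'[of i S b s]) (use i S in simp_all)
 have 2: "run (Push j b) T (S(i := s)) 3 T S'"
  by (rule run_Push'[OF i(2)]) (use i(3) in \<open>simp add: S'\<close>)
 have *: "run (Seq (Pop i) (Push j b)) T S (3 + 1 + 1) T S'"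
  by (rule run_Seq[OF 1 2])
 have "run (move_bit i j) T S (3 + 1 + 1 + 1) T S'"
 proof (cases b)
  case True
  show ?thesis unfolding move_bit_def
   by (rule run_If_True[of S i s]) (use True S i * in simp_all)
 next
  case False
  show ?thesis unfolding move_bit_def
   by (rule run_If_False[of S i]) (use False S i * in simp_all)
 qed
 then show ?thesis by simp
qed

lemma run_While_nonempty:
 assumes "i : {1..4}" "S i ~= []" "run a T S t T' S'" "run (While_nonempty i a) T' S' t' T'' S''"
 shows "run (While_nonempty i a) T S (t' + t + 1) T'' S''"
proof -
 have "(%as. as ! i ~= 0) (tops T S)" using assms by (simp add: tops_nonempty del: neq0_conv)
 from run_While_True[of "%as. as ! i ~= 0", OF this assms(3,4)] show ?thesis .
qed

lemma run_While_empty: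
 assumes "i : {1..4}" "S i = []" shows "run (While_nonempty i a) T S 1 T S"
proof -
 have "~ (%as. as ! i ~= 0) (tops T S)" using assms by (simp add: tops_nonempty del: neq0_conv)
 from run_While_False[of "%as. as ! i ~= 0", OF this] show ?thesis .
qed

lemma run_move_all:
 assumes i: "i : {1..4}" "j : {1..4}" "i ~= j"
 shows "S i = s ==> S' = S(i := [], j := rev s @ S j) ==>
  run (move_all i j) T S (7 * length s + 1) T S'"
proof (induction s arbitrary: S)
 case Nil
 have "S' = S" using Nil by (simp add: fun_eq_iff)
 then show ?case
  unfolding move_all_def using run_While_empty[OF i(1), of S] Nil by simp
next
 case (Cons b s)
 define S1 where "S1 = S(i := s, j := b # S j)"
 have 1: "run (move_bit i j) T S 6 T S1"
  by (rule run_move_bit[of i j S b s]) (use i Cons.prems in \<open>simp_all add: S1_def\<close>)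
 have 2: "run (move_all i j) T S1 (7 * length s + 1) T S'"
  by (rule Cons.IH) (use i Cons.prems in \<open>auto simp: S1_def fun_eq_iff\<close>)
 have "run (move_all i j) T S (7 * length s + 1 + 6 + 1) T S'"
  unfolding move_all_def
  by (rule run_While_nonempty[OF i(1) _ 1 2[unfolded move_all_def]]) (simp add: Cons.prems)
 then show ?case by (rule run_mono) simp
qed

text \<open>Stated relative to a run that continues after \<open>x\<close>, because the loop does
  not stop between the two subtrees of a node. In the node case, the hypothesis for \<open>y\<close>
  supplies the continuation for \<open>x\<close>.\<close>

lemma run_scan_loop:
 assumes j: "j : {2, 3}"
 shows "S 1 = enc x @ rest ==> S 4 = b # cs ==>
  S'' = S(1 := rest, j := rev (enc x) @ S j, 4 := cs) ==> run (scan_loop j) T S'' t T' S' ==>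
  run (scan_loop j) T S (t + 12 * tsz x) T' S'"
proof (induction x arbitrary: S S'' rest b cs t)
 case Leaf
 have j': "j ~= 1" "j ~= 4" "j : {1..4}" using j by auto
 define S1 where "S1 = S(1 := rest, j := False # S j)"
 have 1: "run (move_bit 1 j) T S 6 T S1"
  by (rule run_move_bit[of _ _ _ False rest]) (use j' Leaf in \<open>simp_all add: S1_def\<close>)
 have 2: "run (Pop 4) T S1 1 T S''"
  by (rule run_Pop'[of _ _ b cs]) (use Leaf j' in \<open>auto simp: S1_def fun_eq_iff\<close>)
 have 3: "run (If_top 1 (Seq (move_bit 1 j) (Push 4 True)) (Seq (move_bit 1 j) (Pop 4))) T S
   (1 + 6 + 1 + 1) T S''"
  by (rule run_If_False[OF _ _ run_Seq[OF 1 2]]) (use Leaf in simp_all)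
 have "run (scan_loop j) T S (t + (1 + 6 + 1 + 1) + 1) T' S'"
  unfolding scan_loop_def
  by (rule run_While_nonempty[OF _ _ 3 Leaf.prems(4)[unfolded scan_loop_def]])
   (use Leaf in simp_all)
 then show ?case by (rule run_mono) simp
next
 case (Node x y)
 have j': "j ~= 1" "j ~= 4" "j : {1..4}" using j by auto
 define S1 where "S1 = S(1 := enc x @ enc y @ rest, j := True # S j)"
 define S2 where "S2 = S1(4 := True # b # cs)"
 define S3 where "S3 = S2(1 := enc y @ rest, j := rev (enc x) @ S2 j, 4 := b # cs)"
 have 1: "run (move_bit 1 j) T S 6 T S1"
  by (rule run_move_bit[of _ _ _ True "enc x @ enc y @ rest"])
   (use j' Node.prems in \<open>simp_all add: S1_def\<close>)
 have 2: "run (Push 4 True) T S1 3 T S2"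
  by (rule run_Push') (use j' Node.prems in \<open>simp_all add: S1_def S2_def\<close>)
 have 3: "run (If_top 1 (Seq (move_bit 1 j) (Push 4 True)) (Seq (move_bit 1 j) (Pop 4))) T S
   (3 + 6 + 1 + 1) T S2"
  by (rule run_If_True[OF _ _ run_Seq[OF 1 2]]) (use Node.prems in simp_all)
 have 4: "run (scan_loop j) T S3 (t + 12 * tsz y) T' S'"
  by (rule Node.IH(2)[OF _ _ _ Node.prems(4), of _ rest b cs])
   (use j' Node.prems in \<open>auto simp: S1_def S2_def S3_def fun_eq_iff\<close>)
 have 5: "run (scan_loop j) T S2 (t + 12 * tsz y + 12 * tsz x) T' S'"
  by (rule Node.IH(1)[OF _ _ _ 4, of _ "enc y @ rest" True "b # cs"])
   (use j' in \<open>auto simp: S1_def S2_def S3_def fun_eq_iff\<close>)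
 have "run (scan_loop j) T S (t + 12 * tsz y + 12 * tsz x + (3 + 6 + 1 + 1) + 1) T' S'"
  unfolding scan_loop_def
  by (rule run_While_nonempty[OF _ _ 3 5[unfolded scan_loop_def]]) (use Node.prems in simp_all)
 then show ?case by (rule run_mono) simp
qed

lemma run_scan:
 assumes j: "j : {2, 3}" and S: "S 1 = enc x @ rest" "S 4 = []"
  and S': "S' = S(1 := rest, j := rev (enc x) @ S j)"
 shows "run (scan j) T S (12 * tsz x + 5) T S'"
proof -
 have j': "j ~= 1" "j ~= 4" "j : {1..4}" using j by auto
 define S1 where "S1 = S(4 := [True])"
 have 1: "run (Push 4 True) T S 3 T S1"
  by (rule run_Push') (use S in \<open>simp_all add: S1_def\<close>)
 have 2: "run (scan_loop j) T S' 1 T S'"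
  unfolding scan_loop_def by (rule run_While_empty) (use S S' j' in simp_all)
 have 3: "run (scan_loop j) T S1 (1 + 12 * tsz x) T S'"
  by (rule run_scan_loop[OF j _ _ _ 2, of _ x rest True "[]"])
   (use S S' j' in \<open>auto simp: S1_def fun_eq_iff\<close>)
 show ?thesis unfolding scan_def by (rule run_mono[OF run_Seq[OF 1 3]]) simp
qed

text \<open>Stack 4 is in use only while \<open>scan\<close> runs, so it is empty in every state
  between two stack operations.\<close>

definition St :: "bool list => bool list => bool list => nat => bool list" where
 "St a b c = (%_. [])(1 := a, 2 := b, 3 := c)"

lemma St_simps [simp]:
 "St a b c 1 = a" "St a b c 2 = b" "St a b c 3 = c" "St a b c 4 = []"
 "(St a b c)(1 := x) = St x b c" "(St a b c)(2 := x) = St a x c" "(St a b c)(3 := x) = St a b x"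
 by (auto simp: St_def fun_eq_iff)

abbreviation "main s == St s [] []"

lemma run_drop: "run drop_top T (main (enc x @ rest)) (15 * tsz x + 10) T (main rest)"
proof -
 have 1: "run (scan 2) T (main (enc x @ rest)) (12 * tsz x + 5) T (St rest (rev (enc x)) [])"
  by (rule run_scan) auto
 have "run (While_nonempty 2 (Pop 2)) T (St rest s []) (2 * length s + 1) T (main rest)" for s
 proof (induction s)
  case Nil
  then show ?case by (intro run_mono[OF run_While_empty]) auto
 next
  case (Cons b s)
  have "run (Pop 2) T (St rest (b # s) []) 1 T (St rest s [])" by (rule run_Pop') auto
  from run_While_nonempty[OF _ _ this Cons] show ?case by (rule run_mono) auto
 qed
 from run_Seq[OF 1 this] show ?thesis
  unfolding drop_top_def by (rule run_mono) (simp add: tsz_def)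
qed

lemma run_swap:
 "run swap_top T (main (enc x @ enc y @ rest)) (20 * (tsz x + tsz y) + 20) T
   (main (enc y @ enc x @ rest))"
proof -
 have 1: "run (scan 2) T (main (enc x @ enc y @ rest)) (12 * tsz x + 5) T
   (St (enc y @ rest) (rev (enc x)) [])"
  by (rule run_scan) auto
 have 2: "run (scan 3) T (St (enc y @ rest) (rev (enc x)) []) (12 * tsz y + 5) T
   (St rest (rev (enc x)) (rev (enc y)))"
  by (rule run_scan) auto
 have 3: "run (move_all 2 1) T (St rest (rev (enc x)) (rev (enc y))) (7 * length (rev (enc x)) + 1) T
   (St (enc x @ rest) [] (rev (enc y)))"
  by (rule run_move_all) auto
 have 4: "run (move_all 3 1) T (St (enc x @ rest) [] (rev (enc y))) (7 * length (rev (enc y)) + 1) T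
   (main (enc y @ enc x @ rest))"
  by (rule run_move_all) auto
 show ?thesis
  unfolding swap_top_def
  by (rule run_mono[OF run_Seq[OF 1 run_Seq[OF 2 run_Seq[OF 3 4]]]]) (simp add: tsz_def)
qed

lemma run_dup:
 "run dup_top T (main (enc x @ rest)) (40 * tsz x + 40) T (main (enc x @ enc x @ rest))"
proof -
 have 1: "run (scan 2) T (main (enc x @ rest)) (12 * tsz x + 5) T (St rest (rev (enc x)) [])"
  by (rule run_scan) auto
 have "run copy_loop T (St r s c) (11 * length s + 1) T (St (rev s @ r) [] (rev s @ c))" for r s c
 proof (induction s arbitrary: r c)
  case Nil
  have "run copy_loop T (St r [] c) 1 T (St r [] c)"
   unfolding copy_loop_def by (rule run_While_empty) auto
  then show ?case by simp
 next
  case (Cons b s)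
  have a: "run (Pop 2) T (St r (b # s) c) 1 T (St r s c)" by (rule run_Pop') auto
  have b: "run (Push 1 b) T (St r s c) 3 T (St (b # r) s c)" by (rule run_Push') auto
  have c: "run (Push 3 b) T (St (b # r) s c) 3 T (St (b # r) s (b # c))" by (rule run_Push') auto
  note abc = run_Seq[OF a run_Seq[OF b c]]
  have "run (If_top 2 (Seq (Pop 2) (Seq (Push 1 True) (Push 3 True)))
    (Seq (Pop 2) (Seq (Push 1 False) (Push 3 False)))) T (St r (b # s) c)
    (3 + 3 + 1 + 1 + 1 + 1) T (St (b # r) s (b # c))"
  proof (cases b)
   case True
   show ?thesis by (rule run_If_True[of _ _ s]) (use True abc in simp_all)
  next
   case False
   show ?thesis by (rule run_If_False) (use False abc in simp_all)
  qed
  note step = run_While_nonempty[OF _ _ this Cons[of "b # r" "b # c", unfolded copy_loop_def]]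
  show ?case
   using run_mono[OF step, of "11 * length (b # s) + 1"] by (simp add: copy_loop_def)
 qed
 note 2 = this[of rest "rev (enc x)" "[]", simplified]
 have 3: "run (move_all 3 2) T (St (enc x @ rest) [] (enc x)) (7 * length (enc x) + 1) T
   (St (enc x @ rest) (rev (enc x)) [])"
  by (rule run_move_all) auto
 have 4: "run (move_all 2 1) T (St (enc x @ rest) (rev (enc x)) []) (7 * length (rev (enc x)) + 1) T
   (main (enc x @ enc x @ rest))"
  by (rule run_move_all) auto
 show ?thesis
  unfolding dup_top_def
  by (rule run_mono[OF run_Seq[OF 1 run_Seq[OF 2 run_Seq[OF 3 4]]]]) (simp add: tsz_def)
qed


section \<open>Polynomial time functions on trees\<close>

text \<open>Correctness above an arbitrary \<open>rest\<close> lets a program act as a subroutine on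
  the top of the stack. The size bound \<open>q\<close> accompanies the time bound \<open>p\<close>
  since a composition runs the outer program on an intermediate value. The domain \<open>D\<close>
  allows both bounds to hold only for trees that code data of a given kind.\<close>

definition pf_witness :: "tree set => prog => (nat => nat) => (nat => nat) => (tree => tree) => bool"
 where "pf_witness D c p q f <-> wf_prog 5 c & polyb p & polyb q & (ALL x : D. tsz (f x) <= q (tsz x)) &
   (ALL x : D. ALL rest T. run c T (main (enc x @ rest)) (p (tsz x)) T (main (enc (f x) @ rest)))"

definition pf :: "tree set => (tree => tree) => bool" where
 "pf D f <-> (EX c p q. pf_witness D c p q f)"

lemma pfI:
 assumes "wf_prog 5 c" "polyb p" "polyb q" "!!x. x : D ==> tsz (f x) <= q (tsz x)"
  "!!x T rest. x : D ==> run c T (main (enc x @ rest)) (p (tsz x)) T (main (enc (f x) @ rest))"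
 shows "pf D f"
proof -
 have "pf_witness D c p q f" unfolding pf_witness_def using assms by (intro conjI allI ballI)
 then show ?thesis unfolding pf_def by blast
qed

lemma pf_witnessD:
 assumes "pf_witness D c p q f"
 shows "wf_prog 5 c" "polyb p" "polyb q" "!!x. x : D ==> tsz (f x) <= q (tsz x)"
  "!!x rest T. x : D ==> run c T (main (enc x @ rest)) (p (tsz x)) T (main (enc (f x) @ rest))"
 using assms[unfolded pf_witness_def] by (simp_all only: simp_thms)

lemma pf_id: "pf D (%x. x)"
 by (rule pfI[where p = "%_. 1" and q = "%n. n" and c = Nop]) (auto intro: polyb_intros)

lemma pf_comp:
 assumes "pf D' f" "pf D g" and sub: "!!x. x : D ==> g x : D'"
 shows "pf D (%x. f (g x))"
proof -
 from assms(1) obtain c p q where "pf_witness D' c p q f" unfolding pf_def by blast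
 note f = pf_witnessD[OF this]
 from assms(2) obtain c' p' q' where "pf_witness D c' p' q' g" unfolding pf_def by blast
 note g = pf_witnessD[OF this]
 show ?thesis
 proof (rule pfI)
  show "wf_prog 5 (Seq c' c)" using f g by simp
  show "polyb (%n. p (q' n) + p' n + 1)" "polyb (%n. q (q' n))"
   by (intro polyb_intros polyb_comp[OF f(2) g(3)] polyb_comp[OF f(3) g(3)] f g)+
  fix x assume x: "x : D"
  show "tsz (f (g x)) <= q (q' (tsz x))"
   using f(4)[OF sub[OF x]] polyb_mono[OF f(3) g(4)[OF x]] by simp
  show "run (Seq c' c) T (main (enc x @ rest)) (p (q' (tsz x)) + p' (tsz x) + 1) T
    (main (enc (f (g x)) @ rest))" for T rest
   using run_mono[OF run_Seq[OF g(5)[OF x] f(5)[OF sub[OF x]]]] polyb_mono[OF f(2) g(4)[OF x]]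
   by simp
 qed
qed

text \<open>\<open>g\<close> is applied to the copy first, because the left subtree has to end on
  top. Two adjacent codes become the code of a \<open>Node\<close> by pushing the single bit
  \<open>True\<close>.\<close>

lemma pf_Node:
 assumes "pf D f" "pf D g"
 shows "pf D (%x. Node (f x) (g x))"
proof -
 from assms(1) obtain c p q where "pf_witness D c p q f" unfolding pf_def by blast
 note f = pf_witnessD[OF this]
 from assms(2) obtain c' p' q' where "pf_witness D c' p' q' g" unfolding pf_def by blast
 note g = pf_witnessD[OF this]
 show ?thesis
 proof (rule pfI)
  show "wf_prog 5 (Seq dup_top (Seq c' (Seq swap_top (Seq c (Push 1 True)))))"
   using f g by (simp del: wf_prog.simps(1))
  show "polyb (%n. p n + p' n + 40 * n + 20 * (q' n + n) + 80)" "polyb (%n. q n + q' n + 1)"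
   by (intro polyb_intros f g)+
  fix x assume x: "x : D"
  show "tsz (Node (f x) (g x)) <= q (tsz x) + q' (tsz x) + 1"
   using f(4)[OF x] g(4)[OF x] by simp
  fix T rest
  have 5: "run (Push 1 True) T (main (enc (f x) @ enc (g x) @ rest)) 3 T
    (main (enc (Node (f x) (g x)) @ rest))" by (rule run_Push') auto
  note r = run_Seq[OF run_dup run_Seq[OF g(5)[OF x] run_Seq[OF run_swap run_Seq[OF f(5)[OF x] 5]]]]
  show "run (Seq dup_top (Seq c' (Seq swap_top (Seq c (Push 1 True))))) T (main (enc x @ rest))
   (p (tsz x) + p' (tsz x) + 40 * tsz x + 20 * (q' (tsz x) + tsz x) + 80) T
   (main (enc (Node (f x) (g x)) @ rest))"
   by (rule run_mono[OF r]) (use g(4)[OF x] in simp)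
 qed
qed

fun left :: "tree => tree" where "left Leaf = Leaf" | "left (Node a b) = a"
fun right :: "tree => tree" where "right Leaf = Leaf" | "right (Node a b) = b"

lemma pf_left: "pf D left"
proof (rule pfI)
 show "wf_prog 5 (If_top 1 (Seq (Pop 1) (Seq swap_top drop_top)) Nop)"
  by (simp del: wf_prog.simps(1))
 show "polyb (%n. 100 * n + 100)" "polyb (%n. n)" by (intro polyb_intros)+
 show "tsz (left x) <= tsz x" for x by (cases x) auto
 show "run (If_top 1 (Seq (Pop 1) (Seq swap_top drop_top)) Nop) T (main (enc x @ rest))
   (100 * tsz x + 100) T (main (enc (left x) @ rest))" for T x rest
 proof (cases x)
  case Leaf
  show ?thesis unfolding Leaf left.simps right.simps
   by (rule run_mono[OF run_If_False[OF _ _ run_Nop]]) auto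
 next
  case (Node a b)
  have "run (Pop 1) T (main (enc x @ rest)) 1 T (main (enc a @ enc b @ rest))"
   by (rule run_Pop') (auto simp: Node)
  note r = run_Seq[OF this run_Seq[OF run_swap run_drop]]
  show ?thesis
   unfolding Node left.simps right.simps
   by (rule run_mono[OF run_If_True[OF _ _ r[unfolded Node]]]) auto
 qed
qed

lemma pf_right: "pf D right"
proof (rule pfI)
 show "wf_prog 5 (If_top 1 (Seq (Pop 1) drop_top) Nop)"
  by (simp del: wf_prog.simps(1))
 show "polyb (%n. 100 * n + 100)" "polyb (%n. n)" by (intro polyb_intros)+
 show "tsz (right x) <= tsz x" for x by (cases x) auto
 show "run (If_top 1 (Seq (Pop 1) drop_top) Nop) T (main (enc x @ rest))
   (100 * tsz x + 100) T (main (enc (right x) @ rest))" for T x rest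
 proof (cases x)
  case Leaf
  show ?thesis unfolding Leaf left.simps right.simps
   by (rule run_mono[OF run_If_False[OF _ _ run_Nop]]) auto
 next
  case (Node a b)
  have "run (Pop 1) T (main (enc x @ rest)) 1 T (main (enc a @ enc b @ rest))"
   by (rule run_Pop') (auto simp: Node)
  note r = run_Seq[OF this run_drop]
  show ?thesis
   unfolding Node left.simps right.simps
   by (rule run_mono[OF run_If_True[OF _ _ r[unfolded Node]]]) auto
 qed
qed

lemma pf_const: "pf D (%_. t)"
proof (induction t)
 case Leaf
 show ?case
 proof (rule pfI)
  show "wf_prog 5 (Seq drop_top (Push 1 False))" by (simp del: wf_prog.simps(1))
  show "polyb (%n. 100 * n + 100)" "polyb (%n. 1)" by (intro polyb_intros)+
  show "tsz Leaf <= 1" by simp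
  fix T x rest
  have "run (Push 1 False) T (main rest) 3 T (main (enc Leaf @ rest))" by (rule run_Push') auto
  from run_Seq[OF run_drop this]
  show "run (Seq drop_top (Push 1 False)) T (main (enc x @ rest)) (100 * tsz x + 100) T
   (main (enc Leaf @ rest))" by (rule run_mono) simp
 qed
qed (rule pf_Node)

lemma pf_cond:
 assumes "pf D b" "pf D f" "pf D g"
 shows "pf D (%x. if b x ~= Leaf then f x else g x)"
proof -
 from assms(1) obtain c0 p0 q0 where "pf_witness D c0 p0 q0 b" unfolding pf_def by blast
 note b = pf_witnessD[OF this]
 from assms(2) obtain c p q where "pf_witness D c p q f" unfolding pf_def by blast
 note f = pf_witnessD[OF this]
 from assms(3) obtain c' p' q' where "pf_witness D c' p' q' g" unfolding pf_def by blast
 note g = pf_witnessD[OF this]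
 let ?c = "Seq dup_top (Seq c0 (If_top 1 (Seq drop_top c) (Seq drop_top c')))"
 show ?thesis
 proof (rule pfI)
  show "wf_prog 5 ?c" using f g b by (simp del: wf_prog.simps(1))
  show "polyb (%n. p0 n + p n + p' n + 40 * n + 15 * q0 n + 100)" "polyb (%n. q n + q' n)"
   by (intro polyb_intros f g b)+
  show "tsz (if b x ~= Leaf then f x else g x) <= q (tsz x) + q' (tsz x)" if "x : D" for x
   using f(4)[OF that] g(4)[OF that] by simp
  fix x T rest assume x: "x : D"
  have 1: "run (Seq drop_top c) T (main (enc (b x) @ enc x @ rest)) (p (tsz x) + (15 * tsz (b x) + 10) + 1)
   T (main (enc (f x) @ rest))" by (rule run_Seq[OF run_drop f(5)[OF x]])
  have 2: "run (Seq drop_top c') T (main (enc (b x) @ enc x @ rest)) (p' (tsz x) + (15 * tsz (b x) + 10) + 1)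
   T (main (enc (g x) @ rest))" by (rule run_Seq[OF run_drop g(5)[OF x]])
  have 3: "run (If_top 1 (Seq drop_top c) (Seq drop_top c')) T (main (enc (b x) @ enc x @ rest))
    (p (tsz x) + p' (tsz x) + 15 * q0 (tsz x) + 12) T
    (main (enc (if b x ~= Leaf then f x else g x) @ rest))"
  proof (cases "b x")
   case Leaf
   have "run (If_top 1 (Seq drop_top c) (Seq drop_top c')) T (main (enc (b x) @ enc x @ rest))
     (p (tsz x) + p' (tsz x) + 15 * q0 (tsz x) + 12) T (main (enc (g x) @ rest))"
    by (rule run_mono[OF run_If_False[OF _ _ 2]]) (use Leaf b(4)[OF x] in auto)
   then show ?thesis using Leaf by simp
  next
   case (Node l r)
   have "run (If_top 1 (Seq drop_top c) (Seq drop_top c')) T (main (enc (b x) @ enc x @ rest))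
     (p (tsz x) + p' (tsz x) + 15 * q0 (tsz x) + 12) T (main (enc (f x) @ rest))"
    by (rule run_mono[OF run_If_True[OF _ _ 1]]) (use Node b(4)[OF x] in auto)
   then show ?thesis using Node by simp
  qed
  show "run ?c T (main (enc x @ rest))
   (p0 (tsz x) + p (tsz x) + p' (tsz x) + 40 * tsz x + 15 * q0 (tsz x) + 100) T
    (main (enc (if b x ~= Leaf then f x else g x) @ rest))"
   by (rule run_mono[OF run_Seq[OF run_dup run_Seq[OF b(5)[OF x] 3]]]) simp
 qed
qed

text \<open>The loop runs as long as the state is of the form \<open>Node (Node _ _) _\<close>; this is visible from
 the two topmost bits.\<close>

definition looping :: "tree => bool" where
 "looping x <-> left x ~= Leaf"

text \<open>A polynomial step iterated polynomially often may blow up exponentially, so besides the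
  number \<open>m\<close> of rounds, bounded by \<open>p\<close>, a bound \<open>q\<close> on all
  intermediate states is demanded. The states on which another round is made have to lie in
  \<open>D'\<close>, where the step function is known to be polynomial; the final state need
  not.\<close>

lemma pf_while:
 assumes f: "pf D' f" and p: "polyb p" "polyb q"
  and it: "!!x. x : D ==> EX m <= p (tsz x). (ALL i<m. (f ^^ i) x : D' & looping ((f ^^ i) x)) & ~ looping ((f ^^ m) x) &
   (ALL i<=m. tsz ((f ^^ i) x) <= q (tsz x)) & g x = (f ^^ m) x"
 shows "pf D g"
proof -
 from f obtain c r s where "pf_witness D' c r s f" unfolding pf_def by blast
 note f = pf_witnessD[OF this]
 text \<open>Tape 2 holds a flag that tells whether to continue.\<close>
 define test where "test = If_top 1 (Seq (Pop 1) (If_top 1 (Seq (Push 1 True) (Push 2 True)) (Push 1 True))) Nop"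
 define body where "body = Seq (Pop 2) (Seq c test)"
 have wf: "wf_prog 5 (Seq test (While_nonempty 2 body))"
  using f by (simp add: test_def body_def del: wf_prog.simps(1))
 have test: "run test T (main (enc x @ rest)) 12 T
   (St (enc x @ rest) (if looping x then [True] else []) [])" for T x rest
 proof (cases x)
  case Leaf
  have "run test T (main (enc x @ rest)) (1 + 1) T (main (enc x @ rest))"
   unfolding test_def by (rule run_If_False[OF _ _ run_Nop]) (auto simp: Leaf)
  then show ?thesis using Leaf by (auto simp: looping_def intro: run_mono)
 next
  case (Node a b)
  have 1: "run (Pop 1) T (main (enc x @ rest)) 1 T (main (enc a @ enc b @ rest))"
   by (rule run_Pop') (auto simp: Node)
  have 2: "run (Push 1 True) T (main (enc a @ enc b @ rest)) 3 T (main (enc x @ rest))"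
   by (rule run_Push') (auto simp: Node)
  have 3: "run (Push 2 True) T (main (enc x @ rest)) 3 T (St (enc x @ rest) [True] [])"
   by (rule run_Push') auto
  have "run (If_top 1 (Seq (Push 1 True) (Push 2 True)) (Push 1 True)) T (main (enc a @ enc b @ rest))
   8 T (St (enc x @ rest) (if looping x then [True] else []) [])"
  proof (cases a)
   case Leaf
   have "run (If_top 1 (Seq (Push 1 True) (Push 2 True)) (Push 1 True)) T (main (enc a @ enc b @ rest))
    8 T (main (enc x @ rest))"
    by (rule run_mono[OF run_If_False[OF _ _ 2]]) (auto simp: Leaf)
   then show ?thesis by (simp add: looping_def Leaf \<open>x = Node a b\<close>)
  next
   case (Node a' b')
   have "run (If_top 1 (Seq (Push 1 True) (Push 2 True)) (Push 1 True)) T (main (enc a @ enc b @ rest))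
    8 T (St (enc x @ rest) [True] [])"
    by (rule run_mono[OF run_If_True[OF _ _ run_Seq[OF 2 3]]]) (auto simp: Node)
   then show ?thesis by (simp add: looping_def Node \<open>x = Node a b\<close>)
  qed
  note 4 = run_Seq[OF 1 this]
  show ?thesis unfolding test_def by (rule run_mono[OF run_If_True[OF _ _ 4]]) (auto simp: Node)
 qed
 show ?thesis
 proof (rule pfI[OF wf])
  show "polyb (%n. (r (q n) + 17) * p n + 14)" "polyb q"
   by (intro polyb_intros polyb_comp[OF f(2) p(2)] p)+
  show "tsz (g x) <= q (tsz x)" if "x : D" for x using it[OF that] by auto
  fix x T rest assume x: "x : D"
  obtain m where m: "m <= p (tsz x)" "!!i. i < m ==> (f ^^ i) x : D' & looping ((f ^^ i) x)"
   "~ looping ((f ^^ m) x)" "!!i. i <= m ==> tsz ((f ^^ i) x) <= q (tsz x)" "g x = (f ^^ m) x"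
   using it[OF x] by blast
  \<comment> \<open>Induction on the number \<open>j\<close> of rounds that are left, so that each
    case prefixes one round to the run of the remaining ones.\<close>
  have loop: "run (While_nonempty 2 body) T
   (St (enc ((f ^^ (m - j)) x) @ rest) (if looping ((f ^^ (m - j)) x) then [True] else []) [])
   ((r (q (tsz x)) + 17) * j + 1) T (main (enc ((f ^^ m) x) @ rest))" if "j <= m" for j
   using that
  proof (induction j)
   case 0
   have "run (While_nonempty 2 body) T (main (enc ((f ^^ m) x) @ rest)) 1 T (main (enc ((f ^^ m) x) @ rest))"
    by (rule run_While_empty) auto
   then show ?case using m(3) by simp
  next
   case (Suc j)
   let ?y = "(f ^^ (m - Suc j)) x"
   have y: "f ?y = (f ^^ (m - j)) x"
    using Suc.prems by (metis Suc_diff_le diff_Suc_Suc funpow.simps(2) o_apply)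
   have l: "looping ?y" "?y : D'" using m(2)[of "m - Suc j"] Suc.prems by simp_all
   have 1: "run (Pop 2) T (St (enc ?y @ rest) [True] []) 1 T (main (enc ?y @ rest))"
    by (rule run_Pop') auto
   note 2 = run_Seq[OF 1 run_Seq[OF f(5)[OF l(2), of T rest] test[of T "f ?y" rest]], folded body_def, unfolded y]
   have le: "r (tsz ?y) <= r (q (tsz x))" using m(4)[of "m - Suc j"] f(2) by (auto intro: polyb_mono)
   have "run (While_nonempty 2 body) T (St (enc ?y @ rest) [True] [])
    ((r (q (tsz x)) + 17) * j + 1 + (12 + r (tsz ?y) + 1 + 1 + 1) + 1) T (main (enc ((f ^^ m) x) @ rest))"
    by (rule run_While_nonempty[OF _ _ 2 Suc.IH]) (use Suc.prems in auto)
   from run_mono[OF this, of "(r (q (tsz x)) + 17) * Suc j + 1"] le l show ?case by simp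
  qed
  have "run (Seq test (While_nonempty 2 body)) T (main (enc x @ rest))
    ((r (q (tsz x)) + 17) * m + 1 + 12 + 1) T (main (enc (g x) @ rest))"
   using run_Seq[OF test loop[of m]] m(5) by simp
  moreover have "(r (q (tsz x)) + 17) * m <= (r (q (tsz x)) + 17) * p (tsz x)"
   by (rule mult_le_mono2[OF m(1)])
  ultimately show "run (Seq test (While_nonempty 2 body)) T (main (enc x @ rest))
    ((r (q (tsz x)) + 17) * p (tsz x) + 14) T (main (enc (g x) @ rest))"
   by - (rule run_mono, assumption, simp)
 qed
qed


section \<open>Input and output\<close>

fun bt :: "bool => tree" where "bt False = Leaf" | "bt True = Node Leaf Leaf"
fun lt :: "bool list => tree" where "lt [] = Leaf" | "lt (b # bs) = Node (bt b) (lt bs)"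

lemma tsz_bt: "tsz (bt b) <= 3" by (cases b) auto

lemma tsz_lt: "tsz (lt bs) <= 4 * length bs + 1"
proof (induction bs)
 case (Cons b bs)
 then show ?case using tsz_bt[of b] by simp
qed simp

lemma length_le_tsz_lt: "length bs <= tsz (lt bs)"
 by (induction bs) auto

text \<open>The bits are put in front of the list in the order in which they leave stack 2, so a
  word stored there in reverse becomes the list tree of the word itself.\<close>

definition build :: prog where
 "build = While_nonempty 2 (If_top 2
   (Seq (Pop 2) (Seq (Push 1 False) (Seq (Push 1 False) (Seq (Push 1 True) (Push 1 True)))))
   (Seq (Pop 2) (Seq (Push 1 False) (Push 1 True))))"

lemma wf_build: "wf_prog 5 build" by (simp add: build_def del: wf_prog.simps(1))

lemma run_build:
 "run build T (St (enc (lt l) @ r) s []) (20 * length s + 1) T (main (enc (lt (rev s @ l)) @ r))"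
proof (induction s arbitrary: l)
 case Nil
 have "run build T (St (enc (lt l) @ r) [] []) 1 T (St (enc (lt l) @ r) [] [])"
  unfolding build_def by (rule run_While_empty) auto
 then show ?case by simp
next
 case (Cons b s)
 have 1: "run (Pop 2) T (St (enc (lt l) @ r) (b # s) []) 1 T (St (enc (lt l) @ r) s [])"
  by (rule run_Pop') auto
 have P: "run (Push 1 c) T (St a s []) 3 T (St (c # a) s [])" for c a
  by (rule run_Push') auto
 have "run (If_top 2
   (Seq (Pop 2) (Seq (Push 1 False) (Seq (Push 1 False) (Seq (Push 1 True) (Push 1 True)))))
   (Seq (Pop 2) (Seq (Push 1 False) (Push 1 True)))) T (St (enc (lt l) @ r) (b # s) []) 18 T
   (St (enc (lt (b # l)) @ r) s [])"
 proof (cases b)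
  case True
  have "run (If_top 2
   (Seq (Pop 2) (Seq (Push 1 False) (Seq (Push 1 False) (Seq (Push 1 True) (Push 1 True)))))
   (Seq (Pop 2) (Seq (Push 1 False) (Push 1 True)))) T (St (enc (lt l) @ r) (b # s) []) 18 T
   (St (True # True # False # False # enc (lt l) @ r) s [])"
   by (rule run_mono[OF run_If_True[OF _ _ run_Seq[OF 1 run_Seq[OF P run_Seq[OF P run_Seq[OF P P]]]]]])
    (auto simp: True)
  then show ?thesis using True by simp
 next
  case False
  have "run (If_top 2
   (Seq (Pop 2) (Seq (Push 1 False) (Seq (Push 1 False) (Seq (Push 1 True) (Push 1 True)))))
   (Seq (Pop 2) (Seq (Push 1 False) (Push 1 True)))) T (St (enc (lt l) @ r) (b # s) []) 18 T
   (St (True # False # enc (lt l) @ r) s [])"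
   by (rule run_mono[OF run_If_False[OF _ _ run_Seq[OF 1 run_Seq[OF P P]]]])
    (auto simp: False)
  then show ?thesis using False by simp
 qed
 note step = run_While_nonempty[OF _ _ this Cons[of "b # l", unfolded build_def]]
 show ?case
  using run_mono[OF step, of "20 * length (b # s) + 1"] by (simp add: build_def)
qed

text \<open>Makes the code of a value available as data. This yields a test for equality that is
  uniform in the type, and an injection of all typed data into the numbers.\<close>

lemma pf_bits: "pf D (%x. lt (enc x))"
proof (rule pfI)
 show "wf_prog 5 (Seq (scan 2) (Seq (Push 1 False) build))"
  using wf_build by (simp del: wf_prog.simps(1))
 show "polyb (%n. 40 * n + 40)" "polyb (%n. 4 * n + 1)" by (intro polyb_intros)+
 show "tsz (lt (enc x)) <= 4 * tsz x + 1" for x using tsz_lt[of "enc x"] by (simp add: tsz_def)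
 fix T x rest
 have 1: "run (scan 2) T (main (enc x @ rest)) (12 * tsz x + 5) T (St rest (rev (enc x)) [])"
  by (rule run_scan) auto
 have 2: "run (Push 1 False) T (St rest (rev (enc x)) []) 3 T (St (enc (lt []) @ rest) (rev (enc x)) [])"
  by (rule run_Push') auto
 have "run (Seq (scan 2) (Seq (Push 1 False) build)) T (main (enc x @ rest)) (40 * tsz x + 40) T
   (main (enc (lt (rev (rev (enc x)) @ [])) @ rest))"
  by (rule run_mono[OF run_Seq[OF 1 run_Seq[OF 2 run_build]]]) (simp add: tsz_def)
 then show "run (Seq (scan 2) (Seq (Push 1 False) build)) T (main (enc x @ rest)) (40 * tsz x + 40) T
   (main (enc (lt (enc x)) @ rest))" by simp
qed

lemma run_tape0: "T' = act (g (fst T (snd T))) T ==> run (one_tape 0 g) T S 1 T' S"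
 unfolding run_def
proof (intro allI impI)
 fix ts assume T': "T' = act (g (fst T (snd T))) T" and r: "rep T S ts"
 then have "0 < length ts" "ts ! 0 = T" by (auto simp: rep_def)
 then have "exec (one_tape 0 g) ts 1 (ts[0 := T'])"
  using exec_one_tape[of 0 ts g] T' by simp
 then show "EX n<=1. EX ts'. exec (one_tape 0 g) ts n ts' & rep T' S ts'"
  using rep_update0[OF r] by blast
qed

text \<open>The word is copied twice in reverse: stack 2 is the source for \<open>build\<close>,
  while stack 3 only records the length, by which the head is later moved back to cell 0. The input
  is erased on the way.\<close>

definition read_input :: prog where
 "read_input = While (%as. as ! 0 ~= 0) (Cond (%as. as ! 0 = 2)
   (Seq (one_tape 0 (%_. (0, Go_Right))) (Seq (Push 2 True) (Push 3 True)))
   (Seq (one_tape 0 (%_. (0, Go_Right))) (Seq (Push 2 False) (Push 3 False))))"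

definition rewind :: prog where
 "rewind = While_nonempty 3 (Seq (Pop 3) (one_tape 0 (%_. (0, Go_Left))))"

text \<open>In the code of a list of bits, \<open>True\<close> announces another element; the next
  bit then tells \<open>bt True\<close>, with a code of three bits, from \<open>bt False\<close>,
  with a code of one.\<close>

definition write_output :: prog where
 "write_output = While (%as. as ! 1 = 2) (Seq (Pop 1) (If_top 1
   (Seq (Pop 1) (Seq (Pop 1) (Seq (Pop 1) (one_tape 0 (%_. (2, Go_Right))))))
   (Seq (Pop 1) (one_tape 0 (%_. (1, Go_Right))))))"

lemma wf_io: "wf_prog 5 read_input" "wf_prog 5 rewind" "wf_prog 5 write_output"
 by (auto simp: read_input_def rewind_def write_output_def simp del: wf_prog.simps(1)
   intro!: wf_one_tape)

lemma run_Cond0: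
 assumes "run (if fst T (snd T) = 2 then a else b) T S t T' S'"
 shows "run (Cond (%as. as ! 0 = 2) a b) T S (t + 1) T' S'"
 unfolding run_def
proof (intro allI impI)
 fix ts assume r: "rep T S ts"
 with assms obtain n ts' where 1: "n <= t" "exec (if fst T (snd T) = 2 then a else b) ts n ts'"
   "rep T' S' ts'"
  unfolding run_def by blast
 have "reads ts ! 0 = fst T (snd T)" by (simp add: rep_tops[OF r] tops_def)
 then show "EX n<=t + 1. EX ts'. exec (Cond (%as. as ! 0 = 2) a b) ts n ts' & rep T' S' ts'"
  using exec_Cond[of "%as. as ! 0 = 2" ts a b n ts'] 1 by (intro exI[of _ "n + 1"]) auto
qed

lemma run_read_input:
 "stk s (f, p) ==> run read_input (f, p) (St [] u v) (12 * length s + 1)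
   (%_. 0, p + int (length s)) (St [] (rev s @ u) (rev s @ v))"
proof (induction s arbitrary: f p u v)
 case Nil
 then have f: "f = (%_. 0)" by (auto simp: stk_Pair)
 have "run read_input (f, p) (St [] u v) 1 (f, p) (St [] u v)"
  unfolding read_input_def by (rule run_While_False) (simp add: tops_def f)
 then show ?case by (simp add: f)
next
 case (Cons b s)
 then have fp: "f p = bsym b" by (auto simp: stk_Pair)
 have "stk s (f(p := 0), p + 1)" using Cons.prems
  by (auto simp: stk_Pair fun_eq_iff nth_Cons' One_nat_def intro!: arg_cong[where f = "%i. bsym (s ! i)"])
 from Cons.IH[OF this, of "b # u" "b # v"]
 have IH: "run read_input (f(p := 0), p + 1) (St [] (b # u) (b # v)) (12 * length s + 1)
   (%_. 0, p + int (length (b # s))) (St [] (rev (b # s) @ u) (rev (b # s) @ v))"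
  by (simp add: algebra_simps fun_upd_def)
 have 1: "run (one_tape 0 (%_. (0, Go_Right))) (f, p) (St [] u v) 1 (f(p := 0), p + 1) (St [] u v)"
  by (rule run_tape0) simp
 have 2: "run (Push 2 b) (f(p := 0), p + 1) (St [] u v) 3 (f(p := 0), p + 1) (St [] (b # u) v)"
  by (rule run_Push') auto
 have 3: "run (Push 3 b) (f(p := 0), p + 1) (St [] (b # u) v) 3 (f(p := 0), p + 1) (St [] (b # u) (b # v))"
  by (rule run_Push') auto
 note 4 = run_Seq[OF 1 run_Seq[OF 2 3]]
 have 5: "run (Cond (%as. as ! 0 = 2)
   (Seq (one_tape 0 (%_. (0, Go_Right))) (Seq (Push 2 True) (Push 3 True)))
   (Seq (one_tape 0 (%_. (0, Go_Right))) (Seq (Push 2 False) (Push 3 False)))) (f, p) (St [] u v)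
   (3 + 3 + 1 + 1 + 1 + 1) (f(p := 0), p + 1) (St [] (b # u) (b # v))"
  by (rule run_Cond0) (use 4 in \<open>cases b; simp add: fp bsym_def\<close>)
 show ?case unfolding read_input_def
  by (rule run_mono[OF run_While_True[OF _ 5 IH[unfolded read_input_def]]])
   (auto simp: tops_def fp bsym_def)
qed

lemma run_rewind:
 "run rewind (%_. 0, int (length v)) (St [] u v) (4 * length v + 1) (%_. 0, 0) (St [] u [])"
proof (induction v)
 case Nil
 have "run rewind (%_. 0, 0) (St [] u []) 1 (%_. 0, 0) (St [] u [])"
  unfolding rewind_def by (rule run_While_empty) auto
 then show ?case by simp
next
 case (Cons b v)
 have 1: "run (Pop 3) T (St [] u (b # v)) 1 T (St [] u v)" for T by (rule run_Pop') auto
 have 2: "run (one_tape 0 (%_. (0, Go_Left))) (%_. 0, int (length (b # v))) (St [] u v) 1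
   (%_. 0, int (length v)) (St [] u v)" by (rule run_tape0) (simp add: fun_eq_iff)
 show ?case unfolding rewind_def
  by (rule run_mono[OF run_While_nonempty[OF _ _ run_Seq[OF 1 2] Cons[unfolded rewind_def]]]) auto
qed

lemma word_tape_snoc:
 "(word_tape y)(int (length y) := (if b then 2 else 1)) = word_tape (y @ [b])"
 by (auto simp: word_tape_def fun_eq_iff nth_append)

lemma run_write_output:
 "run write_output (word_tape y, int (length y)) (main (enc (lt s) @ r)) (20 * length s + 1)
   (word_tape (y @ s), int (length (y @ s))) (main (False # r))"
proof (induction s arbitrary: y)
 case Nil
 have "run write_output (word_tape y, int (length y)) (main (False # r)) 1
   (word_tape y, int (length y)) (main (False # r))"
  unfolding write_output_def by (rule run_While_False) (simp add: tops_nth bsym_def)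
 then show ?case by simp
next
 case (Cons b s)
 let ?T = "(word_tape y, int (length y))" and ?T' = "(word_tape (y @ [b]), int (length (y @ [b])))"
 let ?s = "enc (lt s) @ r"
 have P: "run (Pop 1) ?T (main (c # t)) 1 ?T (main t)" for c t by (rule run_Pop') auto
 have W: "run (one_tape 0 (%_. (if b then 2 else 1, Go_Right))) ?T (main t) 1 ?T' (main t)" for t
  by (rule run_tape0) (simp add: word_tape_snoc)
 have "run (If_top 1
   (Seq (Pop 1) (Seq (Pop 1) (Seq (Pop 1) (one_tape 0 (%_. (2, Go_Right))))))
   (Seq (Pop 1) (one_tape 0 (%_. (1, Go_Right))))) ?T (main (enc (bt b) @ ?s)) 12 ?T' (main ?s)"
 proof (cases b)
  case True
  have "run (Seq (Pop 1) (Seq (Pop 1) (Seq (Pop 1) (one_tape 0 (%_. (2, Go_Right)))))) ?T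
    (main (True # False # False # ?s)) 8 ?T' (main ?s)"
   using run_mono[OF run_Seq[OF P run_Seq[OF P run_Seq[OF P W]]], of 8] True by simp
  from run_mono[OF run_If_True[OF _ _ this], of 1 _ 12] show ?thesis using True by simp
 next
  case False
  have "run (Seq (Pop 1) (one_tape 0 (%_. (1, Go_Right)))) ?T
    (main (False # ?s)) 8 ?T' (main ?s)"
   using run_mono[OF run_Seq[OF P W], of 8] False by simp
  from run_mono[OF run_If_False[OF _ _ this], of 1 12] show ?thesis using False by simp
 qed
 from run_Seq[OF P[of True "enc (bt b) @ ?s"] this]
 have 5: "run (Seq (Pop 1) (If_top 1
   (Seq (Pop 1) (Seq (Pop 1) (Seq (Pop 1) (one_tape 0 (%_. (2, Go_Right))))))
   (Seq (Pop 1) (one_tape 0 (%_. (1, Go_Right)))))) ?T (main (enc (lt (b # s)) @ r)) (12 + 1 + 1) ?T' (main ?s)"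
  by simp
 have "run write_output ?T (main (enc (lt (b # s)) @ r)) (20 * length s + 1 + (12 + 1 + 1) + 1)
  (word_tape ((y @ [b]) @ s), int (length ((y @ [b]) @ s))) (main (False # r))"
  unfolding write_output_def
  by (rule run_While_True[OF _ 5 Cons[of "y @ [b]", unfolded write_output_def]])
   (auto simp: tops_nth bsym_def)
 from run_mono[OF this, of "20 * length (b # s) + 1"] show ?case by simp
qed

lemma step_halted: "(step M ^^ n) (1, ts) = (1, ts)"
 by (induction n) auto

theorem poly_time_if_pf:
 assumes g: "pf (range lt) g" and eq: "!!x. g (lt x) = lt (f x)"
 shows "poly_time f"
proof -
 from g obtain c p q where "pf_witness (range lt) c p q g" unfolding pf_def by blast
 note c = pf_witnessD[OF this]
 define prog where "prog = Seq read_input (Seq rewind (Seq (Push 1 False) (Seq build (Seq c write_output))))"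
 have wf: "wf_prog 5 prog"
  using c(1) wf_io wf_build by (simp add: prog_def del: wf_prog.simps(1))
 obtain M where M: "turing_machine M" "num_tapes M = 5"
  "!!ts n ts'. (pstep ^^ n) ([prog], ts) = ([], ts') ==> (step M ^^ n) (0, ts) = (1, ts')"
  using compile[OF wf] by auto
 define P where "P n = 12 * n + 1 + (4 * n + 1) + 3 + (20 * n + 1) + p (4 * n + 1) + (20 * q (4 * n + 1) + 1) + 5" for n
 have "polyb P" unfolding P_def
  by (intro polyb_intros polyb_comp[OF c(2)] polyb_comp[OF c(3)])
 then obtain a d where ad: "!!n. P n <= a * n ^ d + a" unfolding polyb_def by blast
 have "outputs_within M x (a * length x ^ d + a) (f x)" for x
 proof -
  let ?n = "length x"
  have "stk x (word_tape x, 0)" by (simp add: stk_Pair word_tape_def bsym_def fun_eq_iff)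
  from run_read_input[OF this, of "[]" "[]"]
  have 1: "run read_input (word_tape x, 0) (main []) (12 * ?n + 1) (%_. 0, int (length (rev x))) (St [] (rev x) (rev x))"
   by simp
  have 2: "run (Push 1 False) T (St [] (rev x) []) 3 T (St (enc (lt []) @ []) (rev x) [])" for T
   by (rule run_Push') auto
  have 3: "run build T (St (enc (lt []) @ []) (rev x) []) (20 * ?n + 1) T (main (enc (lt x) @ []))" for T
   using run_build[of T "[]" "[]" "rev x"] by simp
  have 4: "run c T (main (enc (lt x) @ [])) (p (tsz (lt x))) T (main (enc (lt (f x)) @ []))" for T
   using c(5)[of "lt x" T "[]"] by (simp add: eq)
  \<comment> \<open>Reading has erased the input, so after rewinding tape 0 is the tape of the empty
    word and the output begins at cell 0.\<close>
  have "(%_. 0, 0) = (word_tape [], int (length ([] :: bool list)))" by (simp add: word_tape_def fun_eq_iff)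
  with run_write_output[of "[]" "f x" "[]"]
  have 5: "run write_output (%_. 0, 0) (main (enc (lt (f x)) @ [])) (20 * length (f x) + 1)
    (word_tape (f x), int (length (f x))) (main [False])" by simp
  note r = run_Seq[OF 1 run_Seq[OF run_rewind run_Seq[OF 2 run_Seq[OF 3 run_Seq[OF 4 5]]]], folded prog_def]
  have tx: "tsz (lt x) <= 4 * ?n + 1" by (rule tsz_lt)
  have fx: "length (f x) <= q (4 * ?n + 1)"
   using length_le_tsz_lt[of "f x"] c(4)[of "lt x"] polyb_mono[OF c(3) tx] by (simp add: eq)
  have px: "p (tsz (lt x)) <= p (4 * ?n + 1)" by (rule polyb_mono[OF c(2) tx])
  have "run prog (word_tape x, 0) (main []) (P ?n) (word_tape (f x), int (length (f x))) (main [False])"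
   by (rule run_mono[OF r]) (use fx px in \<open>simp add: P_def\<close>)
  moreover have "rep (word_tape x, 0) (main []) (snd (init M x))"
  proof -
   have "i < 5 ==> i = 0 | i = 1 | i = 2 | i = 3 | i = 4" for i :: nat by linarith
   then show ?thesis
    by (auto simp: rep_def init_def M(2) St_def stk_Pair nth_Cons' fun_eq_iff)
  qed
  ultimately obtain m ts' where m: "m <= P ?n" "exec prog (snd (init M x)) m ts'"
   "rep (word_tape (f x), int (length (f x))) (main [False]) ts'"
   unfolding run_def by blast
  have "(step M ^^ m) (init M x) = (1, ts')"
   using M(3)[of m "snd (init M x)" ts'] m(2) unfolding exec_def by (simp add: init_def)
  moreover have "m <= a * ?n ^ d + a" using m(1) ad[of ?n] by linarith
  \<comment> \<open>A halted configuration stays fixed, so the exact running time \<open>m\<close>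
    may be padded up to the polynomial.\<close>
  then obtain k where "a * ?n ^ d + a = k + m" using le_Suc_ex by (metis add.commute)
  ultimately have "(step M ^^ (a * ?n ^ d + a)) (init M x) = (1, ts')"
   by (simp add: funpow_add step_halted)
  moreover have "hd ts' = (word_tape (f x), int (length (f x)))"
   using m(3) by (cases ts') (auto simp: rep_def)
  ultimately show ?thesis by (simp add: outputs_within_def)
 qed
 with M(1) show ?thesis unfolding poly_time_def by blast
qed

declare One_nat_def [simp]

section \<open>Polynomial time functions on algebraic types\<close>

class tr =
 fixes to_tree :: "'a => tree"
 assumes to_tree_inj: "to_tree x = to_tree y ==> x = y"

instantiation unit :: tr
begin
definition "to_tree_unit (x :: unit) = Leaf"
instance by standard simp
end

instantiation bool :: tr
begin
definition "to_tree_bool = bt"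
instance
proof
 fix x y :: bool show "to_tree x = to_tree y ==> x = y"
  by (cases x; cases y) (auto simp: to_tree_bool_def)
qed
end

instantiation prod :: (tr, tr) tr
begin
definition "to_tree_prod p = Node (to_tree (fst p)) (to_tree (snd p))"
instance by standard (auto simp: to_tree_prod_def prod_eq_iff dest: to_tree_inj)
end

instantiation option :: (tr) tr
begin
definition "to_tree_option x = (case x of None => Leaf | Some y => Node Leaf (to_tree y))"
instance by standard (auto simp: to_tree_option_def dest: to_tree_inj split: option.splits)
end

instantiation list :: (tr) tr
begin
primrec to_tree_list :: "'a list => tree" where
 "to_tree_list [] = Leaf"
| "to_tree_list (x # xs) = Node (to_tree x) (to_tree_list xs)"
instance
proof
 fix x y :: "'a list" show "to_tree x = to_tree y ==> x = y"
 proof (induction x arbitrary: y)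
  case Nil then show ?case by (cases y) auto
 next
  case (Cons a x) then show ?case by (cases y) (auto dest: to_tree_inj)
 qed
qed
end

instantiation nat :: tr
begin
definition "to_tree_nat n = to_tree (nat_bits n)"
instance by standard (auto simp: to_tree_nat_def dest: to_tree_inj nat_bits_inject)
end

lemma to_tree_bools: "to_tree (bs :: bool list) = lt bs"
 by (induction bs) (auto simp: to_tree_bool_def)

definition sz :: "'a::tr => nat" where "sz x = tsz (to_tree x)"

lemma sz_simps [simp]:
 "sz () = 1" "sz (a, b) = Suc (sz a + sz b)" "sz ([] :: 'a::tr list) = 1" "sz (x # xs) = Suc (sz x + sz xs)"
 "sz (None :: 'a::tr option) = 1" "sz (Some x) = Suc (Suc (sz x))" "sz True = 3" "sz False = 1"
 by (simp_all add: sz_def to_tree_unit_def to_tree_prod_def to_tree_option_def to_tree_bool_def)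

lemma sz_pos [simp]: "0 < sz x" "Suc 0 <= sz x" by (simp_all add: sz_def)

lemma sz_bool: "sz (b::bool) <= 3" by (cases b) auto

lemma sz_nat: "sz n = sz (nat_bits n)" by (simp add: sz_def to_tree_nat_def)

lemma sz_append: "sz (xs @ ys) + 1 = sz xs + sz ys"
 by (induction xs) auto

lemma sz_take: "sz (take n xs) <= sz xs"
proof (induction xs arbitrary: n)
 case (Cons x xs)
 then show ?case by (cases n) auto
qed simp

lemma sz_drop: "sz (drop n xs) <= sz xs"
proof (induction xs arbitrary: n)
 case (Cons x xs)
 then show ?case by (cases n) (auto intro: le_SucI trans_le_add2)
qed simp

lemma sz_rev: "sz (rev xs) = sz xs"
proof (induction xs)
 case (Cons x xs)
 then show ?case using sz_append[of "rev xs" "[x]"] by simp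
qed simp

lemma length_less_sz: "length xs < sz xs"
 by (induction xs) auto

lemma sz_member: "x : set xs ==> sz x < sz xs"
 by (induction xs) auto

lemma sz_list_le: "(!!x. x : set xs ==> sz x <= B) ==> sz xs <= length xs * (B + 1) + 1"
proof (induction xs)
 case (Cons x xs)
 then have "sz xs <= length xs * (B + 1) + 1" "sz x <= B" by simp_all
 then show ?case by simp
qed simp

text \<open>The tree function is constrained only on codes of the argument type. Codes of different
  types may coincide: \<open>[]\<close>, \<open>None\<close>, \<open>False\<close> and
  \<open>0\<close> are all \<open>Leaf\<close>, and a pair of an element and a list is coded like
  the list with that element in front. Several constructors and destructors thereby act as the
  identity on trees.\<close>

definition realizes :: "(tree => tree) => ('a::tr => 'b::tr) => bool" where
 "realizes g f <-> pf (range (to_tree :: 'a => tree)) g & (ALL x. g (to_tree x) = to_tree (f x))"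

definition pt :: "('a::tr => 'b::tr) => bool" where
 "pt f <-> (EX g. realizes g f)"

lemma realizesD:
 fixes f :: "'a::tr => 'b::tr"
 assumes "realizes g f"
 shows "pf (range (to_tree :: 'a => tree)) g" "!!x. g (to_tree x) = to_tree (f x)"
 using assms unfolding realizes_def by blast+

lemma ptI:
 fixes f :: "'a::tr => 'b::tr"
 assumes "pf (range (to_tree :: 'a => tree)) g" "!!x. g (to_tree x) = to_tree (f x)"
 shows "pt f"
 using assms unfolding pt_def realizes_def by blast

lemma pt_bound:
 assumes "pt f"
 obtains q where "polyb q" "!!x. sz (f x) <= q (sz x)"
proof -
 from assms obtain g where g: "realizes g f" unfolding pt_def by blast
 obtain c p q where "pf_witness (range (to_tree :: 'a => tree)) c p q g"
  using realizesD(1)[OF g] unfolding pf_def by blast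
 note * = pf_witnessD(3,4)[OF this]
 have "sz (f x) <= q (sz x)" for x
  using *(2)[of "to_tree x"] realizesD(2)[OF g, of x] by (simp add: sz_def)
 with *(1) show ?thesis by (rule that)
qed

lemma poly_time_if_pt: "pt f ==> poly_time f"
proof -
 assume "pt f"
 then obtain g where g: "realizes g f" unfolding pt_def by blast
 have "(to_tree :: bool list => tree) = lt" by (rule ext) (rule to_tree_bools)
 with realizesD[OF g] show ?thesis by (intro poly_time_if_pf[of g]) auto
qed

lemma pt_id: "pt (%x. x)" by (rule ptI[OF pf_id]) simp

lemma pt_const: "pt (%_. c)" by (rule ptI[OF pf_const]) simp

lemma pt_comp:
 fixes f :: "'b::tr => 'c::tr" and g :: "'a::tr => 'b"
 assumes "pt f" "pt g" shows "pt (%x. f (g x))"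
proof -
 from assms obtain f' g' where "realizes f' f" "realizes g' g" unfolding pt_def by blast
 note f = realizesD[OF this(1)] and g = realizesD[OF this(2)]
 show ?thesis by (rule ptI[OF pf_comp[OF f(1) g(1)]]) (auto simp: f(2) g(2))
qed

lemma pt_Pair:
 fixes f :: "'a::tr => 'b::tr" and g :: "'a => 'c::tr"
 assumes "pt f" "pt g" shows "pt (%x. (f x, g x))"
proof -
 from assms obtain f' g' where "realizes f' f" "realizes g' g" unfolding pt_def by blast
 note f = realizesD[OF this(1)] and g = realizesD[OF this(2)]
 show ?thesis by (rule ptI[OF pf_Node[OF f(1) g(1)]]) (auto simp: to_tree_prod_def f(2) g(2))
qed

lemma pt_fst: "pt f ==> pt (%x. fst (f x))"
 by (rule pt_comp[of fst]) (auto intro: ptI[OF pf_left] simp: to_tree_prod_def)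

lemma pt_snd: "pt f ==> pt (%x. snd (f x))"
 by (rule pt_comp[of snd]) (auto intro: ptI[OF pf_right] simp: to_tree_prod_def)

lemma pt_comp2:
 assumes "pt (%p. h (fst p) (snd p))" "pt f" "pt g" shows "pt (%x. h (f x) (g x))"
 using pt_comp[OF assms(1) pt_Pair[OF assms(2,3)]] by simp

lemma pt_comp3:
 assumes "pt (%p. h (fst p) (fst (snd p)) (snd (snd p)))" "pt f" "pt g" "pt k"
 shows "pt (%x. h (f x) (g x) (k x))"
 using pt_comp[OF assms(1) pt_Pair[OF assms(2) pt_Pair[OF assms(3,4)]]] by simp

lemma pt_Cons: "pt f ==> pt g ==> pt (%x. f x # g x)"
 by (rule pt_comp2[of "(#)"]) (auto intro!: ptI[OF pf_id] simp: to_tree_prod_def)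

lemma pt_Some: "pt f ==> pt (%x. Some (f x))"
 by (rule pt_comp[of Some], rule ptI[OF pf_Node[OF pf_const pf_id]])
  (auto simp: to_tree_option_def)

lemma pt_if:
 fixes f g :: "'a::tr => 'b::tr"
 assumes "pt b" "pt f" "pt g" shows "pt (%x. if b x then f x else g x)"
proof -
 from assms obtain b' f' g' where "realizes b' b" "realizes f' f" "realizes g' g"
  unfolding pt_def by blast
 note b = realizesD[OF this(1)] and f = realizesD[OF this(2)] and g = realizesD[OF this(3)]
 have "to_tree c ~= Leaf <-> c" for c :: bool by (cases c) (auto simp: to_tree_bool_def)
 then show ?thesis
  by (intro ptI[OF pf_cond[OF b(1) f(1) g(1)]]) (simp add: f(2) g(2) b(2))
qed

text \<open>A nonempty list has the same code as the pair of its head and tail, so the node of the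
  codes of \<open>x\<close> and \<open>l x\<close> is already the code of the argument triple of
  \<open>h\<close>. For the empty list the argument is replaced by \<open>junk\<close>, since
  \<open>h'\<close> may be composed only with a function that maps into its domain.\<close>

lemma pt_case_list:
 fixes l :: "'a::tr => 'b::tr list" and a :: "'a => 'c::tr"
 assumes "pt l" "pt a" "pt (%p. h (fst p) (fst (snd p)) (snd (snd p)))"
 shows "pt (%x. case l x of [] => a x | y # ys => h x y ys)"
proof -
 from assms obtain l' a' h' where "realizes l' l" "realizes a' a"
  "realizes h' (%p. h (fst p) (fst (snd p)) (snd (snd p)))" unfolding pt_def by blast
 note l = realizesD[OF this(1)] and a = realizesD[OF this(2)] and h = realizesD[OF this(3)]
 define D1 where "D1 = range (%x. Node (to_tree x) (to_tree (l x)))"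
 define junk where "junk = to_tree (undefined :: 'a, undefined :: 'b, undefined :: 'b list)"
 define F where "F z = (if right z ~= Leaf then h' (if right z ~= Leaf then z else junk) else a' (left z))" for z
 have 1: "pf (range (to_tree :: 'a => tree)) (%x. Node x (l' x))" by (intro pf_Node pf_id l)
 have 2: "pf D1 (%z. if right z ~= Leaf then z else junk)"
  by (intro pf_cond pf_right pf_id pf_const)
 have 3: "pf D1 (%x. h' (if right x ~= Leaf then x else junk))"
 proof (rule pf_comp[OF h(1) 2])
  fix z assume "z : D1"
  then obtain x where z: "z = Node (to_tree x) (to_tree (l x))" by (auto simp: D1_def)
  show "(if right z ~= Leaf then z else junk) : range (to_tree :: 'a * 'b * 'b list => tree)"
  proof (cases "l x")
   case (Cons y ys)
   then have "z = to_tree (x, y, ys)" by (simp add: z to_tree_prod_def)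
   then show ?thesis by (auto simp: junk_def)
  qed (auto simp: z junk_def)
 qed
 have 4: "pf D1 (%x. a' (left x))"
  by (rule pf_comp[OF a(1) pf_left]) (auto simp: D1_def)
 have 5: "pf D1 F" unfolding F_def by (rule pf_cond[OF pf_right 3 4])
 show ?thesis
 proof (rule ptI[OF pf_comp[OF 5 1]])
  show "Node x (l' x) : D1" if "x : range (to_tree :: 'a => tree)" for x
   using that by (auto simp: D1_def l(2))
  fix x
  show "F (Node (to_tree x) (l' (to_tree x))) = to_tree (case l x of [] => a x | y # ys => h x y ys)"
   using h(2)[of "(x, hd (l x), tl (l x))"]
   by (cases "l x") (auto simp: F_def l(2) a(2) to_tree_prod_def)
 qed
qed

lemma pt_case_option:
 fixes l :: "'a::tr => 'b::tr option" and a :: "'a => 'c::tr"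
 assumes l: "pt l" and a: "pt a" and h: "pt (%p. h (fst p) (snd p))"
 shows "pt (%x. case l x of None => a x | Some y => h x y)"
proof -
 \<comment> \<open>\<open>Some y\<close> has the same code as the pair \<open>((), y)\<close>; one
   further node turns an optional value into a list with at most one element.\<close>
 define as_list :: "'b option => (unit \<times> 'b) list" where
  "as_list z = (case z of None => [] | Some y => [((), y)])" for z
 have "pt (as_list)"
 proof (rule ptI)
  show "pf (range (to_tree :: 'b option => tree)) (%z. if z ~= Leaf then Node z Leaf else Leaf)"
   by (intro pf_cond pf_id pf_Node pf_const)
  show "(if to_tree x ~= Leaf then Node (to_tree x) Leaf else Leaf) = to_tree (as_list x)" for x :: "'b option"
   by (cases x) (auto simp: as_list_def to_tree_option_def to_tree_prod_def to_tree_unit_def)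
 qed
 then have "pt (%x. as_list (l x))" by (rule pt_comp[OF _ l])
 moreover have "pt (%p. h (fst p) (snd (fst (snd p))))"
  by (rule pt_comp2[OF h]) (intro pt_fst pt_snd pt_id)+
 ultimately have "pt (%x. case as_list (l x) of [] => a x | y # ys => h x (snd y))"
  by (rule pt_case_list[OF _ a])
 moreover have "(case as_list (l x) of [] => a x | y # ys => h x (snd y)) =
   (case l x of None => a x | Some y => h x y)" for x
  by (cases "l x") (auto simp: as_list_def)
 ultimately show ?thesis by simp
qed

lemma pt_case_prod:
 "pt (%x. h x (fst (f x)) (snd (f x))) ==> pt (%x. case f x of (a, b) => h x a b)"
 by (simp add: case_prod_beta)

lemma pt_Let: "pt f ==> pt (%p. h (fst p) (snd p)) ==> pt (%x. let y = f x in h x y)"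
 unfolding Let_def by (rule pt_comp2[OF _ pt_id])

lemma pt_conj: "pt f ==> pt g ==> pt (%x. f x & g x)"
proof -
 assume "pt f" "pt g"
 from pt_if[OF this pt_const] have "pt (%x. if f x then g x else False)" .
 moreover have "(if f x then g x else False) <-> f x & g x" for x by simp
 ultimately show ?thesis by simp
qed

lemma pt_not: "pt f ==> pt (%x. ~ f x)"
proof -
 assume "pt f"
 from pt_if[OF this pt_const pt_const] have "pt (%x. if f x then False else True)" .
 moreover have "(%x. if f x then False else True) = (%x. ~ f x)" by (rule ext) simp
 ultimately show ?thesis by (simp only:)
qed

lemma pt_disj: "pt f ==> pt g ==> pt (%x. f x | g x)"
 using pt_not[OF pt_conj[OF pt_not pt_not, of f g]] by simp

lemma pt_imp: "pt f ==> pt g ==> pt (%x. f x --> g x)"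
 using pt_disj[OF pt_not, of f g] by simp

section \<open>Folds over lists and the list operations derived from them\<close>

fun tlen :: "tree => nat" where "tlen Leaf = 0" | "tlen (Node a b) = Suc (tlen b)"

lemma tlen_to_tree [simp]: "tlen (to_tree xs) = length xs" by (induction xs) auto

text \<open>The loop state is the triple of the remaining list, the environment and the accumulator;
  it is of looping form exactly while the list is nonempty. As the number of rounds is at most the
  size of the list, the only thing to be supplied is a bound on the accumulator after every initial
  part of the fold.\<close>

lemma pt_foldl:
 fixes i :: "'e::tr => 'a::tr" and xs :: "'e => 'x::tr list"
 assumes i: "pt i" and xs: "pt xs" and st: "pt (%p. st (fst p) (fst (snd p)) (snd (snd p)))"
  and q: "polyb q" and bound: "!!x n. sz (foldl (st x) (i x) (take n (xs x))) <= q (sz x)"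
 shows "pt (%x. foldl (st x) (i x) (xs x))"
proof -
 from st obtain S where rS: "realizes S (%p. st (fst p) (fst (snd p)) (snd (snd p)))"
  unfolding pt_def by blast
 note S = realizesD(1)[OF rS]
 have S2: "S (to_tree (x, a, y)) = to_tree (st x a y)" for x a y
  using realizesD(2)[OF rS, of "(x, a, y)"] by simp
 define F where "F z = Node (right (left z)) (Node (left (right z))
   (S (Node (left (right z)) (Node (right (right z)) (left (left z))))))" for z
 define D' where "D' = {to_tree (y # ys, x :: 'e, a :: 'a) | y (ys :: 'x list) x a. True} "
 define D where "D = {to_tree (xs x, x, i x) | x. True}"
 define g where "g z = (F ^^ tlen (left z)) z" for z
 have F: "F (to_tree (y # ys, x, a)) = to_tree (ys, x, st x a y)" for y ys x a
  using S2[of x a y] by (simp add: F_def to_tree_prod_def)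
 have it: "(F ^^ n) (to_tree (ys, x, a)) = to_tree (drop n ys, x, foldl (st x) a (take n ys))"
  if "n <= length ys" for n ys x a
  using that
 proof (induction n arbitrary: ys a)
  case (Suc n)
  then obtain z zs where "ys = z # zs" by (cases ys) auto
  then show ?case using Suc by (simp add: funpow_Suc_right F del: funpow.simps)
 qed simp
 have "pf D' F" unfolding F_def
 proof (intro pf_Node pf_comp[OF S])
  fix z assume "z : D'"
  then obtain y :: 'x and ys and x :: 'e and a :: 'a where "z = to_tree (y # ys, x, a)"
   unfolding D'_def by blast
  then have "Node (left (right z)) (Node (right (right z)) (left (left z))) = to_tree (x, a, y)"
   by (simp add: to_tree_prod_def)
  then show "Node (left (right z)) (Node (right (right z)) (left (left z)))
    : range (to_tree :: 'e * 'a * 'x => tree)" by (simp only: rangeI)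
 qed (rule pf_comp[OF pf_left pf_left] pf_comp[OF pf_right pf_left] pf_comp[OF pf_left pf_right]
    pf_comp[OF pf_right pf_right], rule UNIV_I)+
 then have g: "pf D g"
 proof (rule pf_while[of _ _ "%n. n" "%n. n + q n + 2"])
  fix z assume "z : D"
  then obtain x where z: "z = to_tree (xs x, x, i x)" by (auto simp: D_def)
  let ?n = "length (xs x)"
  have gz: "g z = (F ^^ ?n) z" by (simp add: g_def z to_tree_prod_def)
  have szx: "sz x <= tsz z" "sz (xs x) + sz x + sz (i x) + 2 = tsz z"
   by (simp_all add: z sz_def to_tree_prod_def)
  have n: "?n <= tsz z" using length_less_sz[of "xs x"] szx by linarith
  have bd: "tsz ((F ^^ j) z) <= tsz z + q (tsz z) + 2" if "j <= ?n" for j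
  proof -
   have "tsz ((F ^^ j) z) = sz (drop j (xs x)) + sz x + sz (foldl (st x) (i x) (take j (xs x))) + 2"
    unfolding z it[OF that] by (simp add: sz_def to_tree_prod_def)
   moreover have "sz (drop j (xs x)) <= sz (xs x)" by (rule sz_drop)
   moreover have "sz (foldl (st x) (i x) (take j (xs x))) <= q (tsz z)"
    using bound[of x j] polyb_mono[OF q szx(1)] by linarith
   ultimately show ?thesis using szx by linarith
  qed
  have lp: "(F ^^ j) z : D' & looping ((F ^^ j) z)" if "j < ?n" for j
  proof -
   have "drop j (xs x) = xs x ! j # drop (Suc j) (xs x)" using that by (simp add: Cons_nth_drop_Suc)
   then have "(F ^^ j) z = to_tree (xs x ! j # drop (Suc j) (xs x), x, foldl (st x) (i x) (take j (xs x)))"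
    using that by (simp add: z it)
   then show ?thesis unfolding D'_def looping_def by (auto simp: to_tree_prod_def)
  qed
  have "~ looping ((F ^^ ?n) z)"
   unfolding z using it[of ?n "xs x" x "i x"] by (simp add: looping_def to_tree_prod_def)
  then show "EX m<=tsz z. (ALL i<m. (F ^^ i) z : D' & looping ((F ^^ i) z)) & ~ looping ((F ^^ m) z) &
    (ALL i<=m. tsz ((F ^^ i) z) <= tsz z + q (tsz z) + 2) & g z = (F ^^ m) z"
   using n gz bd lp by blast
 qed (intro polyb_intros q)+
 have "pt (%x. (xs x, x, i x))" by (intro pt_Pair pt_id i xs)
 then obtain k where "realizes k (%x. (xs x, x, i x))" unfolding pt_def by blast
 note k = realizesD[OF this]
 have 1: "pf (range (to_tree :: 'e => tree)) (%z. g (k z))"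
  by (rule pf_comp[OF g k(1)]) (auto simp: D_def k(2))
 have 2: "pf (range (to_tree :: 'e => tree)) (%z. right (right (g (k z))))"
  by (rule pf_comp[OF pf_right pf_comp[OF pf_right 1]]) auto
 show ?thesis
 proof (rule ptI[OF 2])
  fix x
  have "left (to_tree (xs x, x, i x)) = to_tree (xs x)" by (simp add: to_tree_prod_def)
  then have "g (k (to_tree x)) = to_tree ([] :: 'x list, x, foldl (st x) (i x) (xs x))"
   unfolding g_def k(2) using it[of "length (xs x)" "xs x" x "i x"] by simp
  then show "right (right (g (k (to_tree x)))) = to_tree (foldl (st x) (i x) (xs x))"
   by (simp add: to_tree_prod_def)
 qed
qed

lemma pt_rev: "pt f ==> pt (%x. rev (f x))"
proof -
 have *: "foldl (%a y. y # a) a xs = rev xs @ a" for a xs :: "'b list" by (induction xs arbitrary: a) auto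
 have "pt (%xs :: 'b list. foldl (%a y. y # a) [] xs)"
 proof (rule pt_foldl[where q = "%n. n"])
  show "sz (foldl (%a y. y # a) [] (take n x)) <= sz x" for n and x :: "'b list"
   by (simp add: * sz_rev sz_take)
 qed (intro pt_const pt_id pt_Cons pt_fst pt_snd polyb_intros)+
 then have "pt (rev :: 'b list => _)" by (simp add: *)
 then show "pt f ==> pt (%x. rev (f x))" by (rule pt_comp)
qed

lemma pt_append: "pt f ==> pt g ==> pt (%x. f x @ g x)"
proof -
 have *: "foldl (%a y. y # a) a xs = rev xs @ a" for a xs :: "'b list" by (induction xs arbitrary: a) auto
 have "pt (%p :: 'b list \<times> 'b list. foldl (%a y. y # a) (snd p) (rev (fst p)))"
 proof (rule pt_foldl[where q = "%n. n"])
  fix x :: "'b list \<times> 'b list" and n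
  show "sz (foldl (%a y. y # a) (snd x) (take n (rev (fst x)))) <= sz x"
   using sz_append[of "rev (take n (rev (fst x)))" "snd x"] sz_take[of n "rev (fst x)"]
   unfolding * sz_rev by (cases x) simp
 qed (intro pt_const pt_id pt_Cons pt_fst pt_snd polyb_intros pt_rev)+
 then have "pt (%p :: 'b list \<times> 'b list. fst p @ snd p)" by (simp add: *)
 then show "pt f ==> pt g ==> pt (%x. f x @ g x)" by (rule pt_comp2)
qed

lemma pt_map:
 assumes xs: "pt xs" and h: "pt (%p. h (fst p) (snd p))"
 shows "pt (%x. map (h x) (xs x))"
proof -
 have *: "foldl (%a y. h x y # a) a ys = rev (map (h x) ys) @ a" for a ys x
  by (induction ys arbitrary: a) auto
 obtain q where q: "polyb q" "!!x y. sz (h x y) <= q (sz (x, y))"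
  using pt_bound[OF h] by (metis fst_conv snd_conv)
 obtain r where r: "polyb r" "!!x. sz (xs x) <= r (sz x)" using pt_bound[OF xs] by blast
 have "pt (%x. rev (foldl (%a y. h x y # a) [] (xs x)))"
 proof (rule pt_rev, rule pt_foldl[OF pt_const xs, where q = "%n. r n * (q (n + r n + 1) + 1) + 1"])
  show "polyb (%n. r n * (q (n + r n + 1) + 1) + 1)"
   by (intro polyb_intros q r polyb_comp[OF q(1)])
  show "pt (%p. h (fst p) (snd (snd p)) # fst (snd p))"
   by (intro pt_Cons pt_comp2[OF h] pt_fst pt_snd pt_id)
  fix x n
  have el: "sz y <= q (sz x + r (sz x) + 1)" if y: "y : set (map (h x) (take n (xs x)))" for y
  proof -
   from y obtain z where "z : set (xs x)" "y = h x z" by (auto dest: in_set_takeD)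
   then have "sz (x, z) <= sz x + r (sz x) + 1" using r(2)[of x] sz_member[of z "xs x"] by simp
   from polyb_mono[OF q(1) this] show ?thesis unfolding \<open>y = h x z\<close> using q(2)[of x z] by linarith
  qed
  have "sz (map (h x) (take n (xs x))) <=
    length (map (h x) (take n (xs x))) * (q (sz x + r (sz x) + 1) + 1) + 1"
   by (rule sz_list_le) (rule el)
  also have "... <= r (sz x) * (q (sz x + r (sz x) + 1) + 1) + 1"
   using length_less_sz[of "xs x"] r(2)[of x] by (intro add_mono mult_le_mono) auto
  finally show "sz (foldl (%a y. h x y # a) [] (take n (xs x))) <=
    r (sz x) * (q (sz x + r (sz x) + 1) + 1) + 1" by (simp add: * sz_rev)
 qed
 then show ?thesis by (simp add: *)
qed

lemma pt_concat: "pt f ==> pt (%x. concat (f x))"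
proof -
 have *: "foldl (%a y. a @ y) a xs = a @ concat xs" for a and xs :: "'b list list"
  by (induction xs arbitrary: a) auto
 have c: "sz (concat xs) <= sz xs" for xs :: "'b list list"
 proof (induction xs)
  case (Cons y xs)
  then show ?case using sz_append[of y "concat xs"] by simp
 qed simp
 have "pt (%xs :: 'b list list. foldl (%a y. a @ y) [] xs)"
 proof (rule pt_foldl[where q = "%n. n"])
  fix x :: "'b list list" and n
  show "sz (foldl (%a y. a @ y) [] (take n x)) <= sz x"
   using c[of "take n x"] sz_take[of n x] by (simp add: *)
 qed (intro pt_const pt_id pt_append pt_fst pt_snd polyb_intros)+
 then have "pt (concat :: 'b list list => _)" by (simp add: *)
 then show "pt f ==> pt (%x. concat (f x))" by (rule pt_comp)
qed

lemma pt_filter: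
 assumes xs: "pt xs" and h: "pt (%p. P (fst p) (snd p))"
 shows "pt (%x. filter (P x) (xs x))"
proof -
 have "pt (%x. concat (map (%y. if P x y then [y] else []) (xs x)))"
  by (intro pt_concat pt_map xs pt_if h pt_Cons pt_const pt_snd pt_id)
 moreover have "concat (map (%y. if P x y then [y] else []) ys) = filter (P x) ys" for x ys
  by (induction ys) auto
 ultimately show ?thesis by simp
qed

lemma pt_Ball:
 assumes xs: "pt xs" and h: "pt (%p. P (fst p) (snd p))"
 shows "pt (%x. ALL y : set (xs x). P x y)"
proof -
 have "pt (%x. case filter (%y. ~ P x y) (xs x) of [] => True | _ # _ => False)"
  by (intro pt_case_list pt_filter xs pt_not h pt_const)
 moreover have "(case filter (%y. ~ P x y) (xs x) of [] => True | _ # _ => False) <-> (ALL y : set (xs x). P x y)" for x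
 proof -
  have "(case filter (%y. ~ P x y) (xs x) of [] => True | _ # _ => False) <-> filter (%y. ~ P x y) (xs x) = []"
   by (simp split: list.split)
  then show ?thesis by (simp add: filter_empty_conv)
 qed
 ultimately show ?thesis by simp
qed

lemma pt_Bex:
 assumes "pt xs" "pt (%p. P (fst p) (snd p))"
 shows "pt (%x. EX y : set (xs x). P x y)"
 using pt_not[OF pt_Ball[OF assms(1) pt_not[OF assms(2)]]] by simp

lemma pt_tl: "pt f ==> pt (%x. tl (f x))"
proof -
 assume f: "pt f"
 have "pt (%x. case f x of [] => [] | y # ys => ys)"
  by (intro pt_case_list f pt_const pt_snd pt_id)
 moreover have "(case l of [] => [] | y # ys => ys) = tl l" for l :: "'b list" by (cases l) auto
 ultimately show ?thesis by simp
qed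

lemmas pt_basic = pt_id pt_const pt_Pair pt_fst pt_snd pt_Cons pt_Some pt_if pt_case_list pt_case_option
 pt_case_prod pt_Let pt_conj pt_not pt_disj pt_imp pt_rev pt_append pt_map pt_concat pt_filter
 pt_Ball pt_Bex pt_tl


section \<open>Equality and membership tests\<close>

lemma enc_append_eq: "enc x @ r = enc y @ r' <-> x = y & r = r'"
proof
 show "enc x @ r = enc y @ r' ==> x = y & r = r'"
 proof (induction x arbitrary: y r r')
  case Leaf
  then show ?case by (cases y) auto
 next
  case (Node a b)
  from Node.prems obtain a' b' where y: "y = Node a' b'" by (cases y) auto
  with Node.prems have "enc a @ enc b @ r = enc a' @ enc b' @ r'" by simp
  from Node.IH(1)[OF this] have a: "a = a'" "enc b @ r = enc b' @ r'" by blast+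
  from Node.IH(2)[OF a(2)] a(1) y show ?case by simp
 qed
qed simp

lemma enc_eq_iff: "enc x = enc y <-> x = y"
 using enc_append_eq[of x "[]" y "[]"] by simp

lemma to_tree_eq_iff: "to_tree x = to_tree y <-> x = y"
 using to_tree_inj by blast

lemma pt_tree_bits: "pt f ==> pt (%x. enc (to_tree (f x)))"
 by (rule pt_comp[OF ptI[OF pf_bits]]) (simp_all add: to_tree_bools)

text \<open>The first component is the part of the second word that is not yet matched. Running out
  of it clears the flag for good; an unmatched remainder at the end also means inequality.\<close>

fun eq_step :: "bool list \<times> bool => bool => bool list \<times> bool" where
 "eq_step s b = (case fst s of [] => ([], False) | c # cs => (cs, snd s & (if b then c else ~ c)))"

lemma foldl_eq_step:
 "foldl eq_step (ys, ok) xs = (zs, ok') ==> (zs = [] & ok') <-> (ok & xs = ys)"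
proof (induction xs arbitrary: ys ok)
 case (Cons x xs)
 note IH = Cons.IH
 show ?case
 proof (cases ys)
  case Nil
  then show ?thesis using Cons.IH[of "[]" False] Cons.prems by simp
 next
  case (Cons y ys')
  from \<open>foldl eq_step (ys, ok) (x # xs) = (zs, ok')\<close> Cons have "foldl eq_step (ys', ok & (if x then y else ~ y)) xs = (zs, ok')" by simp
  from IH[OF this] Cons show ?thesis by (cases x; cases y) simp_all
 qed
qed auto

lemma foldl_eq_step_size: "sz (foldl eq_step s xs) <= sz (fst s) + 4"
proof (induction xs arbitrary: s)
 case Nil
 then show ?case using sz_bool[of "snd s"] by (cases s) auto
next
 case (Cons x xs)
 have "sz (fst (eq_step s x)) <= sz (fst s)" by (auto split: list.split)
 with Cons[of "eq_step s x"] show ?case by simp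
qed

text \<open>Values are equal exactly if their codes are, and codes are compared bit by bit. No
  recursion over the type is involved.\<close>

lemma pt_eq:
 fixes f g :: "'a::tr => 'b::tr"
 assumes "pt f" "pt g" shows "pt (%x. f x = g x)"
proof -
 define h where "h p = foldl eq_step (snd p, True) (fst p)" for p :: "bool list \<times> bool list"
 have "pt h" unfolding h_def
 proof (rule pt_foldl[where q = "%n. n + 4"])
  show "pt (%p. eq_step (fst (snd p)) (snd (snd p)))"
   unfolding eq_step.simps by (intro pt_basic)
  show "sz (foldl eq_step (snd x, True) (take n (fst x))) <= sz x + 4" for n and x :: "bool list \<times> bool list"
   using foldl_eq_step_size[of "(snd x, True)" "take n (fst x)"] by (cases x) simp
 qed (intro pt_basic polyb_intros)+
 then have "pt (%p. (case fst (h p) of [] => True | _ # _ => False) & snd (h p))"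
  by (intro pt_basic)
 then have *: "pt (%p. (case fst (h (fst p, snd p)) of [] => True | _ # _ => False) & snd (h (fst p, snd p)))"
  by simp
 have "pt (%x. (case fst (h (enc (to_tree (f x)), enc (to_tree (g x)))) of [] => True | _ # _ => False)
   & snd (h (enc (to_tree (f x)), enc (to_tree (g x)))))"
  by (rule pt_comp2[OF * pt_tree_bits[OF assms(1)] pt_tree_bits[OF assms(2)]])
 moreover have "((case fst (h (u, v)) of [] => True | _ # _ => False) & snd (h (u, v))) <-> u = v" for u v
 proof -
  obtain zs ok where h: "h (u, v) = (zs, ok)" by (cases "h (u, v)")
  then have "(zs = [] & ok) <-> u = v" using foldl_eq_step[of v True u zs ok] by (simp add: h_def)
  then show ?thesis unfolding h by (cases zs) simp_all
 qed
 ultimately show ?thesis by (simp only: enc_eq_iff to_tree_eq_iff)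
qed

lemma pt_member:
 fixes f :: "'a::tr => 'b::tr"
 assumes "pt f" "pt xs" shows "pt (%x. f x : set (xs x))"
proof -
 have f: "pt (%p :: 'a * 'b. f (fst p))"
  by (rule pt_comp[OF assms(1)]) (intro pt_fst pt_id)
 have "pt (%x. EX y : set (xs x). f x = y)"
  by (rule pt_Bex[OF assms(2)], rule pt_eq[OF f]) (intro pt_snd pt_id)
 moreover have "(EX y : set (xs x). f x = y) <-> f x : set (xs x)" for x by blast
 ultimately show ?thesis by (simp only:)
qed

subsection \<open>Natural numbers in binary\<close>

fun val :: "bool list => nat" where
 "val [] = 0" | "val (b # bs) = of_bool b + 2 * val bs"

fun inc :: "bool list => bool list" where
 "inc [] = [True]" | "inc (b # bs) = (if b then False # inc bs else True # bs)"

lemma nat_bits_0 [simp]: "nat_bits 0 = []" by (simp add: nat_bits.simps)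

text \<open>Bit words are least significant first, so having no leading zero means that the last bit
  is set. This characterizes the words that \<open>nat_bits\<close> produces.\<close>

lemma nat_bits_val: "bs = [] | last bs ==> nat_bits (val bs) = bs"
proof (induction bs)
 case (Cons b bs)
 have pos: "bs ~= [] ==> last bs ==> val bs > 0" for bs by (induction bs) (auto split: if_splits)
 show ?case
 proof (cases "bs = []")
  case True
  then show ?thesis using Cons.prems by (simp add: nat_bits.simps)
 next
  case False
  then have "last bs" using Cons.prems by simp
  then have "val bs > 0" "nat_bits (val bs) = bs" using False pos Cons.IH by auto
  then show ?thesis by (subst nat_bits.simps) auto
 qed
qed simp

lemma val_nat_bits [simp]: "val (nat_bits n) = n"
proof (induction n rule: less_induct)
 case (less n)
 then show ?case
  by (cases "n = 0"; subst nat_bits.simps) (auto simp: of_bool_def elim: oddE)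
qed

lemma last_nat_bits: "n > 0 ==> nat_bits n ~= [] & last (nat_bits n)"
proof (induction n rule: less_induct)
 case (less n)
 have *: "nat_bits n = odd n # nat_bits (n div 2)" using less.prems by (simp add: nat_bits.simps[of n])
 show ?case
 proof (cases "n div 2 = 0")
  case True
  then have "n = 1" using less.prems by linarith
  then show ?thesis unfolding * by simp
 next
  case False
  then show ?thesis unfolding * using less.IH[of "n div 2"] less.prems by auto
 qed
qed

lemma nat_bits_Suc: "nat_bits (Suc n) = inc (nat_bits n)"
proof (induction n rule: less_induct)
 case (less n)
 show ?case
 proof (cases "even n")
  case True
  then show ?thesis by (cases "n = 0") (auto simp: nat_bits.simps[of n] nat_bits.simps[of "Suc n"] nat_bits.simps[of "Suc 0"])
 next
  case False
  then have "nat_bits (Suc (n div 2)) = inc (nat_bits (n div 2))" by (intro less) (auto elim: oddE)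
  moreover have "Suc n div 2 = Suc (n div 2)" using False by (auto elim: oddE)
  ultimately show ?thesis
   using False odd_pos[OF False] nat_bits.simps[of n] nat_bits.simps[of "Suc n"] by auto
 qed
qed

lemma pt_nat_bits: "pt f ==> pt (%x. nat_bits (f x))"
 by (rule pt_comp[OF ptI[OF pf_id]]) (simp_all add: to_tree_nat_def)

lemma pt_natI: "pt (%x. nat_bits (f x)) ==> pt f"
 unfolding pt_def realizes_def by (simp add: to_tree_nat_def)

fun inc_step :: "bool \<times> bool list => bool => bool \<times> bool list" where
 "inc_step s b = (if fst s then (if b then (True, False # snd s) else (False, True # snd s)) else (False, b # snd s))"

lemma foldl_inc_step:
 "foldl inc_step (c, a) bs = (c', r) ==>
   rev r @ (if c' then [True] else []) = rev a @ (if c then inc bs else bs)"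
proof (induction bs arbitrary: c a)
 case (Cons b bs)
 then show ?case by (cases c; cases b) (auto dest!: Cons.IH)
qed auto

lemma foldl_inc_step_size: "sz (foldl inc_step s bs) <= sz s + 6 * length bs + 3"
proof (induction bs arbitrary: s)
 case (Cons b bs)
 have "sz (inc_step s b) <= sz s + 6"
  using sz_bool[of b] sz_bool[of "fst s"] by (cases s; cases b) auto
 with Cons[of "inc_step s b"] show ?case by simp
qed simp

lemma pt_Suc: "pt f ==> pt (%x. Suc (f x))"
proof -
 assume f: "pt f"
 define h where "h bs = foldl inc_step (True, []) bs" for bs
 have "pt h" unfolding h_def
 proof (rule pt_foldl[where q = "%n. 6 * n + 8"])
  show "sz (foldl inc_step (True, []) (take n bs)) <= 6 * sz bs + 8" for n and bs :: "bool list"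
   using foldl_inc_step_size[of "(True, [])" "take n bs"] length_less_sz[of bs]
   by (simp add: min_def split: if_splits)
  show "pt (%p. inc_step (fst (snd p)) (snd (snd p)))"
   unfolding inc_step.simps by (intro pt_basic)
 qed (intro pt_basic polyb_intros)+
 then have "pt (%bs. rev (snd (h bs)) @ (if fst (h bs) then [True] else []))"
  by (intro pt_basic)
 moreover have "rev (snd (h bs)) @ (if fst (h bs) then [True] else []) = inc bs" for bs
  using foldl_inc_step[of True "[]" bs "fst (h bs)" "snd (h bs)"] by (simp add: h_def)
 ultimately have "pt inc" by simp
 from pt_comp[OF this pt_nat_bits[OF f]] show ?thesis
  by (intro pt_natI) (simp add: nat_bits_Suc)
qed

text \<open>The words are read from the least significant bit on. The flag compares the parts read
  so far, and every later pair of different bits overrides it. An exhausted second word counts as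
  zeros; an exhausted first word loses against any \<open>True\<close> left over in the
  second.\<close>

fun le_step :: "bool \<times> bool list => bool => bool \<times> bool list" where
 "le_step s b = (case snd s of [] => (~ b & fst s, [])
   | c # cs => (if b then c & fst s else c | fst s, cs))"

lemma foldl_le_step:
 "foldl le_step (ok, cs) bs = (ok', cs') ==>
  (ok' | True : set cs') <-> (if ok then val bs <= val cs else val bs < val cs)"
proof (induction bs arbitrary: ok cs)
 case Nil
 have "True : set cs <-> 0 < val cs" by (induction cs) auto
 with Nil show ?case by auto
next
 case (Cons b bs)
 show ?case
 proof (cases cs)
  case Nil
  then show ?thesis using Cons.IH[of "~ b & ok" "[]"] Cons.prems by auto
 next
  case (Cons c cs')
  then show ?thesis using Cons.IH[of "if b then c & ok else c | ok" cs'] Cons.prems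
   by (cases b; cases c; cases ok) auto
 qed
qed

lemma foldl_le_step_size: "sz (foldl le_step s xs) <= sz (snd s) + 4"
proof (induction xs arbitrary: s)
 case Nil
 then show ?case using sz_bool[of "fst s"] by (cases s) auto
next
 case (Cons x xs)
 have "sz (snd (le_step s x)) <= sz (snd s)" by (auto split: list.split)
 with Cons[of "le_step s x"] show ?case by simp
qed

lemma pt_le:
 fixes f g :: "'a::tr => nat"
 assumes f: "pt f" and g: "pt g" shows "pt (%x. f x <= g x)"
proof -
 define h where "h p = foldl le_step (True, snd p) (fst p)" for p :: "bool list \<times> bool list"
 have "pt h" unfolding h_def
 proof (rule pt_foldl[where q = "%n. n + 4"])
  show "pt (%p. le_step (fst (snd p)) (snd (snd p)))"
   unfolding le_step.simps by (intro pt_basic)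
  show "sz (foldl le_step (True, snd x) (take n (fst x))) <= sz x + 4" for n and x :: "bool list \<times> bool list"
   using foldl_le_step_size[of "(True, snd x)" "take n (fst x)"] by (cases x) simp
 qed (intro pt_basic polyb_intros)+
 then have "pt (%p. fst (h p) | True : set (snd (h p)))"
  by (intro pt_basic pt_member)
 then have *: "pt (%p. fst (h (fst p, snd p)) | True : set (snd (h (fst p, snd p))))"
  by simp
 have "pt (%x. fst (h (nat_bits (f x), nat_bits (g x))) | True : set (snd (h (nat_bits (f x), nat_bits (g x)))))"
  by (rule pt_comp2[OF * pt_nat_bits[OF f] pt_nat_bits[OF g]])
 moreover have "(fst (h (u, v)) | True : set (snd (h (u, v)))) <-> val u <= val v" for u v
  using foldl_le_step[of True v u "fst (h (u, v))" "snd (h (u, v))"] by (simp add: h_def)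
 ultimately show ?thesis by simp
qed

lemma pt_less: "pt f ==> pt g ==> pt (%x. f x < (g x :: nat))"
 unfolding less_eq_Suc_le by (intro pt_le pt_Suc)

text \<open>The final \<open>True\<close> rules out leading zeros, so no bit of the code is lost and
  \<open>num\<close> is injective. The vertices and arcs of the constructed instances are named in
  this way.\<close>

definition num :: "'a::tr => nat" where "num x = val (enc (to_tree x) @ [True])"

lemma num_eq_iff [simp]: "num x = num y <-> x = y"
proof
 assume "num x = num y"
 then have "nat_bits (num x) = nat_bits (num y)" by simp
 then show "x = y" by (simp add: num_def nat_bits_val enc_eq_iff to_tree_eq_iff)
qed simp

lemma pt_val: "(!!x. f x = [] | last (f x)) ==> pt f ==> pt (%x. val (f x))"
 by (rule pt_natI) (simp add: nat_bits_val)

lemma pt_num: "pt f ==> pt (%x. num (f x))"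
 unfolding num_def by (intro pt_val pt_append pt_tree_bits pt_const) auto

lemma sz_nat_le: "sz n <= 4 * n + 1"
proof (induction n rule: less_induct)
 case (less n)
 show ?case
 proof (cases "n = 0")
  case False
  then have "sz n = Suc (sz (odd n) + sz (n div 2))"
   by (simp add: sz_nat[of n] nat_bits.simps[of n]) (simp add: sz_nat)
  moreover have "sz (n div 2) <= 4 * (n div 2) + 1" using False by (intro less) auto
  ultimately show ?thesis using sz_bool[of "odd n"] False by (cases "odd n") (auto elim!: oddE evenE)
 qed (simp add: sz_nat)
qed

lemma pt_length: "pt xs ==> pt (%x. length (xs x))"
proof -
 have *: "foldl (%a y. Suc a) a xs = a + length xs" for a and xs :: "'b list"
  by (induction xs arbitrary: a) auto
 have "pt (%xs :: 'b list. foldl (%a y. Suc a) 0 xs)"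
 proof (rule pt_foldl[where q = "%n. 4 * n + 1"])
  fix x :: "'b list" and n
  show "sz (foldl (%a y. Suc a) 0 (take n x)) <= 4 * sz x + 1"
   using sz_nat_le[of "length (take n x)"] length_less_sz[of x]
   by (simp add: * min_def split: if_splits)
 qed (intro pt_basic polyb_intros pt_Suc)+
 then have "pt (length :: 'b list => _)" by (simp add: *)
 then show "pt xs ==> pt (%x. length (xs x))" by (rule pt_comp)
qed

lemma pt_upt_length: "pt xs ==> pt (%x. [0..<length (xs x)])"
proof -
 have *: "foldl (%a y. length a # a) (rev [0..<k]) xs = rev [0..<k + length xs]" for k and xs :: "'b list"
 proof (induction xs arbitrary: k)
  case (Cons x xs)
  then show ?case using Cons[of "Suc k"] by simp
 qed simp
 have "pt (%xs :: 'b list. rev (foldl (%a y. length a # a) [] xs))"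
 proof (rule pt_rev, rule pt_foldl[where q = "%n. n * (4 * n + 2) + 1"])
  fix x :: "'b list" and n
  have "sz ([0..<length (take n x)]) <= length [0..<length (take n x)] * (4 * length x + 1 + 1) + 1"
   by (rule sz_list_le) (use sz_nat_le in \<open>fastforce intro: order_trans\<close>)
  also have "... <= sz x * (4 * sz x + 2) + 1"
   using length_less_sz[of x] by (intro add_mono mult_le_mono) auto
  finally show "sz (foldl (%a y. length a # a) [] (take n x)) <= sz x * (4 * sz x + 2) + 1"
   using *[of 0 "take n x"] by (simp add: sz_rev)
 qed (intro pt_basic polyb_intros pt_length)+
 then have "pt (%xs :: 'b list. [0..<length xs])" using *[of 0] by simp
 then show "pt xs ==> pt (%x. [0..<length (xs x)])" by (rule pt_comp)
qed

definition uniq :: "'a list => 'a list" where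
 "uniq xs = foldl (%a y. if y : set a then a else y # a) [] xs"

lemma uniq_aux:
 "distinct a ==> distinct (foldl (%a y. if y : set a then a else y # a) a xs) &
  set (foldl (%a y. if y : set a then a else y # a) a xs) = set a Un set xs"
 by (induction xs arbitrary: a) auto

lemma distinct_uniq [simp]: "distinct (uniq xs)" and set_uniq [simp]: "set (uniq xs) = set xs"
 using uniq_aux[of "[]" xs] by (auto simp: uniq_def)

lemma pt_uniq: "pt xs ==> pt (%x. uniq (xs x))"
proof -
 have b: "sz (foldl (%a y. if y : set a then a else y # a) a xs) <= sz a + sz xs" for a xs :: "'b list"
 proof (induction xs arbitrary: a)
  case (Cons x xs)
  show ?case using Cons[of "if x : set a then a else x # a"] by (auto split: if_splits)
 qed simp
 have "pt (uniq :: 'b list => _)" unfolding uniq_def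
 proof (rule pt_foldl[where q = "%n. n + 1"])
  fix x :: "'b list" and n
  show "sz (foldl (%a y. if y : set a then a else y # a) [] (take n x)) <= sz x + 1"
   using b[of "[]" "take n x"] sz_take[of n x] by simp
 qed (intro pt_basic polyb_intros pt_member)+
 then show "pt xs ==> pt (%x. uniq (xs x))" by (rule pt_comp)
qed

lemma pt_distinct: "pt xs ==> pt (%x. distinct (xs x))"
proof -
 assume xs: "pt xs"
 have *: "length (uniq l) = length l <-> distinct l" for l :: "'b list"
  by (metis card_distinct distinct_card distinct_uniq set_uniq)
 have "pt (%x. length (uniq (xs x)) = length (xs x))" by (intro pt_eq pt_length pt_uniq xs)
 then show ?thesis by (simp add: *)
qed

text \<open>A polynomially long list serves as a unary number.\<close>

definition mult_list :: "'a list => 'b list => unit list" where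
 "mult_list xs ys = concat (map (%_. map (%_. ()) ys) xs)"

lemma length_mult_list [simp]: "length (mult_list xs ys) = length xs * length ys"
 by (induction xs) (auto simp: mult_list_def)

lemma pt_poly_list:
 assumes "pt xs" obtains l :: "'a::tr => unit list" where "pt l" "!!x. length (l x) = c * length (xs x) ^ d + c"
proof -
 have "EX l :: 'a => unit list. pt l & (ALL x. length (l x) = length (xs x) ^ d)"
 proof (induction d)
  case 0
  show ?case by (intro exI[of _ "%_. [()]"]) (auto intro: pt_const)
 next
  case (Suc d)
  then obtain l :: "'a => unit list" where l: "pt l" "!!x. length (l x) = length (xs x) ^ d" by blast
  have "pt (%x. mult_list (xs x) (l x))" unfolding mult_list_def
   by (intro pt_basic assms pt_comp[OF l(1)])
  then show ?case using l(2) by (intro exI[of _ "%x. mult_list (xs x) (l x)"]) auto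
 qed
 then obtain l :: "'a => unit list" where l: "pt l" "!!x. length (l x) = length (xs x) ^ d" by blast
 show ?thesis
 proof (rule that[of "%x. mult_list (replicate c ()) (l x) @ replicate c ()"])
  show "pt (%x. mult_list (replicate c ()) (l x) @ replicate c ())" unfolding mult_list_def
   by (intro pt_basic assms pt_comp[OF l(1)])
 qed (simp add: l)
qed

lemmas pt_intros = pt_basic pt_eq pt_member pt_Suc pt_le pt_less pt_num pt_length pt_upt_length pt_uniq
 pt_distinct pt_nat_bits pt_tree_bits

definition flat :: "'a list => ('a => 'b list) => 'b list" where
 "flat xs f = concat (map f xs)"

lemma set_flat [simp]: "set (flat xs f) = (\<Union>x \<in> set xs. set (f x))"
 by (simp add: flat_def)

lemma pt_flat: "pt xs ==> pt (%p. h (fst p) (snd p)) ==> pt (%x. flat (xs x) (h x))"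
 unfolding flat_def by (intro pt_concat pt_map)

lemma sz_nat_le_mono: "a <= b ==> sz a <= 4 * b + 1"
 using sz_nat_le[of a] by linarith

section \<open>Parsing\<close>

definition parser_for :: "('a::tr => bool list) => (bool list => ('a * bool list) option) => bool" where
 "parser_for e p <-> pt p & (ALL a r. p (e a @ r) = Some (a, r)) &
   (ALL w a r. p w = Some (a, r) --> w = e a @ r)"

text \<open>The linear bound relates the size of a tree to the length of the word it was parsed
  from; the parser for lists depends on it to bound its accumulator.\<close>

definition codec :: "('a::tr => bool list) => bool" where
 "codec e <-> pt e & (EX p. parser_for e p) & (EX C. ALL a. sz a <= C * length (e a) + C)"

lemma parser_forD:
 assumes "parser_for e p"
 shows "pt p" "p (e a @ r) = Some (a, r)" "p w = Some (a, r) ==> w = e a @ r"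
 using assms unfolding parser_for_def by blast+

lemma codec_bit: "codec (%b :: bool. [b])"
 unfolding codec_def
proof (intro conjI exI allI)
 show "pt (%b :: bool. [b])" by (intro pt_intros)
 show "parser_for (%b :: bool. [b]) (%w. case w of [] => None | b # r => Some (b, r))"
  unfolding parser_for_def by (auto intro!: pt_intros split: list.splits)
 show "sz a <= 3 * length [a] + 3" for a :: bool using sz_bool[of a] by simp
qed

lemma codec_pair:
 fixes f :: "'a::tr => bool list" and g :: "'b::tr => bool list"
 assumes "codec f" "codec g" shows "codec (enc_pair f g)"
proof -
 from assms obtain p q C D where f: "pt f" "parser_for f p" "!!a. sz a <= C * length (f a) + C"
  and g: "pt g" "parser_for g q" "!!a. sz a <= D * length (g a) + D" unfolding codec_def by blast
 note p = parser_forD[OF f(2)] and q = parser_forD[OF g(2)]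
 define h where "h w = (case p w of None => None | Some u => (case q (snd u) of None => None
   | Some v => Some ((fst u, fst v), snd v)))" for w
 have "pt h" unfolding h_def
  by (intro pt_case_option p(1) pt_const pt_comp[OF q(1)] pt_Some pt_Pair pt_fst pt_snd pt_id)
 moreover have "h (enc_pair f g a @ r) = Some (a, r)" for a r
  by (simp add: h_def enc_pair_def p(2) q(2))
 moreover have "h w = Some (a, r) ==> w = enc_pair f g a @ r" for w a r
  by (auto simp: h_def enc_pair_def split: option.splits dest!: p(3) q(3))
 ultimately have "parser_for (enc_pair f g) h" unfolding parser_for_def by blast
 moreover have "pt (enc_pair f g)" unfolding enc_pair_def[abs_def]
  by (intro pt_append pt_comp[OF f(1)] pt_comp[OF g(1)] pt_fst pt_snd pt_id)
 moreover have "sz a <= (C + D + 1) * length (enc_pair f g a) + (C + D + 1)" for a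
 proof -
  have "sz a = Suc (sz (fst a) + sz (snd a))" by (cases a) simp
  then show ?thesis using f(3)[of "fst a"] g(3)[of "snd a"] by (simp add: enc_pair_def algebra_simps)
 qed
 ultimately show ?thesis unfolding codec_def by blast
qed

text \<open>\<open>None\<close> is failure; otherwise the state holds a flag for completion, the
  unread word and the parsed elements in reverse. The fold runs over the input word merely as a
  clock, which is long enough because every element and the end mark consume at least one
  bit.\<close>

definition list_step :: "(bool list => ('a * bool list) option) =>
  (bool \<times> bool list \<times> 'a list) option => (bool \<times> bool list \<times> 'a list) option" where
 "list_step p s = (case s of None => None | Some t =>
   if fst t then Some t else (case fst (snd t) of [] => None | b # r =>
    if b then (case p r of None => None | Some u => Some (False, snd u, fst u # snd (snd t)))
    else Some (True, r, snd (snd t))))"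

lemma list_step_sound:
 assumes p: "!!w a r. p w = Some (a, r) ==> w = e a @ r"
 shows "foldl (%s _. list_step p s) (Some (False, w, [])) ys = Some (f, r, acc) ==>
  w = concat (map (%x. True # e x) (rev acc)) @ (if f then [False] else []) @ r"
proof (induction ys arbitrary: f r acc rule: rev_induct)
 case Nil
 then show ?case by simp
next
 case (snoc y ys)
 let ?s = "foldl (%s _. list_step p s) (Some (False, w, [])) ys"
 from snoc.prems have st: "list_step p ?s = Some (f, r, acc)" by simp
 then obtain f' r' acc' where s: "?s = Some (f', r', acc')" by (cases ?s) (auto simp: list_step_def)
 note IH = snoc.IH[OF s]
 show ?case
 proof (cases f')
  case True
  then show ?thesis using st s IH by (auto simp: list_step_def)
 next
  case False
  show ?thesis
  proof (cases r')
   case Nil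
   then show ?thesis using st s False by (simp add: list_step_def)
  next
   case (Cons b r'')
   show ?thesis
   proof (cases b)
    case True
    then obtain a where "p r'' = Some (a, r)" "acc = a # acc'" "~ f"
     using st s False Cons by (auto simp: list_step_def split: option.splits)
    then show ?thesis using IH p[of r'' a r] False True Cons by simp
   next
    case b: False
    then have "f" "r = r''" "acc = acc'" using st s False Cons by (auto simp: list_step_def)
    then show ?thesis using IH b False Cons by simp
   qed
  qed
 qed
qed

lemma list_step_complete:
 assumes p: "!!a r. p (e a @ r) = Some (a, r)"
 shows "length xs < length ys ==>
  foldl (%s _. list_step p s) (Some (False, enc_list e xs @ r, acc)) ys = Some (True, r, rev xs @ acc)"
proof (induction xs arbitrary: acc ys)
 case Nil
 have *: "foldl (%s _. list_step p s) (Some (True, r, acc)) ys = Some (True, r, acc)" for ys :: "'c list"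
  by (induction ys) (auto simp: list_step_def)
 have "list_step p (Some (False, enc_list e [] @ r, acc)) = Some (True, r, acc)"
  by (simp add: list_step_def enc_list_def)
 with Nil * show ?case by (cases ys) auto
next
 case (Cons x xs)
 then obtain y ys' where ys: "ys = y # ys'" by (cases ys) auto
 have "list_step p (Some (False, enc_list e (x # xs) @ r, acc)) = Some (False, enc_list e xs @ r, x # acc)"
  using p[of x "enc_list e xs @ r"] by (simp add: list_step_def enc_list_def)
 then show ?case using Cons.IH[of ys' "x # acc"] Cons.prems by (simp add: ys)
qed

lemma sz_bools: "sz (bs :: bool list) <= 4 * length bs + 1"
 using tsz_lt[of bs] by (simp add: sz_def to_tree_bools)

lemma sz_le_enc_list:
 assumes "!!a. sz a <= C * length (e a) + C"
 shows "sz xs <= (C + 1) * length (concat (map (%x. True # e x) xs)) + 1"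
proof (induction xs)
 case (Cons x xs)
 then show ?case using assms[of x] by (simp add: algebra_simps)
qed simp

lemma codec_list:
 fixes e :: "'a::tr => bool list"
 assumes "codec e" shows "codec (enc_list e)"
proof -
 from assms obtain p C where e: "pt e" "parser_for e p" "!!a. sz a <= C * length (e a) + C"
  unfolding codec_def by blast
 note p = parser_forD[OF e(2)]
 define h where "h w = foldl (%s _. list_step p s) (Some (False, w, [])) w" for w
 have "pt h" unfolding h_def
 proof (rule pt_foldl[where q = "%n. 4 * n + 1 + ((C + 1) * n + 1) + 7"])
  show "pt (%q. list_step p (fst (snd q)))"
   unfolding list_step_def
   by (intro pt_case_option pt_case_list pt_if pt_comp[OF p(1)] pt_Some pt_Pair pt_Cons pt_fst pt_snd
     pt_const pt_id)
  fix w n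
  show "sz (foldl (%s _. list_step p s) (Some (False, w, [])) (take n w))
   <= 4 * sz w + 1 + ((C + 1) * sz w + 1) + 7"
  proof (cases "foldl (%s _. list_step p s) (Some (False, w, [])) (take n w)")
   case (Some t)
   obtain f r acc where t: "t = (f, r, acc)" by (cases t)
   have w: "w = concat (map (%x. True # e x) (rev acc)) @ (if f then [False] else []) @ r"
    by (rule list_step_sound[of p e]) (use p(3) Some t in auto)
   then have l: "length r <= length w" "length (concat (map (%x. True # e x) (rev acc))) <= length w"
    by (metis length_append le_add2 trans_le_add2) (metis w length_append le_add1)
   have "sz acc <= (C + 1) * length (concat (map (%x. True # e x) (rev acc))) + 1"
    using sz_le_enc_list[of C e "rev acc"] e(3) by (simp add: sz_rev)
   also have "... <= (C + 1) * sz w + 1"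
    using l(2) length_less_sz[of w] by (intro add_mono mult_le_mono) auto
   finally have "sz acc <= (C + 1) * sz w + 1" .
   then show ?thesis
    unfolding Some t using sz_bools[of r] l(1) length_less_sz[of w] sz_bool[of f] by simp
  qed simp
 qed (intro pt_basic polyb_intros)+
 define h' where "h' w = (case h w of None => None | Some t =>
   if fst t then Some (rev (snd (snd t)), fst (snd t)) else None)" for w
 have "pt h'" unfolding h'_def
  by (intro pt_case_option \<open>pt h\<close> pt_if pt_Some pt_Pair pt_rev pt_fst pt_snd pt_const pt_id)
 moreover have "h' (enc_list e xs @ r) = Some (xs, r)" for xs r
 proof -
  have "length xs < length (enc_list e xs @ r)"
   by (induction xs) (auto simp: enc_list_def)
  from list_step_complete[of p e, OF p(2) this, of r "[]"]
  show ?thesis by (simp add: h'_def h_def)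
 qed
 moreover have "h' w = Some (xs, r) ==> w = enc_list e xs @ r" for w xs r
 proof -
  assume a: "h' w = Some (xs, r)"
  then obtain acc where "h w = Some (True, r, acc)" "xs = rev acc"
   by (auto simp: h'_def split: option.splits if_splits)
  with list_step_sound[of p e w w True r acc] p(3) show ?thesis
   unfolding h_def by (auto simp: enc_list_def)
 qed
 ultimately have "parser_for (enc_list e) h'" unfolding parser_for_def by blast
 moreover have "pt (enc_list e)" unfolding enc_list_def[abs_def]
  by (intro pt_append pt_concat pt_map pt_Cons pt_comp[OF e(1)] pt_fst pt_snd pt_const pt_id)
 moreover have "sz xs <= (C + 1) * length (enc_list e xs) + (C + 1)" for xs
  using sz_le_enc_list[of C e xs] e(3) by (simp add: enc_list_def)
 ultimately show ?thesis unfolding codec_def by blast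
qed

lemma codec_word: "codec enc_word"
 unfolding enc_word_def by (rule codec_list[OF codec_bit])

lemma codec_nat: "codec enc_nat"
proof -
 obtain p C where e: "parser_for enc_word p" "!!a. sz a <= C * length (enc_word a) + C" and w: "pt enc_word"
  using codec_word unfolding codec_def by blast
 note p = parser_forD[OF e(1)]
 define ok where "ok bs = (case rev bs of [] => True | b # _ => b)" for bs :: "bool list"
 have ok: "ok bs <-> bs = [] | last bs" for bs
  by (cases bs rule: rev_cases) (auto simp: ok_def)
 \<comment> \<open>Words with a leading zero are rejected, as they code no number in the sense of
   \<open>enc_nat\<close>. The test is repeated inside \<open>val\<close> because
   \<open>pt_val\<close> asks for a canonical word in all cases.\<close>
 define h where "h w = (case p w of None => None | Some u =>
   if ok (fst u) then Some (val (if ok (fst u) then fst u else []), snd u) else None)" for w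
 have pt_ok: "pt ok" unfolding ok_def by (intro pt_intros)
 have "pt h" unfolding h_def
  by (intro pt_case_option p(1) pt_if pt_val pt_comp[OF pt_ok] pt_Some pt_Pair pt_fst pt_snd pt_const pt_id)
   (auto simp: ok)
 moreover have "h (enc_nat n @ r) = Some (n, r)" for n r
  using last_nat_bits[of n] by (cases "n = 0") (auto simp: h_def enc_nat_def p(2) ok)
 moreover have "h w = Some (n, r) ==> w = enc_nat n @ r" for w n r
  by (auto simp: h_def enc_nat_def ok nat_bits_val split: option.splits if_splits dest!: p(3))
 ultimately have "parser_for enc_nat h" unfolding parser_for_def by blast
 moreover have "pt enc_nat" unfolding enc_nat_def[abs_def]
  by (intro pt_comp[OF w] pt_nat_bits pt_id)
 moreover have "sz n <= C * length (enc_nat n) + C" for n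
  using e(2)[of "nat_bits n"] by (simp add: sz_nat enc_nat_def)
 ultimately show ?thesis unfolding codec_def by blast
qed

lemma codec_instance: "codec enc_instance"
 unfolding enc_instance_def enc_presentation_def by (intro codec_pair codec_list codec_nat)

lemma codec_presentation: "codec enc_presentation"
 unfolding enc_presentation_def by (intro codec_pair codec_list codec_nat)

lemma codec_pt: "codec e ==> pt e" by (simp add: codec_def)

lemma codec_inj: "codec e ==> e a = e b <-> a = b"
 unfolding codec_def parser_for_def by (metis append_Nil2 option.inject prod.inject)

lemma codec_decode:
 assumes "codec e"
 obtains d where "pt d" "!!w a. d w = Some a <-> w = e a" "!!a. d (e a) = Some a"
proof -
 obtain p where e: "parser_for e p" using assms unfolding codec_def by blast
 note p = parser_forD[OF e]
 define d where "d w = (case p w of None => None | Some u => if snd u = [] then Some (fst u) else None)" for w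
 have "pt d" unfolding d_def by (intro pt_intros p(1))
 moreover have "d (e a) = Some a" for a using p(2)[of a "[]"] by (simp add: d_def)
 moreover have "d w = Some a ==> w = e a" for w a
  by (auto simp: d_def split: option.splits if_splits dest!: p(3))
 ultimately show ?thesis by (intro that) blast+
qed

section \<open>Criteria for membership in P and NP\<close>

lemma class_P_I:
 assumes "codec e" "pt P"
 shows "{e a | a. P a} : class_P"
proof -
 obtain d where d: "pt d" "!!w a. d w = Some a <-> w = e a" "!!a. d (e a) = Some a"
  using codec_decode[OF assms(1)] by blast
 have "pt (%w. [case d w of None => False | Some a => P a])"
  by (intro pt_Cons pt_const pt_case_option d(1) pt_comp[OF assms(2)] pt_snd pt_id)
 moreover have "(case d w of None => False | Some a => P a) <-> w : {e a | a. P a}" for w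
  using d(2)[of w] by (auto simp: d(3) codec_inj[OF assms(1)] split: option.splits)
 ultimately show ?thesis unfolding class_P_def using poly_time_if_pt by auto
qed

text \<open>A verifier on typed data suffices: pairs whose first part is no code of an instance are
  rejected, and prefix-freeness of \<open>enc_word\<close> separates the input from the certificate.
  A length bound is asked of only one certificate for each positive instance.\<close>

lemma class_NP_I:
 fixes e :: "'a::tr => bool list" and c :: "'b::tr => bool list"
 assumes e: "codec e" and c: "codec c" and V: "pt V"
  and L: "!!a. P a <-> (EX y. V (a, y))"
  and b: "polyb q" "!!a. P a ==> EX y. V (a, y) & length (c y) <= q (length (e a))"
 shows "{e a | a. P a} : class_NP"
proof -
 obtain d where d: "pt d" "!!w a. d w = Some a <-> w = e a" "!!a. d (e a) = Some a"
  using codec_decode[OF e] by blast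
 have "codec (enc_pair enc_word c)" by (intro codec_pair codec_word c)
 moreover have "pt (%p. case d (fst p) of None => False | Some a => V (a, snd p))"
  by (rule pt_case_option[OF pt_comp[OF d(1) pt_fst[OF pt_id]] pt_const],
    rule pt_comp[OF V]) (intro pt_Pair pt_snd pt_fst pt_id)
 ultimately have VP: "{enc_pair enc_word c p | p. case d (fst p) of None => False | Some a => V (a, snd p)} : class_P"
  by (rule class_P_I)
 obtain k l where kl: "!!n. q n <= k * n ^ l + k" using b(1) unfolding polyb_def by blast
 have "w : {e a | a. P a} <-> (EX y. length y <= k * length w ^ l + k &
   enc_word w @ y : {enc_pair enc_word c p | p. case d (fst p) of None => False | Some a => V (a, snd p)})" for w
 proof
  assume "w : {e a | a. P a}"
  then obtain a where a: "w = e a" "P a" by blast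
  obtain y where y: "V (a, y)" "length (c y) <= q (length (e a))" using b(2)[OF a(2)] by blast
  show "EX y. length y <= k * length w ^ l + k &
   enc_word w @ y : {enc_pair enc_word c p | p. case d (fst p) of None => False | Some a => V (a, snd p)}"
  proof (intro exI conjI)
   show "length (c y) <= k * length w ^ l + k" using y(2) kl[of "length (e a)"] a(1) by simp
   show "enc_word w @ c y : {enc_pair enc_word c p | p. case d (fst p) of None => False | Some a => V (a, snd p)}"
    using y(1) a(1) d(3)[of a] by (intro CollectI exI[of _ "(w, y)"]) (simp add: enc_pair_def)
  qed
 next
  assume "EX y. length y <= k * length w ^ l + k &
   enc_word w @ y : {enc_pair enc_word c p | p. case d (fst p) of None => False | Some a => V (a, snd p)}"
  then obtain y p where yp: "enc_word w @ y = enc_word (fst p) @ c (snd p)"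
   "case d (fst p) of None => False | Some a => V (a, snd p)" unfolding enc_pair_def by blast
  then have "w = fst p" using prefix_free_enc_word unfolding prefix_free_def by blast
  with yp(2) d(2)[of w] L show "w : {e a | a. P a}" by (auto split: option.splits)
 qed
 with VP show ?thesis unfolding class_NP_def by blast
qed

section \<open>Packing branchings\<close>

abbreviation tl_of :: "'e * 'v * 'v => 'v" where "tl_of a == fst (snd a)"
abbreviation hd_of :: "'e * 'v * 'v => 'v" where "hd_of a == snd (snd a)"

text \<open>The pairs in \<open>Z\<close> are free: every branching may use them.\<close>

locale packing =
 fixes V :: "'v set" and Z :: "('v * 'v) set" and k :: nat
 assumes finV: "finite V" and ZV: "Z <= V \<times> V"
begin

definition rho :: "('e * 'v * 'v) set => 'v set => nat" where
 "rho E X = card {a : E. tl_of a ~: X & hd_of a : X}"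

text \<open>A set entered by a free pair can be reached at no cost from outside, so it imposes no
  demand of its own.\<close>

definition fam :: "'v set => bool" where
 "fam X <-> X <= V & X ~= {} & (ALL (x, y) : Z. y : X --> x : X)"

text \<open>The demand of \<open>X\<close>: each branching whose roots miss \<open>X\<close> has to
  enter it by an arc of its own.\<close>

definition pp :: "(nat => 'v set) => 'v set => nat" where
 "pp R X = card {i. i < k & R i Int X = {}}"

text \<open>The cut condition of Edmonds' theorem on disjoint branchings with prescribed root sets,
  restricted to the sets that no free pair enters.\<close>

definition edm :: "('e * 'v * 'v) set => (nat => 'v set) => bool" where
 "edm E R <-> (ALL X. fam X --> pp R X <= rho E X)"

definition rch :: "('e * 'v * 'v) set => 'v set => 'v set" where
 "rch E R = (Z Un snd ` E)\<^sup>* `` R"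

lemma rho_submodular:
 assumes "finite E"
 shows "rho E (X Int Y) + rho E (X Un Y) <= rho E X + rho E Y"
proof -
 let ?D = "%X. {a : E. tl_of a ~: X & hd_of a : X}"
 have fin: "finite (?D X)" for X using assms by simp
 have "rho E (X Int Y) + rho E (X Un Y) = card (?D (X Int Y) Un ?D (X Un Y)) + card (?D (X Int Y) Int ?D (X Un Y))"
  unfolding rho_def by (rule card_Un_Int[OF fin fin])
 also have "... <= card (?D X Un ?D Y) + card (?D X Int ?D Y)"
  using fin by (intro add_mono card_mono finite_UnI) (auto simp: assms)
 also have "... = rho E X + rho E Y"
  unfolding rho_def by (rule card_Un_Int[OF fin fin, symmetric])
 finally show ?thesis .
qed

text \<open>Root sets that miss both \<open>X\<close> and \<open>Y\<close> miss their union, and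
  those that miss one of them miss the intersection.\<close>

lemma pp_supermodular:
 "pp R X + pp R Y <= pp R (X Int Y) + pp R (X Un Y)"
proof -
 let ?P = "%X. {i. i < k & R i Int X = {}}"
 have fin: "finite (?P X)" for X by simp
 have "pp R X + pp R Y = card (?P X Un ?P Y) + card (?P X Int ?P Y)"
  unfolding pp_def by (rule card_Un_Int[OF fin fin])
 also have "... <= card (?P (X Int Y)) + card (?P (X Un Y))"
  by (intro add_mono card_mono) auto
 finally show ?thesis unfolding pp_def .
qed

text \<open>A free path that ends in \<open>X\<close> never left it, since \<open>X\<close> contains
  the free predecessors of its members. So a root set meets \<open>X\<close> as soon as its free
  closure does.\<close>

lemma fam_rch: "fam X ==> x : Z\<^sup>* `` R ==> x : X ==> R Int X ~= {}"
proof -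
 assume X: "fam X" and x: "x : Z\<^sup>* `` R" "x : X"
 then obtain r where r: "r : R" "(r, x) : Z\<^sup>*" by blast
 from r(2) x(2) have "r : X"
  by (induction rule: rtrancl_induct) (use X in \<open>auto simp: fam_def\<close>)
 with r(1) show ?thesis by blast
qed

lemma pp_strict:
 assumes "i < k" "R i Int X ~= {}" "R i Int Y = {}" "!!j. j < k ==> R j Int X = {} ==> R' j Int Y = {}"
  "R' i Int Y = {}"
 shows "pp R X < pp R' Y"
proof -
 have "{j. j < k & R j Int X = {}} \<subset> {j. j < k & R' j Int Y = {}}" using assms by blast
 then show ?thesis unfolding pp_def by (intro psubset_card_mono) auto
qed

lemma closure_subset: "R <= V ==> Z\<^sup>* `` R <= V"
proof
 fix x assume R: "R <= V" and "x : Z\<^sup>* `` R"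
 then obtain r where "r : R" "(r, x) : Z\<^sup>*" by blast
 from this(2,1) show "x : V" by (induction rule: rtrancl_induct) (use R ZV in auto)
qed

text \<open>Lovasz' argument: an arc that enters the unreached part of a minimal tight set is safe.\<close>

lemma lovasz_step:
 assumes finE: "finite E" and E: "!!a. a : E ==> tl_of a : V & hd_of a : V"
  and edm: "edm E R" and R: "R i <= V" and i: "i < k" and CneV: "Z\<^sup>* `` R i ~= V"
 obtains a where "a : E" "tl_of a : Z\<^sup>* `` R i" "hd_of a ~: Z\<^sup>* `` R i"
  "edm (E - {a}) (R(i := insert (hd_of a) (R i)))"
proof -
 define C where "C = Z\<^sup>* `` R i"
 have CV: "C <= V" unfolding C_def by (rule closure_subset[OF R])
 have Cclosed: "y : C" if "x : C" "(x, y) : Z" for x y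
  using that unfolding C_def by (auto intro: rtrancl.rtrancl_into_rtrancl)
 have RC: "R i <= C" unfolding C_def by auto
 have meet: "R i Int X ~= {} <-> C Int X ~= {}" if "fam X" for X
  using fam_rch[OF that] RC unfolding C_def by blast
 have VC: "V - C ~= {}" using CneV CV unfolding C_def by blast
 have Vfam: "fam V" using VC ZV unfolding fam_def by blast
 have rhoV: "rho E V = 0" unfolding rho_def using E by (auto simp: card_eq_0_iff)
 \<comment> \<open>An empty closure would mean that \<open>R i\<close> is empty; then
   \<open>V\<close> has a positive demand, while no arc enters \<open>V\<close>.\<close>
 have Cne: "C ~= {}"
 proof
  assume "C = {}"
  then have "R i Int V = {}" using RC by blast
  then have "i : {j. j < k & R j Int V = {}}" using i by blast
  then have "pp R V > 0" unfolding pp_def by (intro card_gt_0_iff[THEN iffD2]) auto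
  then show False using edm Vfam rhoV unfolding edm_def by fastforce
 qed
 \<comment> \<open>Under \<open>edm\<close> the inequality is an equality. The last two conditions
   make \<open>X\<close> a set across which branching \<open>i\<close> can still grow;
   \<open>V\<close> itself qualifies because no arc enters it.\<close>
 define tight where "tight X <-> fam X & rho E X <= pp R X & X Int C ~= {} & X - C ~= {}" for X
 have "tight V" unfolding tight_def using Vfam rhoV VC Cne CV by auto
 then obtain X where X: "tight X" and min: "!!Y. tight Y ==> card X <= card Y"
  using ex_has_least_nat[of tight V card] by blast
 have XV: "X <= V" "fam X" using X unfolding tight_def fam_def by auto
 \<comment> \<open>\<open>C\<close> is closed under free successors, so a free predecessor of a
   vertex of \<open>X - C\<close> lies in \<open>X\<close> but not in \<open>C\<close>.\<close>
 have "fam (X - C)" using X Cclosed unfolding tight_def fam_def by blast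
 then have 1: "pp R (X - C) <= rho E (X - C)" using edm unfolding edm_def by blast
 \<comment> \<open>Passing to the subset loses no index from the demand and gains \<open>i\<close>,
   whose roots meet \<open>X\<close> but miss \<open>X - C\<close>.\<close>
 have "pp R X < pp R (X - C)"
  by (rule pp_strict[of i]) (use i RC X meet[OF XV(2)] in \<open>auto simp: tight_def\<close>)
 with 1 X have "rho E X < rho E (X - C)" unfolding tight_def by linarith
 \<comment> \<open>By the strict inequality some arc enters \<open>X - C\<close> without entering
   \<open>X\<close>; its tail then lies in both \<open>X\<close> and \<open>C\<close>.\<close>
 have "~ {a : E. tl_of a ~: X - C & hd_of a : X - C} <= {a : E. tl_of a ~: X & hd_of a : X}"
 proof
  assume "{a : E. tl_of a ~: X - C & hd_of a : X - C} <= {a : E. tl_of a ~: X & hd_of a : X}"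
  then have "rho E (X - C) <= rho E X" unfolding rho_def by (intro card_mono) (use finE in simp_all)
  with \<open>rho E X < rho E (X - C)\<close> show False by simp
 qed
 then obtain a where a: "a : E" "tl_of a : X" "tl_of a : C" "hd_of a : X" "hd_of a ~: C" by blast
 define R' where "R' = R(i := insert (hd_of a) (R i))"
 have "edm (E - {a}) R'"
  unfolding edm_def
 proof (intro allI impI, rule ccontr)
  fix Y assume Y: "fam Y" and "~ pp R' Y <= rho (E - {a}) Y"
  then have lt: "rho (E - {a}) Y < pp R' Y" by simp
  have le: "pp R' Y <= pp R Y" unfolding pp_def R'_def by (intro card_mono) (auto split: if_splits)
  have ed: "pp R Y <= rho E Y" using edm Y unfolding edm_def by blast
  have enter: "tl_of a ~: Y & hd_of a : Y"
  proof (rule ccontr)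
   assume "~ (tl_of a ~: Y & hd_of a : Y)"
   then have "{b : E - {a}. tl_of b ~: Y & hd_of b : Y} = {b : E. tl_of b ~: Y & hd_of b : Y}" by blast
   then show False using lt le ed unfolding rho_def by simp
  qed
  have "{b : E. tl_of b ~: Y & hd_of b : Y} = insert a {b : E - {a}. tl_of b ~: Y & hd_of b : Y}"
   using enter a by blast
  then have "rho E Y = Suc (rho (E - {a}) Y)" unfolding rho_def using finE by simp
  with lt le ed have eq: "pp R' Y = pp R Y" "rho E Y = pp R Y" by linarith+
  \<comment> \<open>If \<open>R i\<close> missed \<open>Y\<close>, the new root
    \<open>hd_of a\<close> would lower the demand of \<open>Y\<close> by one, just as the removal of
    \<open>a\<close> lowers its in-degree.\<close>
  have RiY: "R i Int Y ~= {}"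
  proof
   assume RiY: "R i Int Y = {}"
   have "pp R' Y < pp R Y"
   proof -
    have "{j. j < k & R' j Int Y = {}} \<subset> {j. j < k & R j Int Y = {}}"
     using RiY i enter by (auto simp: R'_def split: if_splits)
    then show ?thesis unfolding pp_def by (intro psubset_card_mono) auto
   qed
   with eq show False by simp
  qed
  then have YC: "Y Int C ~= {}" using RC by blast
  have fXY: "fam (X Int Y)" "fam (X Un Y)" using XV(2) Y a enter unfolding fam_def by blast+
  have sub: "rho E (X Int Y) + rho E (X Un Y) <= rho E X + rho E Y" by (rule rho_submodular[OF finE])
  have eXY: "pp R (X Un Y) <= rho E (X Un Y)" "pp R (X Int Y) <= rho E (X Int Y)"
   using edm fXY unfolding edm_def by blast+
  have sup: "pp R X + pp R Y <= pp R (X Int Y) + pp R (X Un Y)" by (rule pp_supermodular)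
  have tX: "rho E X <= pp R X" using X by (simp add: tight_def)
  \<comment> \<open>Otherwise \<open>i\<close> is counted for the intersection but for neither of
    the two sets; supermodularity becomes strict and contradicts the tightness of \<open>X\<close>
    and \<open>Y\<close>.\<close>
  have RiXY: "R i Int (X Int Y) ~= {}"
  proof
   assume e: "R i Int (X Int Y) = {}"
   let ?P = "%X. {j. j < k & R j Int X = {}}"
   have RiX: "R i Int X ~= {}" using meet[OF XV(2)] X unfolding tight_def by blast
   have "pp R X + pp R Y = card (?P X Un ?P Y) + card (?P X Int ?P Y)"
    unfolding pp_def by (rule card_Un_Int) auto
   moreover have "card (?P X Un ?P Y) < card (?P (X Int Y))"
   proof (rule psubset_card_mono)
    have "i : ?P (X Int Y)" using e i by blast
    moreover have "i ~: ?P X Un ?P Y" using RiX RiY by blast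
    moreover have "?P X Un ?P Y <= ?P (X Int Y)" by blast
    ultimately show "?P X Un ?P Y \<subset> ?P (X Int Y)" by blast
   qed simp
   moreover have "card (?P X Int ?P Y) <= card (?P (X Un Y))" by (rule card_mono) auto
   ultimately have "pp R X + pp R Y < pp R (X Int Y) + pp R (X Un Y)" unfolding pp_def by linarith
   with sub eXY tX eq(2) show False by linarith
  qed
  \<comment> \<open>Uncrossing makes the intersection tight. It contains \<open>hd_of a\<close> but
    not \<open>tl_of a\<close>, so it is smaller than the minimal set \<open>X\<close>.\<close>
  have "tight (X Int Y)" unfolding tight_def
   using fXY sub eXY sup tX eq(2) RiXY RC a enter by auto
  from min[OF this] have "card X <= card (X Int Y)" .
  moreover have "card (X Int Y) < card X"
   using a enter finite_subset[OF XV(1) finV] by (intro psubset_card_mono) auto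
  ultimately show False by simp
 qed
 with a that[of a] show ?thesis unfolding R'_def C_def by blast
qed

text \<open>A violated set is exactly a set cut off from the roots after deleting the arcs
  \<open>F\<close> that enter it and the root sets \<open>I\<close> that meet it, and the violation
  says that fewer than \<open>k\<close> objects were deleted. For fixed \<open>k\<close> this
  replaces a test of all sets by polynomially many reachability tests.\<close>

lemma edm_iff_reach:
 assumes finE: "finite E" and E: "!!a. a : E ==> tl_of a : V & hd_of a : V" and R: "!!i. i < k ==> R i <= V"
 shows "edm E R <-> (ALL F I. F <= E --> I <= {..<k} --> card F + card I < k -->
  V <= rch (E - F) (\<Union>i \<in> {..<k} - I. R i))"
proof
 assume edm: "edm E R"
 show "ALL F I. F <= E --> I <= {..<k} --> card F + card I < k --> V <= rch (E - F) (\<Union>i \<in> {..<k} - I. R i)"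
 proof (intro allI impI, rule ccontr)
  fix F I assume FI: "F <= E" "I <= {..<k}" "card F + card I < k"
   and n: "~ V <= rch (E - F) (\<Union>i \<in> {..<k} - I. R i)"
  define S where "S = rch (E - F) (\<Union>i \<in> {..<k} - I. R i)"
  define X where "X = V - S"
  have closed: "y : S" if "x : S" "(x, y) : Z Un snd ` (E - F)" for x y
   using that unfolding S_def rch_def by (meson Image_iff rtrancl.rtrancl_into_rtrancl)
  have "fam X" using n closed ZV unfolding fam_def X_def S_def[symmetric] by blast
  then have "pp R X <= rho E X" using edm unfolding edm_def by blast
  moreover have "rho E X <= card F"
   unfolding rho_def
  proof (rule card_mono)
   show "finite F" using FI finE finite_subset by blast
   show "{a : E. tl_of a ~: X & hd_of a : X} <= F"
   proof
    fix a assume a: "a : {a : E. tl_of a ~: X & hd_of a : X}"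
    show "a : F"
    proof (rule ccontr)
     assume "a ~: F"
     with a have "(tl_of a, hd_of a) : snd ` (E - F)" by force
     then show False using closed[of "tl_of a" "hd_of a"] a E[of a] unfolding X_def by blast
    qed
   qed
  qed
  moreover have "k - card I <= pp R X"
  proof -
   have "{..<k} - I <= {i. i < k & R i Int X = {}}"
   proof
    fix i assume i: "i : {..<k} - I"
    then have "R i <= S" unfolding S_def rch_def by blast
    with i show "i : {i. i < k & R i Int X = {}}" unfolding X_def by blast
   qed
   then have "card ({..<k} - I) <= pp R X" unfolding pp_def by (intro card_mono) auto
   then show ?thesis using card_Diff_subset[of I "{..<k}"] FI(2) finite_subset[OF FI(2)] by simp
  qed
  ultimately show False using FI(3) by linarith
 qed
next
 assume reach: "ALL F I. F <= E --> I <= {..<k} --> card F + card I < k --> V <= rch (E - F) (\<Union>i \<in> {..<k} - I. R i)"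
 show "edm E R" unfolding edm_def
 proof (intro allI impI, rule ccontr)
  fix X assume X: "fam X" and "~ pp R X <= rho E X"
  then have lt: "rho E X < pp R X" by simp
  define F where "F = {a : E. tl_of a ~: X & hd_of a : X}"
  define I where "I = {i. i < k & R i Int X ~= {}}"
  have "{i. i < k & R i Int X = {}} = {..<k} - I" unfolding I_def by auto
  then have "pp R X = k - card I" unfolding pp_def
   using card_Diff_subset[of I "{..<k}"] unfolding I_def by (simp add: subset_iff)
  with lt have "card F + card I < k" unfolding F_def rho_def by linarith
  moreover have "F <= E" "I <= {..<k}" unfolding F_def I_def by auto
  ultimately have VS: "V <= rch (E - F) (\<Union>i \<in> {..<k} - I. R i)" using reach by blast
  have "x ~: X" if "x : rch (E - F) (\<Union>i \<in> {..<k} - I. R i)" for x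
  proof -
   from that obtain r where r: "r : (\<Union>i \<in> {..<k} - I. R i)" "(r, x) : (Z Un snd ` (E - F))\<^sup>*"
    unfolding rch_def by blast
   have "r ~: X" using r(1) unfolding I_def by blast
   from r(2) this show ?thesis
   proof (induction rule: rtrancl_induct)
    case (step y z)
    then show ?case using X unfolding F_def fam_def by fastforce
   qed
  qed
  moreover obtain x where "x : X" "x : V" using X unfolding fam_def by blast
  ultimately show False using VS by blast
 qed
qed

text \<open>Every branching whose roots miss \<open>X\<close> has an arc that enters
  \<open>X\<close>, and disjointness makes these arcs distinct.\<close>

lemma edm_if_packing:
 assumes finE: "finite E" and F: "!!i. i < k ==> F i <= E"
  and dis: "!!i j. i < k ==> j < k ==> i ~= j ==> F i Int F j = {}"
  and reach: "!!i. i < k ==> V <= rch (F i) (R i)"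
 shows "edm E R"
 unfolding edm_def
proof (intro allI impI)
 fix X assume X: "fam X"
 have ex: "EX a : F i. tl_of a ~: X & hd_of a : X" if i: "i < k" "R i Int X = {}" for i
 proof (rule ccontr)
  assume n: "~ (EX a : F i. tl_of a ~: X & hd_of a : X)"
  obtain x where x: "x : X" "x : V" using X unfolding fam_def by blast
  then obtain r where r: "r : R i" "(r, x) : (Z Un snd ` F i)\<^sup>*" using reach[OF i(1)] unfolding rch_def by blast
  have "r ~: X" using r(1) i(2) by blast
  from r(2) this have "x ~: X"
  proof (induction rule: rtrancl_induct)
   case (step y z)
   then show ?case using X n unfolding fam_def by fastforce
  qed
  with x show False by blast
 qed
 then obtain f where f: "!!i. i < k ==> R i Int X = {} ==> f i : F i & tl_of (f i) ~: X & hd_of (f i) : X"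
  by metis
 have "inj_on f {i. i < k & R i Int X = {}}"
 proof (rule inj_onI)
  fix i j assume ij: "i : {i. i < k & R i Int X = {}}" "j : {i. i < k & R i Int X = {}}" "f i = f j"
  then have "f i : F i Int F j" using f[of i] f[of j] by auto
  then show "i = j" using dis[of i j] ij by blast
 qed
 moreover have "f ` {i. i < k & R i Int X = {}} <= {a : E. tl_of a ~: X & hd_of a : X}"
  using f F by blast
 ultimately show "pp R X <= rho E X" unfolding pp_def rho_def
  by (rule card_inj_on_le) (use finE in simp)
qed

end

subsection \<open>Reachability\<close>

definition grow :: "'v list => ('v * 'v) list => 'v list => 'v list" where
 "grow V Es S = filter (%v. v : set S | (EX e : set Es. snd e = v & fst e : set S)) V"

text \<open>The fold over \<open>V\<close> is a clock: the set is stationary after as many rounds as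
  there are vertices. Filtering from \<open>V\<close> keeps every intermediate list below the size
  of \<open>V\<close>.\<close>

definition reach :: "'v list => ('v * 'v) list => 'v list => 'v list" where
 "reach V Es R = foldl (%S _. grow V Es S) (filter (%v. v : set R) V) V"

lemma set_grow: "set S <= set V ==> set Es <= set V \<times> set V ==> set (grow V Es S) = set S Un set Es `` set S"
 by (force simp: grow_def)

text \<open>A chain growing strictly through index \<open>card V + 1\<close> would outgrow
  \<open>V\<close>; and since every set is a function of its predecessor, one standstill lasts
  forever.\<close>

lemma stabilizes:
 fixes A :: "nat => 'a set"
 assumes fin: "finite V" and A: "!!n. A n <= V" and Suc: "!!n. A (Suc n) = g (A n)" and mono: "!!n. A n <= A (Suc n)"
 shows "A (Suc (card V)) = A (card V)"
proof -
 have "EX n <= card V. A (Suc n) = A n"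
 proof (rule ccontr)
  assume n: "~ ?thesis"
  have "n <= Suc (card V) ==> n <= card (A n)" for n
  proof (induction n)
   case (Suc n)
   then have "A n \<subset> A (Suc n)" using n mono[of n] by fastforce
   then have "card (A n) < card (A (Suc n))" using finite_subset[OF A fin] by (intro psubset_card_mono)
   with Suc show ?case by simp
  qed simp
  from this[of "Suc (card V)"] show False using card_mono[OF fin A[of "Suc (card V)"]] by simp
 qed
 then obtain n where n: "n <= card V" "A (Suc n) = A n" by blast
 have "A (n + m) = A n" for m by (induction m) (use n(2) Suc in auto)
 from this[of "card V - n"] this[of "Suc (card V - n)"] n(1) show ?thesis by simp
qed

lemma set_reach:
 assumes Es: "set Es <= set V \<times> set V" and R: "set R <= set V"
 shows "set (reach V Es R) = (set Es)\<^sup>* `` set R"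
proof -
 define A where "A n = ((%S. S Un set Es `` S) ^^ n) (set R)" for n
 have AV: "A n <= set V" for n by (induction n) (use R Es in \<open>auto simp: A_def\<close>)
 have fold: "set (foldl (%S _. grow V Es S) (filter (%v. v : set R) V) ys) = A (length ys)" for ys :: "'b list"
 proof (induction ys rule: rev_induct)
  case Nil
  then show ?case using R by (auto simp: A_def)
 next
  case (snoc y ys)
  then show ?case using set_grow[OF _ Es] AV by (simp add: A_def)
 qed
 have sub: "A n <= (set Es)\<^sup>* `` set R" for n
 proof (induction n)
  case (Suc n)
  have "A (Suc n) = A n Un set Es `` A n" by (simp add: A_def)
  moreover have "set Es `` ((set Es)\<^sup>* `` set R) <= (set Es)\<^sup>* `` set R"
   by (auto intro: rtrancl.rtrancl_into_rtrancl)
  ultimately show ?case using Suc by blast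
 qed (auto simp: A_def)
 let ?c = "card (set V)"
 have st: "A (Suc ?c) = A ?c"
  by (rule stabilizes[where A = A and g = "%S. S Un set Es `` S", OF _ AV]) (auto simp: A_def)
 have const: "A (?c + m) = A ?c" for m
 proof (induction m)
  case (Suc m)
  then have "A (Suc (?c + m)) = A ?c Un set Es `` A ?c" by (simp add: A_def)
  also have "... = A (Suc ?c)" by (simp add: A_def)
  finally show ?case using st by simp
 qed simp
 have "?c <= length V" by (rule card_length)
 then have Al: "A (length V) = A ?c" using const[of "length V - ?c"] by simp
 have "(set Es)\<^sup>* `` set R <= A ?c"
 proof
  fix x assume "x : (set Es)\<^sup>* `` set R"
  then obtain r where r: "r : set R" "(r, x) : (set Es)\<^sup>*" by blast
  have "set R <= A n" for n by (induction n) (auto simp: A_def)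
  from r(2) show "x : A ?c"
  proof (induction rule: rtrancl_induct)
   case base
   then show ?case using r(1) \<open>!!n. set R <= A n\<close> by blast
  next
   case (step y z)
   then have "z : A (Suc ?c)" by (auto simp: A_def)
   then show ?case by (simp add: st)
  qed
 qed
 then show ?thesis using sub[of ?c] unfolding reach_def fold Al by blast
qed

lemma sz_filter: "sz (filter P xs) <= sz xs"
 by (induction xs) auto

lemma pt_reach:
 assumes "pt V" "pt Es" "pt R" shows "pt (%x. reach (V x) (Es x) (R x))"
proof -
 have "pt (%p :: 'b list \<times> ('b * 'b) list \<times> 'b list. reach (fst p) (fst (snd p)) (snd (snd p)))"
  unfolding reach_def
 proof (rule pt_foldl[where q = "%n. n"])
  fix x :: "'b list \<times> ('b * 'b) list \<times> 'b list" and n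
  have "EX P. foldl (%S _. grow (fst x) (fst (snd x)) S) (filter (%v. v : set (snd (snd x))) (fst x)) ys = filter P (fst x)"
   for ys :: "'b list" by (induction ys rule: rev_induct) (auto simp: grow_def)
  then obtain P where "foldl (%S _. grow (fst x) (fst (snd x)) S) (filter (%v. v : set (snd (snd x))) (fst x)) (take n (fst x)) = filter P (fst x)"
   by blast
  moreover have "sz (filter P (fst x)) <= sz x"
   using sz_filter[of P "fst x"] by (cases x) simp
  ultimately show "sz (foldl (%S _. grow (fst x) (fst (snd x)) S) (filter (%v. v : set (snd (snd x))) (fst x)) (take n (fst x))) <= sz x"
   by simp
 next
  show "pt (%p :: ('b list \<times> ('b * 'b) list \<times> 'b list) \<times> 'b list \<times> 'b. grow (fst (fst p)) (fst (snd (fst p))) (fst (snd p)))"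
   unfolding grow_def by (intro pt_intros)
 qed (intro pt_intros polyb_intros)+
 from pt_comp[OF this pt_Pair[OF assms(1) pt_Pair[OF assms(2,3)]]] show ?thesis by simp
qed


subsection \<open>The greedy algorithm\<close>

text \<open>Short lists stand for small sets of deleted objects. The length bound \<open>n\<close>
  is a constant of the algorithm, so there are polynomially many of them.\<close>

fun tuples :: "nat => 'a list => 'a list list" where
 "tuples 0 xs = [[]]"
| "tuples (Suc n) xs = flat (tuples n xs) (%r. r # map (%x. x # r) xs)"

lemma tuples_sound: "r : set (tuples n xs) ==> set r <= set xs"
proof (induction n arbitrary: r)
 case (Suc n)
 then obtain r' where r': "r' : set (tuples n xs)" "r = r' | (EX x : set xs. r = x # r')" by auto
 from Suc.IH[OF r'(1)] r'(2) show ?case by auto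
qed simp

lemma tuples_complete: "set r <= set xs ==> length r <= n ==> r : set (tuples n xs)"
proof (induction n arbitrary: r)
 case (Suc n)
 show ?case
 proof (cases r)
  case Nil
  then have "r : set (tuples n xs)" by (intro Suc.IH) auto
  then show ?thesis by auto
 next
  case (Cons x r')
  then have "r' : set (tuples n xs)" using Suc.prems by (intro Suc.IH) auto
  then show ?thesis using Cons Suc.prems(1) by auto
 qed
qed simp

lemma pt_tuples: "pt xs ==> pt (%x. tuples n (xs x))"
proof -
 have "pt (tuples n :: 'b list => _)"
 proof (induction n)
  case 0
  show ?case by (simp add: pt_const)
 next
  case (Suc n)
  show ?case unfolding tuples.simps by (intro pt_flat pt_comp[OF Suc] pt_intros)
 qed
 then show "pt xs ==> pt (%x. tuples n (xs x))" by (rule pt_comp)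
qed

text \<open>The program form of \<open>edm_iff_reach\<close>: fewer than \<open>k\<close> deletions
  in total means at most \<open>k - 1\<close> of each kind. The sum of the two lengths is expressed
  as the length of a concatenation, an operation already known to be polynomial.\<close>

definition cut_test :: "nat => 'v list => ('v * 'v) list => ('e * 'v * 'v) list => (nat * 'v) list => bool" where
 "cut_test k V Z E Rp <-> (ALL F : set (tuples (k - 1) E). ALL I : set (tuples (k - 1) [0..<k]).
   length (map (%_. ()) F @ map (%_. ()) I) < k -->
   (ALL v : set V. v : set (reach V (Z @ map snd (filter (%a. a ~: set F) E)) (map snd (filter (%r. fst r ~: set I) Rp)))))"

definition reached :: "'v list => ('v * 'v) list => (nat * 'v) list => nat => 'v list" where
 "reached V Z Rp i = reach V Z (map snd (filter (%r. fst r = i) Rp))"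

text \<open>A partial solution is a list of arcs tagged with the branching that uses them. The head
  of a used arc acts as a new root, so the vertices covered by a branching are the free closure of
  its grown roots.\<close>

definition grown :: "(nat * 'v) list => (nat * 'e * 'v * 'v) list => (nat * 'v) list" where
 "grown Rp st = map (%c. (fst c, hd_of (snd c))) st @ Rp"

definition unused :: "('e * 'v * 'v) list => (nat * 'e * 'v * 'v) list => ('e * 'v * 'v) list" where
 "unused E st = filter (%a. a ~: set (map snd st)) E"

definition candidates :: "nat => 'v list => ('v * 'v) list => ('e * 'v * 'v) list => (nat * 'v) list =>
  (nat * 'e * 'v * 'v) list => (nat * 'e * 'v * 'v) list" where
 "candidates k V Z E Rp st = flat [0..<k] (%i. map (%a. (i, a)) (filter (%a.
   tl_of a : set (reached V Z (grown Rp st) i) & hd_of a ~: set (reached V Z (grown Rp st) i) &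
   cut_test k V Z (unused E ((i, a) # st)) (grown Rp ((i, a) # st))) (unused E st)))"

definition pack_step :: "nat => 'v list => ('v * 'v) list => ('e * 'v * 'v) list => (nat * 'v) list =>
  (nat * 'e * 'v * 'v) list => (nat * 'e * 'v * 'v) list" where
 "pack_step k V Z E Rp st = (case candidates k V Z E Rp st of [] => st | c # _ => c # st)"

text \<open>Every productive round uses up an arc, so the length of \<open>E\<close> bounds the
  number of rounds and \<open>E\<close> can serve as the clock.\<close>

definition pack :: "nat => 'v list => ('v * 'v) list => ('e * 'v * 'v) list => (nat * 'v) list =>
  (nat * 'e * 'v * 'v) list" where
 "pack k V Z E Rp = foldl (%st _. pack_step k V Z E Rp st) [] E"

definition packed :: "nat => 'v list => ('v * 'v) list => (nat * 'v) list => (nat * 'e * 'v * 'v) list => bool" where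
 "packed k V Z Rp st <-> (ALL i : set [0..<k]. ALL v : set V. v : set (reached V Z (grown Rp st) i))"

lemma pt_candidates:
 "pt (%p. candidates k (fst (fst p)) (fst (snd (fst p))) (fst (snd (snd (fst p)))) (snd (snd (snd (fst p)))) (snd p))"
 unfolding candidates_def cut_test_def reached_def grown_def unused_def
 by (intro pt_flat pt_tuples pt_reach pt_intros)

lemma pack_step_size:
 "sz (foldl (%st _. pack_step k V Z E Rp st) [] ys) <= length ys * (sz E + (4 * k + 1) + 2) + 1"
proof (induction ys rule: rev_induct)
 case (snoc y ys)
 let ?st = "foldl (%st _. pack_step k V Z E Rp st) [] ys"
 have bound: "sz c <= sz E + (4 * k + 1) + 1" if c: "c : set (candidates k V Z E Rp st)" for c st
 proof -
  from c have "fst c < k" "snd c : set E" by (auto simp: candidates_def unused_def)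
  then show ?thesis using sz_member[of "snd c" E] sz_nat_le_mono[of "fst c" k] by (cases c) simp
 qed
 have "sz (pack_step k V Z E Rp st) <= sz st + (sz E + (4 * k + 1) + 2)" for st
 proof (cases "candidates k V Z E Rp st")
  case (Cons c cs)
  then have "c : set (candidates k V Z E Rp st)" by simp
  from bound[OF this] show ?thesis
   by (simp add: pack_step_def Cons)
 qed (simp add: pack_step_def)
 from this[of ?st] snoc show ?case by simp
qed simp

lemma pt_pack:
 assumes "pt V" "pt Z" "pt E" "pt Rp"
 shows "pt (%x. pack k (V x) (Z x) (E x) (Rp x))"
proof -
 have "pt (%q :: 'b list \<times> ('b * 'b) list \<times> ('c * 'b * 'b) list \<times> (nat * 'b) list.
   pack k (fst q) (fst (snd q)) (fst (snd (snd q))) (snd (snd (snd q))))"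
  unfolding pack_def
 proof (rule pt_foldl[where q = "%n. n * (n + (4 * k + 1) + 2) + 1"])
  fix x :: "'b list \<times> ('b * 'b) list \<times> ('c * 'b * 'b) list \<times> (nat * 'b) list" and n
  let ?E = "fst (snd (snd x))"
  have E: "sz ?E <= sz x" by (cases x) simp
  have "length (take n ?E) * (sz ?E + (4 * k + 1) + 2) + 1 <= sz x * (sz x + (4 * k + 1) + 2) + 1"
   using E length_less_sz[of ?E] by (intro add_mono mult_le_mono) auto
  then show "sz (foldl (%st _. pack_step k (fst x) (fst (snd x)) ?E (snd (snd (snd x))) st) [] (take n ?E))
   <= sz x * (sz x + (4 * k + 1) + 2) + 1"
   using pack_step_size[of k "fst x" "fst (snd x)" ?E "snd (snd (snd x))" "take n ?E"] by linarith
 next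
  show "pt (%p :: ('b list \<times> ('b * 'b) list \<times> ('c * 'b * 'b) list \<times> (nat * 'b) list) \<times>
    (nat * 'c * 'b * 'b) list \<times> 'c * 'b * 'b.
    pack_step k (fst (fst p)) (fst (snd (fst p))) (fst (snd (snd (fst p)))) (snd (snd (snd (fst p)))) (fst (snd p)))"
   unfolding pack_step_def
   by (intro pt_case_list pt_comp2[OF pt_candidates] pt_intros)
 qed (intro pt_intros polyb_intros)+
 from pt_comp[OF this pt_Pair[OF assms(1) pt_Pair[OF assms(2) pt_Pair[OF assms(3,4)]]]] show ?thesis by simp
qed

lemma pt_packed:
 assumes "pt V" "pt Z" "pt Rp" "pt st"
 shows "pt (%x. packed k (V x) (Z x) (Rp x) (st x))"
proof -
 have "pt (%p. packed k (fst p) (fst (snd p)) (fst (snd (snd p))) (snd (snd (snd p))))"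
  unfolding packed_def reached_def grown_def by (intro pt_reach pt_intros)
 from pt_comp[OF this pt_Pair[OF assms(1) pt_Pair[OF assms(2) pt_Pair[OF assms(3,4)]]]] show ?thesis by simp
qed

section \<open>Correctness of the greedy algorithm\<close>

definition rt :: "(nat * 'v) list => nat => 'v set" where
 "rt Rp i = {v. (i, v) : set Rp}"

definition chosen :: "(nat * 'e * 'v * 'v) list => nat => ('e * 'v * 'v) set" where
 "chosen st i = {a. (i, a) : set st}"

context
 fixes V :: "'v list" and Z :: "('v * 'v) list" and E :: "('e * 'v * 'v) list" and Rp :: "(nat * 'v) list"
  and k :: nat
 assumes Z: "set Z <= set V \<times> set V" and E: "snd ` set E <= set V \<times> set V"
  and Rp: "snd ` set Rp <= set V"
begin

interpretation packing "set V" "set Z" k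
 by unfold_locales (use Z in auto)

lemma E_ends: "a : set E ==> tl_of a : set V & hd_of a : set V"
proof -
 assume "a : set E"
 then have "snd a : set V \<times> set V" using E by blast
 then show ?thesis by (cases "snd a") auto
qed

lemma rt_grown: "rt (grown Rp ((i, a) # st)) = (rt (grown Rp st))(i := insert (hd_of a) (rt (grown Rp st) i))"
 by (rule ext) (auto simp: rt_def grown_def)

lemma set_reached:
 assumes "snd ` set Q <= set V" shows "set (reached V Z Q i) = (set Z)\<^sup>* `` rt Q i"
proof -
 have "set (map snd (filter (%r. fst r = i) Q)) = rt Q i" by (force simp: rt_def)
 moreover have "rt Q i <= set V" using assms by (force simp: rt_def)
 ultimately show ?thesis unfolding reached_def by (subst set_reach[OF Z]) simp_all
qed

lemma cut_test_iff:
 assumes k: "1 <= k" and E': "set E' <= set E" and Q: "snd ` set Q <= set V" "fst ` set Q <= {..<k}"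
 shows "cut_test k V Z E' Q <-> edm (set E') (rt Q)"
proof -
 have r: "set (reach V (Z @ map snd (filter (%a. a ~: set F) E')) (map snd (filter (%r. fst r ~: set I) Q)))
   = rch (set E' - set F) (\<Union>i \<in> {..<k} - set I. rt Q i)" for F I
 proof -
  have e: "set (Z @ map snd (filter (%a. a ~: set F) E')) = set Z Un snd ` (set E' - set F)" by auto
  have q: "set (map snd (filter (%r. fst r ~: set I) Q)) = (\<Union>i \<in> {..<k} - set I. rt Q i)"
   using Q(2) by (force simp: rt_def)
  have "set Z Un snd ` (set E' - set F) <= set V \<times> set V" using Z E E' by blast
  moreover have "(\<Union>i \<in> {..<k} - set I. rt Q i) <= set V" using Q(1) by (force simp: rt_def)
  ultimately show ?thesis unfolding rch_def by (subst set_reach) (simp_all only: e q)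
 qed
 have ep: "edm (set E') (rt Q) <-> (ALL F I. F <= set E' --> I <= {..<k} --> card F + card I < k -->
  set V <= rch (set E' - F) (\<Union>i \<in> {..<k} - I. rt Q i))"
 proof (rule edm_iff_reach)
  show "tl_of a : set V & hd_of a : set V" if "a : set E'" for a
   using E_ends[of a] that E' by blast
  show "rt Q i <= set V" for i using Q(1) by (force simp: rt_def)
 qed simp
 show ?thesis
  unfolding cut_test_def r ep length_append length_map
 proof (intro iffI allI impI ballI)
  fix F I assume *: "ALL F:set (tuples (k - 1) E'). ALL I:set (tuples (k - 1) [0..<k]). length F + length I < k -->
    (ALL v:set V. v : rch (set E' - set F) (\<Union>i\<in>{..<k} - set I. rt Q i))"
   and F: "F <= set E'" and I: "I <= {..<k}" and c: "card F + card I < k"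
  obtain lF where lF: "set lF = F" "length lF = card F"
   using finite_distinct_list[OF finite_subset[OF F]] distinct_card by (metis List.finite_set)
  obtain lI where lI: "set lI = I" "length lI = card I"
   using finite_distinct_list[OF finite_subset[OF I]] distinct_card by (metis finite_lessThan)
  have "lF : set (tuples (k - 1) E')" using lF c F by (intro tuples_complete) auto
  moreover have "lI : set (tuples (k - 1) [0..<k])" using lI c I by (intro tuples_complete) auto
  ultimately show "set V <= rch (set E' - F) (\<Union>i\<in>{..<k} - I. rt Q i)"
   using * lF lI c by auto
 next
  fix F I v assume *: "ALL F I. F <= set E' --> I <= {..<k} --> card F + card I < k -->
    set V <= rch (set E' - F) (\<Union>i\<in>{..<k} - I. rt Q i)"
   and F: "F : set (tuples (k - 1) E')" and I: "I : set (tuples (k - 1) [0..<k])"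
   and l: "length F + length I < k" and v: "v : set V"
  have "set F <= set E'" "set I <= {..<k}" using tuples_sound[OF F] tuples_sound[OF I] by auto
  moreover have "card (set F) + card (set I) < k" using l card_length[of F] card_length[of I] by linarith
  ultimately show "v : rch (set E' - set F) (\<Union>i\<in>{..<k} - set I. rt Q i)" using * v by blast
 qed
qed

text \<open>The free closure of the grown roots is really reachable from the original roots by the
  chosen arcs. Distinct heads outside the root set make each part a branching, which is what
  uniqueness of walks will require.\<close>

definition pinv :: "(nat * 'e * 'v * 'v) list => bool" where
 "pinv st <-> snd ` set st <= set E & fst ` set st <= {..<k} & distinct (map snd st) &
   (ALL i. (set Z)\<^sup>* `` rt (grown Rp st) i <= rch (chosen st i) (rt Rp i)) &
   (ALL i. inj_on hd_of (chosen st i)) & (ALL i. hd_of ` chosen st i Int rt Rp i = {})"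

lemma grown_V: "snd ` set st <= set E ==> snd ` set (grown Rp st) <= set V"
proof -
 assume "snd ` set st <= set E"
 then have "hd_of (snd c) : set V" if "c : set st" for c
  using that E_ends[of "snd c"] by blast
 then show ?thesis using Rp by (auto simp: grown_def)
qed

lemma pinv_step: "pinv st ==> pinv (pack_step k V Z E Rp st)"
proof (cases "candidates k V Z E Rp st")
 case (Cons c cs)
 assume inv: "pinv st"
 then have sE: "snd ` set st <= set E" by (simp add: pinv_def)
 obtain i a where c: "c = (i, a)" by (cases c)
 have "(i, a) : set (candidates k V Z E Rp st)" using Cons c by simp
 then have i: "i < k" and a: "a : set E" "a ~: snd ` set st"
  and tl: "tl_of a : (set Z)\<^sup>* `` rt (grown Rp st) i" and hd: "hd_of a ~: (set Z)\<^sup>* `` rt (grown Rp st) i"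
  by (auto simp: candidates_def unused_def set_reached[OF grown_V[OF sE]])
 have ch: "chosen ((i, a) # st) j = (if j = i then insert a (chosen st j) else chosen st j)" for j
  by (auto simp: chosen_def)
 have hd': "hd_of a ~: rt (grown Rp st) i" using hd by auto
 have hd1: "hd_of a ~: rt Rp i" "hd_of a ~: hd_of ` chosen st i"
  using hd' by (force simp: rt_def grown_def chosen_def)+
 have mono: "rch (chosen st j) (rt Rp j) <= rch (chosen ((i, a) # st) j) (rt Rp j)" for j
  unfolding rch_def ch by (intro Image_mono rtrancl_mono Un_mono image_mono) auto
 have "(set Z)\<^sup>* `` rt (grown Rp ((i, a) # st)) j <= rch (chosen ((i, a) # st) j) (rt Rp j)" for j
 proof (cases "j = i")
  case False
  have "(set Z)\<^sup>* `` rt (grown Rp st) j <= rch (chosen st j) (rt Rp j)"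
   using inv by (simp only: pinv_def)
  from order_trans[OF this mono] show ?thesis using False by (simp only: rt_grown fun_upd_apply if_False)
 next
  case True
  let ?S = "rch (chosen ((i, a) # st) i) (rt Rp i)"
  have "(set Z)\<^sup>* `` rt (grown Rp st) i <= rch (chosen st i) (rt Rp i)"
   using inv by (simp only: pinv_def)
  from order_trans[OF this mono] have old: "(set Z)\<^sup>* `` rt (grown Rp st) i <= ?S" .
  have closed: "y : ?S" if "x : ?S" "(x, y) : set Z Un snd ` chosen ((i, a) # st) i" for x y
   using that unfolding rch_def by (blast intro: rtrancl.rtrancl_into_rtrancl)
  have "(tl_of a, hd_of a) : snd ` chosen ((i, a) # st) i" unfolding ch by force
  with old tl have ha: "hd_of a : ?S" using closed by blast
  have "y : ?S" if "x : ?S" "(x, y) : (set Z)\<^sup>*" for x y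
   using that(2,1) by (induction rule: rtrancl_induct) (use closed in blast)+
  then show ?thesis using True ha old by (auto simp: rt_grown)
 qed
 moreover have "inj_on hd_of (chosen ((i, a) # st) j)" for j
  using inv hd1 unfolding ch pinv_def by (auto simp: inj_on_insert)
 moreover have "hd_of ` chosen ((i, a) # st) j Int rt Rp j = {}" for j
  using inv hd1 unfolding ch pinv_def by auto
 ultimately show ?thesis
  using inv i a Cons c unfolding pinv_def pack_step_def by auto
qed (simp add: pack_step_def)

lemma pinv_Nil: "pinv []"
 using rtrancl_mono[of "set Z" "set Z Un snd ` {}"]
 by (auto simp: pinv_def grown_def chosen_def rch_def)

lemma pinv_pack: "pinv (pack k V Z E Rp)"
proof -
 have "pinv []" by (rule pinv_Nil)
 then have "pinv (foldl (%st _. pack_step k V Z E Rp st) [] ys)" for ys :: "'c list"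
  by (induction ys rule: rev_induct) (auto intro: pinv_step)
 then show ?thesis by (simp add: pack_def)
qed

lemma pack_sound:
 assumes "packed k V Z Rp (pack k V Z E Rp)" "i < k"
 shows "set V <= rch (chosen (pack k V Z E Rp) i) (rt Rp i)"
proof -
 have "set V <= (set Z)\<^sup>* `` rt (grown Rp (pack k V Z E Rp)) i"
  using assms set_reached[OF grown_V, of "pack k V Z E Rp"] pinv_pack unfolding packed_def pinv_def by auto
 moreover have "(set Z)\<^sup>* `` rt (grown Rp (pack k V Z E Rp)) i <= rch (chosen (pack k V Z E Rp) i) (rt Rp i)"
  using pinv_pack by (simp only: pinv_def)
 ultimately show ?thesis by (rule order_trans)
qed

lemma pack_complete:
 assumes k: "1 <= k" and Rk: "fst ` set Rp <= {..<k}" and edm: "edm (set E) (rt Rp)"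
 shows "packed k V Z Rp (pack k V Z E Rp)"
proof -
 define good where "good st <-> pinv st & edm (set (unused E st)) (rt (grown Rp st))" for st
 have un: "set (unused E ((i, a) # st)) = set (unused E st) - {a}" for i a st by (auto simp: unused_def)
 have gk: "fst ` set (grown Rp st) <= {..<k}" if "pinv st" for st
  using that Rk by (auto simp: pinv_def grown_def)
 have step: "good (pack_step k V Z E Rp st) & (packed k V Z Rp st & pack_step k V Z E Rp st = st |
   length (pack_step k V Z E Rp st) = Suc (length st))" if g: "good st" for st
 proof -
  have inv: "pinv st" and ed: "edm (set (unused E st)) (rt (grown Rp st))" using g by (auto simp: good_def)
  then have sE: "snd ` set st <= set E" by (simp add: pinv_def)
  note gV = grown_V[OF sE]
  have ct: "cut_test k V Z (unused E ((i, a) # st)) (grown Rp ((i, a) # st)) <->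
    edm (set (unused E st) - {a}) ((rt (grown Rp st))(i := insert (hd_of a) (rt (grown Rp st) i)))"
   if "i < k" "a : set (unused E st)" for i a
  proof -
   have "snd ` set ((i, a) # st) <= set E" using sE that by (auto simp: unused_def)
   from grown_V[OF this] have "snd ` set (grown Rp ((i, a) # st)) <= set V" .
   moreover have "fst ` set (grown Rp ((i, a) # st)) <= {..<k}" using gk[OF inv] that by (auto simp: grown_def)
   moreover have "set (unused E ((i, a) # st)) <= set E" by (auto simp: unused_def)
   ultimately show ?thesis using cut_test_iff[OF k] by (simp only: un rt_grown)
  qed
  show ?thesis
  proof (cases "candidates k V Z E Rp st")
   case Nil
   \<comment> \<open>If some branching were incomplete, \<open>lovasz_step\<close> would yield a
     candidate.\<close>
   have "packed k V Z Rp st"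
   proof (rule ccontr)
    assume "~ packed k V Z Rp st"
    moreover have "packed k V Z Rp st <-> (ALL i : {0..<k}. set V <= (set Z)\<^sup>* `` rt (grown Rp st) i)"
     unfolding packed_def set_reached[OF gV] set_upt subset_eq ..
    ultimately obtain i where i: "i < k" "~ set V <= (set Z)\<^sup>* `` rt (grown Rp st) i"
     by (metis atLeastLessThan_iff)
    have RiV: "rt (grown Rp st) i <= set V" using gV by (force simp: rt_def)
    obtain a where a: "a : set (unused E st)" "tl_of a : (set Z)\<^sup>* `` rt (grown Rp st) i"
     "hd_of a ~: (set Z)\<^sup>* `` rt (grown Rp st) i"
     "edm (set (unused E st) - {a}) ((rt (grown Rp st))(i := insert (hd_of a) (rt (grown Rp st) i)))"
    proof (rule lovasz_step[OF _ _ ed RiV i(1)])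
     show "tl_of b : set V & hd_of b : set V" if "b : set (unused E st)" for b
      using that E_ends[of b] by (simp add: unused_def)
    qed (use i in auto)
    then have "a : set (filter (%a. tl_of a : set (reached V Z (grown Rp st) i) &
      hd_of a ~: set (reached V Z (grown Rp st) i) &
      cut_test k V Z (unused E ((i, a) # st)) (grown Rp ((i, a) # st))) (unused E st))"
     unfolding set_filter mem_Collect_eq set_reached[OF gV] ct[OF i(1) a(1)] by (intro conjI)
    moreover have "i : set [0..<k]" using i by simp
    ultimately have "(i, a) : set (candidates k V Z E Rp st)"
     unfolding candidates_def set_flat set_map by - (rule UN_I, assumption, rule imageI)
    with Nil show False by simp
   qed
   then show ?thesis using g Nil by (simp add: pack_step_def)
  next
   case (Cons c cs)
   obtain i a where c: "c = (i, a)" by (cases c)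
   have "(i, a) : set (candidates k V Z E Rp st)" using Cons c by simp
   then have i: "i < k" and a: "a : set (unused E st)"
    and "cut_test k V Z (unused E ((i, a) # st)) (grown Rp ((i, a) # st))"
    by (auto simp: candidates_def)
   with ct[OF i a] have "edm (set (unused E ((i, a) # st))) (rt (grown Rp ((i, a) # st)))"
    by (simp only: un rt_grown)
   moreover have "pack_step k V Z E Rp st = (i, a) # st" using Cons c by (simp add: pack_step_def)
   ultimately show ?thesis using pinv_step[OF inv] by (simp add: good_def)
  qed
 qed
 have g0: "good []" using edm pinv_Nil by (simp add: good_def unused_def grown_def)
 have main: "good (foldl (%st _. pack_step k V Z E Rp st) [] ys) &
   (packed k V Z Rp (foldl (%st _. pack_step k V Z E Rp st) [] ys) |
   length (foldl (%st _. pack_step k V Z E Rp st) [] ys) = length ys)" for ys :: "'c list"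
 proof (induction ys rule: rev_induct)
  case Nil
  then show ?case using g0 by simp
 next
  case (snoc y ys)
  let ?st = "foldl (%st _. pack_step k V Z E Rp st) [] ys"
  have gst: "good ?st" using snoc by blast
  show ?case
  proof (cases "packed k V Z Rp ?st")
   case True
   have "pack_step k V Z E Rp ?st = ?st"
   proof -
    have sE: "snd ` set ?st <= set E" using gst by (simp add: good_def pinv_def)
    \<comment> \<open>A candidate has its head outside the closure, which is all of \<open>V\<close>
      by now.\<close>
    have "candidates k V Z E Rp ?st = []"
    proof (rule ccontr)
     assume "candidates k V Z E Rp ?st ~= []"
     then obtain c where "c : set (candidates k V Z E Rp ?st)" by (meson list.set_sel(1))
     then have "fst c < k" "hd_of (snd c) ~: set (reached V Z (grown Rp ?st) (fst c))" "snd c : set E"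
      by (auto simp: candidates_def unused_def)
     moreover from this(3) have "hd_of (snd c) : set V"
      using E_ends by blast
     ultimately show False using True unfolding packed_def by auto
    qed
    then show ?thesis by (simp add: pack_step_def)
   qed
   then show ?thesis using gst True by simp
  next
   case False
   then show ?thesis using step[OF gst] snoc by auto
  qed
 qed
 let ?st = "pack k V Z E Rp"
 have g: "good ?st" and d: "packed k V Z Rp ?st | length ?st = length E"
  using main[of E] by (auto simp: pack_def)
 show ?thesis
 proof (rule ccontr)
  assume np: "~ packed k V Z Rp ?st"
  then have l: "length ?st = length E" using d by blast
  \<comment> \<open>As many distinct arcs have been placed as the list has entries, so every arc is
    used and no candidate is left, although something is unreached.\<close>
  have "distinct (map snd ?st)" "set (map snd ?st) <= set E" using g by (auto simp: good_def pinv_def)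
  moreover from this have "card (set (map snd ?st)) = length E"
   using l distinct_card[of "map snd ?st"] by (simp only: length_map)
  ultimately have "set (map snd ?st) = set E"
   by (metis List.finite_set card_length card_mono card_subset_eq le_antisym)
  then have "candidates k V Z E Rp ?st = []" by (auto simp: candidates_def unused_def flat_def filter_False)
  then have "pack_step k V Z E Rp ?st = ?st" by (simp add: pack_step_def)
  with step[OF g] np show False by simp
 qed
qed

end

section \<open>Satisfiability is NP-hard\<close>

type_synonym 'v cnf = "(bool \<times> 'v) list list"

definition csat :: "('v => bool) => (bool \<times> 'v) list => bool" where
 "csat A c <-> (EX l : set c. A (snd l) = fst l)"

definition sat :: "'v cnf => bool" where
 "sat ph <-> (EX A. ALL c : set ph. csat A c)"

definition horn :: "'v list => 'v => (bool \<times> 'v) list" where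
 "horn body h = (True, h) # map (%v. (False, v)) body"

lemma csat_horn [simp]: "csat A (horn body h) <-> ((ALL v : set body. A v) --> A h)"
 by (auto simp: csat_def horn_def)

lemma pt_horn: "pt f ==> pt g ==> pt (%x. horn (f x) (g x))"
 unfolding horn_def by (intro pt_Cons pt_map pt_Pair pt_const pt_snd pt_id)

type_synonym var = "nat * nat * nat * nat * nat"

text \<open>The letters stand for the state, the head being at a position or not, the content of a
  cell, the scanned symbol, the written symbol and the direction of the move, always at time
  \<open>t\<close>. The absence of the head is a variable of its own, so that the rules of the
  tableau are implications with positive premises.\<close>

abbreviation "vQ t q == (0, t, q, 0, 0) :: var"
abbreviation "vH t j p == (1, t, j, p, 0) :: var"
abbreviation "vN t j p == (2, t, j, p, 0) :: var"
abbreviation "vC t j p a == (3, t, j, p, a) :: var"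
abbreviation "vS t j a == (4, t, j, a, 0) :: var"
abbreviation "vW t j b == (5, t, j, b, 0) :: var"
abbreviation "vD t j m == (6, t, j, m, 0) :: var"

fun mcode :: "move => nat" where "mcode Go_Left = 0" | "mcode Go_Stay = 1" | "mcode Go_Right = 2"

lemma offset_mcode: "offset m = int (mcode m) - 1" by (cases m) auto

locale machine =
 fixes M :: tm
 assumes tm: "turing_machine M"
begin

abbreviation "N == num_tapes M"
abbreviation "K == num_syms M"

text \<open>Halting is treated as a step that changes nothing, so every time step of the tableau
  obeys the same table.\<close>

definition dl :: "nat => nat list => nat * (nat \<times> move) list" where
 "dl q as = (if q = 1 then (1, stay as) else delta M q as)"

lemma step_dl: "step M (q, ts) = (fst (dl q (reads ts)), map2 act (snd (dl q (reads ts))) ts)"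
 by (cases "q = 1") (simp_all add: dl_def act_stay, simp add: reads_def split: prod.split)

text \<open>The machine is fixed, so the whole table is a constant of the reduction. Symbols, and
  pairs of written symbol and move, are numbered by their tapes.\<close>

definition transitions :: "(nat * (nat * nat) list \<times> nat * (nat * nat * nat) list) list" where
 "transitions = flat [0..<num_states M] (%q. map (%as. (q, List.enumerate 0 as, fst (dl q as),
   List.enumerate 0 (map (%bm. (fst bm, mcode (snd bm))) (snd (dl q as))))) (List.n_lists N [0..<K]))"

text \<open>The local rules that do not depend on the transition table: reading, writing, inertia of
  the cells away from the head, and displacement of the head by \<open>m - 1\<close>.\<close>

definition clauses1 :: "nat list => nat list => var cnf" where
 "clauses1 Ts Ps = flat Ts (%t. flat [0..<N] (%j. flat Ps (%p.
   flat [0..<K] (%a. [horn [vH t j p, vC t j p a] (vS t j a),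
    horn [vH t j p, vW t j a] (vC (Suc t) j p a), horn [vN t j p, vC t j p a] (vC (Suc t) j p a)])
   @ flat [0,1,2] (%m. flat Ps (%p'. [horn [vH t j p, vD t j m]
     (if m = 0 & p = Suc p' | m = 1 & p = p' | m = 2 & p' = Suc p
     then vH (Suc t) j p' else vN (Suc t) j p')])))))"

definition clauses2 :: "nat list => var cnf" where
 "clauses2 Ts = flat Ts (%t. flat transitions (%r.
   let body = vQ t (fst r) # map (%u. vS t (fst u) (snd u)) (fst (snd r)) in
    horn body (vQ (Suc t) (fst (snd (snd r)))) #
    flat (snd (snd (snd r))) (%u. [horn body (vW t (fst u) (fst (snd u))), horn body (vD t (fst u) (snd (snd u)))])))"

text \<open>Position \<open>p\<close> of a tape is represented by the number \<open>p + B\<close>. The cells \<open>p\<close> with \<open>u <= p < v\<close>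
 hold the certificate.\<close>

definition clauses3 :: "nat list => nat => (nat \<times> bool) list => nat => nat => nat => var cnf" where
 "clauses3 Ps B w u v T = [horn [] (vQ 0 0), [(False, vC T 0 B 1)]]
  @ flat [0..<N] (%j. flat Ps (%p. [horn [] (if p = B then vH 0 j p else vN 0 j p)]
    @ (if j ~= 0 | p < B | v <= p then [horn [] (vC 0 j p 0)] else [])))
  @ flat w (%c. [horn [] (vC 0 0 (fst c) (if snd c then 2 else 1))])
  @ flat Ps (%p. if u <= p & p < v then [[(True, vC 0 0 p 0), (True, vC 0 0 p 1), (True, vC 0 0 p 2)],
    horn [vC 0 0 p 0] (vC 0 0 (Suc p) 0)] else [])"

section \<open>The run of the machine as a valuation of the variables\<close>

definition cfg :: "bool list => nat => config" where "cfg z t = (step M ^^ t) (init M z)"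

abbreviation "st z t == fst (cfg z t)"
abbreviation "tp z t == snd (cfg z t)"

lemma cfg_Suc: "cfg z (Suc t) = step M (cfg z t)" by (simp add: cfg_def)

lemma N_pos: "0 < N" "3 <= K" "2 <= num_states M" using tm by (auto simp: turing_machine_def)

lemma dl_wf:
 assumes "q < num_states M" "length as = N" "ALL a : set as. a < K"
 shows "fst (dl q as) < num_states M" "length (snd (dl q as)) = N"
  "ALL bm : set (snd (dl q as)). fst bm < K"
proof -
 obtain q' bs where d: "delta M q as = (q', bs)" by fastforce
 have as: "length as = num_tapes M & (ALL a : set as. a < num_syms M)" using assms by simp
 have "q' < num_states M & length bs = N & (ALL (b, m) : set bs. b < K)"
  using tm[unfolded turing_machine_def, THEN conjunct2, THEN conjunct2, THEN conjunct2, rule_format,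
   OF assms(1) as] unfolding d prod.case .
 then have "fst (dl q as) < num_states M & length (snd (dl q as)) = N &
   (ALL bm : set (snd (dl q as)). fst bm < K)"
  using assms(2,3) N_pos by (cases "q = 1") (auto simp: dl_def stay_def d)
 then show "fst (dl q as) < num_states M" "length (snd (dl q as)) = N"
  "ALL bm : set (snd (dl q as)). fst bm < K"
  by blast+
qed

lemma cfg_wf: "st z t < num_states M & length (tp z t) = N & (ALL tt : set (tp z t). ALL i. fst tt i < K)"
proof (induction t)
 case 0
 then show ?case using N_pos by (auto simp: cfg_def init_def word_tape_def)
next
 case (Suc t)
 let ?as = "reads (tp z t)"
 have as: "length ?as = N" "ALL a : set ?as. a < K" using Suc by (auto simp: reads_def)
 note d = dl_wf[OF _ as, of "st z t"]
 have c: "cfg z (Suc t) = (fst (dl (st z t) ?as), map2 act (snd (dl (st z t) ?as)) (tp z t))"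
  using step_dl[of "st z t" "tp z t"] by (simp add: cfg_Suc)
 have "fst tt i < K" if tt: "tt : set (map2 act (snd (dl (st z t) ?as)) (tp z t))" for tt i
 proof -
  from tt obtain bm f p where "(bm, (f, p)) : set (zip (snd (dl (st z t) ?as)) (tp z t))" "tt = act bm (f, p)"
   by auto
  then have "bm : set (snd (dl (st z t) ?as))" "(f, p) : set (tp z t)"
   by (auto dest: set_zip_leftD set_zip_rightD)
  then have "fst bm < K" "!!i. f i < K" using d Suc by fastforce+
  then show ?thesis using \<open>tt = act bm (f, p)\<close> by (cases bm) auto
 qed
 then show ?case using d Suc by (simp add: c)
qed

definition bms :: "bool list => nat => (nat \<times> move) list" where
 "bms z t = snd (dl (st z t) (reads (tp z t)))"

lemma cfg_tape:
 assumes "j < N"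
 shows "tp z (Suc t) ! j = act (bms z t ! j) (tp z t ! j)"
proof -
 let ?as = "reads (tp z t)"
 have as: "length ?as = N" "ALL a : set ?as. a < K" using cfg_wf[of z t] by (auto simp: reads_def)
 have "length (bms z t) = N" unfolding bms_def by (rule dl_wf(2)) (use as cfg_wf[of z t] in auto)
 moreover have "tp z (Suc t) = map2 act (bms z t) (tp z t)"
  using step_dl[of "st z t" "tp z t"] by (simp add: cfg_Suc bms_def)
 ultimately show ?thesis using assms cfg_wf[of z t] by simp
qed

lemma bms_wf: "length (bms z t) = N" "j < N ==> fst (bms z t ! j) < K"
proof -
 let ?as = "reads (tp z t)"
 have as: "length ?as = N" "ALL a : set ?as. a < K" using cfg_wf[of z t] by (auto simp: reads_def)
 note d = dl_wf[OF _ as, of "st z t"]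
 show l: "length (bms z t) = N" unfolding bms_def using d cfg_wf[of z t] by auto
 show "j < N ==> fst (bms z t ! j) < K" using d cfg_wf[of z t] l unfolding bms_def by (metis nth_mem)
qed

lemma st_Suc: "st z (Suc t) = fst (dl (st z t) (reads (tp z t)))"
 using step_dl[of "st z t" "tp z t"] by (simp add: cfg_Suc)

abbreviation "hd_at z t j == snd (tp z t ! j)"
abbreviation "cell z t j == fst (tp z t ! j)"

lemma hd_Suc: "j < N ==> hd_at z (Suc t) j = hd_at z t j + offset (snd (bms z t ! j))"
 by (cases "bms z t ! j"; cases "tp z t ! j") (simp add: cfg_tape)

lemma cell_Suc: "j < N ==> cell z (Suc t) j = (cell z t j)(hd_at z t j := fst (bms z t ! j))"
 by (cases "bms z t ! j"; cases "tp z t ! j") (simp add: cfg_tape)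

lemma init_tape: "j < N ==> tp z 0 ! j = (if j = 0 then (word_tape z, 0) else (%_. 0, 0))"
 by (cases j) (auto simp: cfg_def init_def)

lemma hd_bound: "j < N ==> \<bar>hd_at z t j\<bar> <= int t"
proof (induction t)
 case 0
 then show ?case by (simp add: init_tape)
next
 case (Suc t)
 have "\<bar>offset (snd (bms z t ! j))\<bar> <= 1" by (cases "snd (bms z t ! j)") auto
 with Suc show ?case by (simp add: hd_Suc)
qed


text \<open>The intended valuation, read off the run on input \<open>z\<close>. The shift by
  \<open>B\<close> lets natural numbers name cells on both sides of the origin.\<close>

fun holds :: "nat => bool list => var => bool" where
 "holds B z (k, t, a, b, c) <->
   (k = 0 & st z t = a) |
   (k = 1 & a < N & hd_at z t a + int B = int b) |
   (k = 2 & a < N & hd_at z t a + int B ~= int b) |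
   (k = 3 & a < N & cell z t a (int b - int B) = c) |
   (k = 4 & a < N & cell z t a (hd_at z t a) = b) |
   (k = 5 & a < N & fst (bms z t ! a) = b) |
   (k = 6 & a < N & mcode (snd (bms z t ! a)) = b)"

definition tableau :: "nat list => nat list => nat => (nat \<times> bool) list => nat => nat => nat => var cnf" where
 "tableau Ts Ps B w u v T = clauses1 Ts Ps @ clauses2 Ts @ clauses3 Ps B w u v T"

lemma set_transitions: "r : set transitions <-> (EX q as. q < num_states M & length as = N &
  set as <= {..<K} & r = (q, List.enumerate 0 as, fst (dl q as),
   List.enumerate 0 (map (%bm. (fst bm, mcode (snd bm))) (snd (dl q as)))))"
 by (auto simp: transitions_def set_n_lists lessThan_atLeast0)

lemma clauses1_memI:
 assumes "t : set Ts" "j < N" "p : set Ps"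
 shows "a < K ==> horn [vH t j p, vC t j p a] (vS t j a) : set (clauses1 Ts Ps)"
  "a < K ==> horn [vH t j p, vW t j a] (vC (Suc t) j p a) : set (clauses1 Ts Ps)"
  "a < K ==> horn [vN t j p, vC t j p a] (vC (Suc t) j p a) : set (clauses1 Ts Ps)"
 unfolding clauses1_def set_flat set_append
 by (rule UN_I[of t], rule assms, rule UN_I[of j], simp add: assms, rule UN_I[of p], rule assms,
   rule UnI1, rule UN_I[of a], simp, simp only: list.set insert_iff simp_thms)+

lemma clauses1_memI':
 assumes "t : set Ts" "j < N" "p : set Ps" "m : {0, 1, 2}" "p' : set Ps"
 shows "horn [vH t j p, vD t j m]
    (if m = 0 & p = Suc p' | m = 1 & p = p' | m = 2 & p' = Suc p
     then vH (Suc t) j p' else vN (Suc t) j p') : set (clauses1 Ts Ps)"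
 unfolding clauses1_def set_flat set_append
 by (rule UN_I[of t], rule assms, rule UN_I[of j], simp add: assms, rule UN_I[of p], rule assms,
   rule UnI2, rule UN_I[of m], use assms in simp, rule UN_I[of p'], rule assms, rule list.set_intros(1))

lemma clauses1_holds: "c : set (clauses1 Ts Ps) ==> csat (holds B z) c"
proof -
 have pos: "hd_at z t j + int B = int p <-> int p - int B = hd_at z t j" for t j p by linarith
 have 1: "csat (holds B z) (horn [vH t j p, vC t j p a] (vS t j a))" for t j p a
  by (auto simp: pos)
 have 2: "csat (holds B z) (horn [vH t j p, vW t j a] (vC (Suc t) j p a))" for t j p a
  by (auto simp: pos cell_Suc)
 have 3: "csat (holds B z) (horn [vN t j p, vC t j p a] (vC (Suc t) j p a))" for t j p a
  by (auto simp: pos cell_Suc)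
 have 4: "csat (holds B z) (horn [vH t j p, vD t j m] (if m = 0 & p = Suc p' | m = 1 & p = p' | m = 2 & p' = Suc p
     then vH (Suc t) j p' else vN (Suc t) j p'))" for t j p p' m
 proof (unfold csat_horn, intro impI)
  assume "ALL v : set [vH t j p, vD t j m]. holds B z v"
  then have j: "j < N" and h: "hd_at z t j + int B = int p" and m: "mcode (snd (bms z t ! j)) = m" by auto
  have "hd_at z (Suc t) j + int B = int p + int m - 1" using h m by (simp add: hd_Suc[OF j] offset_mcode)
  moreover have "m : {0, 1, 2}" using m by (cases "snd (bms z t ! j)") auto
  ultimately show "holds B z (if m = 0 & p = Suc p' | m = 1 & p = p' | m = 2 & p' = Suc p
     then vH (Suc t) j p' else vN (Suc t) j p')" using j by (cases "m = 0"; cases "m = 1") auto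
 qed
 show "c : set (clauses1 Ts Ps) ==> csat (holds B z) c"
  unfolding clauses1_def set_flat set_append UN_iff Un_iff list.set(1,2)
  by (elim bexE disjE insertE emptyE) (simp_all only: 1 2 3 4)
qed

lemma clauses2_holds: "c : set (clauses2 Ts) ==> csat (holds B z) c"
proof -
 assume "c : set (clauses2 Ts)"
 then obtain t r where r: "r : set transitions" and
  c: "c : set (let body = vQ t (fst r) # map (%u. vS t (fst u) (snd u)) (fst (snd r)) in
    horn body (vQ (Suc t) (fst (snd (snd r)))) #
    flat (snd (snd (snd r))) (%u. [horn body (vW t (fst u) (fst (snd u))), horn body (vD t (fst u) (snd (snd u)))]))"
  unfolding clauses2_def set_flat by blast
 from r obtain q as where 1: "length as = N" and r: "r = (q, List.enumerate 0 as, fst (dl q as),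
   List.enumerate 0 (map (%bm. (fst bm, mcode (snd bm))) (snd (dl q as))))"
  unfolding set_transitions by blast
 from c have
  c: "let body = vQ t q # map (%u. vS t (fst u) (snd u)) (List.enumerate 0 as) in
    c = horn body (vQ (Suc t) (fst (dl q as))) |
    (EX u : set (List.enumerate 0 (map (%bm. (fst bm, mcode (snd bm))) (snd (dl q as)))).
     c = horn body (vW t (fst u) (fst (snd u))) | c = horn body (vD t (fst u) (snd (snd u))))"
  unfolding r by (auto simp: Let_def)
 define body where "body = vQ t q # map (%u. vS t (fst u) (snd u)) (List.enumerate 0 as)"
 \<comment> \<open>A row whose premises hold is the one that the run itself uses at time
   \<open>t\<close>, so its writes and moves are those in \<open>bms z t\<close>; for all other rows
   the clauses hold vacuously.\<close>
 have q: "st z t = q & reads (tp z t) = as" if b: "ALL v : set body. holds B z v"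
 proof
  show "st z t = q" using b by (simp add: body_def)
  show "reads (tp z t) = as"
  proof (rule nth_equalityI)
   show "length (reads (tp z t)) = length as" using 1 cfg_wf[of z t] by simp
   fix i assume "i < length (reads (tp z t))"
   then have i: "i < N" using cfg_wf[of z t] by simp
   then have "(i, as ! i) : set (List.enumerate 0 as)" using 1 by (simp add: in_set_enumerate_eq)
   then have "holds B z (vS t i (as ! i))" using b unfolding body_def by force
   then show "reads (tp z t) ! i = as ! i" using i cfg_wf[of z t] by (simp add: reads_def split_beta)
  qed
 qed
 from c consider "c = horn body (vQ (Suc t) (fst (dl q as)))"
  | u where "u : set (List.enumerate 0 (map (%bm. (fst bm, mcode (snd bm))) (snd (dl q as))))"
    "c = horn body (vW t (fst u) (fst (snd u))) | c = horn body (vD t (fst u) (snd (snd u)))"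
  unfolding Let_def body_def by blast
 then show "csat (holds B z) c"
 proof cases
  case 1
  then show ?thesis using q by (auto simp: st_Suc)
 next
  case 2
  show ?thesis
  proof (cases "ALL v : set body. holds B z v")
   case True
   from q[OF True] have "snd (dl q as) = bms z t" by (auto simp: bms_def)
   then have "fst u < N" and u: "snd u = (fst (bms z t ! fst u), mcode (snd (bms z t ! fst u)))"
    using 2(1) bms_wf(1)[of z t] by (auto simp: in_set_enumerate_eq)
   then have "fst (snd u) = fst (bms z t ! fst u)" "snd (snd u) = mcode (snd (bms z t ! fst u))"
    by (simp_all add: u)
   then show ?thesis using 2(2) \<open>fst u < N\<close> by auto
  next
   case False
   then have "csat (holds B z) (horn body h)" for h unfolding csat_horn by blast
   then show ?thesis using 2(2) by metis
  qed
 qed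
qed

context
 fixes A :: "var => bool" and B T :: nat and z :: "bool list"
 assumes sat1: "!!c. c : set (clauses1 [0..<T] [0..<Suc (2 * B)]) ==> csat A c"
  and sat2: "!!c. c : set (clauses2 [0..<T]) ==> csat A c"
  and TB: "T < B"
  and Q0: "A (vQ 0 0)"
  and H0: "!!j p. j < N ==> p <= 2 * B ==> A (if p = B then vH 0 j p else vN 0 j p)"
  and C0: "!!j p. j < N ==> p <= 2 * B ==> A (vC 0 j p (cell z 0 j (int p - int B)))"
begin

text \<open>Unit propagation along time: every fact about the run is derived, by the rules, from the
  facts about the initial configuration. A satisfying valuation may make further variables true,
  which does no harm because the premises of the rules are positive.\<close>

lemma forced:
 "t <= T ==> A (vQ t (st z t)) & (ALL j p. j < N --> p <= 2 * B -->
   A (if int p = hd_at z t j + int B then vH t j p else vN t j p) &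
   A (vC t j p (cell z t j (int p - int B))))"
proof (induction t)
 case 0
 have "int p = hd_at z 0 j + int B <-> p = B" if "j < N" for j p using that by (simp add: init_tape)
 moreover have "st z 0 = 0" by (simp add: cfg_def init_def)
 ultimately show ?case using Q0 H0 C0 by simp
next
 case (Suc t)
 then have t: "t < T" by simp
 from Suc have Q: "A (vQ t (st z t))"
  and HN: "!!j p. j < N ==> p <= 2 * B ==> A (if int p = hd_at z t j + int B then vH t j p else vN t j p)"
  and C: "!!j p. j < N ==> p <= 2 * B ==> A (vC t j p (cell z t j (int p - int B)))" by auto
 define pos where "pos j = nat (hd_at z t j + int B)" for j
 \<comment> \<open>A head moves at most one cell per step and \<open>T < B\<close>, so it stays
   strictly inside the window of cells \<open>0, ..., 2 * B\<close>.\<close>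
 have pos: "int (pos j) = hd_at z t j + int B" "0 < pos j" "pos j < 2 * B" if "j < N" for j
  using hd_bound[OF that, of z t] t TB by (auto simp: pos_def)
 have H: "A (vH t j (pos j))" if "j < N" for j using HN[of j "pos j"] pos[OF that] that by simp
 have cl: "cell z t j i < K" if "j < N" for j i using cfg_wf[of z t] that by (metis nth_mem)
 have S: "A (vS t j (cell z t j (hd_at z t j)))" if j: "j < N" for j
 proof -
  have "horn [vH t j (pos j), vC t j (pos j) (cell z t j (hd_at z t j))] (vS t j (cell z t j (hd_at z t j)))
   : set (clauses1 [0..<T] [0..<Suc (2 * B)])"
   by (rule clauses1_memI(1)) (use t j pos[OF j] cl[OF j] in auto)
  from sat1[OF this] show ?thesis using H[OF j] C[OF j, of "pos j"] pos[OF j] by simp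
 qed
 let ?as = "reads (tp z t)"
 have as: "length ?as = N" "set ?as <= {..<K}" using cfg_wf[of z t] by (auto simp: reads_def)
 define body where "body = vQ t (st z t) # map (%u. vS t (fst u) (snd u)) (List.enumerate 0 ?as)"
 have body: "ALL v : set body. A v"
  using Q S as cfg_wf[of z t] by (auto simp: body_def in_set_enumerate_eq reads_def split_beta)
 let ?r = "(st z t, List.enumerate 0 ?as, fst (dl (st z t) ?as), List.enumerate 0 (map (%bm. (fst bm, mcode (snd bm))) (bms z t)))"
 have r: "?r : set transitions" unfolding set_transitions bms_def using as cfg_wf[of z t] by blast
 have sub: "set (horn body (vQ (Suc t) (st z (Suc t))) # flat (List.enumerate 0 (map (%bm. (fst bm, mcode (snd bm))) (bms z t)))
   (%u. [horn body (vW t (fst u) (fst (snd u))), horn body (vD t (fst u) (snd (snd u)))])) <= set (clauses2 [0..<T])"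
 proof -
  have "t : set [0..<T]" using t by simp
  then show ?thesis unfolding clauses2_def set_flat[of "[0..<T]"] set_flat[of transitions]
   using r unfolding body_def st_Suc Let_def by fastforce
 qed
 have Q': "A (vQ (Suc t) (st z (Suc t)))"
  using sat2[of "horn body (vQ (Suc t) (st z (Suc t)))"] sub body by auto
 have WD: "A (vW t j (fst (bms z t ! j))) & A (vD t j (mcode (snd (bms z t ! j))))" if j: "j < N" for j
 proof -
  have "(j, fst (bms z t ! j), mcode (snd (bms z t ! j))) : set (List.enumerate 0 (map (%bm. (fst bm, mcode (snd bm))) (bms z t)))"
   using j bms_wf(1)[of z t] by (simp add: in_set_enumerate_eq)
  then have "horn body (vW t j (fst (bms z t ! j))) : set (clauses2 [0..<T])"
   "horn body (vD t j (mcode (snd (bms z t ! j)))) : set (clauses2 [0..<T])"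
   using sub by force+
  from this[THEN sat2] show ?thesis using body by simp
 qed
 show ?case
 proof (intro conjI allI impI)
  show "A (vQ (Suc t) (st z (Suc t)))" by (rule Q')
  fix j p assume j: "j < N" and p: "p <= 2 * B"
  let ?m = "mcode (snd (bms z t ! j))"
  have m: "?m : {0, 1, 2}" by (cases "snd (bms z t ! j)") auto
  let ?h = "if ?m = 0 & pos j = Suc p | ?m = 1 & pos j = p | ?m = 2 & p = Suc (pos j)
     then vH (Suc t) j p else vN (Suc t) j p"
  have "horn [vH t j (pos j), vD t j ?m] ?h : set (clauses1 [0..<T] [0..<Suc (2 * B)])"
   by (rule clauses1_memI'[OF _ j _ m]) (use t p pos(3)[OF j] in auto)
  from sat1[OF this] have "A ?h" using H[OF j] WD[OF j] by simp
  moreover have "(?m = 0 & pos j = Suc p | ?m = 1 & pos j = p | ?m = 2 & p = Suc (pos j)) <->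
    int p = hd_at z (Suc t) j + int B"
   using m pos[OF j] by (auto simp: hd_Suc[OF j] offset_mcode)
  ultimately show "A (if int p = hd_at z (Suc t) j + int B then vH (Suc t) j p else vN (Suc t) j p)"
   by simp
  show "A (vC (Suc t) j p (cell z (Suc t) j (int p - int B)))"
  proof (cases "p = pos j")
   case True
   let ?b = "fst (bms z t ! j)"
   have "horn [vH t j p, vW t j ?b] (vC (Suc t) j p ?b) : set (clauses1 [0..<T] [0..<Suc (2 * B)])"
    by (rule clauses1_memI(2)) (use t j p bms_wf(2)[OF j, of z t] in auto)
   from sat1[OF this] show ?thesis
    using H[OF j] WD[OF j] True pos[OF j] by (simp add: cell_Suc[OF j])
  next
   case False
   let ?a = "cell z t j (int p - int B)"
   have ne: "int p ~= hd_at z t j + int B" using False pos[OF j] by linarith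
   have "horn [vN t j p, vC t j p ?a] (vC (Suc t) j p ?a) : set (clauses1 [0..<T] [0..<Suc (2 * B)])"
    by (rule clauses1_memI(3)) (use t j p cl[OF j] in auto)
   from sat1[OF this] show ?thesis
    using HN[OF j p] C[OF j p] ne by (simp add: cell_Suc[OF j])
  qed
 qed
qed

end

text \<open>The symbol 1 codes the bit \<open>False\<close>, so the last condition says that the
  machine does not reject. From a satisfying valuation only the certificate cells are read off; the
  rest of the run is then forced.\<close>

lemma tableau_sat_iff:
 assumes TB: "T < B" and mB: "m <= B" and wm: "length w <= m"
 shows "sat (tableau [0..<T] [0..<Suc (2 * B)] B (List.enumerate B w) (B + length w) (B + m) T) <->
  (EX y. length w + length y <= m & cell (w @ y) T 0 0 ~= 1)" (is "?L <-> ?R")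
proof
 assume ?R
 then obtain y where y: "length w + length y <= m" "cell (w @ y) T 0 0 ~= 1" by blast
 let ?z = "w @ y"
 have N0: "0 < N" by (rule N_pos)
 have wt: "word_tape ?z (int p - int B) = (if B <= p & p < B + length ?z then (if ?z ! (p - B) then 2 else 1) else 0)" for p
  by (auto simp: word_tape_def nat_diff_distrib' simp flip: of_nat_diff)
 have "csat (holds B ?z) c" if "c : set (clauses3 [0..<Suc (2 * B)] B (List.enumerate B w) (B + length w) (B + m) T)" for c
 proof -
  have 1: "csat (holds B ?z) (horn [] (vQ 0 0))" by (simp add: cfg_def init_def)
  have 2: "csat (holds B ?z) [(False, vC T 0 B 1)]" using y N0 by (simp add: csat_def)
  have 3: "csat (holds B ?z) (horn [] (if p = B then vH 0 j p else vN 0 j p))" if "j < N" for j p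
   using that by (auto simp: init_tape)
  have 4: "csat (holds B ?z) (horn [] (vC 0 j p 0))" if "j < N" "j ~= 0 | p < B | B + m <= p" for j p
   using that y(1) N0 by (cases "j = 0") (auto simp: init_tape wt)
  have 5: "csat (holds B ?z) (horn [] (vC 0 0 (fst c) (if snd c then 2 else 1)))" if "c : set (List.enumerate B w)" for c
  proof -
   obtain p b where pb: "c = (p, b)" by (cases c)
   with that have "B <= p" "p < B + length w" "b = w ! (p - B)" by (auto simp: in_set_enumerate_eq)
   moreover from this have "p - B < length w" by linarith
   ultimately show ?thesis using N0 by (simp add: pb init_tape wt nth_append)
  qed
  have 6: "csat (holds B ?z) [(True, vC 0 0 p 0), (True, vC 0 0 p 1), (True, vC 0 0 p 2)]" for p
   using N0 by (auto simp: csat_def init_tape wt)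
  have 7: "csat (holds B ?z) (horn [vC 0 0 p 0] (vC 0 0 (Suc p) 0))" if "B + length w <= p" for p
   using that N0 by (auto simp: init_tape wt simp del: of_nat_Suc split: if_splits)
  have s1: "d = X" if "d : set [X]" for d X :: "(bool \<times> var) list" using that by simp
  have s2: "d = X | d = Y" if "d : set [X, Y]" for d X Y :: "(bool \<times> var) list" using that by simp
  have s3: "P & d : set xs" if "d : set (if P then xs else [])" for d P and xs :: "var cnf"
   using that by (simp split: if_splits)
  from that show ?thesis unfolding clauses3_def set_append set_flat
  proof (elim UnE UN_E)
   assume "c : set [horn [] (vQ 0 0), [(False, vC T 0 B 1)]]"
   from s2[OF this] 1 2 show ?thesis by (elim disjE) (simp_all only:)
  next
   fix j p assume "j : set [0..<N]" and c: "c : set [horn [] (if p = B then vH 0 j p else vN 0 j p)]"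
   then have "j < N" by simp
   then show ?thesis unfolding s1[OF c] by (rule 3)
  next
   fix j p assume "j : set [0..<N]"
    and c: "c : set (if j ~= 0 | p < B | B + m <= p then [horn [] (vC 0 j p 0)] else [])"
   then have "j < N" by simp
   then show ?thesis unfolding s1[OF s3[OF c, THEN conjunct2]] using s3[OF c, THEN conjunct1] by (rule 4)
  next
   fix d assume d: "d : set (List.enumerate B w)" and c: "c : set [horn [] (vC 0 0 (fst d) (if snd d then 2 else 1))]"
   show ?thesis unfolding s1[OF c] by (rule 5[OF d])
  next
   fix p assume c: "c : set (if B + length w <= p & p < B + m
     then [[(True, vC 0 0 p 0), (True, vC 0 0 p 1), (True, vC 0 0 p 2)],
      horn [vC 0 0 p 0] (vC 0 0 (Suc p) 0)] else [])"
   from s2[OF s3[OF c, THEN conjunct2]] 6[of p] 7[OF s3[OF c, THEN conjunct1, THEN conjunct1]]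
   show ?thesis by (elim disjE) (simp_all only:)
  qed
 qed
 then show ?L unfolding sat_def tableau_def
  using clauses1_holds clauses2_holds by (intro exI[of _ "holds B ?z"]) auto
next
 assume ?L
 then obtain A where A: "!!c. c : set (tableau [0..<T] [0..<Suc (2 * B)] B (List.enumerate B w) (B + length w) (B + m) T) ==> csat A c"
  unfolding sat_def by blast
 have A3: "csat A c" if "c : set (clauses3 [0..<Suc (2 * B)] B (List.enumerate B w) (B + length w) (B + m) T)" for c
  using A[of c] that by (simp add: tableau_def)
 note A3' = A3[unfolded clauses3_def, simplified]
 have N0: "0 < N" by (rule N_pos)
 have Q0: "A (vQ 0 0)" using A3[of "horn [] (vQ 0 0)"] by (simp add: clauses3_def)
 have fin: "~ A (vC T 0 B 1)" using A3[of "[(False, vC T 0 B 1)]"] by (simp add: clauses3_def csat_def)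
 have pI: "p : set [0..<Suc (2 * B)]" if "p <= 2 * B" for p using that by auto
 have H0: "A (if p = B then vH 0 j p else vN 0 j p)" if "j < N" "p <= 2 * B" for j p
 proof -
  have "horn [] (if p = B then vH 0 j p else vN 0 j p) : set (clauses3 [0..<Suc (2 * B)] B (List.enumerate B w) (B + length w) (B + m) T)"
   unfolding clauses3_def set_append set_flat
   by (rule UnI2, rule UnI1, rule UN_I[of j], use that in simp, rule UN_I[of p], rule pI, rule that(2), rule UnI1, rule list.set_intros(1))
  from A3[OF this] show ?thesis by simp
 qed
 have Z0: "A (vC 0 j p 0)" if "j < N" "p <= 2 * B" "j ~= 0 | p < B | B + m <= p" for j p
 proof -
  have "horn [] (vC 0 j p 0) : set (clauses3 [0..<Suc (2 * B)] B (List.enumerate B w) (B + length w) (B + m) T)"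
   unfolding clauses3_def set_append set_flat
   by (rule UnI2, rule UnI1, rule UN_I[of j], use that in simp, rule UN_I[of p], rule pI, rule that(2), rule UnI2)
    (use that(3) in simp)
  from A3[OF this] show ?thesis by simp
 qed
 have W0: "A (vC 0 0 (B + i) (if w ! i then 2 else 1))" if "i < length w" for i
 proof -
  have "(B + i, w ! i) : set (List.enumerate B w)" using that by (simp add: in_set_enumerate_eq)
  then have "horn [] (vC 0 0 (B + i) (if w ! i then 2 else 1)) : set (clauses3 [0..<Suc (2 * B)] B (List.enumerate B w) (B + length w) (B + m) T)"
   unfolding clauses3_def set_append set_flat
   by - (rule UnI2, rule UnI2, rule UnI1, rule UN_I[of "(B + i, w ! i)"], simp_all)
  from A3[OF this] show ?thesis by simp
 qed
 have Y: "(A (vC 0 0 (B + i) 0) | A (vC 0 0 (B + i) 1) | A (vC 0 0 (B + i) 2)) &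
   (A (vC 0 0 (B + i) 0) --> A (vC 0 0 (Suc (B + i)) 0))" if "length w <= i" "i < m" for i
 proof -
  have "B + i : set [0..<Suc (2 * B)]" using that mB by (intro pI) simp
  then have "{[(True, vC 0 0 (B + i) 0), (True, vC 0 0 (B + i) 1), (True, vC 0 0 (B + i) 2)],
    horn [vC 0 0 (B + i) 0] (vC 0 0 (Suc (B + i)) 0)} <= set (clauses3 [0..<Suc (2 * B)] B (List.enumerate B w) (B + length w) (B + m) T)"
   unfolding clauses3_def set_append set_flat
   by (intro le_supI2 order_trans[OF _ UN_upper[of "B + i"]]) (use that in simp_all)
  then have "csat A [(True, vC 0 0 (B + i) 0), (True, vC 0 0 (B + i) 1), (True, vC 0 0 (B + i) 2)]"
   "csat A (horn [vC 0 0 (B + i) 0] (vC 0 0 (Suc (B + i)) 0))" using A3 by blast+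
  then show ?thesis unfolding csat_horn by (simp add: csat_def)
 qed
 \<comment> \<open>The certificate ends at the first cell behind \<open>w\<close> that may be blank,
   or at the bound \<open>m\<close>. The clauses that propagate blanks to the right make all later
   cells blank as well.\<close>
 define R where "R i <-> length w <= i & (m <= i | A (vC 0 0 (B + i) 0))" for i
 define k where "k = (LEAST i. R i)"
 have Rm: "R m" using wm by (simp add: R_def)
 have k: "R k" "k <= m" using LeastI[of R m] Least_le[of R m] Rm by (auto simp: k_def)
 have below: "~ R i" if "i < k" for i using not_less_Least that unfolding k_def by blast
 have above: "A (vC 0 0 (B + i) 0)" if "k <= i" "i < m" for i
  using that
 proof (induction i rule: dec_induct)
  case base
  then show ?case using k by (simp add: R_def)
 next
  case (step i)
  then show ?case using Y[of i] k by (simp add: R_def)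
 qed
 \<comment> \<open>No clause forbids that a cell carries several symbols. Below \<open>k\<close> a
   cell is not blank, so it carries 2 or else 1, and the chosen symbol is among the ones that are
   true.\<close>
 define y where "y = map (%i. A (vC 0 0 (B + i) 2)) [length w..<k]"
 have lw: "length w <= k" using k by (simp add: R_def)
 let ?z = "w @ y"
 have lz: "length ?z = k" using lw by (simp add: y_def)
 have C0: "A (vC 0 j p (cell ?z 0 j (int p - int B)))" if j: "j < N" and p: "p <= 2 * B" for j p
 proof (cases "j ~= 0 | p < B | B + m <= p")
  case True
  have "cell ?z 0 j (int p - int B) = 0" using True j lz k(2) by (auto simp: init_tape word_tape_def)
  with Z0[OF j p True] show ?thesis by simp
 next
  case False
  define i where "i = p - B"
  have i: "p = B + i" "i < m" "j = 0" using False by (auto simp: i_def)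
  have c: "cell ?z 0 j (int p - int B) = (if i < k then if ?z ! i then 2 else 1 else 0)"
   using i lz N0 by (simp add: init_tape word_tape_def)
  consider "i < length w" | "length w <= i" "i < k" | "k <= i" using lw by linarith
  then show ?thesis
  proof cases
   case 1
   then show ?thesis using W0[OF 1] c i lw by (simp add: nth_append)
  next
   case 2
   then have "?z ! i = A (vC 0 0 (B + i) 2)" using lw by (simp add: nth_append y_def)
   moreover have "~ A (vC 0 0 (B + i) 0)" using below[OF 2(2)] 2 by (simp add: R_def)
   ultimately show ?thesis using Y[OF 2(1) i(2)] c i 2 by auto
  next
   case 3
   then show ?thesis using above[OF 3 i(2)] c i by simp
  qed
 qed
 have A1: "csat A c" if "c : set (clauses1 [0..<T] [0..<Suc (2 * B)])" for c
  using A[of c] that by (simp only: tableau_def set_append Un_iff simp_thms)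
 have A2: "csat A c" if "c : set (clauses2 [0..<T])" for c
  using A[of c] that by (simp only: tableau_def set_append Un_iff simp_thms)
 have "A (vQ T (st ?z T)) & (ALL j p. j < N --> p <= 2 * B -->
   A (if int p = hd_at ?z T j + int B then vH T j p else vN T j p) &
   A (vC T j p (cell ?z T j (int p - int B))))"
  by (rule forced[of T B A ?z T]; (rule A1 A2 TB Q0 H0 C0 order_refl; assumption))
 from this[THEN conjunct2, rule_format, OF N0, of B]
 have "A (vC T 0 B (cell ?z T 0 (int B - int B)))" by simp
 then have "cell ?z T 0 0 ~= 1" using fin by auto
 moreover have "length w + length y <= m" using lz k(2) by simp
 ultimately show ?R by blast
qed

lemma pt_tableau:
 assumes "pt Ts" "pt Ps" "pt B" "pt w" "pt u" "pt v" "pt T"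
 shows "pt (%x. tableau (Ts x) (Ps x) (B x) (w x) (u x) (v x) (T x))"
proof -
 have "pt (%p. clauses1 (fst p) (snd p))"
  unfolding clauses1_def by (intro pt_flat pt_horn pt_intros)
 note 1 = pt_comp2[OF this assms(1,2)]
 have "pt clauses2" unfolding clauses2_def by (intro pt_flat pt_horn pt_intros)
 note 2 = pt_comp[OF this assms(1)]
 have "pt (%e. clauses3 (fst e) (fst (snd e)) (fst (snd (snd e))) (fst (snd (snd (snd e))))
   (fst (snd (snd (snd (snd e))))) (snd (snd (snd (snd (snd e))))))"
  unfolding clauses3_def by (intro pt_flat pt_horn pt_intros)
 from pt_comp[OF this pt_Pair[OF assms(2) pt_Pair[OF assms(3) pt_Pair[OF assms(4) pt_Pair[OF assms(5)
   pt_Pair[OF assms(6,7)]]]]]]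
 have 3: "pt (%x. clauses3 (Ps x) (B x) (w x) (u x) (v x) (T x))" by simp
 show ?thesis unfolding tableau_def by (intro pt_append 1 2 3)
qed

end

text \<open>The first number is given as the length of a list, hence in unary, which keeps all
  numbers that occur linear in the size of the arguments.\<close>

lemma pt_enumerate: "pt k ==> pt xs ==> pt (%x. List.enumerate (length (k x)) (xs x))"
proof -
 have *: "foldl (%a y. (Suc (fst a), (fst a, y) # snd a)) (n, acc) xs = (n + length xs, rev (List.enumerate n xs) @ acc)"
  for n acc and xs :: "'c list" by (induction xs arbitrary: n acc) auto
 have "pt (%p :: 'b list \<times> 'c list. rev (snd (foldl (%a y. (Suc (fst a), (fst a, y) # snd a)) (length (fst p), []) (snd p))))"
 proof (intro pt_rev pt_snd, rule pt_foldl[where q = "%n. 4 * (n + n) + 1 + (n * (4 * (n + n) + 1 + n + 1 + 1) + 1) + 1"])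
  fix p :: "'b list \<times> 'c list" and n
  obtain k xs where p: "p = (k, xs)" by (cases p)
  have l: "length k < sz p" "length (take n xs) < sz p"
   using length_less_sz[of k] length_less_sz[of xs] by (auto simp: p)
  have a: "sz (length k + length (take n xs)) <= 4 * (sz p + sz p) + 1"
   by (rule sz_nat_le_mono) (use l in linarith)
  have "sz y <= 4 * (sz p + sz p) + 1 + sz p + 1" if y: "y : set (rev (List.enumerate (length k) (take n xs)))" for y
  proof -
   obtain i c where yc: "y = (i, c)" by (cases y)
   with y have i: "i < length k + length (take n xs)" and "c = take n xs ! (i - length k)" "i - length k < length (take n xs)"
    by (auto simp: in_set_enumerate_eq)
   then have "c : set (take n xs)" by (metis nth_mem)
   then have "sz c < sz p" using sz_member[of c xs] by (auto simp: p dest: in_set_takeD)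
   moreover have "sz i <= 4 * (sz p + sz p) + 1" by (rule sz_nat_le_mono) (use i l in linarith)
   ultimately show ?thesis by (simp add: yc)
  qed
  then have "sz (rev (List.enumerate (length k) (take n xs))) <=
   length (rev (List.enumerate (length k) (take n xs))) * (4 * (sz p + sz p) + 1 + sz p + 1 + 1) + 1"
   by (rule sz_list_le)
  also have "... <= sz p * (4 * (sz p + sz p) + 1 + sz p + 1 + 1) + 1"
   using l(2) by (intro add_mono mult_le_mono) auto
  finally show "sz (foldl (%a y. (Suc (fst a), (fst a, y) # snd a)) (length (fst p), []) (take n (snd p)))
   <= 4 * (sz p + sz p) + 1 + (sz p * (4 * (sz p + sz p) + 1 + sz p + 1 + 1) + 1) + 1"
   using a by (simp add: p *)
 qed (intro pt_intros polyb_intros)+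
 then have "pt (%p :: 'b list \<times> 'c list. List.enumerate (length (fst p)) (snd p))" by (simp add: *)
 then show "pt k ==> pt xs ==> pt (%x. List.enumerate (length (k x)) (xs x))" by (rule pt_comp2)
qed

text \<open>The bounds on the certificate and on the running time are computed as lists of units of
  polynomial length, over which the tableau then ranges.\<close>

theorem NP_reduces_to_sat:
 assumes "L : class_NP"
 obtains F :: "bool list => var cnf" where "pt F" "!!x. x : L <-> sat (F x)"
proof -
 from assms obtain V c d where V: "V : class_P"
  and L: "!!x. x : L <-> (EX y. length y <= c * length x ^ d + c & enc_word x @ y : V)"
  unfolding class_NP_def by blast
 from V obtain M a e where M: "turing_machine M" "!!z. outputs_within M z (a * length z ^ e + a) [z : V]"
  unfolding class_P_def poly_time_def by blast
 interpret machine M by unfold_locales (rule M(1))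
 have ptw: "pt enc_word" using codec_word by (rule codec_pt)
 obtain lq :: "bool list => unit list" where lq: "pt lq" "!!x. length (lq x) = c * length x ^ d + c"
  using pt_poly_list[OF pt_id, of c d] by metis
 define lm where "lm x = map (%_. ()) (enc_word x) @ lq x" for x
 have lm: "pt lm" unfolding lm_def[abs_def] by (intro pt_append pt_map ptw lq(1) pt_const)
 obtain lT :: "bool list => unit list" where lT: "pt lT" "!!x. length (lT x) = a * length (lm x) ^ e + a"
  using pt_poly_list[OF lm, of a e] by metis
 \<comment> \<open>Chosen so that both the running time is smaller than \<open>B\<close> and the
   length of the input with its certificate is at most \<open>B\<close>.\<close>
 define lB where "lB x = () # lT x @ lm x" for x
 have lB: "pt lB" unfolding lB_def[abs_def] by (intro pt_Cons pt_append lm lT(1) pt_const)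
 define F where "F x = tableau [0..<length (lT x)] [0..<length (() # lB x @ lB x)] (length (lB x))
   (List.enumerate (length (lB x)) (enc_word x)) (length (lB x @ map (%_. ()) (enc_word x))) (length (lB x @ lm x)) (length (lT x))" for x
 have "pt F" unfolding F_def[abs_def]
  by (intro pt_tableau pt_upt_length pt_length pt_enumerate pt_append pt_Cons pt_map lB lT(1) lm ptw pt_const)
 moreover have "x : L <-> sat (F x)" for x
 proof -
  let ?w = "enc_word x" and ?T = "length (lT x)" and ?m = "length (lm x)" and ?B = "length (lB x)"
  have m: "?m = length ?w + (c * length x ^ d + c)" by (simp add: lm_def lq)
  have "length (() # lB x @ lB x) = Suc (2 * ?B)" by simp
  then have "F x = tableau [0..<?T] [0..<Suc (2 * ?B)] ?B (List.enumerate ?B ?w) (?B + length ?w) (?B + ?m) ?T"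
   unfolding F_def by (simp only: length_append length_map)
  then have "sat (F x) <-> (EX y. length ?w + length y <= ?m & cell (?w @ y) ?T 0 0 ~= 1)"
   using tableau_sat_iff[of ?T ?B ?m ?w] m by (simp add: lB_def)
  \<comment> \<open>For words of length at most \<open>?m\<close> the verifier has halted by time
    \<open>?T\<close>, with output \<open>[True]\<close> or \<open>[False]\<close>; then the first
    cell differs from 1 exactly if the word is accepted.\<close>
  moreover have "cell z ?T 0 0 ~= 1 <-> z : V" if z: "length z <= ?m" for z
  proof -
   let ?n = "a * length z ^ e + a"
   have "?n <= ?T" using z by (simp add: lT power_mono)
   then obtain i where i: "?T = i + ?n" by (metis le_add_diff_inverse2)
   obtain ts where ts: "(step M ^^ ?n) (init M z) = (1, ts)" "fst (hd ts) = word_tape [z : V]"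
    using M(2)[of z] unfolding outputs_within_def by (auto split: prod.splits)
   have "cfg z ?T = (step M ^^ i) ((step M ^^ ?n) (init M z))"
    unfolding cfg_def i by (simp only: funpow_add[of i ?n] o_apply)
   then have "cfg z ?T = (1, ts)" unfolding ts(1) step_halted .
   moreover have "ts ~= []" using cfg_wf[of z ?T] calculation N_pos(1) by auto
   ultimately have "cell z ?T 0 = word_tape [z : V]" using ts(2) by (simp add: hd_conv_nth)
   then show ?thesis by (simp add: word_tape_def)
  qed
  ultimately have "sat (F x) <-> (EX y. length ?w + length y <= ?m & ?w @ y : V)"
   by (metis length_append)
  then show ?thesis unfolding L m by simp
 qed
 ultimately show ?thesis by (rule that)
qed

section \<open>Temporal walks and branchings\<close>

definition src :: "('v, 'e) tdigraph => 'e * nat * nat => 'v * nat" where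
 "src G f = (tail (base G) (fst f), fst (snd f))"

definition dst :: "('v, 'e) tdigraph => 'e * nat * nat => 'v * nat" where
 "dst G f = (head (base G) (fst f), snd (snd f))"

definition nonstart :: "('v * nat) set => 'v * nat => bool" where
 "nonstart W y <-> (EX v t. y = (v, Suc t) & (v, t) : W)"

definition waits :: "('v * nat) set => (('v * nat) \<times> ('v * nat)) set" where
 "waits W = {((v, t), (v, Suc t)) | v t. (v, t) : W & (v, Suc t) : W}"

text \<open>An edge into a temporal vertex that can also be reached by waiting would create a second
  walk. Only edges into starts are usable, where starts are taken relative to
  \<open>W\<close>.\<close>

definition links :: "('v, 'e) tdigraph => ('v * nat) set => ('e * nat * nat) set => ('e * nat * nat) set" where
 "links G W F = {f : F. src G f : W & dst G f : W & ~ nonstart W (dst G f)}"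

text \<open>The combinatorial content of a branching: \<open>W\<close> are the temporal vertices it
  reaches, and mere reachability takes the place of unique reachability. A root that is no start
  would be reached twice, by itself and by waiting.\<close>

definition system :: "('v, 'e) tdigraph => ('v * nat) set => ('e * nat * nat) set => ('v * nat) set => bool" where
 "system G W F R <->
   W <= (waits W Un (%f. (src G f, dst G f)) ` links G W F)\<^sup>* `` (R Int W) &
   (ALL y : R Int W. ~ nonstart W y)"

text \<open>Walks that grow at their end, so that the last step can be compared with the structure
  at the end vertex.\<close>

inductive twalk :: "('v, 'e) tdigraph => 'v * nat => ('v, 'e) titem list => 'v * nat => bool" for B where
 base: "x : tverts B ==> twalk B x [TV x] x"
| wait: "twalk B x s (v, t) ==> (v, Suc t) : tverts B ==> twalk B x (s @ [TV (v, Suc t)]) (v, Suc t)"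
| edge: "twalk B x s (src B f) ==> f : tedges B ==> twalk B x (s @ [TE f, TV (dst B f)]) (dst B f)"

lemma tedges_ends:
 assumes "temporal_digraph B" "f : tedges B"
 shows "src B f : tverts B" "dst B f : tverts B"
proof -
 interpret fin_digraph "base B" using assms by (simp add: temporal_digraph_def)
 obtain e t t' where f: "f = (e, t, t')" by (cases f)
 then have e: "e : arcs (base B)" "(t, t') : avail B e" using assms(2) by (auto simp: tedges_def)
 then have "t : active B (tail (base B) e)" "t' : active B (head (base B) e)"
  using assms(1) unfolding temporal_digraph_def by fast+
 then show "src B f : tverts B" "dst B f : tverts B"
  using e wellformed by (auto simp: src_def dst_def tverts_def f)
qed

lemma twalk_ends: "twalk B x s y ==> s ~= [] & hd s = TV x & last s = TV y"
 by (induction rule: twalk.induct) auto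

lemma twalk_tverts: "temporal_digraph B ==> twalk B x s y ==> y : tverts B"
 by (erule twalk.cases) (auto dest: tedges_ends)

text \<open>The prefix has to end with a temporal vertex, since an edge is legal only between its
  two end vertices.\<close>

lemma temporal_walk_take:
 assumes w: "temporal_walk B (s @ s')" and s: "s ~= []" "last s = TV x"
 shows "temporal_walk B s"
proof -
 have nth: "(s @ s') ! i = s ! i" if "i < length s" for i using that by (simp add: nth_append)
 have 1: "0 < i & i + 1 < length s & s ! (i - 1) = TV (tail (base B) e, t) & s ! (i + 1) = TV (head (base B) e, t')"
  if i: "i < length s" "s ! i = TE (e, t, t')" for i e t t'
 proof -
  have "i ~= length s - 1" using i s by (auto simp: last_conv_nth)
  then have l: "i + 1 < length s" using i by linarith
  have "0 < i & (s @ s') ! (i - 1) = TV (tail (base B) e, t) & (s @ s') ! (i + 1) = TV (head (base B) e, t')"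
   using w i nth[OF i(1)] unfolding temporal_walk_def by (metis length_append trans_less_add1)
  then show ?thesis using l nth by simp
 qed
 have 2: "w = v & u = t + 1" if "i + 1 < length s" "s ! i = TV (v, t) & s ! (i + 1) = TV (w, u)" for i v t w u
 proof -
  have "i + 1 < length (s @ s')" "(s @ s') ! i = TV (v, t) & (s @ s') ! (i + 1) = TV (w, u)"
   using that nth by auto
  then show ?thesis using w unfolding temporal_walk_def by blast
 qed
 have 3: "set s <= TV ` tverts B Un TE ` tedges B" using w unfolding temporal_walk_def by simp
 show ?thesis unfolding temporal_walk_def using s(1) 1 2 3 by blast
qed

lemma twalk_if_temporal_walk: "temporal_walk B s ==> EX x y. twalk B x s y"
proof (induction "length s" arbitrary: s rule: less_induct)
 case less
 have ne: "s ~= []" and sub: "set s <= TV ` tverts B Un TE ` tedges B"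
  using less.prems by (auto simp: temporal_walk_def)
 have teF: "0 < i & i + 1 < length s & s ! (i - 1) = TV (tail (base B) e, t) & s ! (i + 1) = TV (head (base B) e, t')"
  if "i < length s" "s ! i = TE (e, t, t')" for i e t t'
  using less.prems that unfolding temporal_walk_def by blast
 have tvF: "w = v & u = t + 1" if "i + 1 < length s" "s ! i = TV (v, t)" "s ! (i + 1) = TV (w, u)" for i v t w u
  using less.prems that unfolding temporal_walk_def by blast
 obtain s0 z where s0: "s = s0 @ [z]" using ne by (metis append_butlast_last_id)
 obtain y where z: "z = TV y"
 proof (cases z)
  case (TE f)
  obtain e t t' where "f = (e, t, t')" by (cases f)
  then show ?thesis using teF[of "length s0" e t t'] \<open>z = TE f\<close> s0 by simp
 qed auto
 have y: "y : tverts B" using sub s0 z by auto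
 show ?case
 proof (cases s0 rule: rev_cases)
  case Nil
  then have "s = [TV y]" using s0 z by simp
  then show ?thesis using twalk.base[OF y] by blast
 next
  case (snoc s1 z')
  show ?thesis
  proof (cases z')
   case z': (TV x)
   obtain v t where x: "x = (v, t)" by (cases x)
   obtain w u where yw: "y = (w, u)" by (cases y)
   have "w = v & u = t + 1"
    by (rule tvF[of "length s1"]) (auto simp: s0 snoc z z' x yw nth_append)
   then have y': "y = (v, Suc t)" by (simp add: yw)
   have "temporal_walk B s0"
    using temporal_walk_take[of B s0 "[z]" x] less.prems s0 snoc z' by simp
   then obtain x0 y0 where w: "twalk B x0 s0 y0" using less.hyps[of s0] s0 by auto
   then have "y0 = (v, t)" using twalk_ends[OF w] snoc z' x by simp
   with w have "twalk B x0 s0 (v, t)" by simp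
   from twalk.wait[OF this] y y' have "twalk B x0 (s0 @ [TV (v, Suc t)]) (v, Suc t)" by simp
   moreover have "s = s0 @ [TV (v, Suc t)]" using s0 z y' by simp
   ultimately show ?thesis by blast
  next
   case z': (TE f)
   obtain e t t' where f: "f = (e, t, t')" by (cases f)
   have *: "0 < length s1 & s ! (length s1 - 1) = TV (tail (base B) e, t) & s ! (length s1 + 1) = TV (head (base B) e, t')"
   proof -
    have "length s1 < length s" "s ! length s1 = TE (e, t, t')" by (simp_all add: s0 snoc z' f nth_append)
    from teF[OF this] show ?thesis by blast
   qed
   then have l0: "s1 ~= []" by simp
   then have "s ! (length s1 - 1) = s1 ! (length s1 - 1)"
    unfolding s0 snoc append_assoc by (intro nth_append_left) simp
   then have "s ! (length s1 - 1) = last s1" using l0 by (simp add: last_conv_nth)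
   with * l0 have l1: "s1 ~= []" "last s1 = TV (src B f)" by (simp_all add: src_def f)
   have yd: "y = dst B f" using * by (simp add: s0 snoc nth_append z dst_def f)
   have fe: "f : tedges B" using sub s0 snoc z' by auto
   have "temporal_walk B s1"
    by (rule temporal_walk_take[of B s1 "[z', z]"]) (use less.prems s0 snoc l1 in auto)
   then obtain x0 y0 where w: "twalk B x0 s1 y0" using less.hyps[of s1] s0 snoc by auto
   then have "y0 = src B f" using twalk_ends[OF w] l1 by simp
   with w have "twalk B x0 s1 (src B f)" by simp
   from twalk.edge[OF this fe] have "twalk B x0 (s1 @ [TE f, TV (dst B f)]) (dst B f)" .
   moreover have "s = s1 @ [TE f, TV (dst B f)]" using s0 snoc z z' yd by simp
   ultimately show ?thesis by blast
  qed
 qed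
qed

lemma temporal_walk_if_twalk:
 assumes B: "temporal_digraph B"
 shows "twalk B x s y ==> temporal_walk B s"
proof (induction rule: twalk.induct)
 case (base x)
 then show ?case by (auto simp: temporal_walk_def)
next
 case (wait x s v t)
 note e = twalk_ends[OF wait.hyps(1)]
 let ?s = "s @ [TV (v, Suc t)]"
 have "0 < i & i + 1 < length ?s & ?s ! (i - 1) = TV (tail (base B) e, a) & ?s ! (i + 1) = TV (head (base B) e, b)"
  if "i < length ?s" "?s ! i = TE (e, a, b)" for i e a b
 proof -
  have i: "i < length s" "s ! i = TE (e, a, b)" using that by (auto simp: nth_append split: if_splits)
  then have "0 < i & i + 1 < length s & s ! (i - 1) = TV (tail (base B) e, a) & s ! (i + 1) = TV (head (base B) e, b)"
   using wait.IH unfolding temporal_walk_def by blast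
  moreover have "i - 1 < length s" using i by simp
  ultimately show ?thesis using i by (simp add: nth_append)
 qed
 moreover have "w' = v' & u = t' + 1"
  if "i + 1 < length ?s" "?s ! i = TV (v', t') & ?s ! (i + 1) = TV (w', u)" for i v' t' w' u
 proof (cases "i + 1 < length s")
  case True
  then have "s ! i = TV (v', t') & s ! (i + 1) = TV (w', u)" using that by (simp add: nth_append)
  then show ?thesis using wait.IH True unfolding temporal_walk_def by blast
 next
  case False
  then have "i = length s - 1" "i < length s" using that e by auto
  then have "?s ! i = TV (v, t)" "?s ! (i + 1) = TV (v, Suc t)"
   using e last_conv_nth[of s] by (simp_all add: nth_append)
  then show ?thesis using that by simp
 qed
 moreover have "set ?s <= TV ` tverts B Un TE ` tedges B"
  using wait unfolding temporal_walk_def by auto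
 ultimately show ?case unfolding temporal_walk_def by blast
next
 case (edge x s f)
 note e = twalk_ends[OF edge.hyps(1)]
 let ?s = "s @ [TE f, TV (dst B f)]"
 have "0 < i & i + 1 < length ?s & ?s ! (i - 1) = TV (tail (base B) e, a) & ?s ! (i + 1) = TV (head (base B) e, b)"
  if i: "i < length ?s" "?s ! i = TE (e, a, b)" for i e a b
 proof (cases "i < length s")
  case True
  then have "s ! i = TE (e, a, b)" using i by (simp add: nth_append)
  then have "0 < i & i + 1 < length s & s ! (i - 1) = TV (tail (base B) e, a) & s ! (i + 1) = TV (head (base B) e, b)"
   using edge.IH True unfolding temporal_walk_def by blast
  moreover have "i - 1 < length s" using True by simp
  ultimately show ?thesis using True by (simp add: nth_append)
 next
  case False
  then have "i = length s | i = Suc (length s)" using i by auto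
  then have il: "i = length s" using i(2) by (auto simp: nth_append)
  then have "f = (e, a, b)" using i by simp
  then show ?thesis using e il last_conv_nth[of s] by (simp add: nth_append src_def dst_def)
 qed
 moreover have "w' = v' & u = t' + 1"
  if i: "i + 1 < length ?s" "?s ! i = TV (v', t') & ?s ! (i + 1) = TV (w', u)" for i v' t' w' u
 proof (cases "i + 1 < length s")
  case True
  then have "s ! i = TV (v', t') & s ! (i + 1) = TV (w', u)" using i by (simp add: nth_append)
  then show ?thesis using edge.IH True unfolding temporal_walk_def by blast
 next
  case False
  then have "i + 1 = length s | i = length s" using i e by auto
  then have "?s ! (i + 1) = TE f | ?s ! i = TE f" by (auto simp: nth_append)
  then show ?thesis using i by auto
 qed
 moreover have "set ?s <= TV ` tverts B Un TE ` tedges B"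
  using edge tedges_ends[OF B] unfolding temporal_walk_def by auto
 ultimately show ?case unfolding temporal_walk_def by blast
qed

lemma temporal_walk_from_iff:
 assumes "temporal_digraph B"
 shows "temporal_walk B s & (EX r : R. hd s = TV r) & last s = TV y <-> (EX r : R. twalk B r s y)"
proof
 assume w: "temporal_walk B s & (EX r : R. hd s = TV r) & last s = TV y"
 then obtain x z where xz: "twalk B x s z" using twalk_if_temporal_walk by blast
 then show "EX r : R. twalk B r s y" using twalk_ends[OF xz] w by auto
next
 assume "EX r : R. twalk B r s y"
 then obtain r where "r : R" "twalk B r s y" by blast
 then show "temporal_walk B s & (EX r : R. hd s = TV r) & last s = TV y"
  using temporal_walk_if_twalk[OF assms] twalk_ends by blast
qed

text \<open>The end of a walk determines its last step: a non-start is entered by waiting, a root is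
  not entered at all, and any other start is entered by the only edge leading to it.\<close>

lemma twalk_unique:
 assumes B: "temporal_digraph B"
  and root: "!!y. y : R ==> y : tverts B ==> ~ nonstart (tverts B) y & (ALL f : tedges B. dst B f ~= y)"
  and inj: "inj_on (dst B) (tedges B)"
  and start: "!!f. f : tedges B ==> ~ nonstart (tverts B) (dst B f)"
 shows "twalk B r s y ==> r : R ==> twalk B r' s' y ==> r' : R ==> s = s'"
proof (induction arbitrary: r' s' rule: twalk.induct)
 case (base x)
 from base.prems(2) show ?case
 proof cases
  case (wait s v t)
  then have "nonstart (tverts B) x" using twalk_tverts[OF B] by (auto simp: nonstart_def)
  then show ?thesis using root[of x] base by auto
 next
  case (edge s f)
  then show ?thesis using root[of x] base by auto
 qed simp
next
 case (wait x s v t)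
 note IH = wait.IH and xR = wait.prems(1) and rR = wait.prems(3) and vB = wait.hyps(2)
 have ns: "nonstart (tverts B) (v, Suc t)" using twalk_tverts[OF B wait.hyps(1)] by (auto simp: nonstart_def)
 from wait.prems(2) show ?case
 proof cases
  case base
  then have "(v, Suc t) : R" using rR by simp
  with root vB ns show ?thesis by blast
 next
  case (wait s1)
  then have "s = s1" using IH[OF xR _ rR] by simp
  with wait show ?thesis by simp
 next
  case (edge s1 f)
  then show ?thesis using start[of f] ns by simp
 qed
next
 case (edge x s f)
 note IH = edge.IH and xR = edge.prems(1) and rR = edge.prems(3) and fB = edge.hyps(2)
 have df: "dst B f : tverts B" using tedges_ends[OF B edge.hyps(2)] by simp
 from edge.prems(2) show ?case
 proof cases
  case base
  then have "dst B f : R" using rR by simp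
  with root df fB show ?thesis by blast
 next
  case (wait s1 v1 t1)
  then have "nonstart (tverts B) (dst B f)" using twalk_tverts[OF B wait(3)] by (auto simp: nonstart_def)
  then show ?thesis using start[OF fB] by blast
 next
  case (edge s1 f1)
  then have f: "f1 = f" using inj fB by (auto dest: inj_onD)
  with \<open>twalk B r' s1 (src B f1)\<close> have "twalk B r' s1 (src B f)" by (simp only:)
  from IH[OF xR this rR] f \<open>s' = s1 @ [TE f1, TV (dst B f1)]\<close> show ?thesis by (simp only:)
 qed
qed

lemma twalk_exists:
 assumes "(x, y) : (waits (tverts B) Un (%f. (src B f, dst B f)) ` tedges B)\<^sup>*" "x : tverts B"
 shows "EX s. twalk B x s y"
 using assms(1)
proof (induction rule: rtrancl_induct)
 case base
 then show ?case using twalk.base[OF assms(2)] by blast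
next
 case (step y z)
 then obtain s where s: "twalk B x s y" by blast
 from step.hyps(2) show ?case
 proof
  assume "(y, z) : waits (tverts B)"
  then show ?thesis using twalk.wait s by (fastforce simp: waits_def)
 next
  assume "(y, z) : (%f. (src B f, dst B f)) ` tedges B"
  then show ?thesis using twalk.edge s by fastforce
 qed
qed

lemma unique_walks:
 assumes B: "temporal_digraph B"
  and "!!y. y : R ==> y : tverts B ==> ~ nonstart (tverts B) y & (ALL f : tedges B. dst B f ~= y)"
  and "inj_on (dst B) (tedges B)"
  and "!!f. f : tedges B ==> ~ nonstart (tverts B) (dst B f)"
  and reach: "tverts B <= (waits (tverts B) Un (%f. (src B f, dst B f)) ` tedges B)\<^sup>* `` (R Int tverts B)"
  and y: "y : tverts B"
 shows "EX! s. temporal_walk B s & (EX r : R. hd s = TV r) & last s = TV y"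
proof -
 obtain r where "r : R" "r : tverts B"
  "(r, y) : (waits (tverts B) Un (%f. (src B f, dst B f)) ` tedges B)\<^sup>*" using reach y by blast
 then obtain s where s: "twalk B r s y" using twalk_exists by blast
 show ?thesis
  unfolding temporal_walk_from_iff[OF B]
  using s \<open>r : R\<close> twalk_unique[OF assms(1-4)] by blast
qed

text \<open>A root that is no start, or a used edge that enters a non-start, would yield a second
  walk to the same temporal vertex. Hence all walks consist of waits and links.\<close>

lemma system_if_unique:
 assumes B: "temporal_digraph B" and ends: "!!f. f : tedges B ==> src G f = src B f & dst G f = dst B f"
  and W: "W = {y. EX r : R. EX s. twalk B r s y}"
  and uniq: "!!y s s' r r'. r : R ==> twalk B r s y ==> r' : R ==> twalk B r' s' y ==> s = s'"
 shows "system G W (tedges B) R"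
proof -
 have WB: "W <= tverts B" using W twalk_tverts[OF B] by blast
 let ?Q = "waits W Un (%f. (src G f, dst G f)) ` links G W (tedges B)"
 have start: "~ nonstart W y" if y: "y : R Int W" for y
 proof
  assume "nonstart W y"
  then obtain v t where v: "y = (v, Suc t)" "(v, t) : W" by (auto simp: nonstart_def)
  then obtain r s where r: "r : R" "twalk B r s (v, t)" using W by blast
  have "twalk B r (s @ [TV y]) y" using twalk.wait[OF r(2)] y v WB by blast
  moreover have "twalk B y [TV y] y" using twalk.base y WB by blast
  ultimately have "s @ [TV y] = [TV y]" using uniq r(1) y by blast
  then show False using twalk_ends[OF r(2)] by simp
 qed
 have reach: "(r, y) : ?Q\<^sup>*" if r: "r : R" and "twalk B r s y" for r s y
  using that(2,1)
 proof (induction rule: twalk.induct)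
  case (base x)
  show ?case by simp
 next
  case (wait x s v t)
  have "(v, t) : W" "(v, Suc t) : W"
   using wait.hyps(1) twalk.wait[OF wait.hyps] wait.prems W by blast+
  then have "((v, t), (v, Suc t)) : ?Q" unfolding waits_def by blast
  with wait.IH[OF wait.prems] show ?case by (rule rtrancl.rtrancl_into_rtrancl)
 next
  case (edge x s f)
  have sW: "src B f : W" "dst B f : W"
   using edge.hyps(1) twalk.edge[OF edge.hyps] edge.prems W by blast+
  have "~ nonstart W (dst B f)"
  proof
   assume "nonstart W (dst B f)"
   then obtain v t where v: "dst B f = (v, Suc t)" "(v, t) : W" by (auto simp: nonstart_def)
   then obtain r s' where r: "r : R" "twalk B r s' (v, t)" using W by blast
   have "(v, Suc t) : tverts B" using sW(2) WB v(1) by auto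
   from twalk.wait[OF r(2) this] have "twalk B r (s' @ [TV (v, Suc t)]) (dst B f)" by (simp add: v(1))
   from uniq[OF r(1) this edge.prems twalk.edge[OF edge.hyps]]
   \<comment> \<open>Without the common last vertex, one walk ends in a temporal vertex and the
     other in a temporal edge.\<close>
   have "s' @ [TV (v, Suc t)] = (s @ [TE f]) @ [TV (dst B f)]" by simp
   then have "s' = s @ [TE f]" by (simp only: append1_eq_conv)
   then show False using twalk_ends[OF r(2)] by simp
  qed
  then have "f : links G W (tedges B)" using sW ends[OF edge.hyps(2)] edge.hyps(2) by (simp add: links_def)
  then have "(src G f, dst G f) : ?Q" by blast
  then have "(src B f, dst B f) : ?Q" by (simp only: ends[OF edge.hyps(2)])
  with edge.IH[OF edge.prems] show ?case by (rule rtrancl.rtrancl_into_rtrancl)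
 qed
 have rW: "r : W" if r: "r : R" and w: "twalk B r s y" for r s y
 proof -
  from w have "r : tverts B" by (induction rule: twalk.induct) auto
  then show ?thesis using twalk.base r W by blast
 qed
 have "y : ?Q\<^sup>* `` (R Int W)" if y: "y : W" for y
 proof -
  obtain r s where r: "r : R" "twalk B r s y" using y W by blast
  show ?thesis using reach[OF r] rW[OF r] r(1) by (intro ImageI[of r]) simp_all
 qed
 then show ?thesis unfolding system_def using start by (intro conjI subsetI ballI) simp_all
qed

section \<open>Subdigraphs cut out by a set of temporal edges\<close>

definition restrict :: "('v, 'e) tdigraph => ('v * nat) set => ('e * nat * nat) set => ('v, 'e) tdigraph" where
 "restrict G W F = \<lparr>base = (base G)\<lparr>arcs := fst ` F\<rparr>, active = (%v. {t. (v, t) : W}),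
   avail = (%e. {(t, t'). (e, t, t') : F})\<rparr>"

text \<open>Characterizes the subdigraph only where it matters: the presentations produced by the
  algorithm have other values of \<open>tail\<close> and \<open>head\<close> outside their arcs than
  \<open>restrict\<close> does.\<close>

definition carves :: "('v, 'e) tdigraph => ('v * nat) set => ('e * nat * nat) set => ('v, 'e) tdigraph => bool" where
 "carves G W F B <-> verts (base B) = verts (base G) & arcs (base B) = fst ` F &
   (ALL e : fst ` F. tail (base B) e = tail (base G) e & head (base B) e = head (base G) e) &
   (ALL v. active B v = {t. (v, t) : W}) & (ALL e. avail B e = {(t, t'). (e, t, t') : F})"

lemma carves_restrict: "carves G W F (restrict G W F)"
 by (simp add: carves_def restrict_def)

lemma carvesD:
 assumes c: "carves G W F B" and G: "temporal_digraph G" and W: "W <= tverts G" and F: "F <= tedges G"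
  and FW: "ALL f : F. src G f : W & dst G f : W"
 shows "tverts B = W" "tedges B = F" "!!f. f : F ==> src B f = src G f & dst B f = dst G f"
  "tsubdigraph B G"
proof -
 interpret fin_digraph "base G" using G by (simp add: temporal_digraph_def)
 show 1: "tverts B = W" using c W by (auto simp: carves_def tverts_def)
 have "tedges B = {(e, t, t'). e : fst ` F & (e, t, t') : F}" using c by (simp add: carves_def tedges_def)
 also have "... = F" by force
 finally show "tedges B = F" .
 show "!!f. f : F ==> src B f = src G f & dst B f = dst G f"
  using c by (auto simp: carves_def src_def dst_def)
 have arcsub: "fst ` F <= arcs (base G)" using F by (auto simp: tedges_def)
 have actsub: "active B v <= active G v" if "v : verts (base G)" for v
  using c W that by (auto simp: carves_def tverts_def)
 have te: "tail (base B) e = tail (base G) e & head (base B) e = head (base G) e" if "e : fst ` F" for e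
  using c that unfolding carves_def by blast
 have "fin_digraph (base B)"
 proof
  show "finite (verts (base B))" "finite (arcs (base B))"
   using c finite_subset[OF arcsub] by (simp_all add: carves_def)
  fix e assume "e : arcs (base B)"
  then have "e : fst ` F" using c by (simp add: carves_def)
  then show "tail (base B) e : verts (base B)" "head (base B) e : verts (base B)"
   using c arcsub wellformed te unfolding carves_def by auto
 qed
 moreover have "ALL v : verts (base B). finite (active B v) & 0 ~: active B v"
 proof
  fix v assume "v : verts (base B)"
  then have v: "v : verts (base G)" using c by (simp add: carves_def)
  then have "finite (active G v) & 0 ~: active G v" using G by (simp add: temporal_digraph_def)
  then show "finite (active B v) & 0 ~: active B v" using actsub[OF v] finite_subset by auto
 qed
 moreover have "ALL e : arcs (base B). ALL (t, t') : avail B e.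
   t <= t' & t : active B (tail (base B) e) & t' : active B (head (base B) e)"
 proof (intro ballI, clarify)
  fix e t t' assume "e : arcs (base B)" and tt: "(t, t') : avail B e"
  then have e: "e : fst ` F" "(e, t, t') : F" using c by (auto simp: carves_def)
  have "t <= t'" using e(2) F G unfolding temporal_digraph_def tedges_def by fast
  moreover have "(tail (base G) e, t) : W" "(head (base G) e, t') : W"
   using bspec[OF FW e(2)] by (auto simp: src_def dst_def)
  ultimately show "t <= t' & t : active B (tail (base B) e) & t' : active B (head (base B) e)"
   using c te[OF e(1)] by (simp add: carves_def)
 qed
 ultimately have "temporal_digraph B" by (simp add: temporal_digraph_def)
 then show "tsubdigraph B G" unfolding tsubdigraph_def
  using c arcsub actsub F by (auto simp: carves_def tedges_def)
qed

lemma carve_unique: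
 assumes c: "carves G W F B" and G: "temporal_digraph G" and W: "W <= tverts G" and F: "F <= tedges G"
  and FW: "links G W F = F" and inj: "inj_on (dst G) F" and root: "dst G ` F Int R = {}"
  and sys: "system G W F R" and y: "y : W"
 shows "EX! s. temporal_walk B s & (EX r : R. hd s = TV r) & last s = TV y"
proof -
 have FW': "ALL f : F. src G f : W & dst G f : W" using FW unfolding links_def by blast
 note B = carvesD[OF c G W F FW']
 have td: "temporal_digraph B" using B(4) by (simp add: tsubdigraph_def)
 have st: "~ nonstart W (dst G f)" if "f : F" for f using FW that unfolding links_def by blast
 have im: "(%f. (src B f, dst B f)) ` F = (%f. (src G f, dst G f)) ` F"
  by (rule image_cong) (use B(3) in auto)
 have 1: "~ nonstart W z & (ALL f:F. dst B f ~= z)" if "z : R" "z : W" for z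
  using that sys root B(3) unfolding system_def by auto
 have 2: "inj_on (dst B) F" using inj B(3) unfolding inj_on_def by simp
 have 3: "~ nonstart W (dst B f)" if "f : F" for f using st[OF that] B(3)[OF that] by simp
 have 4: "W <= (waits W Un (%f. (src B f, dst B f)) ` F)\<^sup>* `` (R Int W)"
  unfolding im using sys unfolding system_def FW by blast
 show ?thesis
  by (rule unique_walks[OF td]) (unfold B(1,2), fact 1, fact 2, fact 3, fact 4, fact y)
qed

text \<open>A shortest-path forest turns reachability into unique reachability.\<close>

lemma prune_system:
 assumes sys: "system G W F R"
 obtains F' where "F' <= F" "links G W F' = F'" "inj_on (dst G) F'" "dst G ` F' Int R = {}" "system G W F' R"
proof -
 let ?E = "%F. waits W Un (%f. (src G f, dst G f)) ` links G W F"
 have inW: "x : W & y : W" if "(x, y) : ?E F" for x y F using that by (auto simp: waits_def links_def)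
 \<comment> \<open>The distance from the roots, counting waits and links alike.\<close>
 define D where "D y = (LEAST n. EX r : R Int W. (r, y) : (?E F) ^^ n)" for y
 have ex: "EX n. EX r : R Int W. (r, y) : (?E F) ^^ n" if "y : W" for y
  using sys that unfolding system_def by (blast dest: rtrancl_imp_relpow)
 have pred: "EX x. (x, y) : ?E F & D x < D y" if y: "y : W" "y ~: R" for y
 proof -
  obtain r where r: "r : R Int W" "(r, y) : (?E F) ^^ (D y)" using LeastI_ex[OF ex[OF y(1)]] unfolding D_def by blast
  have "D y ~= 0" using r y by (cases "D y") auto
  then obtain n where n: "D y = Suc n" by (cases "D y") auto
  then obtain x where x: "(r, x) : (?E F) ^^ n" "(x, y) : ?E F" using r(2) by auto
  have "D x <= n" unfolding D_def by (rule Least_le) (use r x in blast)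
  then have "D x < D y" using n by simp
  with x(2) show ?thesis by blast
 qed
 have "EX f. f : links G W F & dst G f = y & D (src G f) < D y" if y: "y : W" "y ~: R" "~ nonstart W y" for y
 proof -
  obtain x where x: "(x, y) : ?E F" "D x < D y" using pred y by blast
  have "(x, y) ~: waits W" using y(3) unfolding waits_def nonstart_def by blast
  with x show ?thesis by auto
 qed
 \<comment> \<open>One entering edge is kept for every start that is no root, and its tail is
   strictly closer to the roots. This gives distinct heads and preserves reachability by induction
   on the distance.\<close>
 then obtain p where p: "!!y. y : W ==> y ~: R ==> ~ nonstart W y ==>
   p y : links G W F & dst G (p y) = y & D (src G (p y)) < D y" by metis
 define Y where "Y = {y : W. y ~: R & ~ nonstart W y}"
 define F' where "F' = p ` Y"
 have F': "F' <= links G W F" using p unfolding F'_def Y_def by blast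
 have l: "links G W F' = F'" using F' unfolding links_def by blast
 have "y : (?E F')\<^sup>* `` (R Int W)" if "y : W" for y
  using that
 proof (induction "D y" arbitrary: y rule: less_induct)
  case less
  show ?case
  proof (cases "y : R")
   case True
   then show ?thesis using less.prems by blast
  next
   case yR: False
   have "EX x. (x, y) : ?E F' & D x < D y"
   proof (cases "nonstart W y")
    case True
    obtain x where x: "(x, y) : ?E F" "D x < D y" using pred less.prems yR by blast
    have "(x, y) : waits W" using x(1) True unfolding links_def by auto
    with x show ?thesis by blast
   next
    case False
    then have "p y : F'" using less.prems yR unfolding F'_def Y_def by blast
    then have "p y : links G W F'" by (simp only: l)
    then have e: "(src G (p y), dst G (p y)) : ?E F'" by blast
    have q: "dst G (p y) = y" "D (src G (p y)) < D y" using p[OF less.prems yR False] by simp_all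
    show ?thesis by (rule exI[of _ "src G (p y)"], rule conjI[OF e[unfolded q(1)] q(2)])
   qed
   then obtain x where x: "(x, y) : ?E F'" "D x < D y" by blast
   have "x : (?E F')\<^sup>* `` (R Int W)" using less.hyps[OF x(2)] inW[OF x(1)] by blast
   then show ?thesis using x(1) by (blast intro: rtrancl.rtrancl_into_rtrancl)
  qed
 qed
 then have "system G W F' R" using sys unfolding system_def by blast
 moreover have "inj_on (dst G) F'" using p unfolding F'_def Y_def inj_on_def by auto
 moreover have "dst G ` F' Int R = {}" using p unfolding F'_def Y_def by auto
 moreover have "F' <= F" using F' unfolding links_def by blast
 ultimately show ?thesis using that l by blast
qed

text \<open>The possible reached sets of a vertex-spanning branching. Which time is chosen for each
  vertex is free, and this freedom is the source of hardness.\<close>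

definition one_per_vertex :: "('v, 'e) tdigraph => ('v * nat) set => bool" where
 "one_per_vertex G W <-> W <= tverts G & (ALL u : verts (base G). EX! i. (u, i) : W)"

lemma subdigraph_tedges:
 assumes "tsubdigraph B G" "f : tedges B"
 shows "f : tedges G" "src G f = src B f" "dst G f = dst B f" "fst f : arcs (base B)"
 using assms by (cases f; auto simp: tsubdigraph_def tedges_def src_def dst_def)+

lemma system_of_temporal_spanning:
 assumes B: "tsubdigraph B G" and span: "temporal_spanning G R B" and R: "R <= tverts G"
 shows "system G (tverts G) (tedges B) R"
proof -
 have td: "temporal_digraph B" using B by (simp add: tsubdigraph_def)
 have sub: "tverts B <= tverts G" using B by (auto simp: tsubdigraph_def tverts_def)
 have ex1: "EX! s. EX r : R. twalk B r s y" if "y : tverts G" for y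
  using span that unfolding temporal_spanning_def temporal_walk_from_iff[OF td] by (cases y) blast
 show ?thesis
 proof (rule system_if_unique[OF td])
  show "src G f = src B f & dst G f = dst B f" if "f : tedges B" for f
   using subdigraph_tedges[OF B that] by simp
  show "tverts G = {y. EX r:R. EX s. twalk B r s y}"
   using ex1 twalk_tverts[OF td] sub by blast
  show "s = s'" if "r : R" "twalk B r s y" "r' : R" "twalk B r' s' y" for y s s' r r'
   using ex1[of y] that twalk_tverts[OF td that(2)] sub by blast
 qed
qed

text \<open>If two times of the same vertex were reached, there would be two different walks to that
  vertex. So the reached set itself contains each vertex at exactly one time.\<close>

lemma system_of_vertex_spanning:
 assumes B: "tsubdigraph B G" and span: "vertex_spanning G R B"
 obtains W where "one_per_vertex G W" "system G W (tedges B) R"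
proof -
 have td: "temporal_digraph B" using B by (simp add: tsubdigraph_def)
 have sub: "tverts B <= tverts G" using B by (auto simp: tsubdigraph_def tverts_def)
 have ex1: "EX! s. EX i. (u, i) : tverts G & (EX r : R. twalk B r s (u, i))" if u: "u : verts (base G)" for u
 proof -
  have eq: "(temporal_walk B s & (EX r:R. hd s = TV r) & (EX i. (u, i) : tverts G & last s = TV (u, i))) <->
   (EX i. (u, i) : tverts G & (EX r : R. twalk B r s (u, i)))" for s
   using temporal_walk_from_iff[OF td] by blast
  have "EX! s. temporal_walk B s & (EX r:R. hd s = TV r) & (EX i. (u, i) : tverts G & last s = TV (u, i))"
   using span u unfolding vertex_spanning_def by blast
  then show ?thesis by (simp only: eq)
 qed
 have G: "u : verts (base G)" if "(u, i) : tverts B" for u i using sub that by (auto simp: tverts_def)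
 define W where "W = {y. EX r:R. EX s. twalk B r s y}"
 have "system G W (tedges B) R"
 proof (rule system_if_unique[OF td _ W_def])
  show "src G f = src B f & dst G f = dst B f" if "f : tedges B" for f
   using subdigraph_tedges[OF B that] by simp
  show "s = s'" if "r : R" "twalk B r s y" "r' : R" "twalk B r' s' y" for y s s' r r'
  proof -
   obtain u i where y: "y = (u, i)" by (cases y)
   have "(u, i) : tverts B" using twalk_tverts[OF td that(2)] y by simp
   then show ?thesis using ex1[OF G] sub that y by blast
  qed
 qed
 moreover have "one_per_vertex G W" unfolding one_per_vertex_def
 proof (intro conjI ballI)
  show "W <= tverts G" using twalk_tverts[OF td] sub by (auto simp: W_def)
  fix u assume u: "u : verts (base G)"
  then obtain s i r where s: "(u, i) : tverts G" "r : R" "twalk B r s (u, i)" using ex1 by blast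
  have "j = i" if uj: "(u, j) : W" for j
  proof -
   obtain r' s' where s': "r' : R" "twalk B r' s' (u, j)" using uj unfolding W_def by blast
   then have "(u, j) : tverts G" using twalk_tverts[OF td] sub by blast
   then have "s = s'" using ex1[OF u] s s' by blast
   then show ?thesis using twalk_ends[OF s(3)] twalk_ends[OF s'(2)] by simp
  qed
  then show "EX! i. (u, i) : W" using s by (auto simp: W_def)
 qed
 ultimately show ?thesis using that by blast
qed

lemma spanning_of_carve:
 assumes "carves G W F B" "temporal_digraph G" "F <= tedges G"
  "links G W F = F" "inj_on (dst G) F" "dst G ` F Int R = {}" "system G W F R"
 shows "W = tverts G ==> temporal_spanning G R B" "one_per_vertex G W ==> vertex_spanning G R B"
proof -
 show "temporal_spanning G R B" if "W = tverts G"
  unfolding temporal_spanning_def using carve_unique[OF assms(1,2) _ assms(3-7)] that by blast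
 show "vertex_spanning G R B" if one: "one_per_vertex G W"
  unfolding vertex_spanning_def
 proof
  fix u assume u: "u : verts (base G)"
  have W: "W <= tverts G" using one by (simp add: one_per_vertex_def)
  have FW: "ALL f : F. src G f : W & dst G f : W" using assms(4) unfolding links_def by blast
  note B = carvesD[OF assms(1,2) W assms(3) FW]
  have td: "temporal_digraph B" using B(4) by (simp add: tsubdigraph_def)
  obtain i where i: "(u, i) : W" "!!j. (u, j) : W ==> j = i" using one u unfolding one_per_vertex_def by blast
  have "(temporal_walk B s & (EX r:R. hd s = TV r) & (EX i. (u, i) : tverts G & last s = TV (u, i))) <->
    (temporal_walk B s & (EX r:R. hd s = TV r) & last s = TV (u, i))" for s
  proof -
   have "j = i" if w: "temporal_walk B s" "EX r:R. hd s = TV r" "last s = TV (u, j)" for j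
   proof -
    have "EX r : R. twalk B r s (u, j)" using temporal_walk_from_iff[OF td, of s R "(u, j)"] w by blast
    then obtain r where "twalk B r s (u, j)" by blast
    from twalk_tverts[OF td this] B(1) have "(u, j) : W" by simp
    then show ?thesis by (rule i(2))
   qed
   then show ?thesis using i(1) W by blast
  qed
  then show "EX! s. temporal_walk B s & (EX r:R. hd s = TV r) & (EX i. (u, i) : tverts G & last s = TV (u, i))"
   using carve_unique[OF assms(1,2) W assms(3-7) i(1)] by simp
 qed
qed

text \<open>Transfers a disjointness requirement on subdigraphs to a relation \<open>D\<close> on
  their sets of temporal edges: \<open>D\<close> is necessary for all of them and sufficient for
  carved ones. Passing to subsets preserves it, so pruning does no damage.\<close>

definition disjointness_of ::
  "(('v, 'e) tdigraph => ('v, 'e) tdigraph => bool) => (('e * nat * nat) set => ('e * nat * nat) set => bool) => bool" where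
 "disjointness_of dis D <->
   (ALL B B'. dis B B' --> D (tedges B) (tedges B')) &
   (ALL G W F B W' F' B'. carves G W F B --> carves G W' F' B' --> D F F' --> dis B B') &
   (ALL E E' F F'. F <= E --> F' <= E' --> D E E' --> D F F')"

lemma disjointness_of_t: "disjointness_of t_edge_disjoint (%F F'. F Int F' = {})"
 unfolding disjointness_of_def t_edge_disjoint_def
proof (intro conjI allI impI)
 fix B B' :: "('v, 'e) tdigraph"
 assume "ALL e:arcs (base B) Int arcs (base B'). avail B e Int avail B' e = {}"
 then show "tedges B Int tedges B' = {}" unfolding tedges_def by blast
next
 fix G :: "('v, 'e) tdigraph" and W F B W' F' B'
 assume "carves G W F B" "carves G W' F' B'" "F Int F' = {}"
 then show "ALL e:arcs (base B) Int arcs (base B'). avail B e Int avail B' e = {}"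
  by (simp add: carves_def) blast
qed blast

lemma disjointness_of_e: "disjointness_of edge_disjoint (%F F'. fst ` F Int fst ` F' = {})"
 unfolding disjointness_of_def edge_disjoint_def
proof (intro conjI allI impI)
 fix B B' :: "('v, 'e) tdigraph"
 have "fst ` tedges B <= arcs (base B)" for B :: "('v, 'e) tdigraph" by (auto simp: tedges_def)
 moreover assume "arcs (base B) Int arcs (base B') = {}"
 ultimately show "fst ` tedges B Int fst ` tedges B' = {}" by blast
next
 fix G :: "('v, 'e) tdigraph" and W F B W' F' B'
 assume "carves G W F B" "carves G W' F' B'" "fst ` F Int fst ` F' = {}"
 then show "arcs (base B) Int arcs (base B') = {}" by (simp add: carves_def)
qed blast

text \<open>The same abstraction for the spanning requirement: \<open>wok\<close> tells which sets
  of temporal vertices may be the reached set.\<close>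

definition spanning_of ::
  "('v, 'e) spanning_req => (('v, 'e) tdigraph => ('v * nat) set => bool) => bool" where
 "spanning_of spn wok <->
   (ALL G R B. tsubdigraph B G --> spn G R B --> R <= tverts G -->
    (EX W. wok G W & system G W (tedges B) R)) &
   (ALL G R W F B. carves G W F B --> temporal_digraph G --> F <= tedges G --> links G W F = F -->
    inj_on (dst G) F --> dst G ` F Int R = {} --> system G W F R --> wok G W --> spn G R B) &
   (ALL G W. wok G W --> W <= tverts G)"

lemma spanning_of_temporal: "spanning_of temporal_spanning (%G W. W = tverts G)"
 unfolding spanning_of_def
proof (intro conjI allI impI)
 show "EX W. W = tverts G & system G W (tedges B) R"
  if "tsubdigraph B G" "temporal_spanning G R B" "R <= tverts G" for G :: "('v, 'e) tdigraph" and R B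
  using system_of_temporal_spanning[OF that] by blast
qed (rule spanning_of_carve(1), assumption+, simp)

lemma spanning_of_vertex: "spanning_of vertex_spanning one_per_vertex"
 unfolding spanning_of_def
proof (intro conjI allI impI)
 show "EX W. one_per_vertex G W & system G W (tedges B) R"
  if "tsubdigraph B G" "vertex_spanning G R B" for G :: "('v, 'e) tdigraph" and R B
  using system_of_vertex_spanning[OF that] by metis
qed (rule spanning_of_carve(2), assumption+, simp add: one_per_vertex_def)

lemma disjointness_ofD:
 assumes "disjointness_of dis D"
 shows "dis B B' ==> D (tedges B) (tedges B')"
  "carves G W F B ==> carves G W' F' B' ==> D F F' ==> dis B B'"
  "F <= E ==> F' <= E' ==> D E E' ==> D F F'"
proof -
 note d = assms[unfolded disjointness_of_def]
 show "dis B B' ==> D (tedges B) (tedges B')" by (rule conjunct1[OF d, rule_format])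
 show "carves G W F B ==> carves G W' F' B' ==> D F F' ==> dis B B'"
  by (rule conjunct1[OF conjunct2[OF d], rule_format])
 show "F <= E ==> F' <= E' ==> D E E' ==> D F F'"
  by (rule conjunct2[OF conjunct2[OF d], rule_format])
qed

lemma spanning_ofD:
 assumes "spanning_of spn wok"
 shows "tsubdigraph B G ==> spn G R B ==> R <= tverts G ==> EX W. wok G W & system G W (tedges B) R"
  "carves G W F B ==> temporal_digraph G ==> F <= tedges G ==> links G W F = F ==>
    inj_on (dst G) F ==> dst G ` F Int R = {} ==> system G W F R ==> wok G W ==> spn G R B"
  "wok G W ==> W <= tverts G"
proof -
 note s = assms[unfolded spanning_of_def]
 show "tsubdigraph B G ==> spn G R B ==> R <= tverts G ==> EX W. wok G W & system G W (tedges B) R"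
  by (rule conjunct1[OF s, rule_format])
 show "carves G W F B ==> temporal_digraph G ==> F <= tedges G ==> links G W F = F ==>
    inj_on (dst G) F ==> dst G ` F Int R = {} ==> system G W F R ==> wok G W ==> spn G R B"
  by (rule conjunct1[OF conjunct2[OF s], rule_format])
 show "wok G W ==> W <= tverts G"
  by (rule conjunct2[OF conjunct2[OF s], rule_format])
qed

lemma disjoint_branchings_of_carves:
 assumes G: "temporal_digraph G" and dis: "disjointness_of dis D" and spn: "spanning_of spn wok"
  and len: "length Bs = length Rs"
  and F: "!!i. i < length Rs ==> wok G (W i) & F i <= tedges G & links G (W i) (F i) = F i &
   inj_on (dst G) (F i) & dst G ` F i Int Rs ! i = {} & system G (W i) (F i) (Rs ! i)"
  and D: "!!i j. i < length Rs ==> j < length Rs ==> i ~= j ==> D (F i) (F j)"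
  and carve: "!!i. i < length Rs ==> carves G (W i) (F i) (Bs ! i)"
 shows "disjoint_branchings dis spn G Rs Bs"
 unfolding disjoint_branchings_def
proof (intro conjI allI impI len)
 fix i assume i: "i < length Rs"
 note Fi = F[OF i]
 have W: "W i <= tverts G" using Fi spanning_ofD(3)[OF spn] by blast
 have "ALL f : F i. src G f : W i & dst G f : W i" using Fi unfolding links_def by blast
 from carvesD(4)[OF carve[OF i] G W _ this] Fi show "tsubdigraph (Bs ! i) G" by blast
 show "spn G (Rs ! i) (Bs ! i)"
  by (rule spanning_ofD(2)[OF spn carve[OF i] G]) (simp_all only: Fi)
next
 fix i j assume ij: "i < length Rs" "j < length Rs" "i ~= j"
 show "dis (Bs ! i) (Bs ! j)"
  by (rule disjointness_ofD(2)[OF dis carve[OF ij(1)] carve[OF ij(2)] D[OF ij]])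
qed

text \<open>Forwards, the temporal edges of each branching form a system. Backwards, a system is
  pruned to a forest, which restores unique walks, and then carved out.\<close>

theorem branchings_iff_systems:
 assumes G: "temporal_digraph G" and dis: "disjointness_of dis D" and spn: "spanning_of spn wok"
  and R: "!!i. i < length Rs ==> Rs ! i <= tverts G"
 shows "(EX Bs. disjoint_branchings dis spn G Rs Bs) <->
  (EX W F. (ALL i < length Rs. wok G (W i) & F i <= tedges G & system G (W i) (F i) (Rs ! i)) &
   (ALL i < length Rs. ALL j < length Rs. i ~= j --> D (F i) (F j)))"
  (is "?l <-> ?r")
proof
 assume ?l
 then obtain Bs where Bs: "disjoint_branchings dis spn G Rs Bs" by blast
 have "EX W. wok G W & system G W (tedges (Bs ! i)) (Rs ! i)" if i: "i < length Rs" for i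
  by (rule spanning_ofD(1)[OF spn _ _ R[OF i]]) (use Bs i in \<open>simp_all add: disjoint_branchings_def\<close>)
 then obtain W where W: "!!i. i < length Rs ==> wok G (W i) & system G (W i) (tedges (Bs ! i)) (Rs ! i)" by metis
 have "tedges (Bs ! i) <= tedges G" if "i < length Rs" for i
  using Bs that subdigraph_tedges(1) unfolding disjoint_branchings_def by blast
 moreover have "D (tedges (Bs ! i)) (tedges (Bs ! j))" if "i < length Rs" "j < length Rs" "i ~= j" for i j
  by (rule disjointness_ofD(1)[OF dis]) (use Bs that in \<open>simp add: disjoint_branchings_def\<close>)
 ultimately show ?r using W by (intro exI[of _ W] exI[of _ "%i. tedges (Bs ! i)"]) simp
next
 assume ?r
 then obtain W F where F: "!!i. i < length Rs ==> wok G (W i) & F i <= tedges G & system G (W i) (F i) (Rs ! i)"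
  and D: "!!i j. i < length Rs ==> j < length Rs ==> i ~= j ==> D (F i) (F j)" by blast
 have "EX F'. F' <= F i & links G (W i) F' = F' & inj_on (dst G) F' & dst G ` F' Int Rs ! i = {} & system G (W i) F' (Rs ! i)"
  if i: "i < length Rs" for i
 proof -
  obtain F' where "F' <= F i" "links G (W i) F' = F'" "inj_on (dst G) F'" "dst G ` F' Int Rs ! i = {}"
   "system G (W i) F' (Rs ! i)" using prune_system F[OF i] by metis
  then show ?thesis by blast
 qed
 then obtain F' where F': "!!i. i < length Rs ==> F' i <= F i & links G (W i) (F' i) = F' i & inj_on (dst G) (F' i) &
   dst G ` F' i Int Rs ! i = {} & system G (W i) (F' i) (Rs ! i)" by metis
 have "disjoint_branchings dis spn G Rs (map (%i. restrict G (W i) (F' i)) [0..<length Rs])"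
 proof (rule disjoint_branchings_of_carves[OF G dis spn])
  show "wok G (W i) & F' i <= tedges G & links G (W i) (F' i) = F' i &
   inj_on (dst G) (F' i) & dst G ` F' i Int Rs ! i = {} & system G (W i) (F' i) (Rs ! i)" if "i < length Rs" for i
   using F[OF that] F'[OF that] by blast
  show "D (F' i) (F' j)" if "i < length Rs" "j < length Rs" "i ~= j" for i j
   by (rule disjointness_ofD(3)[OF dis _ _ D[OF that]]) (use F' that in blast)+
 qed (simp_all add: carves_restrict)
 then show ?l by blast
qed

section \<open>Presentations\<close>

abbreviation pvs :: "presentation => nat list" where "pvs p == fst p"
abbreviation pas :: "presentation => (nat * nat * nat) list" where "pas p == fst (snd p)"
abbreviation pgs :: "presentation => (nat * nat) list" where "pgs p == fst (snd (snd p))"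
abbreviation pls :: "presentation => (nat * nat * nat) list" where "pls p == snd (snd (snd p))"

lemma present_sel:
 "verts (base (present p)) = set (pvs p)" "arcs (base (present p)) = fst ` set (pas p)"
 "tail (base (present p)) e = fst (the (map_of (pas p) e))" "head (base (present p)) e = snd (the (map_of (pas p) e))"
 "active (present p) v = {t. (v, t) : set (pgs p)}" "avail (present p) e = {(t, t'). (e, t, t') : set (pls p)}"
 by (cases p, simp)+

lemma valid_sel: "valid_presentation p <-> distinct (map fst (pas p)) & fst ` set (pgs p) <= set (pvs p) &
  fst ` set (pls p) <= fst ` set (pas p) & temporal_digraph (present p)"
 by (cases p) simp

declare present.simps [simp del] valid_presentation.simps [simp del]

lemma map_of_fst: "distinct (map fst as) ==> a : set as ==> map_of as (fst a) = Some (snd a)"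
 by (cases a) simp

lemma map_of_filter_key: "P x ==> map_of (filter (%e. P (fst e)) as) x = map_of as x"
 by (induction as) auto

lemma fst_filter_image: "A <= fst ` S ==> fst ` {x : S. fst x : A} = A"
 by force

lemma restrict_fst: "fst ` L <= A ==> {(e, t, t'). e : A & (e, t, t') : L} = L"
 by fastforce

lemma fiber_eq: "{b. (i, b) : S} = snd ` {c : S. fst c = i}"
 by force

definition ends :: "(nat * nat * nat) list => nat * nat * nat => (nat * nat * nat) \<times> (nat * nat) \<times> (nat * nat)" where
 "ends as f = (f, (fst (the (map_of as (fst f))), fst (snd f)), (snd (the (map_of as (fst f))), snd (snd f)))"

text \<open>Arcs and temporal edges are joined by filtering, a form that is visibly polynomial; as
  arc names are distinct in a valid presentation, exactly one arc matches. The entries have the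
  format of the arcs in the packing problem, named by their temporal edges.\<close>

definition tarcs :: "(nat * nat * nat) list => (nat * nat * nat) list => ((nat * nat * nat) \<times> (nat * nat) \<times> (nat * nat)) list" where
 "tarcs as F = flat F (%f. map (%a. (f, (fst (snd a), fst (snd f)), (snd (snd a), snd (snd f)))) (filter (%a. fst a = fst f) as))"

lemma ends_present: "ends (pas p) f = (f, src (present p) f, dst (present p) f)"
 by (simp add: ends_def src_def dst_def present_sel)

lemma set_tarcs:
 assumes d: "distinct (map fst as)" and F: "fst ` set F <= fst ` set as"
 shows "set (tarcs as F) = ends as ` set F"
proof -
 have "(%a. (f, (fst (snd a), fst (snd f)), (snd (snd a), snd (snd f)))) ` {a : set as. fst a = fst f} = {ends as f}"
  if f: "f : set F" for f
 proof -
  obtain b where b: "b : set as" "fst b = fst f" using F f by (auto simp: image_iff subset_eq)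
  have m: "map_of as (fst f) = Some (snd a)" if "a : set as" "fst a = fst f" for a
   using map_of_fst[OF d that(1)] that(2) by simp
  have "(f, (fst (snd a), fst (snd f)), (snd (snd a), snd (snd f))) = ends as f" if "a : set as" "fst a = fst f" for a
   using m[OF that] by (simp add: ends_def)
  then have "(%a. (f, (fst (snd a), fst (snd f)), (snd (snd a), snd (snd f)))) ` {a : set as. fst a = fst f} =
    (%_. ends as f) ` {a : set as. fst a = fst f}" by (intro image_cong) simp_all
  also have "... = {ends as f}" using b by blast
  finally show ?thesis .
 qed
 then show ?thesis unfolding tarcs_def by auto
qed

lemma pt_tarcs: "pt A ==> pt F ==> pt (%x. tarcs (A x) (F x))"
 by (rule pt_comp2[of tarcs]) (unfold tarcs_def, intro pt_flat pt_intros)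

definition nonst :: "(nat * nat) list => nat * nat => bool" where
 "nonst W y <-> (EX w : set W. fst w = fst y & Suc (snd w) = snd y)"

definition wl :: "(nat * nat) list => ((nat * nat) \<times> (nat * nat)) list" where
 "wl W = flat W (%x. map (%y. (x, y)) (filter (%y. fst y = fst x & snd y = Suc (snd x)) W))"

definition ll :: "(nat * nat * nat) list => (nat * nat) list => (nat * nat * nat) list => ((nat * nat * nat) \<times> (nat * nat) \<times> (nat * nat)) list" where
 "ll as W F = filter (%a. tl_of a : set W & hd_of a : set W & ~ nonst W (hd_of a)) (tarcs as F)"

definition systeml :: "(nat * nat * nat) list => (nat * nat) list => (nat * nat * nat) list => (nat * nat) list => bool" where
 "systeml as W F R <->
   (ALL w : set W. w : set (reach W (wl W @ map snd (ll as W F)) (filter (%r. r : set W) R))) &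
   (ALL y : set R. y : set W --> ~ nonst W y)"

lemma nonst_iff: "nonst W y <-> nonstart (set W) y"
 by (cases y) (auto simp: nonst_def nonstart_def intro: bexI[of _ "(a, b)" for a b])

lemma set_wl: "set (wl W) = waits (set W)"
 by (auto simp: wl_def waits_def)

lemma set_ll:
 assumes d: "distinct (map fst (pas p))" and F: "fst ` set F <= fst ` set (pas p)"
 shows "set (ll (pas p) W F) = ends (pas p) ` links (present p) (set W) (set F)"
 unfolding ll_def set_filter set_tarcs[OF assms] links_def by (auto simp: ends_present nonst_iff)

lemma pt_nonst: "pt W ==> pt y ==> pt (%x. nonst (W x) (y x))"
 by (rule pt_comp2[of nonst]) (unfold nonst_def, intro pt_intros)

lemma pt_wl: "pt W ==> pt (%x. wl (W x))"
 by (rule pt_comp[of wl]) (unfold wl_def, intro pt_flat pt_intros)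

lemma pt_ll: "pt A ==> pt W ==> pt F ==> pt (%x. ll (A x) (W x) (F x))"
 by (rule pt_comp3[of ll]) (unfold ll_def, intro pt_tarcs pt_nonst pt_intros)

lemma pt_systeml: "pt A ==> pt W ==> pt F ==> pt R ==> pt (%x. systeml (A x) (W x) (F x) (R x))"
proof -
 assume a: "pt A" "pt W" "pt F" "pt R"
 have "pt (%p. systeml (fst p) (fst (snd p)) (fst (snd (snd p))) (snd (snd (snd p))))"
  unfolding systeml_def by (intro pt_reach pt_wl pt_ll pt_nonst pt_intros)
 from pt_comp[OF this pt_Pair[OF a(1) pt_Pair[OF a(2) pt_Pair[OF a(3,4)]]]] show ?thesis by simp
qed

lemma systeml_iff:
 assumes d: "distinct (map fst (pas p))" and F: "fst ` set F <= fst ` set (pas p)"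
 shows "systeml (pas p) W F R <-> system (present p) (set W) (set F) (set R)"
proof -
 have 1: "set (wl W @ map snd (ll (pas p) W F)) = waits (set W) Un (%f. (src (present p) f, dst (present p) f)) ` links (present p) (set W) (set F)"
  unfolding set_append set_wl set_map set_ll[OF assms] image_image by (simp add: ends_present)
 have eq: "set (reach W (wl W @ map snd (ll (pas p) W F)) (filter (%r. r : set W) R)) =
   (waits (set W) Un (%f. (src (present p) f, dst (present p) f)) ` links (present p) (set W) (set F))\<^sup>* `` (set R Int set W)"
  unfolding 1[symmetric]
 proof (subst set_reach)
  show "set (wl W @ map snd (ll (pas p) W F)) <= set W \<times> set W"
   unfolding 1 by (auto simp: waits_def links_def)
 qed (auto simp: Int_def)
 show ?thesis unfolding systeml_def system_def nonst_iff eq subset_iff Ball_def by blast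
qed

text \<open>The requirements on functions and sets become finite tests on the four lists; the
  condition on availabilities is tested on the joined list \<open>tarcs\<close>.\<close>

lemma valid_presentation_iff:
 "valid_presentation p <-> distinct (map fst (pas p)) & (ALL g : set (pgs p). fst g : set (pvs p) & ~ snd g = 0) &
   (ALL f : set (pls p). fst f : set (map fst (pas p))) &
   (ALL a : set (pas p). fst (snd a) : set (pvs p) & snd (snd a) : set (pvs p)) &
   (ALL x : set (tarcs (pas p) (pls p)). fst (snd (fst x)) <= snd (snd (fst x)) &
    fst (snd x) : set (pgs p) & snd (snd x) : set (pgs p))"
proof (cases "distinct (map fst (pas p)) & fst ` set (pgs p) <= set (pvs p) & fst ` set (pls p) <= fst ` set (pas p)")
 case True
 then have d: "distinct (map fst (pas p))" and g: "fst ` set (pgs p) <= set (pvs p)" and l: "fst ` set (pls p) <= fst ` set (pas p)" by auto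
 have m: "map_of (pas p) (fst a) = Some (snd a)" if "a : set (pas p)" for a
  by (rule map_of_fst[OF d that])
 have fin: "finite {t. (v, t) : set (pgs p)}" for v
  by (rule finite_subset[of _ "snd ` set (pgs p)"]) force+
 have base: "fin_digraph (base (present p)) <-> (ALL a : set (pas p). fst (snd a) : set (pvs p) & snd (snd a) : set (pvs p))"
 proof -
  have "fin_digraph (base (present p)) <-> (ALL e : fst ` set (pas p). fst (the (map_of (pas p) e)) : set (pvs p) &
    snd (the (map_of (pas p) e)) : set (pvs p))"
   unfolding fin_digraph_def fin_digraph_axioms_def wf_digraph_def present_sel by blast
  also have "... <-> (ALL a : set (pas p). fst (snd a) : set (pvs p) & snd (snd a) : set (pvs p))"
   unfolding ball_simps(9) by (intro ball_cong refl) (simp add: m)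
  finally show ?thesis .
 qed
 have act: "(ALL v : verts (base (present p)). finite (active (present p) v) & 0 ~: active (present p) v) <->
   (ALL x : set (pgs p). snd x ~= 0)"
 proof (intro iffI ballI)
  fix x assume A: "ALL v : verts (base (present p)). finite (active (present p) v) & 0 ~: active (present p) v"
   and x: "x : set (pgs p)"
  have "fst x : set (pvs p)" using g x by blast
  then have "(fst x, 0) ~: set (pgs p)" using A by (simp add: present_sel)
  then show "snd x ~= 0" using x by (metis prod.collapse)
 qed (auto simp: present_sel fin)
 have e1: "(ALL x : set (tarcs (pas p) (pls p)). fst (snd (fst x)) <= snd (snd (fst x)) & fst (snd x) : set (pgs p) & snd (snd x) : set (pgs p)) <->
   (ALL f : set (pls p). fst (snd f) <= snd (snd f) & src (present p) f : set (pgs p) & dst (present p) f : set (pgs p))"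
  unfolding set_tarcs[OF d l] by (simp add: ends_present)
 have e2: "(ALL e : arcs (base (present p)). ALL (t, t') : avail (present p) e.
   t <= t' & t : active (present p) (tail (base (present p)) e) & t' : active (present p) (head (base (present p)) e)) <->
   (ALL f : set (pls p). fst (snd f) <= snd (snd f) & src (present p) f : set (pgs p) & dst (present p) f : set (pgs p))"
  using l unfolding src_def dst_def present_sel by fastforce
 have "temporal_digraph (present p) <-> (ALL a : set (pas p). fst (snd a) : set (pvs p) & snd (snd a) : set (pvs p)) &
   (ALL x : set (pgs p). snd x ~= 0) & (ALL x : set (tarcs (pas p) (pls p)). fst (snd (fst x)) <= snd (snd (fst x)) &
    fst (snd x) : set (pgs p) & snd (snd x) : set (pgs p))"
  unfolding temporal_digraph_def base act e1 e2 ..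
 then show ?thesis unfolding valid_sel using d g l by auto
next
 case False
 then show ?thesis unfolding valid_sel by auto
qed

lemma pt_valid_presentation: "pt f ==> pt (%x. valid_presentation (f x))"
proof -
 have 1: "pt (%p :: presentation. distinct (map fst (pas p)))" by (intro pt_intros)
 have 2: "pt (%p :: presentation. ALL g : set (pgs p). fst g : set (pvs p) & ~ snd g = 0)" by (intro pt_intros)
 have 3: "pt (%p :: presentation. ALL f : set (pls p). fst f : set (map fst (pas p)))" by (intro pt_intros)
 have 4: "pt (%p :: presentation. ALL a : set (pas p). fst (snd a) : set (pvs p) & snd (snd a) : set (pvs p))"
  by (intro pt_intros)
 have 5: "pt (%p :: presentation. ALL x : set (tarcs (pas p) (pls p)). fst (snd (fst x)) <= snd (snd (fst x)) &
    fst (snd x) : set (pgs p) & snd (snd x) : set (pgs p))" by (intro pt_tarcs pt_intros)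
 have "pt valid_presentation"
  using pt_conj[OF 1 pt_conj[OF 2 pt_conj[OF 3 pt_conj[OF 4 5]]]]
  by (subst ext[of valid_presentation, OF valid_presentation_iff])
 then show "pt f ==> pt (%x. valid_presentation (f x))" by (rule pt_comp)
qed

lemma tverts_present: "valid_presentation p ==> tverts (present p) = set (pgs p)"
 unfolding valid_sel tverts_def present_sel by auto

lemma tedges_present: "valid_presentation p ==> tedges (present p) = set (pls p)"
proof -
 assume "valid_presentation p"
 then have "fst ` set (pls p) <= fst ` set (pas p)" by (simp add: valid_sel)
 then show ?thesis unfolding tedges_def present_sel mem_Collect_eq prod.case by (rule restrict_fst)
qed

section \<open>Classes of temporal digraphs that are recognized in polynomial time\<close>

definition decides :: "tdigraph_class => (presentation => bool) => bool" where
 "decides C c <-> pt c & (ALL p. valid_presentation p --> c p = C (present p))"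

lemma decides_any: "decides any_tdigraph (%_. True)"
 by (simp add: decides_def pt_const)

lemma decides_conj: "decides C c ==> decides D d ==> decides (%G. C G & D G) (%p. c p & d p)"
 by (auto simp: decides_def intro: pt_conj)

lemma lifetime_present:
 assumes "valid_presentation p"
 shows "lifetime (present p) = Max (insert 0 (snd ` set (pgs p)))"
proof -
 have "(\<Union>v \<in> verts (base (present p)). active (present p) v) = snd ` set (pgs p)"
  using assms unfolding valid_sel present_sel by force
 then show ?thesis by (simp add: lifetime_def)
qed

lemma lifetime_present_eq:
 assumes "valid_presentation p" "0 < n"
 shows "lifetime (present p) = n <-> (ALL g : set (pgs p). snd g <= n) & (EX g : set (pgs p). snd g = n)"
 unfolding lifetime_present[OF assms(1)] using assms(2) by (subst Max_eq_iff) auto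

lemma decides_lifetime: "0 < n ==> decides (%G. lifetime G = n) (%p. (ALL g : set (pgs p). snd g <= n) & (EX g : set (pgs p). snd g = n))"
 unfolding decides_def using lifetime_present_eq by (auto intro!: pt_intros)

text \<open>The lifetime is written in binary, so the timestamps up to it cannot be enumerated.\<close>

lemma all_eternal_present:
 assumes v: "valid_presentation p"
 shows "all_eternal (present p) <-> (ALL g : set (pgs p). ALL v : set (pvs p). (v, snd g) : set (pgs p)) &
  (ALL g : set (pgs p). snd g = 1 | (EX h : set (pgs p). Suc (snd h) = snd g))"
proof -
 let ?T = "Max (insert 0 (snd ` set (pgs p)))"
 have pos: "snd g ~= 0 & fst g : set (pvs p)" if "g : set (pgs p)" for g using v that unfolding valid_presentation_iff by blast
 have le: "snd g <= ?T" if "g : set (pgs p)" for g using that by (intro Max_ge) auto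
 have ae: "all_eternal (present p) <-> (ALL v : set (pvs p). ALL t : {1..?T}. (v, t) : set (pgs p))"
  unfolding all_eternal_def eternal_def lifetime_present[OF v] present_sel by simp
 show ?thesis unfolding ae
 proof
  assume a: "ALL v : set (pvs p). ALL t : {1..?T}. (v, t) : set (pgs p)"
  have "(v, snd g) : set (pgs p)" if "g : set (pgs p)" "v : set (pvs p)" for g v
   using a that le[OF that(1)] pos[OF that(1)] by simp
  moreover have "snd g = 1 | (EX h : set (pgs p). Suc (snd h) = snd g)" if g: "g : set (pgs p)" for g
  proof (cases "snd g = 1")
   case False
   then have "snd g - 1 : {1..?T}" using pos[OF g] le[OF g] by auto
   then have "(fst g, snd g - 1) : set (pgs p)" using a pos[OF g] by blast
   moreover have "Suc (snd g - 1) = snd g" using pos[OF g] by simp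
   ultimately show ?thesis by force
  qed simp
  ultimately show "(ALL g : set (pgs p). ALL v : set (pvs p). (v, snd g) : set (pgs p)) &
   (ALL g : set (pgs p). snd g = 1 | (EX h : set (pgs p). Suc (snd h) = snd g))" by blast
 next
  assume a: "(ALL g : set (pgs p). ALL v : set (pvs p). (v, snd g) : set (pgs p)) &
   (ALL g : set (pgs p). snd g = 1 | (EX h : set (pgs p). Suc (snd h) = snd g))"
  \<comment> \<open>Every timestamp other than 1 has its predecessor in the list, so all times from
    the largest one down to 1 occur.\<close>
  have down: "EX g : set (pgs p). snd g = ?T - d" if "d < ?T" for d
   using that
  proof (induction d)
   case 0
   have "?T : insert 0 (snd ` set (pgs p))" by (rule Max_in) auto
   then have "?T : snd ` set (pgs p)" using 0 by (simp only: insert_iff) auto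
   then obtain g where "g : set (pgs p)" "?T = snd g" by blast
   then show ?case by (intro bexI[of _ g]) simp_all
  next
   case (Suc d)
   then obtain g where g: "g : set (pgs p)" "snd g = ?T - d" by (meson Suc_lessD)
   then have "snd g ~= 1" using Suc.prems by linarith
   then obtain h where h: "h : set (pgs p)" "Suc (snd h) = snd g" using a g by blast
   then have "snd h = ?T - Suc d" using g by linarith
   then show ?case using h by blast
  qed
  show "ALL v : set (pvs p). ALL t : {1..?T}. (v, t) : set (pgs p)"
  proof (intro ballI)
   fix v t assume v: "v : set (pvs p)" and t: "t : {1..?T}"
   have "?T - t < ?T" "?T - (?T - t) = t" using t by auto
   then obtain g where "g : set (pgs p)" "snd g = t" using down[of "?T - t"] by metis
   then show "(v, t) : set (pgs p)" using a v by blast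
  qed
 qed
qed

lemma decides_all_eternal: "decides all_eternal (%p. (ALL g : set (pgs p). ALL v : set (pvs p). (v, snd g) : set (pgs p)) &
  (ALL g : set (pgs p). snd g = 1 | (EX h : set (pgs p). Suc (snd h) = snd g)))"
 unfolding decides_def using all_eternal_present by (auto intro!: pt_intros)

definition ok_instance :: "nat => (presentation => bool) => problem_instance => bool" where
 "ok_instance k c a <-> valid_presentation (fst a) & c (fst a) & length (snd a) = k &
   (ALL R : set (snd a). ALL r : set R. r : set (pgs (fst a)))"

lemma pt_ok_instance: "pt c ==> pt (ok_instance k c)"
 unfolding ok_instance_def by (intro pt_valid_presentation pt_intros) (rule pt_comp[of c], assumption, intro pt_intros)

lemma ok_instance_iff: "decides C c ==> ok_instance k c a <-> a : instances k C"
proof (cases a)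
 case (Pair p Rs)
 assume C: "decides C c"
 show ?thesis
 proof (cases "valid_presentation p")
  case True
  then have "c p = C (present p)" using C unfolding decides_def by blast
  then show ?thesis using True by (simp add: Pair ok_instance_def instances_def tverts_present subset_eq)
 qed (simp add: Pair ok_instance_def instances_def)
qed

section \<open>Disjoint temporal-spanning branchings in polynomial time\<close>

text \<open>All root sets in one list, each root marked by its branching. The start number 0 is
  written as the length of an empty list, as \<open>pt_enumerate\<close> asks.\<close>

definition tag :: "(nat * nat) list list => (nat * nat * nat) list" where
 "tag Rs = flat (List.enumerate (length ([] :: unit list)) Rs) (%p. map (%r. (fst p, r)) (snd p))"

text \<open>The packing instance has the temporal vertices as vertices, the waits as free pairs and
  the usable temporal edges as arcs. The parameter \<open>sel\<close> admits either all temporal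
  edges or one for each arc.\<close>

definition packing_of :: "nat => (presentation => (nat * nat * nat) list) => problem_instance =>
  (nat * (nat * nat * nat) \<times> (nat * nat) \<times> (nat * nat)) list" where
 "packing_of k sel a = pack k (pgs (fst a)) (wl (pgs (fst a))) (ll (pas (fst a)) (pgs (fst a)) (sel (fst a))) (tag (snd a))"

definition packs :: "nat => (presentation => (nat * nat * nat) list) => problem_instance => bool" where
 "packs k sel a <-> (ALL R : set (snd a). ALL y : set R. ~ nonst (pgs (fst a)) y) &
   packed k (pgs (fst a)) (wl (pgs (fst a))) (tag (snd a)) (packing_of k sel a)"

definition part :: "nat => (presentation => (nat * nat * nat) list) => problem_instance => nat => (nat * nat * nat) list" where
 "part k sel a i = map (%c. fst (snd c)) (filter (%c. fst c = i) (packing_of k sel a))"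

text \<open>Only arcs that carry a chosen temporal edge are kept, because
  \<open>edge_disjoint\<close> compares the arc sets of the outputs. All vertices and active times
  remain.\<close>

definition parts :: "nat => (presentation => (nat * nat * nat) list) => problem_instance => presentation list" where
 "parts k sel a = map (%i. (pvs (fst a), filter (%e. fst e : set (map fst (part k sel a i))) (pas (fst a)),
   pgs (fst a), part k sel a i)) [0..<k]"

lemma tag_iff: "(i, v) : set (tag Rs) <-> i < length Rs & v : set (Rs ! i)"
proof
 assume "i < length Rs & v : set (Rs ! i)"
 then have "(i, Rs ! i) : set (List.enumerate (length ([] :: unit list)) Rs)" "v : set (Rs ! i)"
  by (simp_all add: in_set_enumerate_eq)
 then show "(i, v) : set (tag Rs)" unfolding tag_def set_flat by (intro UN_I[of "(i, Rs ! i)"]) auto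
qed (auto simp: tag_def in_set_enumerate_eq)

lemma rt_tag: "i < length Rs ==> rt (tag Rs) i = set (Rs ! i)"
 by (simp add: rt_def tag_iff)

lemma tag_bounds: "fst ` set (tag Rs) <= {..<length Rs}"
 using tag_iff by auto

lemma pt_tag: "pt f ==> pt (%x. tag (f x))"
 by (rule pt_comp[of tag]) (unfold tag_def, intro pt_flat pt_enumerate pt_intros)

lemma pt_packing_of: "pt sel ==> pt f ==> pt (%x. packing_of k sel (f x))"
proof -
 assume sel: "pt sel" and f: "pt f"
 have s: "pt (%x. sel (g x))" if "pt g" for g :: "'c::tr => presentation" by (rule pt_comp[OF sel that])
 have "pt (packing_of k sel)" unfolding packing_of_def by (intro s pt_pack pt_wl pt_ll pt_tag pt_intros)
 then show ?thesis using f by (rule pt_comp)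
qed

lemma pt_packs: "pt sel ==> pt (packs k sel)"
 unfolding packs_def by (intro pt_packed pt_packing_of pt_nonst pt_wl pt_tag pt_intros)

lemma pt_parts: "pt sel ==> pt (parts k sel)"
 unfolding parts_def part_def by (intro pt_packing_of pt_intros)

context
 fixes k :: nat and C :: tdigraph_class and a :: problem_instance and sel :: "presentation => (nat * nat * nat) list"
 assumes k: "1 <= k" and a: "a : instances k C" and sel: "set (sel (fst a)) <= set (pls (fst a))"
begin

lemma inst:
 "valid_presentation (fst a)" "length (snd a) = k" "i < k ==> set (snd a ! i) <= set (pgs (fst a))"
 "distinct (map fst (pas (fst a)))" "temporal_digraph (present (fst a))"
 "F <= set (sel (fst a)) ==> fst ` F <= fst ` set (pas (fst a))"
proof -
 show v: "valid_presentation (fst a)" and l: "length (snd a) = k" using a by (auto simp: instances_def)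
 show "i < k ==> set (snd a ! i) <= set (pgs (fst a))"
 proof -
  have "set R <= tverts (present (fst a))" if "R : set (snd a)" for R
   using a that unfolding instances_def by (cases a) auto
  then show "i < k ==> set (snd a ! i) <= set (pgs (fst a))" using tverts_present[OF v] l by simp
 qed
 show "distinct (map fst (pas (fst a)))" "temporal_digraph (present (fst a))" using v by (simp_all add: valid_sel)
 show "F <= set (sel (fst a)) ==> fst ` F <= fst ` set (pas (fst a))" using v sel unfolding valid_sel by blast
qed

abbreviation (input) "Gp == present (fst a)"
abbreviation (input) "Vp == pgs (fst a)"
abbreviation (input) "arcl == ll (pas (fst a)) (pgs (fst a)) (sel (fst a))"

lemma set_arcl: "set arcl = ends (pas (fst a)) ` links Gp (set Vp) (set (sel (fst a)))"
 by (rule set_ll[OF inst(4) inst(6)]) simp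

lemma pack_context: "set (wl Vp) <= set Vp \<times> set Vp" "snd ` set arcl <= set Vp \<times> set Vp" "snd ` set (tag (snd a)) <= set Vp"
proof -
 show "set (wl Vp) <= set Vp \<times> set Vp" unfolding set_wl waits_def by auto
 show "snd ` set arcl <= set Vp \<times> set Vp" unfolding set_arcl by (auto simp: ends_present links_def)
 show "snd ` set (tag (snd a)) <= set Vp"
 proof
  fix v assume "v : snd ` set (tag (snd a))"
  then obtain i where "(i, v) : set (tag (snd a))" by (metis imageE prod.collapse)
  then show "v : set Vp" using inst(2) inst(3)[of i] by (auto simp: tag_iff)
 qed
qed

interpretation packing "set Vp" "set (wl Vp)" k
 by unfold_locales (use pack_context in auto)

lemma system_iff_rch:
 assumes F: "F <= set (sel (fst a))" and i: "i < k"
 shows "system Gp (tverts Gp) F (set (snd a ! i)) <->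
  set Vp <= rch (ends (pas (fst a)) ` links Gp (set Vp) F) (rt (tag (snd a)) i) & (ALL y : set (snd a ! i). ~ nonst Vp y)"
proof -
 have "set (snd a ! i) Int set Vp = set (snd a ! i)" using inst(3)[OF i] by blast
 moreover have "snd ` ends (pas (fst a)) ` X = (%f. (src Gp f, dst Gp f)) ` X" for X
  by (simp add: image_image ends_present)
 ultimately show ?thesis
  unfolding system_def tverts_present[OF inst(1)] rch_def
  unfolding set_wl nonst_iff using rt_tag[of i "snd a"] inst(2) i by simp
qed

lemma packs_if_systems:
 assumes F: "!!i. i < k ==> F i <= set (sel (fst a)) & system Gp (tverts Gp) (F i) (set (snd a ! i))"
  and dis: "!!i j. i < k ==> j < k ==> i ~= j ==> F i Int F j = {}"
 shows "packs k sel a"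
proof -
 let ?L = "%i. ends (pas (fst a)) ` links Gp (set Vp) (F i)"
 have "edm (set arcl) (rt (tag (snd a)))"
 proof (rule edm_if_packing[where F = ?L])
  show "?L i <= set arcl" if "i < k" for i
   unfolding set_arcl using F[OF that] by (intro image_mono) (auto simp: links_def)
  show "?L i Int ?L j = {}" if "i < k" "j < k" "i ~= j" for i j
   using dis[OF that] by (auto simp: ends_def links_def)
  show "set Vp <= rch (?L i) (rt (tag (snd a)) i)" if "i < k" for i
   using F[OF that] system_iff_rch[OF _ that, of "F i"] by blast
 qed simp
 from pack_complete[OF pack_context k _ this] have "packed k Vp (wl Vp) (tag (snd a)) (packing_of k sel a)"
  using tag_bounds[of "snd a"] inst(2) by (simp add: packing_of_def)
 moreover have "~ nonst Vp y" if R: "R : set (snd a)" "y : set R" for R y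
 proof -
  obtain i where "i < k" "R = snd a ! i" using R(1) inst(2) by (metis in_set_conv_nth)
  then show ?thesis using F[of i] system_iff_rch[of "F i" i] R(2) by blast
 qed
 ultimately show ?thesis by (simp add: packs_def)
qed

lemma parts_if_packs:
 assumes p: "packs k sel a"
 shows "i < k ==> set (part k sel a i) <= set (sel (fst a))"
  and "i < k ==> links Gp (tverts Gp) (set (part k sel a i)) = set (part k sel a i)"
  and "i < k ==> inj_on (dst Gp) (set (part k sel a i))"
  and "i < k ==> dst Gp ` set (part k sel a i) Int set (snd a ! i) = {}"
  and "i < k ==> system Gp (tverts Gp) (set (part k sel a i)) (set (snd a ! i))"
  and "i ~= j ==> set (part k sel a i) Int set (part k sel a j) = {}"
  and "i < k ==> carves Gp (tverts Gp) (set (part k sel a i)) (present (parts k sel a ! i))"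
  and "i < k ==> valid_presentation (parts k sel a ! i)"
proof -
 let ?st = "packing_of k sel a" and ?e = "ends (pas (fst a))"
 have st: "snd ` set ?st <= set arcl" "distinct (map snd ?st)" "!!i. inj_on hd_of (chosen ?st i)"
  "!!i. hd_of ` chosen ?st i Int rt (tag (snd a)) i = {}"
 proof -
  note pv = pinv_pack[OF pack_context, of k, unfolded pinv_def[OF pack_context], folded packing_of_def]
  show "snd ` set ?st <= set arcl" using pv by (elim conjE)
  show "distinct (map snd ?st)" using pv by (elim conjE)
  have "ALL i. inj_on hd_of (chosen ?st i)" using pv by (elim conjE)
  then show "inj_on hd_of (chosen ?st i)" for i by simp
  have "ALL i. hd_of ` chosen ?st i Int rt (tag (snd a)) i = {}" using pv by (elim conjE)
  then show "hd_of ` chosen ?st i Int rt (tag (snd a)) i = {}" for i by simp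
 qed
 have e: "c = ?e (fst c) & fst c : links Gp (set Vp) (set (sel (fst a)))" if "c : set arcl" for c
  using that unfolding set_arcl by (auto simp: ends_def)
 have pt: "set (part k sel a i) = fst ` chosen ?st i" for i
  unfolding part_def chosen_def fiber_eq set_map set_filter image_image ..
 have ch: "chosen ?st i <= set arcl" for i using st(1) unfolding chosen_def fiber_eq by blast
 have ch_eq: "chosen ?st i = ?e ` set (part k sel a i)" for i
 proof -
  have "chosen ?st i = (%c. c) ` chosen ?st i" by simp
  also have "... = (%c. ?e (fst c)) ` chosen ?st i" using ch[of i] e by (intro image_cong refl) blast
  finally show ?thesis unfolding pt image_image .
 qed
 have sub: "set (part k sel a i) <= links Gp (set Vp) (set (sel (fst a)))" for i
  unfolding pt using ch[of i] e by blast
 show 1: "set (part k sel a i) <= set (sel (fst a))" for i using sub[of i] unfolding links_def by blast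
 show 2: "links Gp (tverts Gp) (set (part k sel a i)) = set (part k sel a i)" for i
  unfolding tverts_present[OF inst(1)] using sub[of i] unfolding links_def by blast
 show 3: "inj_on (dst Gp) (set (part k sel a i))" for i
 proof (rule inj_onI)
  fix f g assume fg: "f : set (part k sel a i)" "g : set (part k sel a i)" "dst Gp f = dst Gp g"
  have "?e f : chosen ?st i" "?e g : chosen ?st i" unfolding ch_eq using fg by blast+
  moreover have "hd_of (?e f) = hd_of (?e g)" using fg(3) by (simp add: ends_present)
  ultimately have "?e f = ?e g" using st(3)[of i] by (auto dest: inj_onD)
  then show "f = g" by (simp add: ends_def)
 qed
 show 4: "dst Gp ` set (part k sel a i) Int set (snd a ! i) = {}" if "i < k" for i
  using st(4)[of i] rt_tag[of i "snd a"] that inst(2) unfolding ch_eq image_image by (simp add: ends_present)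
 show 5: "system Gp (tverts Gp) (set (part k sel a i)) (set (snd a ! i))" if i: "i < k" for i
 proof -
  have "set Vp <= rch (chosen ?st i) (rt (tag (snd a)) i)"
   unfolding packing_of_def by (rule pack_sound[OF pack_context _ i]) (use p in \<open>simp add: packs_def packing_of_def\<close>)
  moreover have "ALL y : set (snd a ! i). ~ nonst Vp y" using p inst(2) i unfolding packs_def by auto
  ultimately show ?thesis
   unfolding system_iff_rch[OF 1 i] ch_eq using 2[of i] unfolding tverts_present[OF inst(1)] by simp
 qed
 show "set (part k sel a i) Int set (part k sel a j) = {}" if ij: "i ~= j"
 proof (rule ccontr)
  assume "set (part k sel a i) Int set (part k sel a j) ~= {}"
  then obtain f where "f : set (part k sel a i)" "f : set (part k sel a j)" by blast
  then have "?e f : chosen ?st i" "?e f : chosen ?st j" unfolding ch_eq by blast+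
  then have "(i, ?e f) : set ?st" "(j, ?e f) : set ?st" by (simp_all add: chosen_def)
  moreover have "inj_on snd (set ?st)" using st(2) by (simp add: distinct_map)
  ultimately show False using ij inj_onD[of snd "set ?st" "(i, ?e f)" "(j, ?e f)"] by simp
 qed
 have carve: "carves Gp (tverts Gp) (set (part k sel a i)) (present (parts k sel a ! i))" if i: "i < k" for i
 proof -
  have nth: "parts k sel a ! i = (pvs (fst a), filter (%e. fst e : set (map fst (part k sel a i))) (pas (fst a)), pgs (fst a), part k sel a i)"
   using i by (simp add: parts_def)
  have fs: "fst ` {x : set (pas (fst a)). fst x : fst ` set (part k sel a i)} = fst ` set (part k sel a i)"
   by (rule fst_filter_image[OF inst(6)[OF 1[of i]]])
  have mo: "map_of (filter (%e. fst e : fst ` set (part k sel a i)) (pas (fst a))) x = map_of (pas (fst a)) x"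
   if "x : fst ` set (part k sel a i)" for x
   using that by (rule map_of_filter_key)
  show ?thesis unfolding carves_def tverts_present[OF inst(1)] present_sel nth
   using mo by (simp add: fs)
 qed
 then show "i < k ==> carves Gp (tverts Gp) (set (part k sel a i)) (present (parts k sel a ! i))" .
 show "valid_presentation (parts k sel a ! i)" if i: "i < k"
 proof -
  have nth: "parts k sel a ! i = (pvs (fst a), filter (%e. fst e : set (map fst (part k sel a i))) (pas (fst a)), pgs (fst a), part k sel a i)"
   using i by (simp add: parts_def)
  have "ALL f : set (part k sel a i). src Gp f : tverts Gp & dst Gp f : tverts Gp"
   using 2[of i] unfolding links_def by blast
  moreover have "set (part k sel a i) <= tedges Gp" using 1[of i] sel tedges_present[OF inst(1)] by blast
  ultimately have "tsubdigraph (present (parts k sel a ! i)) Gp"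
   by (intro carvesD(4)[OF carve[OF i] inst(5)]) simp_all
  then have "temporal_digraph (present (parts k sel a ! i))" by (simp add: tsubdigraph_def)
  moreover have "distinct (map fst (filter (%e. fst e : set (map fst (part k sel a i))) (pas (fst a))))"
   using inst(4) by (rule distinct_map_filter)
  moreover have "fst ` set Vp <= set (pvs (fst a))" using inst(1) by (simp add: valid_sel)
  moreover have "fst ` set (part k sel a i) <= fst ` set (filter (%e. fst e : set (map fst (part k sel a i))) (pas (fst a)))"
   unfolding set_filter set_map fst_filter_image[OF inst(6)[OF 1[of i]]] by simp
  ultimately show ?thesis unfolding valid_sel nth by simp
 qed
qed

end

definition separates :: "nat => tdigraph_class => ((nat * nat * nat) set => (nat * nat * nat) set => bool) =>
  (presentation => (nat * nat * nat) list) => bool" where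
 "separates k C D sel <-> (ALL p Rs. (p, Rs) : instances k C --> set (sel p) <= set (pls p) &
   (ALL F F'. F <= set (sel p) --> F' <= set (sel p) --> F Int F' = {} --> D F F') &
   (ALL F. (ALL i < k. F i <= set (pls p) & system (present p) (tverts (present p)) (F i) (set (Rs ! i))) -->
    (ALL i < k. ALL j < k. i ~= j --> D (F i) (F j)) -->
    (EX F'. (ALL i < k. F' i <= set (sel p) & system (present p) (tverts (present p)) (F' i) (set (Rs ! i))) &
     (ALL i < k. ALL j < k. i ~= j --> F' i Int F' j = {}))))"

lemma separatesD:
 assumes "separates k C D sel" "(p, Rs) : instances k C"
 shows "set (sel p) <= set (pls p)" "F <= set (sel p) ==> F' <= set (sel p) ==> F Int F' = {} ==> D F F'"
  "ALL i < k. H i <= set (pls p) & system (present p) (tverts (present p)) (H i) (set (Rs ! i)) ==>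
    ALL i < k. ALL j < k. i ~= j --> D (H i) (H j) ==>
    EX F'. (ALL i < k. F' i <= set (sel p) & system (present p) (tverts (present p)) (F' i) (set (Rs ! i))) &
     (ALL i < k. ALL j < k. i ~= j --> F' i Int F' j = {})"
proof -
 note s = assms(1)[unfolded separates_def, rule_format, OF assms(2)]
 show "set (sel p) <= set (pls p)" by (rule conjunct1[OF s])
 show "F <= set (sel p) ==> F' <= set (sel p) ==> F Int F' = {} ==> D F F'"
  by (rule conjunct1[OF conjunct2[OF s], rule_format])
 assume H: "ALL i < k. H i <= set (pls p) & system (present p) (tverts (present p)) (H i) (set (Rs ! i))"
  "ALL i < k. ALL j < k. i ~= j --> D (H i) (H j)"
 show "EX F'. (ALL i < k. F' i <= set (sel p) & system (present p) (tverts (present p)) (F' i) (set (Rs ! i))) &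
     (ALL i < k. ALL j < k. i ~= j --> F' i Int F' j = {})"
  using conjunct2[OF conjunct2[OF s]] H by blast
qed

lemma packs_correct:
 assumes k: "1 <= k" and dis: "disjointness_of dis D" and sep: "separates k C D sel" and a: "a : instances k C"
 shows "packs k sel a ==> disjoint_branchings dis temporal_spanning (present (fst a)) (map set (snd a)) (map present (parts k sel a))"
  and "(EX Bs. disjoint_branchings dis temporal_spanning (present (fst a)) (map set (snd a)) Bs) ==> packs k sel a"
proof -
 obtain p Rs where pR: "a = (p, Rs)" by (cases a)
 note s = separatesD[OF sep a[unfolded pR]]
 have sel: "set (sel (fst a)) <= set (pls (fst a))" using s(1) by (simp add: pR)
 note i = inst[where sel = sel, OF k a sel]
 {
  assume p: "packs k sel a"
  note parts = parts_if_packs[where sel = sel, OF k a sel p]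
  have te: "tedges (present (fst a)) = set (pls (fst a))" by (rule tedges_present[OF i(1)])
  show "disjoint_branchings dis temporal_spanning (present (fst a)) (map set (snd a)) (map present (parts k sel a))"
  proof (rule disjoint_branchings_of_carves[OF i(5) dis spanning_of_temporal, where W = "%_. tverts (present (fst a))"
     and F = "%i. set (part k sel a i)"])
   show "length (map present (parts k sel a)) = length (map set (snd a))" using i(2) by (simp add: parts_def)
   fix i assume "i < length (map set (snd a))"
   then have ik: "i < k" using i(2) by simp
   have ni: "map set (snd a) ! i = set (snd a ! i)" using ik i(2) by simp
   show "tverts (present (fst a)) = tverts (present (fst a)) & set (part k sel a i) <= tedges (present (fst a)) &
     links (present (fst a)) (tverts (present (fst a))) (set (part k sel a i)) = set (part k sel a i) &
     inj_on (dst (present (fst a))) (set (part k sel a i)) &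
     dst (present (fst a)) ` set (part k sel a i) Int map set (snd a) ! i = {} &
     system (present (fst a)) (tverts (present (fst a))) (set (part k sel a i)) (map set (snd a) ! i)"
    unfolding ni te using parts(1-5)[OF ik] sel by blast
   have "map present (parts k sel a) ! i = present (parts k sel a ! i)" using ik by (simp add: parts_def)
   then show "carves (present (fst a)) (tverts (present (fst a))) (set (part k sel a i)) (map present (parts k sel a) ! i)"
    using parts(7)[OF ik] by simp
  next
   fix i j assume "i < length (map set (snd a))" "j < length (map set (snd a))" "i ~= j"
   then have ij: "i < k" "j < k" "i ~= j" using i(2) by simp_all
   show "D (set (part k sel a i)) (set (part k sel a j))"
    using s(2)[of "set (part k sel a i)" "set (part k sel a j)"] parts(1)[OF ij(1)] parts(1)[OF ij(2)] parts(6)[OF ij(3)]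
    by (simp add: pR)
  qed
 }
 assume ex: "EX Bs. disjoint_branchings dis temporal_spanning (present (fst a)) (map set (snd a)) Bs"
 have Rt: "map set (snd a) ! j <= tverts (present (fst a))" if "j < length (map set (snd a))" for j
  using that i(2) i(3)[of j] by (simp add: tverts_present[OF i(1)])
 have "EX W F. (ALL i < length (map set (snd a)). W i = tverts (present (fst a)) & F i <= tedges (present (fst a)) &
   system (present (fst a)) (W i) (F i) (map set (snd a) ! i)) &
   (ALL i < length (map set (snd a)). ALL j < length (map set (snd a)). i ~= j --> D (F i) (F j))"
  by (rule iffD1[OF branchings_iff_systems[OF i(5) dis spanning_of_temporal] ex]) (rule Rt)
 then obtain W F where WF: "ALL i < length (map set (snd a)). W i = tverts (present (fst a)) & F i <= tedges (present (fst a)) &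
   system (present (fst a)) (W i) (F i) (map set (snd a) ! i)"
  and D: "ALL i < length (map set (snd a)). ALL j < length (map set (snd a)). i ~= j --> D (F i) (F j)"
  by - (elim exE conjE, rule that)
 have 1: "ALL i < k. F i <= set (pls p) & system (present p) (tverts (present p)) (F i) (set (Rs ! i))"
 proof (intro allI impI)
  fix j assume j: "j < k"
  have "map set (snd a) ! j = set (Rs ! j)" and jl: "j < length (map set (snd a))" using j i(2) by (simp_all add: pR)
  with WF[rule_format, OF jl] tedges_present[OF i(1)]
  show "F j <= set (pls p) & system (present p) (tverts (present p)) (F j) (set (Rs ! j))"
   by (elim conjE) (simp add: pR)
 qed
 have 2: "ALL i < k. ALL j < k. i ~= j --> D (F i) (F j)" using D i(2) by simp
 from s(3)[OF 1 2] obtain F' where F': "ALL i < k. F' i <= set (sel p) & system (present p) (tverts (present p)) (F' i) (set (Rs ! i))"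
  "ALL i < k. ALL j < k. i ~= j --> F' i Int F' j = {}" by - (elim exE conjE, rule that)
 show "packs k sel a"
  by (rule packs_if_systems[where sel = sel and F = F', OF k a sel]) (use F' in \<open>simp_all add: pR\<close>)
qed

theorem solvable_if_separates:
 assumes k: "1 <= k" and dis: "disjointness_of dis D" and sep: "separates k C D sel" and sel: "pt sel" and C: "decides C c"
 shows "solvable_poly_time dis temporal_spanning k C"
 unfolding solvable_poly_time_def
proof
 have iff: "(EX Bs. disjoint_branchings dis temporal_spanning (present (fst a)) (map set (snd a)) Bs) <-> packs k sel a"
  if "a : instances k C" for a using packs_correct[OF k dis sep that] by blast
 have ptc: "pt c" using C by (simp add: decides_def)
 have "branching_problem dis temporal_spanning k C = {enc_instance a | a. ok_instance k c a & packs k sel a}"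
  unfolding branching_problem_def ok_instance_iff[OF C] using iff by fastforce
 moreover have "{enc_instance a | a. ok_instance k c a & packs k sel a} : class_P"
  by (intro class_P_I codec_instance pt_conj pt_ok_instance[OF ptc] pt_packs[OF sel])
 ultimately show "branching_problem dis temporal_spanning k C : class_P" by simp
 obtain d where d: "pt d" "!!w a. d w = Some a <-> w = enc_instance a" "!!a. d (enc_instance a) = Some a"
  by (rule codec_decode[OF codec_instance]) (rule that)
 define f where "f w = (case d w of None => [False] | Some a =>
   if packs k sel a then True # enc_list enc_presentation (parts k sel a) else [False])" for w
 have "pt (enc_list enc_presentation)" by (intro codec_pt codec_list codec_presentation)
 then have "pt (%a. if packs k sel a then True # enc_list enc_presentation (parts k sel a) else [False])"
  by (rule pt_if[OF pt_packs[OF sel] pt_Cons[OF pt_const pt_comp[OF _ pt_parts[OF sel]]] pt_const])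
 from pt_case_option[OF d(1) pt_const pt_comp[OF this pt_snd[OF pt_id]]] have "pt f" unfolding f_def .
 then have pf: "poly_time f" by (rule poly_time_if_pt)
 have main: "if EX Bs. disjoint_branchings dis temporal_spanning (present p) (map set Rs) Bs
    then EX bs. (ALL b : set bs. valid_presentation b) &
        disjoint_branchings dis temporal_spanning (present p) (map set Rs) (map present bs) &
        f (enc_instance (p, Rs)) = True # enc_list enc_presentation bs
    else f (enc_instance (p, Rs)) = [False]" if a: "(p, Rs) : instances k C" for p Rs
 proof -
  have sub: "set (sel (fst (p, Rs))) <= set (pls (fst (p, Rs)))" using separatesD(1)[OF sep a] by simp
  have val: "valid_presentation b" if pb: "packs k sel (p, Rs)" "b : set (parts k sel (p, Rs))" for b
  proof -
   have "length (parts k sel (p, Rs)) = k" by (simp add: parts_def)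
   then obtain i where "i < k" "b = parts k sel (p, Rs) ! i" using pb(2) by (metis in_set_conv_nth)
   then show ?thesis using parts_if_packs(8)[where sel = sel, OF k a sub pb(1)] by blast
  qed
  show ?thesis
  proof (cases "packs k sel (p, Rs)")
   case True
   have "f (enc_instance (p, Rs)) = True # enc_list enc_presentation (parts k sel (p, Rs))" using True by (simp add: f_def d(3))
   moreover have "disjoint_branchings dis temporal_spanning (present p) (map set Rs) (map present (parts k sel (p, Rs)))"
    using packs_correct(1)[OF k dis sep a True] by simp
   moreover from this have "EX Bs. disjoint_branchings dis temporal_spanning (present p) (map set Rs) Bs" by blast
   ultimately show ?thesis using val[OF True] by (simp only: if_True) blast
  next
   case False
   then show ?thesis using iff[OF a] by (simp add: f_def d(3))
  qed
 qed
 show "find_branchings_poly_time dis temporal_spanning k C"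
  unfolding find_branchings_poly_time_def by (intro exI[of _ f] conjI ballI, rule pf) (clarify, rule main)
qed

theorem t_edge_disjoint_solvable: "1 <= k ==> solvable_poly_time t_edge_disjoint temporal_spanning k any_tdigraph"
proof (rule solvable_if_separates[OF _ disjointness_of_t _ _ decides_any, where sel = pls])
 show "separates k any_tdigraph (%F F'. F Int F' = {}) pls" unfolding separates_def by blast
 show "pt pls" by (rule pt_snd[OF pt_snd[OF pt_snd[OF pt_id]]])
qed

definition single_start :: "('v * nat) set => bool" where
 "single_start W <-> (ALL v t t'. (v, t) : W --> (v, t') : W --> ~ nonstart W (v, t) --> ~ nonstart W (v, t') --> t = t')"

text \<open>Going back in time from \<open>(v, u)\<close> as long as \<open>v\<close> is active ends
  at a start of \<open>v\<close>, which can only be \<open>(v, t)\<close>.\<close>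

lemma wait_from_start:
 assumes s: "single_start W" and y: "(v, t) : W" "~ nonstart W (v, t)" and u: "(v, u) : W"
 shows "((v, t), (v, u)) : (waits W)\<^sup>*"
 using u
proof (induction u rule: less_induct)
 case (less u)
 show ?case
 proof (cases "nonstart W (v, u)")
  case True
  then obtain u' where u': "u = Suc u'" "(v, u') : W" by (auto simp: nonstart_def)
  have "((v, t), (v, u')) : (waits W)\<^sup>*" by (rule less.IH) (simp_all add: u')
  moreover have "((v, u'), (v, u)) : waits W" using u' less.prems by (auto simp: waits_def)
  ultimately show ?thesis by (rule rtrancl.rtrancl_into_rtrancl)
 next
  case False
  then have "u = t" using s y less.prems unfolding single_start_def by blast
  then show ?thesis by simp
 qed
qed

text \<open>If every vertex has a single start, all temporal edges of an arc that end there are interchangeable,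
 since the whole vertex is reached as soon as its start is.\<close>

lemma system_exchange:
 assumes s: "single_start W" and sys: "system G W F R"
  and F': "!!f. f : links G W F ==> EX g : links G W F'. fst g = fst f"
 shows "system G W F' R"
proof -
 let ?E = "%F. waits W Un (%f. (src G f, dst G f)) ` links G W F"
 have wm: "(waits W)\<^sup>* <= (?E F')\<^sup>*" by (rule rtrancl_mono) blast
 \<comment> \<open>Strengthened from \<open>y\<close> to all active times of its vertex, because the
   substitute edge may leave the tail at another time than the original one.\<close>
 have all: "ALL u. (fst y, u) : W --> (r, (fst y, u)) : (?E F')\<^sup>*" if r: "r : R" "r : W" and "(r, y) : (?E F)\<^sup>*" for r y
  using that(3)
 proof (induction rule: rtrancl_induct)
  case base
  have "~ nonstart W r" using sys r by (simp add: system_def)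
  then show ?case using wait_from_start[OF s, of "fst r" "snd r"] r wm by auto
 next
  case (step y z)
  from step.hyps(2) show ?case
  proof
   assume "(y, z) : waits W"
   then have "fst z = fst y" by (auto simp: waits_def)
   then show ?thesis using step.IH by simp
  next
   assume "(y, z) : (%f. (src G f, dst G f)) ` links G W F"
   then obtain f where f: "f : links G W F" "y = src G f" "z = dst G f" by blast
   obtain g where g: "g : links G W F'" "fst g = fst f" using F'[OF f(1)] by blast
   have gW: "src G g : W" "dst G g : W" "~ nonstart W (dst G g)" using g(1) by (simp_all add: links_def)
   have "fst (src G g) = fst y" "fst (dst G g) = fst z" using g(2) f by (simp_all add: src_def dst_def)
   then have sg: "src G g = (fst y, snd (src G g))" "dst G g = (fst z, snd (dst G g))" by (metis prod.collapse)+
   have "(fst y, snd (src G g)) : W" using gW(1) by (simp only: sg(1)[symmetric])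
   from step.IH[rule_format, OF this] have "(r, src G g) : (?E F')\<^sup>*" by (simp only: sg(1)[symmetric])
   moreover have "(src G g, dst G g) : ?E F'" using g(1) by blast
   ultimately have rd: "(r, dst G g) : (?E F')\<^sup>*" by (rule rtrancl.rtrancl_into_rtrancl)
   have "(dst G g, (fst z, u)) : (?E F')\<^sup>*" if "(fst z, u) : W" for u
   proof -
    have "((fst z, snd (dst G g)), (fst z, u)) : (waits W)\<^sup>*"
     by (rule wait_from_start[OF s _ _ that]) (simp_all only: sg(2)[symmetric] gW(2,3) not_False_eq_True)
    then have "(dst G g, (fst z, u)) : (waits W)\<^sup>*" by (simp only: sg(2)[symmetric])
    then show ?thesis using wm by blast
   qed
   then show ?thesis using rtrancl_trans[OF rd] by blast
  qed
 qed
 have "y : (?E F')\<^sup>* `` (R Int W)" if y: "y : W" for y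
 proof -
  obtain r where r: "r : R" "r : W" "(r, y) : (?E F)\<^sup>*" using sys y unfolding system_def by blast
  have "(r, y) : (?E F')\<^sup>*" using all[OF r, rule_format, of "snd y"] y by simp
  with r show ?thesis by blast
 qed
 then show ?thesis using sys unfolding system_def by blast
qed

lemma case_first: "x : set (case l of [] => [] | f # _ => [f]) <-> (EX r. l = x # r)"
 by (cases l) auto

text \<open>Each arc is represented by one of its usable temporal edges, if there is any. Owning the
  arc is then the same as owning its representative.\<close>

definition one_per_arc :: "presentation => (nat * nat * nat) list" where
 "one_per_arc p = flat (pas p) (%a. case filter (%f. fst f = fst a) (map fst (ll (pas p) (pgs p) (pls p))) of
   [] => [] | f # _ => [f])"

lemma pt_one_per_arc: "pt one_per_arc"
 unfolding one_per_arc_def by (intro pt_flat pt_ll pt_intros)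

lemma one_per_arc:
 assumes v: "valid_presentation p"
 shows "set (one_per_arc p) <= links (present p) (tverts (present p)) (set (pls p))"
  "inj_on fst (set (one_per_arc p))"
  "f : links (present p) (tverts (present p)) (set (pls p)) ==> EX g : set (one_per_arc p). fst g = fst f"
proof -
 have d: "distinct (map fst (pas p))" and l: "fst ` set (pls p) <= fst ` set (pas p)" using v by (auto simp: valid_sel)
 let ?L = "map fst (ll (pas p) (pgs p) (pls p))"
 have L: "set ?L = links (present p) (tverts (present p)) (set (pls p))"
  unfolding set_map set_ll[OF d l] tverts_present[OF v] image_image by (simp add: ends_def)
 have mem: "f : set (one_per_arc p) <-> (EX a : set (pas p). EX r. filter (%f. fst f = fst a) ?L = f # r)" for f
  unfolding one_per_arc_def set_flat by (simp only: UN_iff case_first)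
 have hd: "f : set ?L & fst f = fst a" if "filter (%f. fst f = fst a) ?L = f # r" for f a r
 proof -
  have "f : set (filter (%f. fst f = fst a) ?L)" unfolding that by simp
  then show ?thesis by simp
 qed
 show "set (one_per_arc p) <= links (present p) (tverts (present p)) (set (pls p))"
  unfolding L[symmetric] using mem hd by blast
 show "inj_on fst (set (one_per_arc p))"
 proof (rule inj_onI)
  fix f g assume fg: "f : set (one_per_arc p)" "g : set (one_per_arc p)" "fst f = fst g"
  obtain a :: "nat * nat * nat" and r where a: "filter (%f. fst f = fst a) ?L = f # r" using iffD1[OF mem fg(1)] by - (elim bexE exE, rule that)
  obtain b :: "nat * nat * nat" and s where b: "filter (%f. fst f = fst b) ?L = g # s" using iffD1[OF mem fg(2)] by - (elim bexE exE, rule that)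
  have "fst a = fst b" using hd[OF a] hd[OF b] fg(3) by simp
  then show "f = g" using a b by simp
 qed
 assume f: "f : links (present p) (tverts (present p)) (set (pls p))"
 then have "fst f : fst ` set (pas p)" using l by (auto simp: links_def)
 then obtain a where a: "a : set (pas p)" "fst a = fst f" by auto
 have "f : set (filter (%f. fst f = fst a) ?L)" using f L a by simp
 then obtain g r where g: "filter (%f. fst f = fst a) ?L = g # r" by (cases "filter (%f. fst f = fst a) ?L") auto
 then show "EX g : set (one_per_arc p). fst g = fst f" using mem a hd[OF g] by metis
qed

lemma separates_one_per_arc:
 assumes "!!p. valid_presentation p ==> C (present p) ==> single_start (tverts (present p))"
 shows "separates k C (%F F'. fst ` F Int fst ` F' = {}) one_per_arc"
 unfolding separates_def
proof (intro allI impI conjI)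
 fix p Rs assume pR: "(p, Rs) : instances k C"
 then have v: "valid_presentation p" and C: "C (present p)" by (auto simp: instances_def)
 note s = assms[OF v C] and o = one_per_arc[OF v]
 show "set (one_per_arc p) <= set (pls p)" using o(1) by (auto simp: links_def)
 show "fst ` F Int fst ` F' = {}" if "F <= set (one_per_arc p)" "F' <= set (one_per_arc p)" "F Int F' = {}" for F F'
  using that inj_on_image_Int[OF o(2) that(1,2)] by simp
 fix F assume F: "ALL i < k. F i <= set (pls p) & system (present p) (tverts (present p)) (F i) (set (Rs ! i))"
  and D: "ALL i < k. ALL j < k. i ~= j --> fst ` F i Int fst ` F j = {}"
 \<comment> \<open>Each branching trades its temporal edges for the representatives of the arcs they
   belong to; arc-disjointness carries over.\<close>
 define F' where "F' i = {f : set (one_per_arc p). fst f : fst ` F i}" for i :: nat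
 have "system (present p) (tverts (present p)) (F' i) (set (Rs ! i))" if i: "i < k" for i
 proof (rule system_exchange[OF s])
  show "system (present p) (tverts (present p)) (F i) (set (Rs ! i))" using F i by blast
  fix f assume f: "f : links (present p) (tverts (present p)) (F i)"
  then have "f : links (present p) (tverts (present p)) (set (pls p))" using F i by (auto simp: links_def)
  then obtain g where g: "g : set (one_per_arc p)" "fst g = fst f" using o(3) by blast
  have "fst f : fst ` F i" using f by (auto simp: links_def)
  then have "g : F' i" using g by (simp add: F'_def)
  moreover have "g : links (present p) (tverts (present p)) (set (pls p))" using o(1) g(1) by blast
  ultimately have "g : links (present p) (tverts (present p)) (F' i)" by (simp add: links_def)
  then show "EX g : links (present p) (tverts (present p)) (F' i). fst g = fst f" using g(2) by blast
 qed
 moreover have "F' i Int F' j = {}" if "i < k" "j < k" "i ~= j" for i j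
  using D that unfolding F'_def by blast
 moreover have "F' i <= set (one_per_arc p)" for i by (auto simp: F'_def)
 ultimately show "EX F'. (ALL i < k. F' i <= set (one_per_arc p) & system (present p) (tverts (present p)) (F' i) (set (Rs ! i))) &
     (ALL i < k. ALL j < k. i ~= j --> F' i Int F' j = {})"
  by (intro exI[of _ F']) simp
qed

text \<open>A time \<open>t\<close> other than 1 at which some vertex is active is preceded by an
  active time of the same vertex, so all starts are at time 1.\<close>

lemma single_start_eternal:
 assumes v: "valid_presentation p" and "all_eternal (present p)"
 shows "single_start (tverts (present p))"
proof -
 have a: "(ALL g : set (pgs p). ALL v : set (pvs p). (v, snd g) : set (pgs p)) &
  (ALL g : set (pgs p). snd g = 1 | (EX h : set (pgs p). Suc (snd h) = snd g))"
  using assms(2) unfolding all_eternal_present[OF v] .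
 have "t = 1" if g: "(u, t) : set (pgs p)" "~ nonstart (set (pgs p)) (u, t)" for u t
 proof (rule ccontr)
  assume "t ~= 1"
  then obtain h where h: "h : set (pgs p)" "Suc (snd h) = t" using a g(1) by force
  have "u : set (pvs p)" using v g(1) unfolding valid_presentation_iff by force
  then have "(u, snd h) : set (pgs p)" using a h(1) by blast
  then show False using g(2) h(2) by (auto simp: nonstart_def)
 qed
 then show ?thesis unfolding single_start_def tverts_present[OF v] by metis
qed

text \<open>Only the times 1 and 2 occur, and time 2 is a start exactly for vertices that are not
  active at time 1.\<close>

lemma single_start_lifetime_2:
 assumes v: "valid_presentation p" and l: "lifetime (present p) = 2"
 shows "single_start (tverts (present p))"
proof -
 have "t = 1 | t = 2" if "(u, t) : set (pgs p)" for u t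
 proof -
  have "t <= 2" using l lifetime_present_eq[OF v, of 2] that by force
  moreover have "t ~= 0" using v that unfolding valid_presentation_iff by force
  ultimately show ?thesis by linarith
 qed
 moreover have "nonstart (set (pgs p)) (u, 2)" if "(u, 1) : set (pgs p)" for u
  using that by (auto simp: nonstart_def numeral_2_eq_2)
 ultimately show ?thesis unfolding single_start_def tverts_present[OF v] by metis
qed

theorem edge_disjoint_solvable_eternal: "1 <= k ==> solvable_poly_time edge_disjoint temporal_spanning k all_eternal"
 by (rule solvable_if_separates[OF _ disjointness_of_e separates_one_per_arc[OF single_start_eternal] pt_one_per_arc decides_all_eternal])

theorem edge_disjoint_solvable_lifetime_2: "1 <= k ==> solvable_poly_time edge_disjoint temporal_spanning k (%G. lifetime G = 2)"
 by (rule solvable_if_separates[OF _ disjointness_of_e separates_one_per_arc[OF single_start_lifetime_2] pt_one_per_arc decides_lifetime]) simp_all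

section \<open>Membership in NP\<close>

abbreviation numbered :: "'a list => (nat * 'a) list" where
 "numbered xs == List.enumerate (length ([] :: unit list)) xs"

lemma numbered_iff: "(i, x) : set (numbered xs) <-> i < length xs & x = xs ! i"
 by (auto simp: in_set_enumerate_eq)

lemma Ball_numbered: "(ALL p : set (numbered xs). P (fst p) (snd p)) <-> (ALL i < length xs. P i (xs ! i))"
proof
 assume "ALL p : set (numbered xs). P (fst p) (snd p)"
 then show "ALL i < length xs. P i (xs ! i)" by (metis numbered_iff fst_conv snd_conv)
next
 assume r: "ALL i < length xs. P i (xs ! i)"
 show "ALL p : set (numbered xs). P (fst p) (snd p)"
 proof
  fix p assume "p : set (numbered xs)"
  then have "fst p < length xs & snd p = xs ! fst p" using numbered_iff[of "fst p" "snd p" xs] by simp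
  then show "P (fst p) (snd p)" using r by simp
 qed
qed

lemma Ball_numbered2:
 "(ALL p : set (numbered xs). ALL q : set (numbered ys). Q (fst p) (snd p) (fst q) (snd q)) <->
  (ALL i < length xs. ALL j < length ys. Q i (xs ! i) j (ys ! j))"
proof -
 have "(ALL q : set (numbered ys). Q i (xs ! i) (fst q) (snd q)) <-> (ALL j < length ys. Q i (xs ! i) j (ys ! j))" for i
  by (rule Ball_numbered)
 then show ?thesis
  using Ball_numbered[of xs "%i x. ALL q : set (numbered ys). Q i x (fst q) (snd q)"] by simp
qed

lemma branchings_iff_instance:
 assumes a: "a : instances k C" and dis: "disjointness_of dis D" and spn: "spanning_of spn wok"
 shows "(EX Bs. disjoint_branchings dis spn (present (fst a)) (map set (snd a)) Bs) <->
  (EX W F. (ALL i < k. wok (present (fst a)) (W i) & F i <= set (pls (fst a)) &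
    system (present (fst a)) (W i) (F i) (set (snd a ! i))) &
   (ALL i < k. ALL j < k. i ~= j --> D (F i) (F j)))"
proof -
 have v: "valid_presentation (fst a)" and l: "length (snd a) = k"
  and R: "!!i. i < k ==> set (snd a ! i) <= tverts (present (fst a))"
  using a unfolding instances_def by (cases a, simp)+
 have td: "temporal_digraph (present (fst a))" using v by (simp add: valid_sel)
 have "(EX Bs. disjoint_branchings dis spn (present (fst a)) (map set (snd a)) Bs) <->
  (EX W F. (ALL i < length (map set (snd a)). wok (present (fst a)) (W i) & F i <= tedges (present (fst a)) &
    system (present (fst a)) (W i) (F i) (map set (snd a) ! i)) &
   (ALL i < length (map set (snd a)). ALL j < length (map set (snd a)). i ~= j --> D (F i) (F j)))"
  by (rule branchings_iff_systems[OF td dis spn]) (use R l in simp)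
 then show ?thesis by (simp add: l tedges_present[OF v])
qed

text \<open>The certificate lists, for each branching, the reached temporal vertices and the
  temporal edges of a system. Entries of two lists are matched by comparing their numbers.\<close>

definition certifies :: "nat => (presentation => bool) => (presentation \<times> (nat * nat) list => bool) =>
  ((nat * nat * nat) list \<times> (nat * nat * nat) list => bool) =>
  problem_instance \<times> ((nat * nat) list \<times> (nat * nat * nat) list) list => bool" where
 "certifies k c wokl Dl x <-> ok_instance k c (fst x) & length (snd x) = k &
   (ALL p : set (numbered (snd x)). ALL q : set (numbered (snd (fst x))). fst p = fst q -->
    wokl (fst (fst x), fst (snd p)) & (ALL f : set (snd (snd p)). f : set (pls (fst (fst x)))) &
    systeml (pas (fst (fst x))) (fst (snd p)) (snd (snd p)) (snd q)) &
   (ALL p : set (numbered (snd x)). ALL q : set (numbered (snd x)). ~ fst p = fst q --> Dl (snd (snd p), snd (snd q)))"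

lemma pt_certifies: "pt c ==> pt wokl ==> pt Dl ==> pt (certifies k c wokl Dl)"
proof -
 assume a: "pt c" "pt wokl" "pt Dl"
 have 1: "pt (%x. ok_instance k c (f x))" if "pt f" for f :: "'b::tr => problem_instance"
  by (rule pt_comp[OF pt_ok_instance[OF a(1)] that])
 have 2: "pt (%x. wokl (f x, g x))" if "pt f" "pt g" for f :: "'b::tr => presentation" and g
  by (rule pt_comp[OF a(2) pt_Pair[OF that]])
 have 3: "pt (%x. Dl (f x, g x))" if "pt f" "pt g" for f :: "'b::tr => (nat * nat * nat) list" and g
  by (rule pt_comp[OF a(3) pt_Pair[OF that]])
 show ?thesis unfolding certifies_def by (intro 1 2 3 pt_enumerate pt_systeml pt_intros)
qed

lemma certifies_iff:
 assumes C: "decides C c" and W: "!!p W. valid_presentation p ==> wokl (p, W) <-> wok (present p) (set W)"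
  and D: "!!F F'. Dl (F, F') <-> D (set F) (set F')"
 shows "certifies k c wokl Dl (a, y) <-> a : instances k C & length y = k &
  (ALL i < k. wok (present (fst a)) (set (fst (y ! i))) & set (snd (y ! i)) <= set (pls (fst a)) &
    system (present (fst a)) (set (fst (y ! i))) (set (snd (y ! i))) (set (snd a ! i))) &
  (ALL i < k. ALL j < k. i ~= j --> D (set (snd (y ! i))) (set (snd (y ! j))))"
proof (cases "a : instances k C & length y = k")
 case True
 then have v: "valid_presentation (fst a)" and l: "length (snd a) = k" "length y = k"
  unfolding instances_def by (cases a, simp)+
 have d: "distinct (map fst (pas (fst a)))" and s: "fst ` set (pls (fst a)) <= fst ` set (pas (fst a))"
  using v by (auto simp: valid_sel)
 have 1: "(ALL p : set (numbered y). ALL q : set (numbered (snd a)). fst p = fst q --> P (snd p) (snd q)) <->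
   (ALL i < k. P (y ! i) (snd a ! i))" for P
  using Ball_numbered2[of y "snd a" "%i x j z. i = j --> P x z"] l by auto
 have 2: "(ALL p : set (numbered y). ALL q : set (numbered y). ~ fst p = fst q --> P (snd p) (snd q)) <->
   (ALL i < k. ALL j < k. i ~= j --> P (y ! i) (y ! j))" for P
  using Ball_numbered2[of y y "%i x j z. ~ i = j --> P x z"] l by auto
 have 3: "wokl (fst a, fst z) & (ALL f : set (snd z). f : set (pls (fst a))) & systeml (pas (fst a)) (fst z) (snd z) R <->
   wok (present (fst a)) (set (fst z)) & set (snd z) <= set (pls (fst a)) &
   system (present (fst a)) (set (fst z)) (set (snd z)) (set R)" for z R
 proof (cases "set (snd z) <= set (pls (fst a))")
  case True
  then have "fst ` set (snd z) <= fst ` set (pas (fst a))" using s by blast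
  then show ?thesis unfolding W[OF v] systeml_iff[OF d \<open>fst ` set (snd z) <= fst ` set (pas (fst a))\<close>] subset_eq by blast
 qed blast
 have ok: "ok_instance k c a" using True ok_instance_iff[OF C] by blast
 show ?thesis
  unfolding certifies_def fst_conv snd_conv
  unfolding 1[of "%z R. wokl (fst a, fst z) & (ALL f : set (snd z). f : set (pls (fst a))) & systeml (pas (fst a)) (fst z) (snd z) R"]
   2[of "%z z'. Dl (snd z, snd z')"]
  unfolding 3 D using True ok by simp
next
 case False
 then show ?thesis unfolding certifies_def fst_conv snd_conv ok_instance_iff[OF C] by blast
qed

lemma length_enc_list_filter: "length (enc_list e (filter P xs)) <= length (enc_list e xs)"
 by (induction xs) (auto simp: enc_list_def)

lemma length_enc_list_le: "(!!x. x : set xs ==> length (e x) <= B) ==> length (enc_list e xs) <= length xs * (B + 1) + 1"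
proof (induction xs)
 case (Cons x xs)
 have "length (e x) <= B" "length (enc_list e xs) <= length xs * (B + 1) + 1" using Cons by simp_all
 then show ?case by (simp add: enc_list_def)
qed (simp add: enc_list_def)

text \<open>Systems rather than subdigraphs are guessed, so the verifier tests reachability and not
  uniqueness of walks.\<close>

theorem branching_problem_in_NP:
 assumes C: "decides C c" and dis: "disjointness_of dis D" and spn: "spanning_of spn wok"
  and W: "pt wokl" "!!p W. valid_presentation p ==> wokl (p, W) <-> wok (present p) (set W)"
  and D: "pt Dl" "!!F F'. Dl (F, F') <-> D (set F) (set F')"
 shows "branching_problem dis spn k C : class_NP"
proof -
 define P where "P a <-> a : instances k C & (EX Bs. disjoint_branchings dis spn (present (fst a)) (map set (snd a)) Bs)" for a
 have bp: "branching_problem dis spn k C = {enc_instance a | a. P a}"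
  unfolding branching_problem_def P_def by (simp only: split_paired_Ex fst_conv snd_conv)
 have ptc: "pt c" using C by (simp add: decides_def)
 have cert: "certifies k c wokl Dl (a, y) <-> a : instances k C & length y = k &
   (ALL i < k. wok (present (fst a)) (set (fst (y ! i))) & set (snd (y ! i)) <= set (pls (fst a)) &
    system (present (fst a)) (set (fst (y ! i))) (set (snd (y ! i))) (set (snd a ! i))) &
   (ALL i < k. ALL j < k. i ~= j --> D (set (snd (y ! i))) (set (snd (y ! j))))" for a y
  by (rule certifies_iff[OF C]) (rule W(2), assumption, rule D(2))
 let ?e = "enc_list (enc_pair (enc_list enc_nat2) (enc_list enc_nat3))"
 have sound: "P a" if cy: "certifies k c wokl Dl (a, y)" for a y
 proof -
  note h = cy[unfolded cert]
  have a: "a : instances k C" using h by (elim conjE)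
  show ?thesis unfolding P_def
  proof (rule conjI[OF a], rule iffD2[OF branchings_iff_instance[OF a dis spn]])
   show "EX W F. (ALL i < k. wok (present (fst a)) (W i) & F i <= set (pls (fst a)) &
     system (present (fst a)) (W i) (F i) (set (snd a ! i))) & (ALL i < k. ALL j < k. i ~= j --> D (F i) (F j))"
    by (rule exI[of _ "%i. set (fst (y ! i))"], rule exI[of _ "%i. set (snd (y ! i))"]) (use h in simp)
  qed
 qed
 have complete: "EX y. certifies k c wokl Dl (a, y) & length (?e y) <= k * (length (enc_instance a) + 1) + 1" if Pa: "P a" for a
 proof -
  have a: "a : instances k C" using Pa by (simp add: P_def)
  have v: "valid_presentation (fst a)" using a unfolding instances_def by (cases a) simp
  obtain W F where WF: "ALL i < k. wok (present (fst a)) (W i) & F i <= set (pls (fst a)) &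
     system (present (fst a)) (W i) (F i) (set (snd a ! i))" and DF: "ALL i < k. ALL j < k. i ~= j --> D (F i) (F j)"
   using iffD1[OF branchings_iff_instance[OF a dis spn] conjunct2[OF Pa[unfolded P_def]]]
   by - (elim exE conjE, rule that)
  \<comment> \<open>The guessed sets are written as sublists of the lists in the instance, which
    bounds the length of their codes by that of the instance.\<close>
  let ?W = "%i. filter (%w. w : W i) (pgs (fst a))" and ?F = "%i. filter (%f. f : F i) (pls (fst a))"
  define y where "y = map (%i. (?W i, ?F i)) [0..<k]"
  have nth: "set (fst (y ! i)) = W i" "set (snd (y ! i)) = F i" if "i < k" for i
  proof -
   have "wok (present (fst a)) (W i)" "F i <= set (pls (fst a))" using WF that by blast+
   moreover from this have "W i <= set (pgs (fst a))" using spanning_ofD(3)[OF spn] tverts_present[OF v] by blast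
   ultimately show "set (fst (y ! i)) = W i" "set (snd (y ! i)) = F i" using that by (auto simp: y_def)
  qed
  have "certifies k c wokl Dl (a, y)"
  proof -
   have "length y = k" by (simp add: y_def)
   then show ?thesis unfolding cert using a WF DF by (simp add: nth)
  qed
  moreover have "length (enc_pair (enc_list enc_nat2) (enc_list enc_nat3) z) <= length (enc_instance a)" if z: "z : set y" for z
  proof -
   obtain i where z: "z = (?W i, ?F i)" using z by (auto simp: y_def)
   have "length (enc_list enc_nat2 (?W i)) <= length (enc_list enc_nat2 (pgs (fst a)))"
    "length (enc_list enc_nat3 (?F i)) <= length (enc_list enc_nat3 (pls (fst a)))" by (rule length_enc_list_filter)+
   then show ?thesis unfolding z enc_instance_def enc_presentation_def enc_pair_def by simp
  qed
  then have "length (?e y) <= length y * (length (enc_instance a) + 1) + 1" by (rule length_enc_list_le)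
  ultimately show ?thesis by (auto simp: y_def)
 qed
 show ?thesis unfolding bp
 proof (rule class_NP_I[where c = ?e and V = "certifies k c wokl Dl" and q = "%n. k * (n + 1) + 1"])
  show "codec enc_instance" by (rule codec_instance)
  show "codec ?e" by (intro codec_list codec_pair codec_nat)
  show "pt (certifies k c wokl Dl)" by (rule pt_certifies[OF ptc W(1) D(1)])
  show "P a <-> (EX y. certifies k c wokl Dl (a, y))" for a using sound complete by blast
  show "polyb (%n. k * (n + 1) + 1)" by (intro polyb_intros)
  show "P a ==> EX y. certifies k c wokl Dl (a, y) & length (?e y) <= k * (length (enc_instance a) + 1) + 1" for a
   by (rule complete)
 qed
qed

lemma temporal_edge_in_NP:
 assumes C: "decides C c" shows "branching_problem edge_disjoint temporal_spanning k C : class_NP"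
proof (rule branching_problem_in_NP[OF C disjointness_of_e spanning_of_temporal])
 show "pt (%x :: presentation \<times> (nat * nat) list. (ALL w : set (snd x). w : set (pgs (fst x))) & (ALL w : set (pgs (fst x)). w : set (snd x)))"
  by (intro pt_intros)
 show "pt (%x :: (nat * nat * nat) list \<times> (nat * nat * nat) list. ALL f : set (fst x). ALL g : set (snd x). ~ fst f = fst g)"
  by (intro pt_intros)
 show "(ALL w : set (snd (p, W)). w : set (pgs (fst (p, W)))) & (ALL w : set (pgs (fst (p, W))). w : set (snd (p, W))) <->
   set W = tverts (present p)" if "valid_presentation p" for p W
  unfolding tverts_present[OF that] by auto
 show "(ALL f : set (fst (F, F')). ALL g : set (snd (F, F')). ~ fst f = fst g) <-> fst ` set F Int fst ` set F' = {}"
  for F F' :: "(nat * nat * nat) list" unfolding fst_conv snd_conv by blast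
qed

lemma vertex_in_NP:
 assumes C: "decides C c"
 shows "branching_problem edge_disjoint vertex_spanning k C : class_NP"
  "branching_problem t_edge_disjoint vertex_spanning k C : class_NP"
proof -
 let ?w = "%x :: presentation \<times> (nat * nat) list. (ALL w : set (snd x). w : set (pgs (fst x))) &
   (ALL u : set (pvs (fst x)). EX w : set (snd x). fst w = u & (ALL v : set (snd x). fst v = u --> v = w))"
 have w: "pt ?w" by (intro pt_intros)
 have w': "?w (p, W) <-> one_per_vertex (present p) (set W)" if v: "valid_presentation p" for p W
 proof -
  have eq: "(EX w : set W. fst w = u & (ALL v : set W. fst v = u --> v = w)) <-> (EX! i. (u, i) : set W)" for u
   by (simp add: Bex_def Ball_def split_paired_Ex split_paired_All Ex1_def)
  show ?thesis unfolding one_per_vertex_def tverts_present[OF v] present_sel(1) fst_conv snd_conv subset_eq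
   using eq by simp
 qed
 show "branching_problem edge_disjoint vertex_spanning k C : class_NP"
 proof (rule branching_problem_in_NP[OF C disjointness_of_e spanning_of_vertex w w'])
  show "pt (%x :: (nat * nat * nat) list \<times> (nat * nat * nat) list. ALL f : set (fst x). ALL g : set (snd x). ~ fst f = fst g)"
   by (intro pt_intros)
  show "(ALL f : set (fst (F, F')). ALL g : set (snd (F, F')). ~ fst f = fst g) <-> fst ` set F Int fst ` set F' = {}"
   for F F' :: "(nat * nat * nat) list" unfolding fst_conv snd_conv by blast
 qed
 show "branching_problem t_edge_disjoint vertex_spanning k C : class_NP"
 proof (rule branching_problem_in_NP[OF C disjointness_of_t spanning_of_vertex w w'])
  show "pt (%x :: (nat * nat * nat) list \<times> (nat * nat * nat) list. ALL f : set (fst x). ~ f : set (snd x))"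
   by (intro pt_intros)
  show "(ALL f : set (fst (F, F')). ~ f : set (snd (F, F'))) <-> set F Int set F' = {}"
   for F F' :: "(nat * nat * nat) list" unfolding fst_conv snd_conv by blast
 qed
qed

text \<open>A cycle exists exactly if the tail of some arc can be reached from its head, and this
  needs one reachability test for each arc.\<close>

lemma decides_dag: "decides (%G. dag (base G)) (%p. ALL a : set (pas p). ~ tl_of a : set (reach (pvs p) (map snd (pas p)) [hd_of a]))"
 unfolding decides_def
proof (intro conjI allI impI)
 show "pt (%p :: presentation. ALL a : set (pas p). ~ tl_of a : set (reach (pvs p) (map snd (pas p)) [hd_of a]))"
  by (intro pt_reach pt_intros)
next
 fix p assume v: "valid_presentation p"
 have d: "distinct (map fst (pas p))" and as: "!!a. a : set (pas p) ==> tl_of a : set (pvs p) & hd_of a : set (pvs p)"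
  using v unfolding valid_presentation_iff by blast+
 interpret fin_digraph "base (present p)" using v by (simp add: valid_sel temporal_digraph_def)
 have ends: "arcs_ends (base (present p)) = snd ` set (pas p)"
  unfolding arcs_ends_def arc_to_ends_def present_sel image_image
  by (rule image_cong[OF refl]) (simp add: map_of_fst[OF d])
 have "dag (base (present p)) <-> acyclic (snd ` set (pas p))"
 proof -
  have "(EX c. cycle c) <-> (EX u c. awalk u c u & c ~= [])"
  proof
   assume "EX c. cycle c"
   then show "EX u c. awalk u c u & c ~= []" unfolding cycle_def by blast
  next
   assume "EX u c. awalk u c u & c ~= []"
   then obtain c where "closed_w c" unfolding closed_w_def by blast
   then show "EX c. cycle c" by (rule closed_w_imp_cycle)
  qed
  also have "... <-> (EX u. u \<rightarrow>\<^sup>+\<^bsub>base (present p)\<^esub> u)" unfolding reachable1_awalk by blast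
  finally show ?thesis unfolding dag_def acyclic_def ends by blast
 qed
 also have "... <-> (ALL a : set (pas p). (hd_of a, tl_of a) ~: (snd ` set (pas p))\<^sup>*)"
 proof
  assume ac: "acyclic (snd ` set (pas p))"
  show "ALL a : set (pas p). (hd_of a, tl_of a) ~: (snd ` set (pas p))\<^sup>*"
  proof (intro ballI notI)
   fix a assume "a : set (pas p)" "(hd_of a, tl_of a) : (snd ` set (pas p))\<^sup>*"
   moreover from this have "(tl_of a, hd_of a) : snd ` set (pas p)" by force
   ultimately have "(tl_of a, tl_of a) : (snd ` set (pas p))\<^sup>+" by (metis rtrancl_into_trancl2)
   then show False using ac by (simp add: acyclic_def)
  qed
 next
  assume n: "ALL a : set (pas p). (hd_of a, tl_of a) ~: (snd ` set (pas p))\<^sup>*"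
  show "acyclic (snd ` set (pas p))" unfolding acyclic_def
  proof (intro allI notI)
   fix u assume "(u, u) : (snd ` set (pas p))\<^sup>+"
   then obtain w where "(u, w) : snd ` set (pas p)" "(w, u) : (snd ` set (pas p))\<^sup>*" by (meson tranclD)
   then show False using n by force
  qed
 qed
 also have "... <-> (ALL a : set (pas p). ~ tl_of a : set (reach (pvs p) (map snd (pas p)) [hd_of a]))"
 proof (rule ball_cong[OF refl])
  fix a assume a: "a : set (pas p)"
  have "set (reach (pvs p) (map snd (pas p)) [hd_of a]) = (set (map snd (pas p)))\<^sup>* `` set [hd_of a]"
  proof (rule set_reach)
   show "set (map snd (pas p)) <= set (pvs p) \<times> set (pvs p)" using as by (force simp: mem_Times_iff)
  qed (use as[OF a] in simp)
  then show "(hd_of a, tl_of a) ~: (snd ` set (pas p))\<^sup>* <-> ~ tl_of a : set (reach (pvs p) (map snd (pas p)) [hd_of a])" by simp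
 qed
 finally show "(ALL a : set (pas p). ~ tl_of a : set (reach (pvs p) (map snd (pas p)) [hd_of a])) = dag (base (present p))" ..
qed

definition joins :: "nat => nat => nat * nat * nat => bool" where
 "joins c v a <-> tl_of a = c & hd_of a = v | tl_of a = v & hd_of a = c"

lemma Ex1_image: "(EX! e. e : f ` S & T e) <-> (EX a : S. T (f a) & (ALL b : S. T (f b) --> f b = f a))"
 by (auto simp: Ex1_def)

lemma underlying_star_present:
 assumes v: "valid_presentation p"
 shows "underlying_star (base (present p)) <-> (EX c : set (pvs p).
  (ALL a : set (pas p). EX v : set (pvs p). ~ v = c & joins c v a) &
  (ALL v : set (pvs p). ~ v = c --> (EX a : set (pas p). joins c v a & (ALL b : set (pas p). joins c v b --> fst b = fst a))))"
proof -
 let ?G = "base (present p)"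
 have d: "distinct (map fst (pas p))" using v by (simp add: valid_sel)
 have j: "{tail ?G (fst a), head ?G (fst a)} = {c, v} <-> joins c v a" if "a : set (pas p)" for a c v
  unfolding present_sel map_of_fst[OF d that] joins_def by (auto simp: doubleton_eq_iff)
 have 1: "(ALL e : arcs ?G. EX v : verts ?G - {c}. {tail ?G e, head ?G e} = {c, v}) <->
   (ALL a : set (pas p). EX v : set (pvs p). ~ v = c & joins c v a)" for c
 proof -
  have "(ALL e : arcs ?G. EX v : verts ?G - {c}. {tail ?G e, head ?G e} = {c, v}) <->
   (ALL a : set (pas p). EX v : set (pvs p) - {c}. {tail ?G (fst a), head ?G (fst a)} = {c, v})"
   unfolding present_sel(1,2) ball_simps(9) ..
  also have "... <-> (ALL a : set (pas p). EX v : set (pvs p). ~ v = c & joins c v a)"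
   using j by (intro ball_cong refl) auto
  finally show ?thesis .
 qed
 have 2: "(EX! e. e : arcs ?G & {tail ?G e, head ?G e} = {c, v}) <->
   (EX a : set (pas p). joins c v a & (ALL b : set (pas p). joins c v b --> fst b = fst a))" for c v
  unfolding present_sel(2) Ex1_image by (simp add: j cong: bex_cong ball_cong)
 have 3: "(ALL v : V - {c}. X v) <-> (ALL v : V. ~ v = c --> X v)" for V and c :: nat and X by blast
 show ?thesis unfolding underlying_star_def 1 2 unfolding present_sel(1) 3 ..
qed

text \<open>An arc inside a snapshot comes with an active end vertex and already exceeds the bound
  1. So the bound means at most one active vertex at each time and no edge that starts and ends at
  the same time.\<close>

lemma snapshots_bounded_present:
 assumes v: "valid_presentation p"
 shows "snapshots_bounded 1 (present p) <-> (ALL g : set (pgs p). ALL h : set (pgs p). snd g = snd h --> g = h) &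
  (ALL f : set (pls p). ~ fst (snd f) = snd (snd f))"
proof -
 let ?V = "%t. {v. (v, t) : set (pgs p)}" and ?A = "%t. {e. (e, t, t) : set (pls p)}"
 have gs: "fst ` set (pgs p) <= set (pvs p)" and ls: "fst ` set (pls p) <= fst ` set (pas p)" using v by (auto simp: valid_sel)
 have V: "verts (snapshot (present p) t) = ?V t" for t
  using gs unfolding snapshot_def by (auto simp: present_sel)
 have A: "arcs (snapshot (present p) t) = ?A t" for t
 proof -
  have "e : fst ` set (pas p)" if "(e, t, t) : set (pls p)" for e using ls that by force
  then show ?thesis unfolding snapshot_def by (auto simp: present_sel)
 qed
 have fin: "finite (?V t)" "finite (?A t)" for t
  by (rule finite_subset[of _ "fst ` set (pgs p)"], force, simp) (rule finite_subset[of _ "fst ` set (pls p)"], force, simp)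
 show ?thesis unfolding snapshots_bounded_def V A
 proof (intro iffI conjI ballI impI allI)
  fix g h assume b: "ALL t. card (?V t) + card (?A t) <= 1" and gh: "g : set (pgs p)" "h : set (pgs p)" "snd g = snd h"
  have "fst g : ?V (snd g)" "fst h : ?V (snd g)" using gh by (simp_all, metis prod.collapse)
  moreover have "card (?V (snd g)) <= 1" using b[rule_format, of "snd g"] by linarith
  ultimately have "fst g = fst h" using fin(1)[of "snd g"] by (simp add: card_le_Suc0_iff_eq)
  then show "g = h" using gh(3) by (simp add: prod_eq_iff)
 next
  fix f assume b: "ALL t. card (?V t) + card (?A t) <= 1" and f: "f : set (pls p)"
  show "~ fst (snd f) = snd (snd f)"
  proof
   assume e: "fst (snd f) = snd (snd f)"
   have "f : tedges (present p)" using f tedges_present[OF v] by simp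
   then have "src (present p) f : set (pgs p)"
    using tedges_ends(1)[of "present p" f] v tverts_present[OF v] by (simp add: valid_sel)
   then have "?V (fst (snd f)) ~= {}" by (auto simp: src_def)
   moreover have "fst f : ?A (fst (snd f))" using f e by (simp, metis prod.collapse)
   then have "?A (fst (snd f)) ~= {}" by blast
   ultimately have "card (?V (fst (snd f))) > 0" "card (?A (fst (snd f))) > 0" using fin by (simp_all add: card_gt_0_iff)
   then show False using b[rule_format, of "fst (snd f)"] by linarith
  qed
 next
  fix t assume b: "(ALL g : set (pgs p). ALL h : set (pgs p). snd g = snd h --> g = h) & (ALL f : set (pls p). ~ fst (snd f) = snd (snd f))"
  have "?A t = {}" using b by force
  moreover have "card (?V t) <= 1" using b fin(1)[of t] by (force simp: card_le_Suc0_iff_eq)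
  ultimately show "card (?V t) + card (?A t) <= 1" by simp
 qed
qed

lemma decides_star: "decides (%G. underlying_star (base G)) (%p. EX c : set (pvs p).
  (ALL a : set (pas p). EX v : set (pvs p). ~ v = c & joins c v a) &
  (ALL v : set (pvs p). ~ v = c --> (EX a : set (pas p). joins c v a & (ALL b : set (pas p). joins c v b --> fst b = fst a))))"
 unfolding decides_def
proof (intro conjI allI impI)
 show "pt (%p :: presentation. EX c : set (pvs p).
  (ALL a : set (pas p). EX v : set (pvs p). ~ v = c & joins c v a) &
  (ALL v : set (pvs p). ~ v = c --> (EX a : set (pas p). joins c v a & (ALL b : set (pas p). joins c v b --> fst b = fst a))))"
  unfolding joins_def by (intro pt_intros)
qed (simp only: underlying_star_present)

lemma decides_snapshots: "decides (snapshots_bounded 1) (%p. (ALL g : set (pgs p). ALL h : set (pgs p). snd g = snd h --> g = h) &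
  (ALL f : set (pls p). ~ fst (snd f) = snd (snd f)))"
 unfolding decides_def
proof (intro conjI allI impI)
 show "pt (%p :: presentation. (ALL g : set (pgs p). ALL h : set (pgs p). snd g = snd h --> g = h) &
  (ALL f : set (pls p). ~ fst (snd f) = snd (snd f)))" by (intro pt_intros)
qed (simp only: snapshots_bounded_present)

section \<open>Reductions from satisfiability\<close>

lemma NP_hard_if:
 fixes inst :: "var cnf => problem_instance"
 assumes i: "pt inst" "!!ph. inst ph : instances k C"
  and sat: "!!ph. (EX Bs. disjoint_branchings dis spn (present (fst (inst ph))) (map set (snd (inst ph))) Bs) <-> sat ph"
  and L: "L : class_NP"
 shows "poly_reducible L (branching_problem dis spn k C)"
proof -
 obtain F :: "bool list => var cnf" where F: "pt F" "!!x. x : L <-> sat (F x)" using NP_reduces_to_sat[OF L] by blast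
 have "pt (%x. enc_instance (inst (F x)))" by (rule pt_comp[OF codec_pt[OF codec_instance] pt_comp[OF i(1) F(1)]])
 then have "poly_time (%x. enc_instance (inst (F x)))" by (rule poly_time_if_pt)
 moreover have "x : L <-> enc_instance (inst (F x)) : branching_problem dis spn k C" for x
 proof -
  have "enc_instance (inst (F x)) : branching_problem dis spn k C <->
   (EX Bs. disjoint_branchings dis spn (present (fst (inst (F x)))) (map set (snd (inst (F x)))) Bs)"
   unfolding branching_problem_def mem_Collect_eq codec_inj[OF codec_instance]
   using i(2)[of "F x"] by (metis prod.collapse fst_conv snd_conv)
  then show ?thesis using F(2) sat by simp
 qed
 ultimately show ?thesis unfolding poly_reducible_def by blast
qed

lemma instances_mono: "a : instances k C ==> a : instances k any_tdigraph"
 by (auto simp: instances_def)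

section \<open>Cuts and reachability in systems\<close>

lemma edge_ends:
 assumes v: "valid_presentation p" and a: "(e, u, w) : set (pas p)"
 shows "src (present p) (e, t, t') = (u, t)" "dst (present p) (e, t, t') = (w, t')"
proof -
 have "map_of (pas p) e = Some (u, w)" using v a by (intro map_of_is_SomeI) (simp_all add: valid_sel)
 then show "src (present p) (e, t, t') = (u, t)" "dst (present p) (e, t, t') = (w, t')"
  by (simp_all add: src_def dst_def present_sel)
qed

text \<open>A walk from the roots to \<open>y\<close> has to step into \<open>S\<close> somewhere.
  All necessity proofs of the reductions apply this to a suitable set without roots and inspect
  which waits or edges can enter it.\<close>

lemma system_enter:
 assumes sys: "system G W F R" and S: "S <= W" "S Int R = {}" "y : S"
 obtains x z where "x ~: S" "z : S" "(x, z) : waits W"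
  | f where "f : links G W F" "src G f ~: S" "dst G f : S"
proof -
 let ?E = "waits W Un (%f. (src G f, dst G f)) ` links G W F"
 obtain r where r: "r : R" "(r, y) : ?E\<^sup>*" using sys S unfolding system_def by blast
 have "r ~: S" using S(2) r(1) by blast
 with r(2) S(3) have "EX x z. x ~: S & z : S & (x, z) : ?E"
 proof (induction rule: rtrancl_induct)
  case (step y z)
  then show ?case by (cases "y : S") blast+
 qed simp
 then obtain x z where xz: "x ~: S" "z : S" "(x, z) : ?E" by blast
 from xz(3) show thesis
 proof
  assume "(x, z) : waits W"
  with xz(1,2) show thesis by (rule that(1))
 next
  assume "(x, z) : (%f. (src G f, dst G f)) ` links G W F"
  then obtain f where f: "f : links G W F" "x = src G f" "z = dst G f" by blast
  show thesis by (rule that(2)[OF f(1)]) (use xz f in simp_all)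
 qed
qed

definition reached_by :: "('v, 'e) tdigraph => ('v * nat) set => ('e * nat * nat) set => ('v * nat) set => ('v * nat) set" where
 "reached_by G W F R = (waits W Un (%f. (src G f, dst G f)) ` links G W F)\<^sup>* `` (R Int W)"

lemma reached_root: "y : R ==> y : W ==> y : reached_by G W F R"
 unfolding reached_by_def by blast

lemma reached_wait: "(v, t) : reached_by G W F R ==> (v, t) : W ==> (v, Suc t) : W ==> (v, Suc t) : reached_by G W F R"
proof -
 assume a: "(v, t) : reached_by G W F R" "(v, t) : W" "(v, Suc t) : W"
 from a(2,3) have "((v, t), (v, Suc t)) : waits W" by (auto simp: waits_def)
 with a(1) show ?thesis unfolding reached_by_def by (blast intro: rtrancl.rtrancl_into_rtrancl)
qed

lemma reached_link:
 assumes "src G f : reached_by G W F R" "f : F" "src G f : W" "dst G f : W" "~ nonstart W (dst G f)"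
 shows "dst G f : reached_by G W F R"
proof -
 have "f : links G W F" using assms by (simp add: links_def)
 then have "(src G f, dst G f) : waits W Un (%f. (src G f, dst G f)) ` links G W F" by blast
 with assms(1) show ?thesis unfolding reached_by_def by (blast intro: rtrancl.rtrancl_into_rtrancl)
qed

lemma systemI:
 assumes "!!y. y : W ==> y : reached_by G W F R" "!!y. y : R ==> y : W ==> ~ nonstart W y"
 shows "system G W F R"
 using assms unfolding system_def reached_by_def by blast

lemma system_all_roots: "W <= R ==> (!!y. y : R ==> y : W ==> ~ nonstart W y) ==> system G W F R"
 by (rule systemI) (auto intro: reached_root)

lemma nat_bits_double: "nat_bits (2 * n) = (if nat_bits n = [] then [] else False # nat_bits n)"
 by (cases "n = 0") (simp_all add: nat_bits.simps[of "2 * n"] nat_bits.simps[of 0], simp add: nat_bits.simps[of n])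

lemma pt_double:
 fixes f :: "'a::tr => nat"
 shows "pt f ==> pt (%x. 2 * f x)"
proof -
 assume f: "pt f"
 have "pt (%x. nat_bits (2 * f x))" unfolding nat_bits_double by (intro pt_intros f)
 then show ?thesis by (rule pt_natI)
qed

subsection \<open>Vertex-spanning branchings\<close>

text \<open>A vertex-spanning branching visits every variable at one of the times 1 and 2, which encodes its value; the
 arc from a variable to a clause can be used at the time for which the literal is true.\<close>

definition xv :: "'v::tr => nat" where "xv v = num (Some v, None :: (bool \<times> 'v) list option)"
definition cv :: "(bool \<times> 'v::tr) list => nat" where "cv c = num (None :: 'v option, Some c)"
text \<open>A dummy vertex without arcs; it makes the lifetime equal to 2 for the empty formula,
  too.\<close>

definition dv :: "'v::tr cnf => nat" where "dv ph = num (None :: 'v option, None :: (bool \<times> 'v) list option)"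

lemma xv_simps [simp]:
 fixes ph :: "'v::tr cnf" and v w :: 'v and c d :: "(bool \<times> 'v) list"
 shows "xv v = xv w <-> v = w" "cv c = cv d <-> c = d" "xv v ~= cv c" "cv c ~= xv v"
 "dv ph ~= xv v" "dv ph ~= cv c" "xv v ~= dv ph" "cv c ~= dv ph"
 by (simp_all add: xv_def cv_def dv_def)

definition lit_time :: "bool => nat" where "lit_time b = (if b then 1 else 2)"

definition occs :: "'v cnf => ((bool \<times> 'v) list \<times> bool \<times> 'v) list" where
 "occs ph = flat ph (%c. map (%l. (c, l)) c)"

definition v_roots :: "'v::tr cnf => nat list" where "v_roots ph = dv ph # map (%q. xv (snd (snd q))) (occs ph)"
definition v_verts :: "'v::tr cnf => nat list" where "v_verts ph = v_roots ph @ map cv ph"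
definition both :: "nat list => (nat * nat) list" where "both V = flat V (%v. [(v, 1), (v, 2)])"
definition v_arcs :: "'v::tr cnf => (nat * nat * nat) list" where
 "v_arcs ph = uniq (map (%q. (num (snd (snd q), fst q), xv (snd (snd q)), cv (fst q))) (occs ph))"
definition v_edges :: "'v::tr cnf => (nat * nat * nat) list" where
 "v_edges ph = map (%q. (num (snd (snd q), fst q), lit_time (fst (snd q)), lit_time (fst (snd q)))) (occs ph)"
definition v_pres :: "'v::tr cnf => presentation" where
 "v_pres ph = (v_verts ph, v_arcs ph, both (v_verts ph), v_edges ph)"
text \<open>The first branching may start at either time of every variable and has to reach the
  clauses. The other root sets contain every vertex at time 1, so those branchings can do without
  any temporal edge.\<close>

definition v_inst :: "nat => 'v::tr cnf => problem_instance" where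
 "v_inst k ph = (v_pres ph, both (v_roots ph) # map (%_. map (%v. (v, 1)) (v_verts ph)) [0..<k - 1])"

lemma pt_v_inst: "pt (v_inst k :: 'v::tr cnf => problem_instance)"
proof -
 have x: "pt (%x. xv (f x :: 'v))" if "pt f" for f :: "'b::tr => 'v" unfolding xv_def by (intro pt_intros that)
 have c: "pt (%x. cv (f x :: (bool \<times> 'v) list))" if "pt f" for f :: "'b::tr => (bool \<times> 'v) list"
  unfolding cv_def by (intro pt_intros that)
 have o: "pt (%x. occs (f x :: 'v cnf))" if "pt f" for f :: "'b::tr => 'v cnf"
  unfolding occs_def by (intro pt_flat pt_intros that)
 have t: "pt (%x. lit_time (f x))" if "pt f" for f :: "'b::tr => bool" unfolding lit_time_def by (intro pt_intros that)
 have r: "pt (v_roots :: 'v cnf => nat list)" unfolding v_roots_def dv_def by (intro x o pt_intros)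
 have v: "pt (v_verts :: 'v cnf => nat list)" unfolding v_verts_def by (intro r c pt_intros)
 then have v': "pt (%x. v_verts (f x :: 'v cnf))" if "pt f" for f :: "'b::tr => 'v cnf" using that by (rule pt_comp)
 have b: "pt (%x. both (f x))" if "pt f" for f :: "'b::tr => nat list" unfolding both_def by (intro pt_flat pt_intros that)
 have a: "pt (v_arcs :: 'v cnf => (nat * nat * nat) list)" unfolding v_arcs_def by (intro x c o pt_intros)
 have e: "pt (v_edges :: 'v cnf => (nat * nat * nat) list)" unfolding v_edges_def by (intro t o pt_intros)
 show ?thesis unfolding v_inst_def v_pres_def by (intro r v v' b a e pt_intros)
qed

context
 fixes ph :: "'v::tr cnf" and k :: nat
 assumes k: "1 <= k"
begin

abbreviation (input) "vp == v_pres ph"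

lemma sel: "pvs vp = v_verts ph" "pas vp = v_arcs ph" "pgs vp = both (v_verts ph)" "pls vp = v_edges ph"
 by (simp_all add: v_pres_def)

lemma set_both: "set (both V) = {(v, t). v : set V & (t = 1 | t = 2)}"
 by (auto simp: both_def)

lemma arc_iff: "a : set (v_arcs ph) <-> (EX c : set ph. EX l : set c. a = (num (snd l, c), xv (snd l), cv c))"
 unfolding v_arcs_def set_uniq set_map by (force simp: occs_def)

lemma edge_iff: "f : set (v_edges ph) <-> (EX c : set ph. EX l : set c. f = (num (snd l, c), lit_time (fst l), lit_time (fst l)))"
 unfolding v_edges_def set_map by (force simp: occs_def)

lemma root_iff: "u : set (v_roots ph) <-> u = dv ph | (EX c : set ph. EX l : set c. u = xv (snd l))"
 unfolding v_roots_def by (force simp: occs_def)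

lemma vert_iff: "u : set (v_verts ph) <-> u : set (v_roots ph) | (EX c : set ph. u = cv c)"
 unfolding v_verts_def by auto

lemma v_valid: "valid_presentation vp"
 unfolding valid_presentation_iff sel
proof (intro conjI ballI)
 have "inj_on fst (set (v_arcs ph))"
 proof (rule inj_onI)
  fix a b assume "a : set (v_arcs ph)" "b : set (v_arcs ph)" "fst a = fst b"
  then show "a = b" unfolding arc_iff by (elim bexE) simp
 qed
 moreover have "distinct (v_arcs ph)" unfolding v_arcs_def by (rule distinct_uniq)
 ultimately show "distinct (map fst (v_arcs ph))" by (simp add: distinct_map)
 show "fst g : set (v_verts ph)" "~ snd g = 0" if "g : set (both (v_verts ph))" for g
  using that by (auto simp: set_both)
 show "fst f : set (map fst (v_arcs ph))" if f: "f : set (v_edges ph)" for f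
 proof -
  obtain c l where cl: "c : set ph" "l : set c" "f = (num (snd l, c), lit_time (fst l), lit_time (fst l))"
   using f unfolding edge_iff by blast
  have "(num (snd l, c), xv (snd l), cv c) : set (v_arcs ph)" unfolding arc_iff using cl(1,2) by blast
  from imageI[OF this, of fst] show ?thesis unfolding cl(3) by simp
 qed
 show V1: "fst (snd a) : set (v_verts ph)" if "a : set (v_arcs ph)" for a
  using that unfolding arc_iff vert_iff root_iff by (elim bexE; simp; blast)
 show V2: "snd (snd a) : set (v_verts ph)" if "a : set (v_arcs ph)" for a
  using that unfolding arc_iff vert_iff root_iff by (elim bexE; simp; blast)
 fix x assume "x : set (tarcs (v_arcs ph) (v_edges ph))"
 then obtain f a where f: "f : set (v_edges ph)" and a: "a : set (v_arcs ph)"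
  and x: "x = (f, (fst (snd a), fst (snd f)), (snd (snd a), snd (snd f)))" unfolding tarcs_def by auto
 obtain b where fb: "fst (snd f) = lit_time b" "snd (snd f) = lit_time b" using f unfolding edge_iff by auto
 show "fst (snd (fst x)) <= snd (snd (fst x))" by (simp add: x fb)
 show "fst (snd x) : set (both (v_verts ph))" "snd (snd x) : set (both (v_verts ph))"
  using V1[OF a] V2[OF a] unfolding x set_both by (simp_all add: fb lit_time_def)
qed

lemma v_ends:
 assumes "c : set ph" "l : set c"
 shows "src (present vp) (num (snd l, c), t, t') = (xv (snd l), t)" "dst (present vp) (num (snd l, c), t, t') = (cv c, t')"
proof -
 have "(num (snd l, c), xv (snd l), cv c) : set (pas vp)" unfolding sel arc_iff using assms by blast
 from edge_ends[OF v_valid this] show "src (present vp) (num (snd l, c), t, t') = (xv (snd l), t)"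
  "dst (present vp) (num (snd l, c), t, t') = (cv c, t')" by blast+
qed

text \<open>Every arc leads from a variable to a clause, so nothing can be continued from the head
  of an arc.\<close>

lemma v_dag: "dag (base (present vp))"
proof -
 let ?R = "set (map snd (v_arcs ph))"
 have R: "EX v :: 'v. fst e = xv v" if "e : ?R" for e
  using that by (auto simp: arc_iff)
 have "~ tl_of a : set (reach (pvs vp) (map snd (pas vp)) [hd_of a])" if a: "a : set (pas vp)" for a
 proof
  assume t: "tl_of a : set (reach (pvs vp) (map snd (pas vp)) [hd_of a])"
  have as: "tl_of a : set (pvs vp) & hd_of a : set (pvs vp)" if "a : set (pas vp)" for a
   using v_valid that unfolding valid_presentation_iff by blast
  have "set (reach (pvs vp) (map snd (pas vp)) [hd_of a]) = (set (map snd (pas vp)))\<^sup>* `` set [hd_of a]"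
  proof (rule set_reach)
   show "set (map snd (pas vp)) <= set (pvs vp) \<times> set (pvs vp)" using as by (force simp: mem_Times_iff)
  qed (use as[OF a] in simp)
  then have r: "(hd_of a, tl_of a) : ?R\<^sup>*" using t by (simp add: sel)
  obtain c :: "(bool \<times> 'v) list" and l :: "bool \<times> 'v" where c: "hd_of a = cv c" "tl_of a = xv (snd l)"
   using a unfolding sel arc_iff by auto
  from r show False
  proof (cases rule: converse_rtranclE)
   case base
   then show False using c by simp
  next
   case (step z)
   then obtain v :: 'v where "cv c = xv v" using R[OF step(1)] c(1) by auto
   then show False by simp
  qed
 qed
 then show ?thesis using decides_dag v_valid unfolding decides_def by blast
qed

lemma v_instance: "v_inst k ph : instances k (%G. dag (base G) & lifetime G = 2 & all_eternal G)"
proof -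
 have l: "lifetime (present vp) = 2"
  using lifetime_present_eq[OF v_valid, of 2] unfolding sel set_both by (force simp: v_verts_def v_roots_def)
 have e: "all_eternal (present vp)"
  unfolding all_eternal_present[OF v_valid] unfolding sel set_both by (auto simp: numeral_2_eq_2)
 have "set (both (v_roots ph)) <= tverts (present vp)" "set (map (%v. (v, 1)) (v_verts ph)) <= tverts (present vp)"
  unfolding tverts_present[OF v_valid] sel by (auto simp: set_both vert_iff)
 then show ?thesis unfolding instances_def v_inst_def using l e v_valid v_dag k by auto
qed

lemma v_roots_nth: "snd (v_inst k ph) ! 0 = both (v_roots ph)" "0 < i ==> i < k ==> snd (v_inst k ph) ! i = map (%v. (v, 1)) (v_verts ph)"
 by (simp_all add: v_inst_def nth_Cons')

text \<open>The time at which a variable is visited is its value. A clause vertex is no root and has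
  no second time from which to wait, so it is entered from a variable, and the edge exists only at
  the time that makes the literal true.\<close>

lemma sat_if_v_system:
 assumes W: "one_per_vertex (present vp) W" and F: "F <= set (v_edges ph)"
  and sys: "system (present vp) W F (set (both (v_roots ph)))"
 shows "sat ph"
proof -
 define A where "A v <-> (xv v, 1) : W" for v :: 'v
 have one: "t = t'" if "(u, t) : W" "(u, t') : W" for u t t'
 proof -
  have "u : verts (base (present vp))" using W that(1) unfolding one_per_vertex_def tverts_def by blast
  then show ?thesis using W that unfolding one_per_vertex_def by blast
 qed
 have "csat A c" if c: "c : set ph" for c
 proof -
  have "cv c : verts (base (present vp))" using c by (simp add: present_sel sel vert_iff)
  then obtain i where i: "(cv c, i) : W" using W unfolding one_per_vertex_def by blast
  have R: "{(cv c, i)} Int set (both (v_roots ph)) = {}" by (auto simp: set_both root_iff)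
  show ?thesis
  proof (rule system_enter[OF sys, of "{(cv c, i)}" "(cv c, i)"])
   show "{(cv c, i)} <= W" using i by simp
   show "{(cv c, i)} Int set (both (v_roots ph)) = {}" by (rule R)
   show "(cv c, i) : {(cv c, i)}" by simp
  next
   fix x z assume "z : {(cv c, i)}" "(x, z) : waits W"
   then obtain t where "i = Suc t" "(cv c, t) : W" by (auto simp: waits_def)
   then show ?thesis using one[OF i, of t] by simp
  next
   fix f assume f: "f : links (present vp) W F" "dst (present vp) f : {(cv c, i)}"
   then have "f : set (v_edges ph)" "src (present vp) f : W" using F by (auto simp: links_def)
   then obtain d l where l: "d : set ph" "l : set d" "f = (num (snd l, d), lit_time (fst l), lit_time (fst l))"
    unfolding edge_iff by blast
   have dc: "d = c" using f(2) unfolding l(3) v_ends[OF l(1,2)] by simp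
   have s: "(xv (snd l), lit_time (fst l)) : W" using \<open>src (present vp) f : W\<close> unfolding l(3) v_ends[OF l(1,2)] .
   have "A (snd l) = fst l"
    using s one[of "xv (snd l)" 1 2] unfolding A_def lit_time_def by (cases "fst l") auto
   then show ?thesis unfolding csat_def using l(2) dc by blast
  qed
 qed
 then show ?thesis unfolding sat_def by blast
qed

lemma v_system_if_sat:
 assumes "sat ph"
 obtains W where "one_per_vertex (present vp) W" "system (present vp) W (set (v_edges ph)) (set (both (v_roots ph)))"
proof -
 obtain A where A: "!!c. c : set ph ==> EX l : set c. A (snd l) = fst l" using assms unfolding sat_def csat_def by blast
 then obtain pick where pick: "!!c. c : set ph ==> pick c : set c & A (snd (pick c)) = fst (pick c)" by metis
 \<comment> \<open>Variables are visited at the time of their value, each clause at the time of a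
   true literal picked from it, and the dummy vertex at time 1.\<close>
 define \<tau> where "\<tau> u = (if u : range (xv :: 'v => nat) then lit_time (A (inv xv u))
   else if u : range (cv :: (bool \<times> 'v) list => nat) then lit_time (fst (pick (inv cv u))) else 1)" for u
 have injs: "inj (xv :: 'v => nat)" "inj (cv :: (bool \<times> 'v) list => nat)" by (simp_all add: inj_def)
 have tx: "\<tau> (xv v) = lit_time (A v)" for v :: 'v by (simp add: \<tau>_def inv_f_f[OF injs(1)])
 have tc: "\<tau> (cv c) = lit_time (fst (pick c))" for c :: "(bool \<times> 'v) list"
 proof -
  have "cv c ~: range (xv :: 'v => nat)" by auto
  then show ?thesis by (simp add: \<tau>_def inv_f_f[OF injs(2)])
 qed
 have t12: "\<tau> u = 1 | \<tau> u = 2" for u by (simp add: \<tau>_def lit_time_def)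
 define W where "W = {(u, \<tau> u) | u. u : set (v_verts ph)}"
 have Wi: "(u, t) : W <-> u : set (v_verts ph) & t = \<tau> u" for u t by (auto simp: W_def)
 have ns: "~ nonstart W y" if "y : W" for y
  using that by (auto simp: nonstart_def Wi)
 have "one_per_vertex (present vp) W"
  unfolding one_per_vertex_def tverts_present[OF v_valid] present_sel sel
  using t12 by (auto simp: W_def set_both)
 moreover have "system (present vp) W (set (v_edges ph)) (set (both (v_roots ph)))"
 proof (rule systemI)
  have root: "(u, \<tau> u) : reached_by (present vp) W (set (v_edges ph)) (set (both (v_roots ph)))" if "u : set (v_roots ph)" for u
   using that t12[of u] by (intro reached_root) (simp_all add: set_both Wi vert_iff)
  fix y assume y: "y : W"
  then obtain u where u: "y = (u, \<tau> u)" "u : set (v_verts ph)" by (auto simp: W_def)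
  show "y : reached_by (present vp) W (set (v_edges ph)) (set (both (v_roots ph)))"
  proof (cases "u : set (v_roots ph)")
   case True
   then show ?thesis using root u by simp
  next
   case False
   then obtain c where c: "c : set ph" "u = cv c" using u vert_iff by blast
   note pc = pick[OF c(1)]
   let ?f = "(num (snd (pick c), c), lit_time (fst (pick c)), lit_time (fst (pick c)))"
   note e = v_ends[OF c(1) conjunct1[OF pc], of "lit_time (fst (pick c))" "lit_time (fst (pick c))"]
   have xr: "xv (snd (pick c)) : set (v_roots ph)" using c(1) pc unfolding root_iff by blast
   have s: "src (present vp) ?f = (xv (snd (pick c)), \<tau> (xv (snd (pick c))))" unfolding e tx using pc by simp
   have d: "dst (present vp) ?f = y" unfolding e u(1) c(2) tc ..
   have "dst (present vp) ?f : reached_by (present vp) W (set (v_edges ph)) (set (both (v_roots ph)))"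
   proof (rule reached_link)
    show "src (present vp) ?f : reached_by (present vp) W (set (v_edges ph)) (set (both (v_roots ph)))"
     unfolding s by (rule root[OF xr])
    show "?f : set (v_edges ph)" unfolding edge_iff using c(1) pc by blast
    show "src (present vp) ?f : W" unfolding s Wi using xr vert_iff by blast
    show "dst (present vp) ?f : W" unfolding d by (rule y)
    show "~ nonstart W (dst (present vp) ?f)" unfolding d by (rule ns[OF y])
   qed
   then show ?thesis unfolding d .
  qed
 qed (rule ns)
 ultimately show ?thesis by (rule that)
qed

text \<open>Only the first branching has temporal edges, so of the disjointness requirement nothing
  is used but its behaviour towards the empty set. This is how one construction serves both
  requirements.\<close>

lemma v_correct:
 assumes dis: "disjointness_of dis D" and D: "!!F. D F {} & D {} F"
 shows "(EX Bs. disjoint_branchings dis vertex_spanning (present (fst (v_inst k ph))) (map set (snd (v_inst k ph))) Bs) <-> sat ph"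
 unfolding branchings_iff_instance[OF v_instance dis spanning_of_vertex]
proof
 have f: "fst (v_inst k ph) = vp" by (simp add: v_inst_def)
 {
  assume "EX W F. (ALL i<k. one_per_vertex (present (fst (v_inst k ph))) (W i) & F i <= set (pls (fst (v_inst k ph))) &
    system (present (fst (v_inst k ph))) (W i) (F i) (set (snd (v_inst k ph) ! i))) & (ALL i<k. ALL j<k. i ~= j --> D (F i) (F j))"
  then obtain W F where WF: "ALL i<k. one_per_vertex (present vp) (W i) & F i <= set (v_edges ph) &
    system (present vp) (W i) (F i) (set (snd (v_inst k ph) ! i))"
   unfolding f sel by - (elim exE conjE, rule that)
  have "0 < k" using k by simp
  from WF[rule_format, OF this, unfolded v_roots_nth(1)] show "sat ph" using sat_if_v_system by blast
 }
 assume "sat ph"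
 then obtain W where W: "one_per_vertex (present vp) W" "system (present vp) W (set (v_edges ph)) (set (both (v_roots ph)))"
  by (rule v_system_if_sat)
 let ?W1 = "{(u, 1 :: nat) | u. u : set (v_verts ph)}"
 have o: "one_per_vertex (present vp) ?W1"
  unfolding one_per_vertex_def tverts_present[OF v_valid] present_sel sel by (auto simp: set_both)
 have s: "system (present vp) ?W1 {} (set (snd (v_inst k ph) ! i))" if "0 < i" "i < k" for i
  unfolding v_roots_nth(2)[OF that] by (rule system_all_roots) (auto simp: nonstart_def)
 show "EX W F. (ALL i<k. one_per_vertex (present (fst (v_inst k ph))) (W i) & F i <= set (pls (fst (v_inst k ph))) &
    system (present (fst (v_inst k ph))) (W i) (F i) (set (snd (v_inst k ph) ! i))) & (ALL i<k. ALL j<k. i ~= j --> D (F i) (F j))"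
  unfolding f sel
 proof (rule exI[of _ "%i. if i = 0 then W else ?W1"], rule exI[of _ "%i. if i = 0 then set (v_edges ph) else {}"], intro conjI allI impI)
  fix i assume i: "i < k"
  show "one_per_vertex (present vp) (if i = 0 then W else ?W1)" using o W(1) by simp
  show "(if i = 0 then set (v_edges ph) else {}) <= set (v_edges ph)" by simp
  show "system (present vp) (if i = 0 then W else ?W1) (if i = 0 then set (v_edges ph) else {}) (set (snd (v_inst k ph) ! i))"
   using s[OF _ i] W(2) v_roots_nth(1) by (cases "i = 0") simp_all
  fix j assume "j < k" "i ~= j"
  then show "D (if i = 0 then set (v_edges ph) else {}) (if j = 0 then set (v_edges ph) else {})" using D by (cases "i = 0") simp_all
 qed
qed

end

subsection \<open>Edge-disjoint branchings on a star\<close>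

text \<open>Every literal is a leaf with one arc to the center. Being edge-disjoint, the first two branchings split the
 arcs between them, and the starts of the center for a variable give each of them one of its two literals; the
 starts for the clauses only have to be reached by the first branching. All timestamps are even, so there are no waits.\<close>

definition literals :: "'v::tr cnf => (bool \<times> 'v) list" where
 "literals ph = uniq (flat (flat ph (map snd)) (%v. [(True, v), (False, v)]))"

text \<open>The position in this list is half the timestamp. The kinds are 0 for the activity of a
  literal leaf, 1 for the start of the center for a variable and 2 for that for a clause. Leaves
  come first, so that edges run forward in time, and the numbering begins with 1 because timestamps
  are positive.\<close>

definition events :: "'v::tr cnf => (nat * nat * (bool \<times> 'v) list) list" where
 "events ph = List.enumerate (length [()]) (map (%l. (0, [l])) (literals ph) @
   (map (%v. (1, [(True, v), (False, v)])) (flat ph (map snd)) @ map (%c. (2, c)) ph))"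

definition leaf :: "bool \<times> 'v::tr => nat" where "leaf l = num (Some l)"
definition hub :: "'v::tr cnf => nat" where "hub ph = num (None :: (bool \<times> 'v) option)"

lemma leaf_simps [simp]:
 fixes ph :: "'v::tr cnf" and l m :: "bool \<times> 'v"
 shows "leaf l = leaf m <-> l = m" "leaf l ~= hub ph" "hub ph ~= leaf l"
 by (simp_all add: leaf_def hub_def)

definition leaf_times :: "'v::tr cnf => (nat * nat) list" where
 "leaf_times ph = flat (filter (%e. fst (snd e) = 0) (events ph)) (%e. map (%l. (leaf l, 2 * fst e)) (snd (snd e)))"
definition hub_times :: "nat => 'v::tr cnf => (nat * nat) list" where
 "hub_times j ph = map (%e. (hub ph, 2 * fst e)) (filter (%e. fst (snd e) = j) (events ph))"
definition s_arcs :: "'v::tr cnf => (nat * nat * nat) list" where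
 "s_arcs ph = map (%l. (num l, leaf l, hub ph)) (literals ph)"
definition s_edges :: "'v::tr cnf => (nat * nat * nat) list" where
 "s_edges ph = flat (filter (%s. ~ fst (snd s) = 0) (events ph)) (%s. flat (snd (snd s)) (%l.
   map (%e. (num l, 2 * fst e, 2 * fst s)) (filter (%e. snd e = (0, [l])) (events ph))))"
definition s_pres :: "'v::tr cnf => presentation" where
 "s_pres ph = (hub ph # map leaf (literals ph), s_arcs ph, leaf_times ph @ (hub_times 1 ph @ hub_times 2 ph), s_edges ph)"
text \<open>All leaves are roots. The first branching must enter the starts for variables and for
  clauses, the second one those for variables only, and the remaining ones have every temporal
  vertex as a root.\<close>

definition s_inst :: "nat => 'v::tr cnf => problem_instance" where
 "s_inst k ph = (s_pres ph, leaf_times ph # (leaf_times ph @ hub_times 2 ph) # map (%_. pgs (s_pres ph)) [0..<k - 2])"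

lemma pt_s_inst: "pt (s_inst k :: 'v::tr cnf => problem_instance)"
proof -
 have lf: "pt (%x. leaf (f x :: bool \<times> 'v))" if "pt f" for f :: "'b::tr => bool \<times> 'v" unfolding leaf_def by (intro pt_intros that)
 have li: "pt (literals :: 'v cnf => _)" unfolding literals_def by (intro pt_flat pt_intros)
 have ev0: "pt (events :: 'v cnf => _)" unfolding events_def by (intro li pt_flat pt_enumerate pt_intros)
 have ev: "pt (%x. events (f x :: 'v cnf))" if "pt f" for f :: "'b::tr => 'v cnf" by (rule pt_comp[OF ev0 that])
 have lt: "pt (leaf_times :: 'v cnf => _)" unfolding leaf_times_def by (intro lf ev pt_double pt_flat pt_intros)
 have ht: "pt (hub_times j :: 'v cnf => _)" for j unfolding hub_times_def hub_def by (intro ev pt_double pt_flat pt_intros)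
 have ar: "pt (s_arcs :: 'v cnf => _)" unfolding s_arcs_def hub_def by (intro lf li pt_intros)
 have ed: "pt (s_edges :: 'v cnf => _)" unfolding s_edges_def by (intro ev pt_double pt_flat pt_intros)
 have pr0: "pt (s_pres :: 'v cnf => _)" unfolding s_pres_def hub_def by (intro lf li ar lt ht ed pt_intros)
 have pr: "pt (%x. s_pres (f x :: 'v cnf))" if "pt f" for f :: "'b::tr => 'v cnf" by (rule pt_comp[OF pr0 that])
 show ?thesis unfolding s_inst_def by (intro pr lt ht pt_intros)
qed

lemma literals_iff: "l : set (literals ph) <-> (EX c : set ph. EX m : set c. snd l = snd m)"
 unfolding literals_def set_uniq by (cases l; cases "fst l") force+

lemma events_set: "(n, e) : set (events ph) ==>
  (EX l : set (literals ph). e = (0, [l])) | (EX c : set ph. EX m : set c. e = (1, [(True, snd m), (False, snd m)])) | (EX c : set ph. e = (2, c))"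
proof -
 assume "(n, e) : set (events ph)"
 then have "e : snd ` set (events ph)" by force
 then have "e : set (map snd (events ph))" by simp
 then show ?thesis unfolding events_def map_snd_enumerate by auto
qed

lemma events_ex:
 "l : set (literals ph) ==> EX n. (n, 0, [l]) : set (events ph)"
 "c : set ph ==> m : set c ==> EX n. (n, 1, [(True, snd m), (False, snd m)]) : set (events ph)"
 "c : set ph ==> EX n. (n, 2, c) : set (events ph)"
proof -
 have ex: "EX n. (n, e) : set (events ph)" if "e : set (map snd (events ph))" for e using that by force
 show "l : set (literals ph) ==> EX n. (n, 0, [l]) : set (events ph)"
  by (rule ex) (unfold events_def map_snd_enumerate, simp)
 show "c : set ph ==> m : set c ==> EX n. (n, 1, [(True, snd m), (False, snd m)]) : set (events ph)"
  by (rule ex) (unfold events_def map_snd_enumerate, force)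
 show "c : set ph ==> EX n. (n, 2, c) : set (events ph)"
  by (rule ex) (unfold events_def map_snd_enumerate, simp)
qed

lemma events_inj: "(n, e) : set (events ph) ==> (n, e') : set (events ph) ==> e = e'"
 unfolding events_def by (simp add: in_set_enumerate_eq)

lemma events_pos: "(n, e) : set (events ph) ==> 0 < n"
 unfolding events_def by (simp add: in_set_enumerate_eq)

text \<open>Leaf events form the initial part of the list, so they precede every start of the
  center; thus an edge from a leaf to the center never stays inside a snapshot.\<close>

lemma events_order:
 assumes "(n, 0, x) : set (events ph)" "(m, j, y) : set (events ph)" "j ~= 0"
 shows "n < m"
proof (rule ccontr)
 assume nm: "~ n < m"
 let ?L = "map (%l. (0 :: nat, [l])) (literals ph)"
  and ?S = "map (%v. (1 :: nat, [(True, v), (False, v)])) (flat ph (map snd)) @ map (%c. (2, c)) ph"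
 have n: "n - 1 < length (?L @ ?S)" "(0, x) = (?L @ ?S) ! (n - 1)" "1 <= n"
  and m: "1 <= m" "(j, y) = (?L @ ?S) ! (m - 1)"
  using assms(1,2) unfolding events_def by (auto simp: in_set_enumerate_eq)
 have "n - 1 < length ?L"
 proof (rule ccontr)
  assume l: "~ n - 1 < length ?L"
  then have "n - 1 - length ?L < length ?S" using n(1) by simp
  then have "?S ! (n - 1 - length ?L) : set ?S" by (rule nth_mem)
  moreover have "(?L @ ?S) ! (n - 1) = ?S ! (n - 1 - length ?L)" using l by (simp only: nth_append if_False)
  ultimately have "(0, x) : set ?S" using n(2) by (simp only:)
  then show False by auto
 qed
 then have ml: "m - 1 < length ?L" using nm m(1) by linarith
 then have "(j, y) = ?L ! (m - 1)" using m(2) by (simp only: nth_append if_True)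
 then show False using ml assms(3) by simp
qed

context
 fixes ph :: "'v::tr cnf" and k :: nat
 assumes k: "2 <= k"
begin

abbreviation (input) "sp == s_pres ph"

lemma s_sel: "pvs sp = hub ph # map leaf (literals ph)" "pas sp = s_arcs ph"
 "pgs sp = leaf_times ph @ (hub_times 1 ph @ hub_times 2 ph)" "pls sp = s_edges ph"
 by (simp_all add: s_pres_def)

lemma leaf_times_iff: "y : set (leaf_times ph) <-> (EX n l. (n, 0, [l]) : set (events ph) & y = (leaf l, 2 * n))"
proof
 assume "y : set (leaf_times ph)"
 then obtain n x l where e: "(n, 0, x) : set (events ph)" "l : set x" "y = (leaf l, 2 * n)" unfolding leaf_times_def by auto
 from events_set[OF e(1)] e(2) have "x = [l]" by auto
 with e show "EX n l. (n, 0, [l]) : set (events ph) & y = (leaf l, 2 * n)" by blast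
next
 assume "EX n l. (n, 0, [l]) : set (events ph) & y = (leaf l, 2 * n)"
 then show "y : set (leaf_times ph)" unfolding leaf_times_def by force
qed

lemma hub_times_iff: "y : set (hub_times j ph) <-> (EX n x. (n, j, x) : set (events ph) & y = (hub ph, 2 * n))"
 unfolding hub_times_def by force

lemma s_edges_iff: "f : set (s_edges ph) <-> (EX n j x m l. (n, j, x) : set (events ph) & j ~= 0 & l : set x &
  (m, 0, [l]) : set (events ph) & f = (num l, 2 * m, 2 * n))"
 unfolding s_edges_def by force

lemma s_arcs_iff: "a : set (s_arcs ph) <-> (EX l : set (literals ph). a = (num l, leaf l, hub ph))"
 unfolding s_arcs_def by auto

lemma leaf_literal: "(n, 0, [l]) : set (events ph) ==> l : set (literals ph)"
 using events_set[of n "(0, [l])" ph] by auto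

lemma s_valid: "valid_presentation sp"
 unfolding valid_presentation_iff s_sel
proof (intro conjI ballI)
 show "distinct (map fst (s_arcs ph))"
  unfolding s_arcs_def literals_def by (simp add: distinct_map distinct_uniq inj_on_def comp_def)
 show "fst g : set (hub ph # map leaf (literals ph))" "~ snd g = 0"
  if "g : set (leaf_times ph @ (hub_times 1 ph @ hub_times 2 ph))" for g
  using that leaf_literal events_pos by (auto simp: leaf_times_iff hub_times_iff)
 show "fst f : set (map fst (s_arcs ph))" if "f : set (s_edges ph)" for f
  using that leaf_literal unfolding s_edges_iff by (force simp: s_arcs_def)
 show "fst (snd a) : set (hub ph # map leaf (literals ph))" "snd (snd a) : set (hub ph # map leaf (literals ph))"
  if "a : set (s_arcs ph)" for a using that unfolding s_arcs_iff by auto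
 fix x assume "x : set (tarcs (s_arcs ph) (s_edges ph))"
 then obtain f a where f: "f : set (s_edges ph)" and a: "a : set (s_arcs ph)" "fst a = fst f"
  and x: "x = (f, (fst (snd a), fst (snd f)), (snd (snd a), snd (snd f)))" unfolding tarcs_def by auto
 obtain n j y m l where e: "(n, j, y) : set (events ph)" "j ~= 0" "(m, 0, [l]) : set (events ph)" "f = (num l, 2 * m, 2 * n)"
  using f s_edges_iff by blast
 have al: "a = (num l, leaf l, hub ph)" using a e(4) unfolding s_arcs_iff by auto
 have j: "j = 1 | j = 2" using events_set[OF e(1)] e(2) by auto
 show "fst (snd (fst x)) <= snd (snd (fst x))" using events_order[OF e(3,1,2)] by (simp add: x e(4))
 have "(leaf l, 2 * m) : set (leaf_times ph)" using e(3) leaf_times_iff by blast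
 then show "fst (snd x) : set (leaf_times ph @ (hub_times 1 ph @ hub_times 2 ph))" by (simp add: x al e(4))
 have "(hub ph, 2 * n) : set (hub_times j ph)" using e(1) hub_times_iff by blast
 then show "snd (snd x) : set (leaf_times ph @ (hub_times 1 ph @ hub_times 2 ph))" using j by (auto simp: x al e(4))
qed

lemma s_ends:
 assumes "l : set (literals ph)"
 shows "src (present sp) (num l, t, t') = (leaf l, t)" "dst (present sp) (num l, t, t') = (hub ph, t')"
proof -
 have "(num l, leaf l, hub ph) : set (pas sp)" unfolding s_sel s_arcs_iff using assms by blast
 from edge_ends[OF s_valid this] show "src (present sp) (num l, t, t') = (leaf l, t)"
  "dst (present sp) (num l, t, t') = (hub ph, t')" by blast+
qed

lemma s_tverts: "tverts (present sp) = set (leaf_times ph) Un (set (hub_times 1 ph) Un set (hub_times 2 ph))"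
 unfolding tverts_present[OF s_valid] s_sel by simp

lemma s_start: "~ nonstart (tverts (present sp)) y" if y: "y : tverts (present sp)" for y
proof
 have ev: "even t" if "(u, t) : tverts (present sp)" for u t
  using that unfolding s_tverts by (auto simp: leaf_times_iff hub_times_iff)
 assume "nonstart (tverts (present sp)) y"
 then obtain v t where "y = (v, Suc t)" "(v, t) : tverts (present sp)" unfolding nonstart_def by blast
 then show False using ev[of v t] ev[of v "Suc t"] y by simp
qed

lemma s_instance: "s_inst k ph : instances k (%G. underlying_star (base G) & snapshots_bounded 1 G)"
proof -
 have star: "underlying_star (base (present sp))"
  unfolding underlying_star_present[OF s_valid] unfolding s_sel
 proof (rule bexI[of _ "hub ph"], intro conjI ballI impI)
  show "EX v : set (hub ph # map leaf (literals ph)). ~ v = hub ph & joins (hub ph) v a" if "a : set (s_arcs ph)" for a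
   using that unfolding s_arcs_iff joins_def by auto
  fix v assume "v : set (hub ph # map leaf (literals ph))" "~ v = hub ph"
  then obtain l where l: "l : set (literals ph)" "v = leaf l" by auto
  show "EX a : set (s_arcs ph). joins (hub ph) v a & (ALL b : set (s_arcs ph). joins (hub ph) v b --> fst b = fst a)"
   by (rule bexI[of _ "(num l, leaf l, hub ph)"]) (use l in \<open>auto simp: s_arcs_iff joins_def\<close>)
 qed simp
 have time: "EX n e. (n, e) : set (events ph) & snd g = 2 * n & (if fst e = 0 then EX l. snd e = [l] & fst g = leaf l else fst g = hub ph)"
  if "g : set (leaf_times ph @ (hub_times 1 ph @ hub_times 2 ph))" for g
 proof -
  from that have "g : set (leaf_times ph) | g : set (hub_times 1 ph) | g : set (hub_times 2 ph)" by simp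
  then have "g : set (leaf_times ph) | (EX j. j ~= 0 & g : set (hub_times j ph))" by (metis zero_neq_one zero_neq_numeral)
  then show ?thesis
  proof
   assume "g : set (leaf_times ph)"
   then obtain n l where "(n, 0, [l]) : set (events ph)" "g = (leaf l, 2 * n)" unfolding leaf_times_iff by blast
   then show ?thesis by (intro exI[of _ n] exI[of _ "(0, [l])"]) simp
  next
   assume "EX j. j ~= 0 & g : set (hub_times j ph)"
   then obtain j n y where "j ~= 0" "(n, j, y) : set (events ph)" "g = (hub ph, 2 * n)" unfolding hub_times_iff by blast
   then show ?thesis by (intro exI[of _ n] exI[of _ "(j, y)"]) simp
  qed
 qed
 have snap: "snapshots_bounded 1 (present sp)"
  unfolding snapshots_bounded_present[OF s_valid] unfolding s_sel
 proof (intro conjI ballI impI)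
  fix g h assume g: "g : set (leaf_times ph @ (hub_times 1 ph @ hub_times 2 ph))"
   and h: "h : set (leaf_times ph @ (hub_times 1 ph @ hub_times 2 ph))" and gh: "snd g = snd h"
  obtain n e where e: "(n, e) : set (events ph)" "snd g = 2 * n" "if fst e = 0 then EX l. snd e = [l] & fst g = leaf l else fst g = hub ph"
   using time[OF g] by blast
  obtain m e' where e': "(m, e') : set (events ph)" "snd h = 2 * m" "if fst e' = 0 then EX l. snd e' = [l] & fst h = leaf l else fst h = hub ph"
   using time[OF h] by blast
  have "e' = e" using events_inj[of n e' ph e] e(1,2) e'(1,2) gh by simp
  then have "fst g = fst h" using e(3) e'(3) by (auto split: if_splits)
  then show "g = h" using gh by (simp add: prod_eq_iff)
 next
  fix f assume "f : set (s_edges ph)"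
  then show "~ fst (snd f) = snd (snd f)" unfolding s_edges_iff using events_order by fastforce
 qed
 have R: "set (leaf_times ph) <= tverts (present sp)" "set (leaf_times ph @ hub_times 2 ph) <= tverts (present sp)"
  "set (pgs sp) <= tverts (present sp)"
  unfolding s_tverts s_sel by auto
 have "length (snd (s_inst k ph)) = k" using k by (simp add: s_inst_def)
 then show ?thesis unfolding instances_def using star snap s_valid R unfolding s_inst_def by auto
qed

lemma s_roots_nth: "snd (s_inst k ph) ! 0 = leaf_times ph" "snd (s_inst k ph) ! 1 = leaf_times ph @ hub_times 2 ph"
 "1 < i ==> i < k ==> snd (s_inst k ph) ! i = pgs sp"
proof -
 show "1 < i ==> i < k ==> snd (s_inst k ph) ! i = pgs sp"
  by (cases i; cases "i - 1") (simp_all add: s_inst_def)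
qed (simp_all add: s_inst_def)

text \<open>Without waits, a start of the center that is no root must be entered by an edge. The
  start determines its event, so the edge belongs to a literal of that event.\<close>

lemma start_reached:
 assumes F: "F <= set (s_edges ph)" and sys: "system (present sp) (tverts (present sp)) F R"
  and n: "(n, j, x) : set (events ph)" "j ~= 0" "(hub ph, 2 * n) ~: R"
 shows "EX l : set x. num l : fst ` F"
proof -
 have j: "j = 1 | j = 2" using events_set[OF n(1)] n(2) by auto
 have W: "(hub ph, 2 * n) : tverts (present sp)" unfolding s_tverts Un_iff hub_times_iff using n(1) j by auto
 show ?thesis
 proof (rule system_enter[OF sys, of "{(hub ph, 2 * n)}" "(hub ph, 2 * n)"])
  show "{(hub ph, 2 * n)} <= tverts (present sp)" "{(hub ph, 2 * n)} Int R = {}" "(hub ph, 2 * n) : {(hub ph, 2 * n)}"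
   using W n(3) by simp_all
 next
  fix y z assume "z : {(hub ph, 2 * n)}" "(y, z) : waits (tverts (present sp))"
  then have "nonstart (tverts (present sp)) (hub ph, 2 * n)" unfolding waits_def nonstart_def by auto
  then show ?thesis using s_start[OF W] by blast
 next
  fix f assume f: "f : links (present sp) (tverts (present sp)) F" "dst (present sp) f : {(hub ph, 2 * n)}"
  then have fF: "f : F" by (simp add: links_def)
  then obtain n' j' x' m l where e: "(n', j', x') : set (events ph)" "l : set x'" "(m, 0, [l]) : set (events ph)" "f = (num l, 2 * m, 2 * n')"
   using F s_edges_iff by blast
  have "n' = n" using f(2) unfolding e(4) s_ends[OF leaf_literal[OF e(3)]] by simp
  then have "x' = x" using events_inj[OF n(1), of "(j', x')"] e(1) by simp
  then show ?thesis using e(2,4) fF by force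
 qed
qed

text \<open>A variable is true if the first branching uses the arc of its positive literal. For a
  clause, the first branching enters the corresponding start by the arc of some literal of the
  clause, which is shown to be true.\<close>

lemma sat_if_s_systems:
 assumes F0: "F0 <= set (s_edges ph)" "system (present sp) (tverts (present sp)) F0 (set (leaf_times ph))"
  and F1: "F1 <= set (s_edges ph)" "system (present sp) (tverts (present sp)) F1 (set (leaf_times ph @ hub_times 2 ph))"
  and dis: "fst ` F0 Int fst ` F1 = {}"
 shows "sat ph"
proof -
 have n0: "(hub ph, t) ~: set (leaf_times ph)" for t by (auto simp: leaf_times_iff)
 have n1: "(hub ph, 2 * n) ~: set (leaf_times ph @ hub_times 2 ph)" if "(n, 1, x) : set (events ph)" for n x
  using that n0 events_inj by (fastforce simp: hub_times_iff)
 define A where "A v <-> num (True, v) : fst ` F0" for v :: 'v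
 have "csat A c" if c: "c : set ph" for c
 proof -
  obtain n where n: "(n, 2, c) : set (events ph)" using events_ex(3)[OF c] by blast
  obtain l where l: "l : set c" "num l : fst ` F0" using start_reached[OF F0 n _ n0] by auto
  obtain b v where bv: "l = (b, v)" by (cases l)
  have "A v = b"
  proof (cases b)
   case True
   then show ?thesis using l(2) by (simp add: A_def bv)
  next
   case False
   \<comment> \<open>The first branching uses the arc of a negative literal here. At the start for
     the variable the second branching needs an arc as well, and only the positive one is left to
     it.\<close>
   obtain m where m: "(m, 1, [(True, snd l), (False, snd l)]) : set (events ph)" using events_ex(2)[OF c l(1)] by blast
   obtain l' where "l' : set [(True, snd l), (False, snd l)]" "num l' : fst ` F1"
    using start_reached[OF F1 m _ n1[OF m]] by auto
   then have "num (True, v) : fst ` F1" using dis l(2) False bv by auto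
   then show ?thesis using dis False by (auto simp: A_def)
  qed
  then show ?thesis unfolding csat_def using l(1) bv by force
 qed
 then show ?thesis unfolding sat_def by blast
qed

text \<open>A branching that owns the arcs of the literals with property \<open>P\<close> reaches a
  start of the center as soon as the event of that start contains such a literal.\<close>

lemma s_system:
 assumes R: "set (leaf_times ph) <= R" "R <= tverts (present sp)"
  and hit: "!!n j x. (n, j, x) : set (events ph) ==> j ~= 0 ==> (hub ph, 2 * n) ~: R ==>
   EX l : set x. l : set (literals ph) & P l"
 shows "system (present sp) (tverts (present sp)) {f : set (s_edges ph). EX l. fst f = num l & P l} R"
  (is "system _ ?W ?F R")
proof (rule systemI)
 show "~ nonstart ?W y" if "y : ?W" for y by (rule s_start[OF that])
 have leaf: "y : reached_by (present sp) ?W ?F R" if "y : set (leaf_times ph)" for y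
  using that R(1) by (intro reached_root) (auto simp: s_tverts)
 fix y assume y: "y : ?W"
 show "y : reached_by (present sp) ?W ?F R"
 proof (cases "y : set (leaf_times ph) | y : R")
  case True
  then show ?thesis using leaf reached_root y by blast
 next
  case False
  then have "y : set (hub_times 1 ph) | y : set (hub_times 2 ph)" using y unfolding s_tverts by blast
  then obtain n j x where n: "(n, j, x) : set (events ph)" "j ~= 0" "y = (hub ph, 2 * n)" unfolding hub_times_iff by fastforce
  obtain l where l: "l : set x" "l : set (literals ph)" "P l" using hit[OF n(1,2)] n(3) False by blast
  obtain m where m: "(m, 0, [l]) : set (events ph)" using events_ex(1)[OF l(2)] by blast
  let ?f = "(num l, 2 * m, 2 * n)"
  note e = s_ends[OF l(2), of "2 * m" "2 * n"]
  have lt: "(leaf l, 2 * m) : set (leaf_times ph)" using m leaf_times_iff by blast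
  have "dst (present sp) ?f : reached_by (present sp) ?W ?F R"
  proof (rule reached_link)
   show "src (present sp) ?f : reached_by (present sp) ?W ?F R" unfolding e by (rule leaf[OF lt])
   have "?f : set (s_edges ph)" unfolding s_edges_iff using n(1,2) l(1) m by blast
   then show "?f : ?F" using l(3) by (intro CollectI conjI exI[of _ l]) simp_all
   show "src (present sp) ?f : ?W" unfolding e s_tverts using lt by blast
   show "dst (present sp) ?f : ?W" unfolding e using y n(3) by simp
   show "~ nonstart ?W (dst (present sp) ?f)" unfolding e using s_start[OF y] n(3) by simp
  qed
  then show ?thesis unfolding e n(3) .
 qed
qed

lemma s_correct:
 "(EX Bs. disjoint_branchings edge_disjoint temporal_spanning (present (fst (s_inst k ph))) (map set (snd (s_inst k ph))) Bs) <-> sat ph"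
 unfolding branchings_iff_instance[OF s_instance disjointness_of_e spanning_of_temporal]
proof
 have f: "fst (s_inst k ph) = sp" by (simp add: s_inst_def)
 have k01: "0 < k" "1 < k" using k by simp_all
 {
  assume "EX W F. (ALL i<k. W i = tverts (present (fst (s_inst k ph))) & F i <= set (pls (fst (s_inst k ph))) &
    system (present (fst (s_inst k ph))) (W i) (F i) (set (snd (s_inst k ph) ! i))) &
    (ALL i<k. ALL j<k. i ~= j --> fst ` F i Int fst ` F j = {})"
  then obtain W F where WF: "ALL i<k. W i = tverts (present sp) & F i <= set (s_edges ph) &
    system (present sp) (W i) (F i) (set (snd (s_inst k ph) ! i))"
   and D: "ALL i<k. ALL j<k. i ~= j --> fst ` F i Int fst ` F j = {}" unfolding f s_sel by - (elim exE conjE, rule that)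
  have "F 0 <= set (s_edges ph)" "system (present sp) (tverts (present sp)) (F 0) (set (leaf_times ph))"
   "F 1 <= set (s_edges ph)" "system (present sp) (tverts (present sp)) (F 1) (set (leaf_times ph @ hub_times 2 ph))"
   "fst ` F 0 Int fst ` F 1 = {}"
   using WF[rule_format, OF k01(1), unfolded s_roots_nth] WF[rule_format, OF k01(2), unfolded s_roots_nth]
    D[rule_format, OF k01] by auto
  then show "sat ph" by (rule sat_if_s_systems)
 }
 assume "sat ph"
 then obtain A where A: "!!c. c : set ph ==> EX l : set c. A (snd l) = fst l" unfolding sat_def csat_def by blast
 let ?P = "%i l. if i = 0 then A (snd l) = fst l else if i = 1 then A (snd l) ~= fst l else False"
 let ?F = "%i :: nat. {f : set (s_edges ph). EX l. fst f = num l & ?P i l}"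
 have n0: "(hub ph, t) ~: set (leaf_times ph)" for t by (auto simp: leaf_times_iff)
 have "system (present sp) (tverts (present sp)) (?F i) (set (snd (s_inst k ph) ! i))" if i: "i < k" for i
 proof (rule s_system)
  consider "i = 0" | "i = 1" | "1 < i" by linarith
  then have R: "set (snd (s_inst k ph) ! i) = set (leaf_times ph) & i = 0 |
    set (snd (s_inst k ph) ! i) = set (leaf_times ph) Un set (hub_times 2 ph) & i = 1 |
    set (snd (s_inst k ph) ! i) = tverts (present sp)"
   using s_roots_nth i by cases (auto simp: s_tverts s_sel)
  then show "set (leaf_times ph) <= set (snd (s_inst k ph) ! i)" "set (snd (s_inst k ph) ! i) <= tverts (present sp)"
   unfolding s_tverts by blast+
  fix n j x assume n: "(n, j, x) : set (events ph)" "j ~= 0" "(hub ph, 2 * n) ~: set (snd (s_inst k ph) ! i)"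
  have h: "(hub ph, 2 * n) : set (hub_times j ph)" using n(1) hub_times_iff by blast
  have j: "(j = 1 & (EX c : set ph. EX m : set c. x = [(True, snd m), (False, snd m)])) | j = 2 & x : set ph"
   using events_set[OF n(1)] n(2) by auto
  then have hW: "(hub ph, 2 * n) : tverts (present sp)" using h unfolding s_tverts by blast
  have i01: "i = 0 | i = 1 & j = 1" using R j hW h n(3) by auto
  show "EX l : set x. l : set (literals ph) & ?P i l"
  proof (cases "j = 1")
   case True
   then obtain c m where m: "c : set ph" "m : set c" "x = [(True, snd m), (False, snd m)]" using j by auto
   have li: "(b, snd m) : set (literals ph)" for b unfolding literals_iff using m by auto
   let ?l = "(if i = 0 then A (snd m) else ~ A (snd m), snd m)"
   have "?l : set x" unfolding m(3) by auto
   moreover have "?P i ?l" using i01 by auto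
   ultimately show ?thesis using li by blast
  next
   case False
   then have i0: "i = 0" and x: "x : set ph" using i01 j by auto
   obtain l where l: "l : set x" "A (snd l) = fst l" using A[OF x] by blast
   have "l : set (literals ph)" unfolding literals_iff using x l(1) by blast
   then show ?thesis using l i0 by auto
  qed
 qed
 moreover have "fst ` ?F i Int fst ` ?F j = {}" if "i ~= j" for i j
  using that by auto
 ultimately show "EX W F. (ALL i<k. W i = tverts (present (fst (s_inst k ph))) & F i <= set (pls (fst (s_inst k ph))) &
    system (present (fst (s_inst k ph))) (W i) (F i) (set (snd (s_inst k ph) ! i))) &
    (ALL i<k. ALL j<k. i ~= j --> fst ` F i Int fst ` F j = {})"
  unfolding f s_sel by (intro exI[of _ "%_. tverts (present sp)"] exI[of _ ?F]) blast
qed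

end

subsection \<open>Edge-disjoint branchings of lifetime 3\<close>

text \<open>For every variable there is a bidirected path from the root to the root with one inner vertex per clause.
 At time 1 each inner vertex has two entering arcs, one from either side, and the first two branchings must use one each;
 this forces each of them to traverse the whole path in one direction. A branching that owns an arc may also use it
 from time 1 to time 3, which allows it to reach the clause.\<close>

definition rootv :: "'v::tr cnf => nat" where "rootv ph = num (0 :: nat, None :: 'v option)"
definition clv :: "'v::tr cnf => nat => nat" where "clv ph j = num (Suc j, None :: 'v option)"
definition nd :: "'v::tr cnf => nat => 'v => nat" where
 "nd ph j x = (if j = 0 | j = Suc (length ph) then rootv ph else num (j, Some x))"
text \<open>The first argument is the kind of the arc at an inner path vertex: 0 enters it from the
  left, 1 enters it from the right, 2 leads from it to the clause vertex and 3 leads back.\<close>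

definition aid :: "nat => nat => 'v::tr => nat" where "aid ka j x = num (ka, j, x)"

definition vars :: "'v cnf => 'v list" where "vars ph = flat ph (map snd)"
definition cells :: "'v cnf => (nat * (bool \<times> 'v) list \<times> 'v) list" where
 "cells ph = flat (numbered ph) (%p. map (%x. (fst p, snd p, x)) (vars ph))"

definition l_verts :: "'v::tr cnf => nat list" where
 "l_verts ph = rootv ph # map (%p. clv ph (fst p)) (numbered ph) @ map (%q. nd ph (Suc (fst q)) (snd (snd q))) (cells ph)"
definition l_arcs :: "'v::tr cnf => (nat * nat * nat) list" where
 "l_arcs ph = uniq (flat (cells ph) (%q.
   [(aid 0 (fst q) (snd (snd q)), nd ph (fst q) (snd (snd q)), nd ph (Suc (fst q)) (snd (snd q))),
   (aid 1 (fst q) (snd (snd q)), nd ph (Suc (Suc (fst q))) (snd (snd q)), nd ph (Suc (fst q)) (snd (snd q))),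
   (aid 2 (fst q) (snd (snd q)), nd ph (Suc (fst q)) (snd (snd q)), clv ph (fst q)),
   (aid 3 (fst q) (snd (snd q)), clv ph (fst q), nd ph (Suc (fst q)) (snd (snd q)))]))"
text \<open>Path vertices are inactive at time 2, so time 3 is a second start for them, while clause
  vertices are active at time 3 only. The root is active throughout and reaches time 3 by
  waiting.\<close>

definition l_late :: "'v::tr cnf => (nat * nat) list" where
 "l_late ph = map (%p. (clv ph (fst p), 3)) (numbered ph) @ map (%q. (nd ph (Suc (fst q)) (snd (snd q)), 3)) (cells ph)"
definition l_early :: "'v::tr cnf => (nat * nat) list" where
 "l_early ph = map (%q. (nd ph (Suc (fst q)) (snd (snd q)), 1)) (cells ph)"
definition l_times :: "'v::tr cnf => (nat * nat) list" where
 "l_times ph = (rootv ph, 1) # (rootv ph, 2) # (rootv ph, 3) # l_late ph @ l_early ph"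
definition l_edges :: "'v::tr cnf => (nat * nat * nat) list" where
 "l_edges ph = flat (cells ph) (%q.
   [(aid 0 (fst q) (snd (snd q)), 1, 1), (aid 1 (fst q) (snd (snd q)), 1, 1),
   (aid 2 (fst q) (snd (snd q)), 3, 3), (aid 3 (fst q) (snd (snd q)), 3, 3)] @
   (if (True, snd (snd q)) : set (fst (snd q)) then [(aid 0 (fst q) (snd (snd q)), 1, 3)] else []) @
   (if (False, snd (snd q)) : set (fst (snd q)) then [(aid 1 (fst q) (snd (snd q)), 1, 3)] else []))"
definition l_pres :: "'v::tr cnf => presentation" where
 "l_pres ph = (l_verts ph, l_arcs ph, l_times ph, l_edges ph)"
text \<open>The first branching has to reach everything from the root. The second one gets the
  starts at time 3 as roots and only has to cover the paths at time 1; the remaining ones get the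
  latter, too.\<close>

definition l_inst :: "nat => 'v::tr cnf => problem_instance" where
 "l_inst k ph = (l_pres ph, [(rootv ph, 1)] # ((rootv ph, 1) # l_late ph) #
   map (%_. (rootv ph, 1) # l_late ph @ l_early ph) [0..<k - 2])"

lemma pt_l_inst: "pt (l_inst k :: 'v::tr cnf => problem_instance)"
proof -
 have ro: "pt (%x. rootv (f x :: 'v cnf))" if "pt f" for f :: "'b::tr => 'v cnf" unfolding rootv_def by (intro pt_intros)
 have cl: "pt (%x. clv (f x :: 'v cnf) (g x))" if "pt g" for f :: "'b::tr => 'v cnf" and g
  unfolding clv_def by (intro pt_intros that)
 have nd: "pt (%x. nd (f x :: 'v cnf) (g x) (h x))" if "pt f" "pt g" "pt h" for f :: "'b::tr => 'v cnf" and g h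
  unfolding nd_def by (intro ro pt_intros that)
 have ai: "pt (%x. aid (f x) (g x) (h x :: 'v))" if "pt f" "pt g" "pt h" for f :: "'b::tr => nat" and g h
  unfolding aid_def by (intro pt_intros that)
 have "pt (cells :: 'v cnf => _)" unfolding cells_def vars_def by (intro pt_enumerate pt_flat pt_intros)
 then have ce: "pt (%x. cells (f x :: 'v cnf))" if "pt f" for f :: "'b::tr => 'v cnf" using that by (rule pt_comp)
 have ve: "pt (l_verts :: 'v cnf => _)" unfolding l_verts_def by (intro ro cl nd ce pt_enumerate pt_intros)
 have ar: "pt (l_arcs :: 'v cnf => _)" unfolding l_arcs_def by (intro ro cl nd ai ce pt_flat pt_intros)
 have "pt (l_late :: 'v cnf => _)" unfolding l_late_def by (intro cl nd ce pt_enumerate pt_intros)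
 then have la: "pt (%x. l_late (f x :: 'v cnf))" if "pt f" for f :: "'b::tr => 'v cnf" using that by (rule pt_comp)
 have "pt (l_early :: 'v cnf => _)" unfolding l_early_def by (intro nd ce pt_intros)
 then have ea: "pt (%x. l_early (f x :: 'v cnf))" if "pt f" for f :: "'b::tr => 'v cnf" using that by (rule pt_comp)
 have ti: "pt (l_times :: 'v cnf => _)" unfolding l_times_def by (intro ro la ea pt_intros)
 have ed: "pt (l_edges :: 'v cnf => _)" unfolding l_edges_def by (intro ai ce pt_flat pt_intros)
 show ?thesis unfolding l_inst_def l_pres_def by (intro ro la ea ve ar ti ed pt_intros)
qed

lemma set_map_iff: "y : set (map g xs) <-> (EX q : set xs. y = g q)"
 by auto

lemma path_cases: "i <= Suc n ==> (i = 0 ==> P) ==> (i = Suc n ==> P) ==> (!!i'. i = Suc i' ==> i' < n ==> P) ==> P"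
 by (cases i; cases "i = Suc n") auto

lemma aid_eq [simp]: "aid ka j x = aid ka' j' x' <-> ka = ka' & j = j' & x = x'"
 by (simp add: aid_def)

context
 fixes ph :: "'v::tr cnf" and k :: nat
 assumes k: "2 <= k"
begin

abbreviation (input) "lp == l_pres ph"
abbreviation (input) "cell j x == j < length ph & x : set (vars ph)"

lemma l_sel: "pvs lp = l_verts ph" "pas lp = l_arcs ph" "pgs lp = l_times ph" "pls lp = l_edges ph"
 by (simp_all add: l_pres_def)

lemma cells_iff: "q : set (cells ph) <-> (EX j x. cell j x & q = (j, ph ! j, x))"
proof -
 have "q : set (cells ph) <-> (EX p : set (numbered ph). EX x : set (vars ph). q = (fst p, snd p, x))"
  unfolding cells_def set_flat by auto
 also have "... <-> (EX j x. cell j x & q = (j, ph ! j, x))"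
  unfolding Bex_def split_paired_Ex numbered_iff by auto
 finally show ?thesis .
qed

lemma cells_Bex: "(EX q : set (cells ph). Q q) <-> (EX j x. cell j x & Q (j, ph ! j, x))"
 unfolding Bex_def cells_iff by blast

lemma numbered_fst: "(EX p : set (numbered ph). u = g (fst p)) <-> (EX j < length ph. u = g j)"
 unfolding Bex_def split_paired_Ex numbered_iff by auto

lemma nd_simps:
 "nd ph 0 x = rootv ph" "nd ph (Suc (length ph)) x = rootv ph"
 "j < length ph ==> j' < length ph ==> nd ph (Suc j) x = nd ph (Suc j') x' <-> j = j' & x = x'"
 "j < length ph ==> nd ph (Suc j) x ~= rootv ph" "nd ph i x ~= clv ph j" "clv ph j ~= nd ph i x"
 "clv ph j = clv ph j' <-> j = j'" "clv ph j ~= rootv ph" "rootv ph ~= clv ph j"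
 by (simp_all add: nd_def rootv_def clv_def)

lemma l_verts_iff: "u : set (l_verts ph) <-> u = rootv ph | (EX j < length ph. u = clv ph j) | (EX j x. cell j x & u = nd ph (Suc j) x)"
 unfolding l_verts_def list.set(2) set_append insert_iff Un_iff set_map_iff numbered_fst[of u "clv ph"] cells_Bex fst_conv snd_conv
 by blast

lemma l_late_iff: "y : set (l_late ph) <-> (EX j < length ph. y = (clv ph j, 3)) | (EX j x. cell j x & y = (nd ph (Suc j) x, 3))"
 unfolding l_late_def set_append Un_iff set_map_iff numbered_fst[of y "%j. (clv ph j, 3)"] cells_Bex fst_conv snd_conv
 by blast

lemma l_early_iff: "y : set (l_early ph) <-> (EX j x. cell j x & y = (nd ph (Suc j) x, 1))"
 unfolding l_early_def set_map_iff cells_Bex fst_conv snd_conv by blast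

lemma l_times_iff: "y : set (l_times ph) <-> y = (rootv ph, 1) | y = (rootv ph, 2) | y = (rootv ph, 3) |
  y : set (l_late ph) | y : set (l_early ph)"
 unfolding l_times_def by auto

definition arc_of :: "nat => nat => 'v => nat * nat" where
 "arc_of ka j x = (if ka = 0 then (nd ph j x, nd ph (Suc j) x) else if ka = 1 then (nd ph (Suc (Suc j)) x, nd ph (Suc j) x)
   else if ka = 2 then (nd ph (Suc j) x, clv ph j) else (clv ph j, nd ph (Suc j) x))"

lemma l_arcs_iff: "a : set (l_arcs ph) <-> (EX ka < 4. EX j x. cell j x & a = (aid ka j x, arc_of ka j x))"
proof -
 have 4: "(EX ka < 4. P ka) <-> P 0 | P 1 | P 2 | P (3 :: nat)" for P
  by (auto simp: less_Suc_eq numeral_eq_Suc)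
 have "a : set (l_arcs ph) <-> (EX q : set (cells ph). EX ka < 4. a = (aid ka (fst q) (snd (snd q)), arc_of ka (fst q) (snd (snd q))))"
  unfolding l_arcs_def set_uniq set_flat 4 arc_of_def by simp
 then show ?thesis unfolding Bex_def cells_iff by (simp only: ex_simps) auto
qed

definition avails :: "nat => nat => 'v => nat => nat => bool" where
 "avails ka j x t t' <-> ka < 2 & t = 1 & t' = 1 | (ka = 2 | ka = 3) & t = 3 & t' = 3 |
   ka = 0 & (True, x) : set (ph ! j) & t = 1 & t' = 3 | ka = 1 & (False, x) : set (ph ! j) & t = 1 & t' = 3"

lemma l_edges_iff: "f : set (l_edges ph) <-> (EX ka j x t t'. cell j x & avails ka j x t t' & f = (aid ka j x, t, t'))"
proof -
 have "f : set (l_edges ph) <-> (EX q : set (cells ph). f = (aid 0 (fst q) (snd (snd q)), 1, 1) | f = (aid 1 (fst q) (snd (snd q)), 1, 1) |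
   f = (aid 2 (fst q) (snd (snd q)), 3, 3) | f = (aid 3 (fst q) (snd (snd q)), 3, 3) |
   (True, snd (snd q)) : set (fst (snd q)) & f = (aid 0 (fst q) (snd (snd q)), 1, 3) |
   (False, snd (snd q)) : set (fst (snd q)) & f = (aid 1 (fst q) (snd (snd q)), 1, 3))"
  unfolding l_edges_def set_flat UN_iff by (intro bex_cong refl, simp, blast)
 also have "... <-> (EX j x. cell j x & (f = (aid 0 j x, 1, 1) | f = (aid 1 j x, 1, 1) | f = (aid 2 j x, 3, 3) | f = (aid 3 j x, 3, 3) |
   (True, x) : set (ph ! j) & f = (aid 0 j x, 1, 3) | (False, x) : set (ph ! j) & f = (aid 1 j x, 1, 3)))"
  unfolding cells_Bex fst_conv snd_conv ..
 also have "... <-> (EX j x. cell j x & (EX ka t t'. avails ka j x t t' & f = (aid ka j x, t, t')))"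
 proof (intro ex_cong1 conj_cong refl)
  fix j x
  have lt: "ka < 2 <-> ka = 0 | ka = (1 :: nat)" for ka by auto
  show "(f = (aid 0 j x, 1, 1) | f = (aid 1 j x, 1, 1) | f = (aid 2 j x, 3, 3) | f = (aid 3 j x, 3, 3) |
   (True, x) : set (ph ! j) & f = (aid 0 j x, 1, 3) | (False, x) : set (ph ! j) & f = (aid 1 j x, 1, 3)) <->
   (EX ka t t'. avails ka j x t t' & f = (aid ka j x, t, t'))"
   unfolding avails_def lt by (rule iffI; elim exE conjE disjE; simp)
 qed
 finally show ?thesis by blast
qed

lemma l_times_nd: "cell j x ==> (nd ph (Suc j) x, t) : set (l_times ph) <-> t = 1 | t = 3"
 unfolding l_times_iff l_late_iff l_early_iff by (auto simp: nd_simps)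

lemma l_times_clv: "j < length ph ==> (clv ph j, t) : set (l_times ph) <-> t = 3"
 unfolding l_times_iff l_late_iff l_early_iff by (auto simp: nd_simps)

lemma l_times_root: "(rootv ph, t) : set (l_times ph) <-> t = 1 | t = 2 | t = 3"
 unfolding l_times_iff l_late_iff l_early_iff by (auto simp: nd_simps dest: nd_simps(4)[THEN not_sym])

lemma l_times_path: "cell j x ==> i <= Suc (length ph) ==> (nd ph i x, 1) : set (l_times ph)"
proof -
 assume c: "cell j x" and i: "i <= Suc (length ph)"
 show ?thesis
 proof (rule path_cases[OF i])
  fix i' assume i': "i = Suc i'" "i' < length ph"
  then have "cell i' x" using c by simp
  then show "(nd ph i x, 1) : set (l_times ph)" unfolding i'(1) using l_times_nd by blast
 qed (simp_all add: nd_simps l_times_root)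
qed

lemma l_valid: "valid_presentation lp"
 unfolding valid_presentation_iff l_sel
proof (intro conjI ballI)
 have "inj_on fst (set (l_arcs ph))" by (rule inj_onI, unfold l_arcs_iff, elim exE conjE, simp)
 moreover have "distinct (l_arcs ph)" unfolding l_arcs_def by (rule distinct_uniq)
 ultimately show "distinct (map fst (l_arcs ph))" by (simp add: distinct_map)
 show "fst g : set (l_verts ph)" if "g : set (l_times ph)" for g
  using that unfolding l_times_iff l_late_iff l_early_iff l_verts_iff by (elim disjE exE conjE; simp only: fst_conv; blast)
 show "~ snd g = 0" if "g : set (l_times ph)" for g
  using that unfolding l_times_iff l_late_iff l_early_iff by auto
 show "fst f : set (map fst (l_arcs ph))" if f: "f : set (l_edges ph)" for f
 proof -
  obtain ka j x t t' where e: "cell j x" "avails ka j x t t'" "f = (aid ka j x, t, t')" using f l_edges_iff by blast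
  have "ka < 4" using e(2) by (auto simp: avails_def)
  then have "(aid ka j x, arc_of ka j x) : set (l_arcs ph)" using e(1) l_arcs_iff by blast
  then show ?thesis using e(3) by force
 qed
 have path: "nd ph i x : set (l_verts ph)" if cx: "cell j x" and il: "i <= Suc (length ph)" for i j x
 proof -
  show ?thesis
  proof (rule path_cases[OF il])
   fix i' assume i': "i = Suc i'" "i' < length ph"
   then have "cell i' x" using cx by simp
   then show "nd ph i x : set (l_verts ph)" unfolding i'(1) l_verts_iff by blast
  qed (simp_all add: nd_simps l_verts_iff)
 qed
 show "fst (snd a) : set (l_verts ph)" "snd (snd a) : set (l_verts ph)" if a: "a : set (l_arcs ph)" for a
 proof -
  obtain ka j x where e: "cell j x" "a = (aid ka j x, arc_of ka j x)" using a l_arcs_iff by blast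
  have "clv ph j : set (l_verts ph)" using e(1) l_verts_iff by blast
  then show "fst (snd a) : set (l_verts ph)" "snd (snd a) : set (l_verts ph)"
   using path[OF e(1), of j] path[OF e(1), of "Suc j"] path[OF e(1), of "Suc (Suc j)"] e by (auto simp: arc_of_def)
 qed
 fix y assume "y : set (tarcs (l_arcs ph) (l_edges ph))"
 then obtain f a where f: "f : set (l_edges ph)" and a: "a : set (l_arcs ph)" "fst a = fst f"
  and y: "y = (f, (fst (snd a), fst (snd f)), (snd (snd a), snd (snd f)))" unfolding tarcs_def by auto
 obtain ka j x t t' where e: "cell j x" "avails ka j x t t'" "f = (aid ka j x, t, t')" using f l_edges_iff by blast
 have al: "a = (aid ka j x, arc_of ka j x)" using a e(3) unfolding l_arcs_iff by auto
 show "fst (snd (fst y)) <= snd (snd (fst y))" using e(2) by (auto simp: y e(3) avails_def)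
 have j: "j < length ph" using e(1) by simp
 show "fst (snd y) : set (l_times ph)" "snd (snd y) : set (l_times ph)"
  using e(2) l_times_path[OF e(1), of j] l_times_path[OF e(1), of "Suc (Suc j)"] l_times_nd[OF e(1)] l_times_clv[OF j] j
  unfolding y al e(3) by (auto simp: avails_def arc_of_def less_2_cases_iff)
qed

lemma l_ends:
 assumes "cell j x" "avails ka j x t t'"
 shows "src (present lp) (aid ka j x, t, t') = (fst (arc_of ka j x), t)" "dst (present lp) (aid ka j x, t, t') = (snd (arc_of ka j x), t')"
proof -
 have "ka < 4" using assms(2) by (auto simp: avails_def)
 then have "(aid ka j x, fst (arc_of ka j x), snd (arc_of ka j x)) : set (pas lp)"
  unfolding l_sel l_arcs_iff using assms by (metis prod.collapse)
 from edge_ends[OF l_valid this] show "src (present lp) (aid ka j x, t, t') = (fst (arc_of ka j x), t)"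
  "dst (present lp) (aid ka j x, t, t') = (snd (arc_of ka j x), t')" by blast+
qed

lemma l_tverts: "tverts (present lp) = set (l_times ph)"
 unfolding tverts_present[OF l_valid] l_sel ..

abbreviation (input) "LW == tverts (present lp)"

lemma nonstart_iff: "nonstart LW y <-> (EX v t. y = (v, Suc t) & (v, t) : set (l_times ph))"
 unfolding nonstart_def l_tverts ..

lemma l_start: "cell j x ==> t = 1 | t = 3 ==> ~ nonstart LW (nd ph (Suc j) x, t)"
 "j < length ph ==> ~ nonstart LW (clv ph j, 3)" "~ nonstart LW (rootv ph, 1)"
 unfolding nonstart_iff using l_times_nd l_times_clv l_times_root by auto

lemma late_start: "y : set (l_late ph) ==> ~ nonstart LW y" "y : set (l_early ph) ==> ~ nonstart LW y"
 unfolding l_late_iff l_early_iff using l_start by auto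

lemma l_instance: "l_inst k ph : instances k (%G. lifetime G = 3)"
proof -
 have "lifetime (present lp) = 3"
  using lifetime_present_eq[OF l_valid, of 3] unfolding l_sel
  by (force simp: l_times_iff l_late_iff l_early_iff)
 moreover have "length (snd (l_inst k ph)) = k" using k by (simp add: l_inst_def)
 moreover have "ALL R : set (snd (l_inst k ph)). set R <= LW"
  unfolding l_inst_def l_tverts by (auto simp: l_times_iff)
 ultimately show ?thesis unfolding instances_def l_inst_def using l_valid by simp
qed

lemma l_roots_nth: "snd (l_inst k ph) ! 0 = [(rootv ph, 1)]" "snd (l_inst k ph) ! 1 = (rootv ph, 1) # l_late ph"
 "1 < i ==> i < k ==> snd (l_inst k ph) ! i = (rootv ph, 1) # l_late ph @ l_early ph"
proof -
 show "1 < i ==> i < k ==> snd (l_inst k ph) ! i = (rootv ph, 1) # l_late ph @ l_early ph"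
  by (cases i; cases "i - 1") (simp_all add: l_inst_def)
qed (simp_all add: l_inst_def)

lemma enter_early:
 assumes F: "F <= set (l_edges ph)" and f: "f : links (present lp) LW F" "dst (present lp) f = (nd ph (Suc j) x, 1)" and c: "cell j x"
 obtains "f = (aid 0 j x, 1, 1)" "src (present lp) f = (nd ph j x, 1)" "aid 0 j x : fst ` F"
  | "f = (aid 1 j x, 1, 1)" "src (present lp) f = (nd ph (Suc (Suc j)) x, 1)" "aid 1 j x : fst ` F"
proof -
 have fF: "f : F" using f(1) by (simp add: links_def)
 then obtain ka j' x' t t' where e: "cell j' x'" "avails ka j' x' t t'" "f = (aid ka j' x', t, t')" using F l_edges_iff by blast
 have t': "t' = 1" "snd (arc_of ka j' x') = nd ph (Suc j) x" using f(2) unfolding e(3) l_ends[OF e(1,2)] by simp_all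
 then have ka: "ka = 0 | ka = 1" "t = 1" using e(2) by (auto simp: avails_def)
 then have "nd ph (Suc j') x' = nd ph (Suc j) x" using t'(2) by (auto simp: arc_of_def)
 then have jx: "j' = j" "x' = x" using nd_simps(3)[of j' j x' x] e(1) c by simp_all
 have s: "src (present lp) f = (fst (arc_of ka j x), 1)" using l_ends(1)[OF e(1,2)] e(3) jx ka(2) by simp
 have i: "aid ka j x : fst ` F" using fF e(3) jx by force
 from ka(1) show thesis
 proof
  assume "ka = 0"
  then show thesis using that(1) e(3) jx t'(1) ka(2) s i by (simp add: arc_of_def)
 next
  assume "ka = 1"
  then show thesis using that(2) e(3) jx t'(1) ka(2) s i by (simp add: arc_of_def)
 qed
qed

lemma no_wait_early: "cell j x ==> (y, (nd ph (Suc j) x, 1)) ~: waits LW"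
 using l_start(1)[of j x 1] unfolding waits_def nonstart_def by blast

lemma no_wait_late: "y : set (l_late ph) ==> (z, y) ~: waits LW"
 using late_start(1)[of y] unfolding waits_def nonstart_def by blast

text \<open>The start at time 1 of a path vertex is no root of the first two branchings, so each of
  them needs one of the two arcs entering it.\<close>

lemma owns:
 assumes F: "F <= set (l_edges ph)" and sys: "system (present lp) LW F R" and R: "R <= insert (rootv ph, 1) (set (l_late ph))" and c: "cell j x"
 shows "aid 0 j x : fst ` F | aid 1 j x : fst ` F"
proof -
 let ?y = "(nd ph (Suc j) x, 1)"
 have y: "?y : LW" unfolding l_tverts using l_times_nd[OF c] by simp
 have yR: "?y ~: R" using R c nd_simps(4)[of j x] by (auto simp: l_late_iff)
 show ?thesis
 proof (rule system_enter[OF sys, of "{?y}" ?y])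
  show "{?y} <= LW" "{?y} Int R = {}" "?y : {?y}" using y yR by simp_all
 next
  fix a z assume "z : {?y}" "(a, z) : waits LW"
  then show ?thesis using no_wait_early[OF c] by blast
 next
  fix f assume f: "f : links (present lp) LW F" "dst (present lp) f : {?y}"
  then have "dst (present lp) f = ?y" by simp
  from enter_early[OF F f(1) this c] show ?thesis by blast
 qed
qed

text \<open>If neither outer arc of two neighbouring path vertices is owned, the two could be
  entered at time 1 only from each other.\<close>

lemma no_turn:
 assumes F: "F <= set (l_edges ph)" and sys: "system (present lp) LW F R" and R: "R <= insert (rootv ph, 1) (set (l_late ph))"
  and c: "cell j x" "Suc j < length ph"
 shows "aid 0 j x : fst ` F | aid 1 (Suc j) x : fst ` F"
proof (rule ccontr)
 assume n: "~ (aid 0 j x : fst ` F | aid 1 (Suc j) x : fst ` F)"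
 let ?S = "{(nd ph (Suc j) x, 1), (nd ph (Suc (Suc j)) x, 1)}"
 have c': "cell (Suc j) x" using c by simp
 show False
 proof (rule system_enter[OF sys, of ?S "(nd ph (Suc j) x, 1)"])
  show "?S <= LW" unfolding l_tverts using l_times_nd[OF c(1)] l_times_nd[OF c'] by simp
  show "?S Int R = {}" using R c c' nd_simps(4)[of j x] nd_simps(4)[of "Suc j" x] by (auto simp: l_late_iff)
  show "(nd ph (Suc j) x, 1) : ?S" by simp
 next
  fix a z assume "z : ?S" "(a, z) : waits LW"
  then show False using no_wait_early[OF c(1)] no_wait_early[OF c'] by blast
 next
  fix f assume f: "f : links (present lp) LW F" "src (present lp) f ~: ?S" "dst (present lp) f : ?S"
  from f(3) have "dst (present lp) f = (nd ph (Suc j) x, 1) | dst (present lp) f = (nd ph (Suc (Suc j)) x, 1)" by simp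
  then show False
  proof
   assume "dst (present lp) f = (nd ph (Suc j) x, 1)"
   from enter_early[OF F f(1) this c(1)] n f(2) show False by (metis insertCI)
  next
   assume "dst (present lp) f = (nd ph (Suc (Suc j)) x, 1)"
   from enter_early[OF F f(1) this c'] n f(2) show False by (metis insertCI)
  qed
 qed
qed

lemma sat_if_l_systems:
 assumes F0: "F0 <= set (l_edges ph)" "system (present lp) LW F0 {(rootv ph, 1)}"
  and F1: "F1 <= set (l_edges ph)" "system (present lp) LW F1 (insert (rootv ph, 1) (set (l_late ph)))"
  and dis: "fst ` F0 Int fst ` F1 = {}"
 shows "sat ph"
proof -
 have R0: "{(rootv ph, 1)} <= insert (rootv ph, 1) (set (l_late ph))" by simp
 note o0 = owns[OF F0 R0] and o1 = owns[OF F1 subset_refl] and t0 = no_turn[OF F0 R0] and t1 = no_turn[OF F1 subset_refl]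
 define A where "A x <-> aid 0 0 x : fst ` F0" for x :: 'v
 have not_both: "~ (aid 0 j x : fst ` F0 & aid 1 j x : fst ` F0)" if "cell j x" for j x
  using o1[OF that] dis by blast
 \<comment> \<open>At each vertex the two branchings own one entering arc each, so owning a forward
   arc means not owning the backward one. Applied to both branchings, \<open>no_turn\<close> then
   carries the direction from each vertex to the next and back.\<close>
 have const: "aid 0 j x : fst ` F0 <-> A x" if "cell j x" for j x
  using that
 proof (induction j)
  case (Suc j)
  then have c: "cell j x" "Suc j < length ph" by simp_all
  have IH: "aid 0 j x : fst ` F0 <-> A x" using Suc.IH c(1) by simp
  have "aid 0 (Suc j) x : fst ` F0 <-> aid 0 j x : fst ` F0"
   using o0[OF c(1)] o1[OF c(1)] o0[OF Suc.prems] o1[OF Suc.prems] t0[OF c] t1[OF c] dis by blast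
  then show ?case using IH by simp
 qed (simp add: A_def)
 have "csat A (ph ! j)" if j: "j < length ph" for j
 proof -
  \<comment> \<open>Arcs of the kinds 2 and 3 at clause \<open>j\<close> stay inside this set. Hence
    it can be entered only by an edge from time 1 to time 3, which exists only for a literal of the
    clause.\<close>
  let ?S = "insert (clv ph j, 3 :: nat) {(nd ph (Suc j) x, 3) | x. x : set (vars ph)}"
  have SL: "?S <= set (l_late ph)" by (intro subsetI) (unfold l_late_iff, use j in blast)
  show ?thesis
  proof (rule system_enter[OF F0(2), of ?S "(clv ph j, 3)"])
   show "?S <= LW" unfolding l_tverts using SL by (auto simp: l_times_iff)
   show "?S Int {(rootv ph, 1)} = {}" by auto
   show "(clv ph j, 3) : ?S" by simp
  next
   fix a z assume "z : ?S" "(a, z) : waits LW"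
   then show ?thesis using no_wait_late SL by blast
  next
   fix f assume f: "f : links (present lp) LW F0" "src (present lp) f ~: ?S" "dst (present lp) f : ?S"
   have fF: "f : F0" using f(1) by (simp add: links_def)
   then obtain ka j' x t t' where e: "cell j' x" "avails ka j' x t t'" "f = (aid ka j' x, t, t')" using F0(1) l_edges_iff by blast
   have d: "(snd (arc_of ka j' x), t') : ?S" using f(3) unfolding e(3) l_ends[OF e(1,2)] .
   have s: "(fst (arc_of ka j' x), t) ~: ?S" using f(2) unfolding e(3) l_ends[OF e(1,2)] .
   have i: "aid ka j' x : fst ` F0" using fF e(3) by force
   have t': "t' = 3" using d by auto
   have jj: "j' = j"
   proof (cases "ka = 2")
    case True
    then show ?thesis using d by (auto simp: arc_of_def nd_simps)
   next
    case False
    then have "snd (arc_of ka j' x) = nd ph (Suc j') x" by (simp add: arc_of_def)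
    then show ?thesis using d e(1) j nd_simps(3)[of j' j x] by (auto simp: nd_simps(5))
   qed
   have "ka ~= 2" using s e(1) e(2) by (auto simp: arc_of_def jj avails_def)
   moreover have "ka ~= 3" using s e(2) by (auto simp: arc_of_def jj avails_def)
   ultimately have "ka = 0 & (True, x) : set (ph ! j) | ka = 1 & (False, x) : set (ph ! j)"
    using e(2) t' by (auto simp: avails_def jj)
   then show ?thesis
   proof
    assume "ka = 0 & (True, x) : set (ph ! j)"
    then show ?thesis using const[OF e(1)] i unfolding csat_def by force
   next
    assume "ka = 1 & (False, x) : set (ph ! j)"
    then show ?thesis using const[OF e(1)] not_both[OF e(1)] i unfolding csat_def by force
   qed
  qed
 qed
 then have "ALL c : set ph. csat A c" by (auto simp: in_set_conv_nth)
 then show ?thesis unfolding sat_def by blast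
qed

text \<open>True variables give their forward arcs, false ones their backward arcs. The second
  branching gets the arcs for the complementary valuation, and the arcs at the clause vertices go to
  the first.\<close>

definition owned :: "('v => bool) => (nat * nat * nat) set" where
 "owned A = {f : set (l_edges ph). EX ka j. EX x :: 'v. fst f = aid ka j x & (ka = 0 & A x | ka = 1 & ~ A x)}"
definition inner :: "(nat * nat * nat) set" where
 "inner = {f : set (l_edges ph). EX ka j. EX x :: 'v. fst f = aid ka j x & (ka = 2 | ka = 3)}"

lemma reach_root:
 assumes "(rootv ph, 1) : R" "t = 1 | t = 2 | t = 3"
 shows "(rootv ph, t) : reached_by (present lp) LW F R"
proof -
 have W: "(rootv ph, 1) : LW" "(rootv ph, 2) : LW" "(rootv ph, 3) : LW" unfolding l_tverts using l_times_root by simp_all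
 have 1: "(rootv ph, 1) : reached_by (present lp) LW F R" by (rule reached_root[OF assms(1) W(1)])
 have 2: "(rootv ph, Suc 1) : reached_by (present lp) LW F R"
  by (rule reached_wait[OF 1 W(1)]) (use W(2) in \<open>simp add: numeral_2_eq_2\<close>)
 have 3: "(rootv ph, Suc 2) : reached_by (present lp) LW F R"
  by (rule reached_wait) (use 2 W in \<open>simp_all add: numeral_2_eq_2 numeral_3_eq_3\<close>)
 show ?thesis using assms(2) 1 2 3 by (auto simp: numeral_2_eq_2 numeral_3_eq_3)
qed

lemma reach_edge:
 assumes c: "cell j x" and a: "avails ka j x t t'" and F: "(aid ka j x, t, t') : F"
  and s: "(fst (arc_of ka j x), t) : reached_by (present lp) LW F R"
 shows "(snd (arc_of ka j x), t') : reached_by (present lp) LW F R"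
proof -
 let ?f = "(aid ka j x, t, t')"
 note e = l_ends[OF c a]
 have "?f : tedges (present lp)" unfolding tedges_present[OF l_valid] l_sel l_edges_iff using c a by blast
 then have W: "src (present lp) ?f : LW" "dst (present lp) ?f : LW"
  using tedges_ends[of "present lp" ?f] l_valid by (simp_all add: valid_sel)
 have j: "j < length ph" using c by simp
 have "~ nonstart LW (dst (present lp) ?f)"
  unfolding e using a l_start(1)[OF c] l_start(2)[OF j] by (auto simp: avails_def arc_of_def)
 from reached_link[of "present lp" ?f, OF s[folded e(1)] F W this] show ?thesis unfolding e .
qed

text \<open>Both ends of the path are the root, so the owned direction allows the path to be
  traversed from the left end or from the right end.\<close>

lemma reach_path:
 assumes F: "owned A <= F" and R: "(rootv ph, 1) : R" and x: "x : set (vars ph)" and i: "i <= Suc (length ph)"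
 shows "(nd ph i x, 1) : reached_by (present lp) LW F R"
proof -
 have av: "avails 0 j x 1 1" "avails 1 j x 1 1" for j by (simp_all add: avails_def)
 have rt: "(rootv ph, 1) : reached_by (present lp) LW F R" by (rule reach_root[OF R]) simp
 have mem: "(aid 0 j x, 1, 1) : set (l_edges ph)" "(aid 1 j x, 1, 1) : set (l_edges ph)" if "cell j x" for j
  using that av unfolding l_edges_iff by blast+
 show ?thesis
 proof (cases "A x")
  case True
  have "i <= length ph ==> (nd ph i x, 1) : reached_by (present lp) LW F R" for i
  proof (induction i)
   case 0
   then show ?case using rt by (simp add: nd_simps)
  next
   case (Suc i)
   then have c: "cell i x" using x by simp
   have f: "(aid 0 i x, 1, 1) : F" using F mem[OF c] True unfolding owned_def by auto
   have "(nd ph i x, 1) : reached_by (present lp) LW F R" using Suc by simp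
   then show ?case using reach_edge[OF c av(1) f, of R] by (simp add: arc_of_def)
  qed
  then show ?thesis using i rt by (cases "i = Suc (length ph)") (simp_all add: nd_simps)
 next
  case False
  have "d <= length ph ==> (nd ph (Suc (length ph) - d) x, 1) : reached_by (present lp) LW F R" for d
  proof (induction d)
   case 0
   then show ?case using rt by (simp add: nd_simps)
  next
   case (Suc d)
   define j where "j = length ph - Suc d"
   have j: "Suc (length ph) - d = Suc (Suc j)" "Suc (length ph) - Suc d = Suc j" "j < length ph"
    using Suc.prems by (auto simp: j_def)
   have c: "cell j x" using x j(3) by simp
   have f: "(aid 1 j x, 1, 1) : F" using F mem[OF c] False unfolding owned_def by auto
   have "(nd ph (Suc (Suc j)) x, 1) : reached_by (present lp) LW F R" using Suc j(1) by simp
   then show ?case using reach_edge[OF c av(2) f, of R] unfolding j(2) by (simp add: arc_of_def)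
  qed
  from this[of "Suc (length ph) - i"] show ?thesis using i rt by (cases "i = 0") (simp_all add: nd_simps)
 qed
qed

text \<open>One direction on every path yields everything at time 1, and waiting yields the root at
  all times; the starts at time 3 are all that remains to be shown.\<close>

lemma l_reached:
 assumes F: "owned A <= F" and R: "(rootv ph, 1) : R" "R <= insert (rootv ph, 1) (set (l_late ph) Un set (l_early ph))"
  and late: "!!y. y : set (l_late ph) ==> y : reached_by (present lp) LW F R"
 shows "system (present lp) LW F R"
proof (rule systemI)
 fix y assume "y : LW"
 then have "y : set (l_times ph)" unfolding l_tverts .
 then consider t where "y = (rootv ph, t)" "t = 1 | t = 2 | t = 3" | "y : set (l_late ph)"
  | j x where "cell j x" "y = (nd ph (Suc j) x, 1)" unfolding l_times_iff l_early_iff by blast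
 then show "y : reached_by (present lp) LW F R"
 proof cases
  case 1
  then show ?thesis using reach_root[OF R(1)] by simp
 next
  case 2
  then show ?thesis by (rule late)
 next
  case 3
  then show ?thesis using reach_path[OF F R(1), of x "Suc j"] by simp
 qed
next
 fix y assume "y : R"
 then show "~ nonstart LW y" using R(2) late_start l_start(3) by blast
qed

text \<open>A true literal of a clause brings its path vertex from time 1 to time 3. From there the
  clause vertex is reached, and from the clause vertex all other path vertices that belong to the
  clause.\<close>

lemma l_systems_if_sat:
 assumes A: "!!c. c : set ph ==> EX l : set c. A (snd l) = fst l"
 shows "system (present lp) LW (owned A Un inner) {(rootv ph, 1)}"
proof (rule l_reached[where A = A])
 let ?r = "reached_by (present lp) LW (owned A Un inner) {(rootv ph, 1)}"
 have in3: "avails 2 j x 3 3" "avails 3 j x 3 3" for j x by (simp_all add: avails_def)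
 have mem: "(aid 2 j x, 3, 3) : owned A Un inner" "(aid 3 j x, 3, 3) : owned A Un inner" if "cell j x" for j x
 proof -
  have "(aid 2 j x, 3, 3) : set (l_edges ph)" "(aid 3 j x, 3, 3) : set (l_edges ph)"
   using that in3 unfolding l_edges_iff by blast+
  then show "(aid 2 j x, 3, 3) : owned A Un inner" "(aid 3 j x, 3, 3) : owned A Un inner" unfolding inner_def by auto
 qed
 have cl: "(clv ph j, 3) : ?r" if j: "j < length ph" for j
 proof -
  obtain l where l: "l : set (ph ! j)" "A (snd l) = fst l" using A[of "ph ! j"] j by auto
  obtain b x where bx: "l = (b, x)" by (cases l)
  have c: "cell j x" using j l(1) nth_mem[OF j] bx unfolding vars_def by force
  have p: "(nd ph j x, 1) : ?r" "(nd ph (Suc (Suc j)) x, 1) : ?r"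
   by (rule reach_path[of A]; use c in simp)+
  have "(nd ph (Suc j) x, 3) : ?r"
  proof (cases b)
   case True
   have a: "avails 0 j x 1 3" using l(1) bx True by (simp add: avails_def)
   have "(aid 0 j x, 1, 3) : set (l_edges ph)" unfolding l_edges_iff using c a by blast
   then have "(aid 0 j x, 1, 3) : owned A Un inner" using l(2) bx True unfolding owned_def by auto
   from reach_edge[OF c a this] p show ?thesis by (simp add: arc_of_def)
  next
   case False
   have a: "avails 1 j x 1 3" using l(1) bx False by (simp add: avails_def)
   have "(aid 1 j x, 1, 3) : set (l_edges ph)" unfolding l_edges_iff using c a by blast
   then have "(aid 1 j x, 1, 3) : owned A Un inner" using l(2) bx False unfolding owned_def by auto
   from reach_edge[OF c a this] p show ?thesis by (simp add: arc_of_def)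
  qed
  then show ?thesis using reach_edge[OF c in3(1) mem(1)[OF c]] by (simp add: arc_of_def)
 qed
 fix y assume "y : set (l_late ph)"
 then consider j where "j < length ph" "y = (clv ph j, 3)" | j x where "cell j x" "y = (nd ph (Suc j) x, 3)"
  unfolding l_late_iff by blast
 then show "y : ?r"
 proof cases
  case 1
  then show ?thesis using cl by simp
 next
  case 2
  then show ?thesis using reach_edge[OF 2(1) in3(2) mem(2)[OF 2(1)]] cl[of j] by (simp add: arc_of_def)
 qed
qed simp_all

lemma l_correct:
 "(EX Bs. disjoint_branchings edge_disjoint temporal_spanning (present (fst (l_inst k ph))) (map set (snd (l_inst k ph))) Bs) <-> sat ph"
 unfolding branchings_iff_instance[OF l_instance disjointness_of_e spanning_of_temporal]
proof
 have f: "fst (l_inst k ph) = lp" by (simp add: l_inst_def)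
 have k01: "0 < k" "1 < k" using k by simp_all
 have r0: "set (snd (l_inst k ph) ! 0) = {(rootv ph, 1)}" and r1: "set (snd (l_inst k ph) ! 1) = insert (rootv ph, 1) (set (l_late ph))"
  unfolding l_roots_nth by simp_all
 {
  assume "EX W F. (ALL i<k. W i = tverts (present (fst (l_inst k ph))) & F i <= set (pls (fst (l_inst k ph))) &
    system (present (fst (l_inst k ph))) (W i) (F i) (set (snd (l_inst k ph) ! i))) &
    (ALL i<k. ALL j<k. i ~= j --> fst ` F i Int fst ` F j = {})"
  then obtain W F where WF: "ALL i<k. W i = LW & F i <= set (l_edges ph) &
    system (present lp) (W i) (F i) (set (snd (l_inst k ph) ! i))"
   and D: "ALL i<k. ALL j<k. i ~= j --> fst ` F i Int fst ` F j = {}" unfolding f l_sel by - (elim exE conjE, rule that)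
  have "F 0 <= set (l_edges ph)" "system (present lp) LW (F 0) {(rootv ph, 1)}"
   "F 1 <= set (l_edges ph)" "system (present lp) LW (F 1) (insert (rootv ph, 1) (set (l_late ph)))" "fst ` F 0 Int fst ` F 1 = {}"
   using WF[rule_format, OF k01(1), unfolded r0] WF[rule_format, OF k01(2), unfolded r1] D[rule_format, OF k01] by auto
  then show "sat ph" by (rule sat_if_l_systems)
 }
 assume "sat ph"
 then obtain A where A: "!!c. c : set ph ==> EX l : set c. A (snd l) = fst l" unfolding sat_def csat_def by blast
 let ?F = "%i :: nat. if i = 0 then owned A Un inner else if i = 1 then owned (%x. ~ A x) else {}"
 have sub: "?F i <= set (l_edges ph)" for i by (auto simp: owned_def inner_def)
 have sys: "system (present lp) LW (?F i) (set (snd (l_inst k ph) ! i))" if i: "i < k" for i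
 proof -
  consider "i = 0" | "i = 1" | "1 < i" by linarith
  then show ?thesis
  proof cases
   case 1
   then show ?thesis using l_systems_if_sat[OF A] r0 by simp
  next
   case 2
   have "system (present lp) LW (owned (%x. ~ A x)) (insert (rootv ph, 1) (set (l_late ph)))"
   proof (rule l_reached[of "%x. ~ A x"])
    show "y : reached_by (present lp) LW (owned (%x. ~ A x)) (insert (rootv ph, 1) (set (l_late ph)))"
     if "y : set (l_late ph)" for y
     using that by (intro reached_root) (auto simp: l_tverts l_times_iff)
   qed auto
   then show ?thesis using 2 r1 by simp
  next
   case 3
   let ?R = "set ((rootv ph, 1) # l_late ph @ l_early ph)"
   have "system (present lp) LW {} ?R"
   proof (rule systemI)
    fix y assume "y : LW"
    then have "y : set (l_times ph)" unfolding l_tverts .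
    then consider t where "y = (rootv ph, t)" "t = 1 | t = 2 | t = 3" | "y : set (l_late ph) Un set (l_early ph)"
     unfolding l_times_iff by blast
    then show "y : reached_by (present lp) LW {} ?R"
    proof cases
     case 1
     then show ?thesis using reach_root[of ?R] by simp
    next
     case 2
     then show ?thesis by (intro reached_root) (auto simp: l_tverts l_times_iff)
    qed
   next
    fix y assume "y : ?R"
    then have "y = (rootv ph, 1) | y : set (l_late ph) | y : set (l_early ph)" by simp
    then show "~ nonstart LW y" using late_start l_start(3) by blast
   qed
   then show ?thesis using 3 l_roots_nth(3)[OF 3 i] by simp
  qed
 qed
 have dis: "fst ` ?F i Int fst ` ?F j = {}" if "i ~= j" for i j
  using that by (auto simp: owned_def inner_def split: if_splits)
 show "EX W F. (ALL i<k. W i = tverts (present (fst (l_inst k ph))) & F i <= set (pls (fst (l_inst k ph))) &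
    system (present (fst (l_inst k ph))) (W i) (F i) (set (snd (l_inst k ph) ! i))) &
    (ALL i<k. ALL j<k. i ~= j --> fst ` F i Int fst ` F j = {})"
  unfolding f l_sel
 proof (rule exI[of _ "%_. LW"], rule exI[of _ ?F], intro conjI allI impI)
  fix i assume i: "i < k"
  show "LW = LW" ..
  show "?F i <= set (l_edges ph)" by (rule sub)
  show "system (present lp) LW (?F i) (set (snd (l_inst k ph) ! i))" by (rule sys[OF i])
  show "fst ` ?F i Int fst ` ?F j = {}" if "j < k" "i ~= j" for j by (rule dis[OF that(2)])
 qed
qed

end

theorem theorem1:
  fixes k :: nat
  assumes "k \<ge> 1"
  shows
    "solvable_poly_time t_edge_disjoint temporal_spanning k any_tdigraph
     \<and>
     (k \<ge> 2 \<longrightarrow>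
        NP_complete (branching_problem edge_disjoint temporal_spanning k any_tdigraph) \<and>
        (\<exists>c. NP_complete (branching_problem edge_disjoint temporal_spanning k
               (\<lambda>\<G>. underlying_star (base \<G>) \<and> snapshots_bounded c \<G>))) \<and>
        NP_complete (branching_problem edge_disjoint temporal_spanning k (\<lambda>\<G>. lifetime \<G> = 3)))
     \<and>
     solvable_poly_time edge_disjoint temporal_spanning k all_eternal
     \<and>
     solvable_poly_time edge_disjoint temporal_spanning k (\<lambda>\<G>. lifetime \<G> = 2)
     \<and>
     NP_complete (branching_problem edge_disjoint vertex_spanning k any_tdigraph) \<and>
     NP_complete (branching_problem edge_disjoint vertex_spanning k
       (\<lambda>\<G>. dag (base \<G>) \<and> lifetime \<G> = 2 \<and> all_eternal \<G>))
     \<and>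
     NP_complete (branching_problem t_edge_disjoint vertex_spanning k any_tdigraph) \<and>
     NP_complete (branching_problem t_edge_disjoint vertex_spanning k
       (\<lambda>\<G>. dag (base \<G>) \<and> lifetime \<G> = 2 \<and> all_eternal \<G>))"
proof -
  have complete: "NP_complete L" if "L \<in> class_NP" "\<And>L'. L' \<in> class_NP \<Longrightarrow> poly_reducible L' L" for L
    using that by (simp add: NP_complete_def)
  have l2: "decides (\<lambda>G. lifetime G = 2) (\<lambda>p. (\<forall>g \<in> set (pgs p). snd g \<le> 2) \<and> (\<exists>g \<in> set (pgs p). snd g = 2))"
    and l3: "decides (\<lambda>G. lifetime G = 3) (\<lambda>p. (\<forall>g \<in> set (pgs p). snd g \<le> 3) \<and> (\<exists>g \<in> set (pgs p). snd g = 3))"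
    by (rule decides_lifetime, simp)+
  note dag = decides_conj[OF decides_dag decides_conj[OF l2 decides_all_eternal]]
  note star = decides_conj[OF decides_star decides_snapshots]
  have e: "(\<lambda>F F' :: (nat \<times> nat \<times> nat) set. fst ` F \<inter> fst ` F' = {}) F {} \<and>
      (\<lambda>F F' :: (nat \<times> nat \<times> nat) set. fst ` F \<inter> fst ` F' = {}) {} F"
    and t: "(\<lambda>F F' :: (nat \<times> nat \<times> nat) set. F \<inter> F' = {}) F {} \<and> (\<lambda>F F' :: (nat \<times> nat \<times> nat) set. F \<inter> F' = {}) {} F"
    for F by simp_all
  note ve = v_correct[OF assms disjointness_of_e e] and vt = v_correct[OF assms disjointness_of_t t]
  \<comment> \<open>Hardness on a subclass carries over to all temporal digraphs, because the
    reduction produces the same instances.\<close>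
  have "NP_complete (branching_problem edge_disjoint temporal_spanning k any_tdigraph)" if "k \<ge> 2"
    by (rule complete[OF temporal_edge_in_NP[OF decides_any]])
      (rule NP_hard_if[OF pt_s_inst instances_mono[OF s_instance[OF that]] s_correct[OF that]])
  \<comment> \<open>The bound can be 1: in the star instances all activities have different times
    and no edge lies inside a snapshot.\<close>
  moreover have "NP_complete (branching_problem edge_disjoint temporal_spanning k
      (\<lambda>\<G>. underlying_star (base \<G>) \<and> snapshots_bounded 1 \<G>))" if "k \<ge> 2"
    by (rule complete[OF temporal_edge_in_NP[OF star]])
      (rule NP_hard_if[OF pt_s_inst s_instance[OF that] s_correct[OF that]])
  moreover have "NP_complete (branching_problem edge_disjoint temporal_spanning k (\<lambda>\<G>. lifetime \<G> = 3))" if "k \<ge> 2"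
    by (rule complete[OF temporal_edge_in_NP[OF l3]])
      (rule NP_hard_if[OF pt_l_inst l_instance[OF that] l_correct[OF that]])
  moreover have "NP_complete (branching_problem edge_disjoint vertex_spanning k any_tdigraph)"
    by (rule complete[OF vertex_in_NP(1)[OF decides_any]])
      (rule NP_hard_if[OF pt_v_inst instances_mono[OF v_instance[OF assms]] ve])
  moreover have "NP_complete (branching_problem edge_disjoint vertex_spanning k
      (\<lambda>\<G>. dag (base \<G>) \<and> lifetime \<G> = 2 \<and> all_eternal \<G>))"
    by (rule complete[OF vertex_in_NP(1)[OF dag]]) (rule NP_hard_if[OF pt_v_inst v_instance[OF assms] ve])
  moreover have "NP_complete (branching_problem t_edge_disjoint vertex_spanning k any_tdigraph)"
    by (rule complete[OF vertex_in_NP(2)[OF decides_any]])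
      (rule NP_hard_if[OF pt_v_inst instances_mono[OF v_instance[OF assms]] vt])
  moreover have "NP_complete (branching_problem t_edge_disjoint vertex_spanning k
      (\<lambda>\<G>. dag (base \<G>) \<and> lifetime \<G> = 2 \<and> all_eternal \<G>))"
    by (rule complete[OF vertex_in_NP(2)[OF dag]]) (rule NP_hard_if[OF pt_v_inst v_instance[OF assms] vt])
  ultimately show ?thesis
    using t_edge_disjoint_solvable[OF assms] edge_disjoint_solvable_eternal[OF assms]
      edge_disjoint_solvable_lifetime_2[OF assms] by blast
qed

end
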